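(* Let $n\ge1$, $R'=\mathbb Q[x_1,\dots,x_6]$, $w=x_1^{n+1}+x_2^{n+1}+x_3^{n+1}-x_4^{n+1}-x_5^{n+1}-x_6^{n+1}$. Consider the graded $(R',w)$-factorizations $$C(\Gamma_1)=W(x_1,x_2;x_7,x_8)\otimes W(x_8,x_3;x_9,x_6)\otimes W(x_7,x_9;x_4,x_5),\qquad C(\Gamma_2)=W(x_2,x_3;x_5,x_6)\otimes L^1_4,$$ $$C(\Gamma_3)=W(x_3,x_2;x_7,x_8)\otimes W(x_8,x_1;x_9,x_4)\otimes W(x_7,x_9;x_6,x_5),\qquad C(\Gamma_4)=W(x_1,x_2;x_4,x_5)\otimes L^3_6,$$ the tensor products being over the polynomial rings in the shared (internal) variables among $x_7,x_8,x_9$ (over $\mathbb Q$ if none). Then there is an isomorphism in $\mathrm{hmf}_w$ $$C(\Gamma_1)\oplus C(\Gamma_2)\cong C(\Gamma_3)\oplus C(\Gamma_4).$$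
   Context: **Graded factorizations.** Let $R$ be a polynomial ring over $\mathbb Q$ in finitely many variables of degree $2$, $w\in R$ homogeneous of degree $2(n+1)$. $\{m\}$ shifts the grading of a graded module up by $m$. A graded $(R,w)$-factorization is a pair of free graded $R$-modules $M^0,M^1$ (possibly of infinite rank) with $R$-linear maps $M^0\xrightarrow{d}M^1\xrightarrow{d}M^0$ of degree $n+1$, $d^2=w$. Morphisms are pairs of degree $0$ maps commuting with $d$; $f,g$ are homotopic if $f-g=hd+dh$ with $h^i:M^i\to N^{i-1}$ of degree $-n-1$. $H(M)$ is the cohomology of $M/\mathfrak mM$, $\mathfrak m$ the ideal generated by the variables. $\mathrm{hmf}_w$ is the category of graded $(R,w)$-factorizations with $\dim_{\mathbb Q}H(M)<\infty$ and morphisms up to homotopy. If $R\subset S$ and $w\in R$, an $(S,w)$-factorization is regarded as an $(R,w)$-factorization. Tensor products have $d(m\otimes m')=dm\otimes m'+(-1)^im\otimes dm'$, $m\in M^i$. For homogeneous $a,b$ with $\deg a+\deg b=2n+2$, $\{a,b\}$ is $R\xrightarrow{a}R\{n+1-\deg a\}\xrightarrow{b}R$; $\{(a_i),(b_i)\}=\bigotimes_i\{a_i,b_i\}$. **Arcs and wide edges.** $L^i_j=\{\pi_{ij},x_i-x_j\}$ over $\mathbb Q[x_i,x_j]$, $\pi_{ij}=(x_i^{n+1}-x_j^{n+1})/(x_i-x_j)$ (an arc oriented from $j$ to $i$). Let $g$ be the polynomial with $g(x+y,xy)=x^{n+1}+y^{n+1}$. For a wide edge with outgoing marks $y_1,y_2$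 and incoming marks $y_3,y_4$, $$W(y_1,y_2;y_3,y_4)=\{(u_1,u_2),(y_1+y_2-y_3-y_4,\;y_1y_2-y_3y_4)\}\{-1\}$$ over $\mathbb Q[y_1,\dots,y_4]$, where $u_1=\frac{g(y_1+y_2,y_1y_2)-g(y_3+y_4,y_1y_2)}{y_1+y_2-y_3-y_4}$, $u_2=\frac{g(y_3+y_4,y_1y_2)-g(y_3+y_4,y_3y_4)}{y_1y_2-y_3y_4}$. *)

theory Defs
  imports
    "HOL-Algebra.Module"
    "HOL-Algebra.Ideal"
    "HOL-Algebra.Generated_Groups"
    "HOL-Algebra.Free_Abelian_Groups"
begin

section \<open>Polynomial rings over the rationals\<close>

text \<open>
  All polynomials live in one type, the rational polynomials in the variables
  \<open>X 0, X 1, \<dots>\<close>; the ring \<open>\<rat>[x\<^sub>i | i \<in> V]\<close> is its subring of polynomials in the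
  variables from \<open>V\<close>, so that inclusions of variable sets are inclusions of rings.
\<close>

type_synonym mono = "nat \<Rightarrow>\<^sub>0 nat"
type_synonym mpol = "mono \<Rightarrow>\<^sub>0 rat"

definition X :: "nat \<Rightarrow> mpol" where
  "X i = Poly_Mapping.single (Poly_Mapping.single i 1) 1"

definition cst :: "rat \<Rightarrow> mpol" where
  "cst c = Poly_Mapping.single 0 c"

definition pols :: "nat set \<Rightarrow> mpol set" where
  "pols V = {p. \<forall>a\<in>Poly_Mapping.keys p. Poly_Mapping.keys a \<subseteq> V}"

definition pol_ring :: "nat set \<Rightarrow> mpol ring" where
  "pol_ring V = \<lparr>carrier = pols V, mult = (*), one = 1, ring.zero = 0, add = (+)\<rparr>"

text \<open>Every variable has degree 2; the zero polynomial is homogeneous of every degree.\<close>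

definition mono_deg :: "mono \<Rightarrow> int" where
  "mono_deg a = 2 * (\<Sum>i\<in>Poly_Mapping.keys a. int (Poly_Mapping.lookup a i))"

definition homogeneous :: "int \<Rightarrow> mpol \<Rightarrow> bool" where
  "homogeneous k p \<longleftrightarrow> (\<forall>a\<in>Poly_Mapping.keys p. mono_deg a = k)"

definition subst :: "(nat \<Rightarrow> mpol) \<Rightarrow> mpol \<Rightarrow> mpol" where
  "subst \<sigma> p = (\<Sum>a\<in>Poly_Mapping.keys p.
     cst (Poly_Mapping.lookup p a) * (\<Prod>i\<in>Poly_Mapping.keys a. \<sigma> i ^ Poly_Mapping.lookup a i))"

text \<open>Meaningful only for \<open>q \<noteq> 0\<close> dividing \<open>p\<close>; the type is an integral domain.\<close>

definition exact_quot :: "mpol \<Rightarrow> mpol \<Rightarrow> mpol" where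
  "exact_quot p q = (THE r. r * q = p)"


section \<open>Graded modules\<close>

record 'm gmodule = "(mpol, 'm) module" +
  deg_part :: "int \<Rightarrow> 'm set"

definition graded_module :: "nat set \<Rightarrow> 'm gmodule \<Rightarrow> bool" where
  "graded_module V M \<longleftrightarrow>
     module (pol_ring V) M \<and>
     (\<forall>k. subgroup (deg_part M k) (add_monoid M)) \<and>
     (\<forall>j k. \<forall>p\<in>pols V. \<forall>x\<in>deg_part M k.
        homogeneous j p \<longrightarrow> p \<odot>\<^bsub>M\<^esub> x \<in> deg_part M (j + k)) \<and>
     (\<forall>x\<in>carrier M. \<exists>!c. (\<forall>k. c k \<in> deg_part M k) \<and> finite {k. c k \<noteq> \<zero>\<^bsub>M\<^esub>} \<and>
        x = finsum M c {k. c k \<noteq> \<zero>\<^bsub>M\<^esub>})"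

definition module_basis :: "nat set \<Rightarrow> 'm gmodule \<Rightarrow> 'm set \<Rightarrow> bool" where
  "module_basis V M B \<longleftrightarrow>
     B \<subseteq> carrier M \<and>
     (\<forall>x\<in>carrier M. \<exists>!c. c \<in> B \<rightarrow> pols V \<and> (\<forall>b. b \<notin> B \<longrightarrow> c b = 0) \<and>
        finite {b. c b \<noteq> 0} \<and> x = finsum M (\<lambda>b. c b \<odot>\<^bsub>M\<^esub> b) {b. c b \<noteq> 0})"

text \<open>A free graded module is a direct sum of shifted copies of the ring, i.e. it has a basis
  (of any cardinality) of homogeneous elements.\<close>

definition free_graded_module :: "nat set \<Rightarrow> 'm gmodule \<Rightarrow> bool" where
  "free_graded_module V M \<longleftrightarrow>
     graded_module V M \<and> (\<exists>B \<subseteq> (\<Union>k. deg_part M k). module_basis V M B)"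

definition lin_maps :: "nat set \<Rightarrow> int \<Rightarrow> 'a gmodule \<Rightarrow> 'b gmodule \<Rightarrow> ('a \<Rightarrow> 'b) set" where
  "lin_maps V k M N =
     {f \<in> hom (add_monoid M) (add_monoid N).
        (\<forall>p\<in>pols V. \<forall>x\<in>carrier M. f (p \<odot>\<^bsub>M\<^esub> x) = p \<odot>\<^bsub>N\<^esub> f x) \<and>
        (\<forall>j. f ` deg_part M j \<subseteq> deg_part N (j + k))}"

definition free_rank1 :: "nat set \<Rightarrow> mpol gmodule" where
  "free_rank1 V = \<lparr>carrier = pols V, mult = (*), one = 1, ring.zero = 0, add = (+), smult = (*),
     deg_part = (\<lambda>k. {p \<in> pols V. homogeneous k p})\<rparr>"

definition shift_module :: "int \<Rightarrow> 'm gmodule \<Rightarrow> 'm gmodule" where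
  "shift_module m M = M\<lparr>deg_part := (\<lambda>k. deg_part M (k - m))\<rparr>"

definition sum_module :: "'a gmodule \<Rightarrow> 'b gmodule \<Rightarrow> ('a \<times> 'b) gmodule" where
  "sum_module M N = \<lparr>carrier = carrier M \<times> carrier N, mult = undefined, one = undefined,
     ring.zero = (\<zero>\<^bsub>M\<^esub>, \<zero>\<^bsub>N\<^esub>),
     add = (\<lambda>(x, y) (x', y'). (x \<oplus>\<^bsub>M\<^esub> x', y \<oplus>\<^bsub>N\<^esub> y')),
     smult = (\<lambda>p (x, y). (p \<odot>\<^bsub>M\<^esub> x, p \<odot>\<^bsub>N\<^esub> y)),
     deg_part = (\<lambda>k. deg_part M k \<times> deg_part N k)\<rparr>"


section \<open>Tensor products of modules\<close>

text \<open>
  For a module \<open>M\<close> over \<open>\<rat>[V]\<close> and a module \<open>N\<close> over \<open>\<rat>[U]\<close>, the tensor product is taken over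
  the ring \<open>\<rat>[V \<inter> U]\<close> in the shared variables: it is the free abelian group on the set
  \<open>M \<times> N\<close> modulo the biadditivity relations and the relations \<open>(p x, y) = (x, p y)\<close>
  for \<open>p \<in> \<rat>[V \<inter> U]\<close>.  It is a module over \<open>\<rat>[V] \<otimes> \<rat>[U] = \<rat>[V \<union> U]\<close>.
\<close>

type_synonym ('a, 'b) tensor = "('a \<times> 'b \<Rightarrow>\<^sub>0 int) set"

definition pairs_group :: "'a gmodule \<Rightarrow> 'b gmodule \<Rightarrow> ('a \<times> 'b \<Rightarrow>\<^sub>0 int) monoid" where
  "pairs_group M N = free_Abelian_group (carrier M \<times> carrier N)"

definition tensor_rel :: "nat set \<Rightarrow> 'a gmodule \<Rightarrow> 'b gmodule \<Rightarrow> ('a \<times> 'b \<Rightarrow>\<^sub>0 int) set" where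
  "tensor_rel A M N = generate (pairs_group M N)
     ({frag_of (x \<oplus>\<^bsub>M\<^esub> x', y) - frag_of (x, y) - frag_of (x', y) | x x' y.
         x \<in> carrier M \<and> x' \<in> carrier M \<and> y \<in> carrier N} \<union>
      {frag_of (x, y \<oplus>\<^bsub>N\<^esub> y') - frag_of (x, y) - frag_of (x, y') | x y y'.
         x \<in> carrier M \<and> y \<in> carrier N \<and> y' \<in> carrier N} \<union>
      {frag_of (p \<odot>\<^bsub>M\<^esub> x, y) - frag_of (x, p \<odot>\<^bsub>N\<^esub> y) | p x y.
         p \<in> pols A \<and> x \<in> carrier M \<and> y \<in> carrier N})"

definition tensor_group :: "nat set \<Rightarrow> 'a gmodule \<Rightarrow> 'b gmodule \<Rightarrow> ('a, 'b) tensor monoid" where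
  "tensor_group A M N = pairs_group M N Mod tensor_rel A M N"

definition pure_tensor ::
    "nat set \<Rightarrow> 'a gmodule \<Rightarrow> 'b gmodule \<Rightarrow> 'a \<Rightarrow> 'b \<Rightarrow> ('a, 'b) tensor" where
  "pure_tensor A M N x y = tensor_rel A M N #>\<^bsub>pairs_group M N\<^esub> frag_of (x, y)"

text \<open>The map \<open>x \<otimes> y \<mapsto> f x \<otimes> g y\<close> from \<open>M \<otimes> N\<close> to \<open>M' \<otimes> N'\<close>, defined on the classes
  modulo \<^const>\<open>tensor_rel\<close> through representatives (its source is determined by its argument).\<close>

definition tensor_map ::
    "nat set \<Rightarrow> 'c gmodule \<Rightarrow> 'd gmodule \<Rightarrow> ('a \<Rightarrow> 'c) \<Rightarrow> ('b \<Rightarrow> 'd) \<Rightarrow>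
     ('a, 'b) tensor \<Rightarrow> ('c, 'd) tensor" where
  "tensor_map A M' N' f g C =
     the_elem ((\<lambda>c. tensor_rel A M' N' #>\<^bsub>pairs_group M' N'\<^esub>
       frag_extend (\<lambda>(x, y). frag_of (f x, g y)) c) ` C)"

definition mono_restrict :: "nat set \<Rightarrow> mono \<Rightarrow> mono" where
  "mono_restrict V a = (\<Sum>i\<in>Poly_Mapping.keys a \<inter> V.
     Poly_Mapping.single i (Poly_Mapping.lookup a i))"

text \<open>In the action of \<open>\<rat>[V \<union> U]\<close>, a term \<open>c x\<^sup>a\<close> is split into the factor with the variables
  in \<open>V\<close>, which acts on the left, and the factor with the variables outside \<open>V\<close>, which acts on
  the right.\<close>

definition tensor_module ::
    "nat set \<Rightarrow> nat set \<Rightarrow> 'a gmodule \<Rightarrow> 'b gmodule \<Rightarrow> ('a, 'b) tensor gmodule" where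
  "tensor_module V U M N =
     (let A = V \<inter> U; T = tensor_group A M N in
      \<lparr>carrier = carrier T, mult = undefined, one = undefined, ring.zero = \<one>\<^bsub>T\<^esub>, add = mult T,
       smult = (\<lambda>p C. finprod T (\<lambda>a. tensor_map A M N
         (\<lambda>x. Poly_Mapping.single (mono_restrict V a) (Poly_Mapping.lookup p a) \<odot>\<^bsub>M\<^esub> x)
         (\<lambda>y. Poly_Mapping.single (mono_restrict (- V) a) 1 \<odot>\<^bsub>N\<^esub> y) C)
         (Poly_Mapping.keys p)),
       deg_part = (\<lambda>k. generate T
         {pure_tensor A M N x y | i j x y.
            x \<in> deg_part M i \<and> y \<in> deg_part N j \<and> i + j = k})\<rparr>)"


section \<open>Graded factorizations\<close>

text \<open>
  The components \<open>M\<^sup>0\<close>, \<open>M\<^sup>1\<close> are \<open>component M False\<close>, \<open>component M True\<close>, and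
  \<open>differential M i\<close> maps \<open>component M i\<close> to \<open>component M (\<not> i)\<close>; thus parities add by \<open>(\<noteq>)\<close>.  The field \<open>ring_vars\<close> holds the
  variables of the base ring.
\<close>

record 'm factorization =
  ring_vars :: "nat set"
  component :: "bool \<Rightarrow> 'm gmodule"
  differential :: "bool \<Rightarrow> 'm \<Rightarrow> 'm"

definition graded_factorization :: "nat \<Rightarrow> mpol \<Rightarrow> 'm factorization \<Rightarrow> bool" where
  "graded_factorization n w M \<longleftrightarrow>
     finite (ring_vars M) \<and> w \<in> pols (ring_vars M) \<and> homogeneous (2 * (int n + 1)) w \<and>
     (\<forall>i. free_graded_module (ring_vars M) (component M i)) \<and>
     (\<forall>i. differential M i \<in> lin_maps (ring_vars M) (int n + 1)
        (component M i) (component M (\<not> i))) \<and>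
     (\<forall>i. \<forall>x\<in>carrier (component M i).
        differential M (\<not> i) (differential M i x) = w \<odot>\<^bsub>component M i\<^esub> x)"

definition factorization_hom ::
    "'a factorization \<Rightarrow> 'b factorization \<Rightarrow> (bool \<Rightarrow> 'a \<Rightarrow> 'b) \<Rightarrow> bool" where
  "factorization_hom M N f \<longleftrightarrow>
     (\<forall>i. f i \<in> lin_maps (ring_vars M) 0 (component M i) (component N i)) \<and>
     (\<forall>i. \<forall>x\<in>carrier (component M i). f (\<not> i) (differential M i x) = differential N i (f i x))"

definition homotopic ::
    "nat \<Rightarrow> 'a factorization \<Rightarrow> 'b factorization \<Rightarrow>
     (bool \<Rightarrow> 'a \<Rightarrow> 'b) \<Rightarrow> (bool \<Rightarrow> 'a \<Rightarrow> 'b) \<Rightarrow> bool" where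
  "homotopic n M N f g \<longleftrightarrow>
     (\<exists>h. (\<forall>i. h i \<in> lin_maps (ring_vars M) (- int n - 1) (component M i) (component N (\<not> i))) \<and>
        (\<forall>i. \<forall>x\<in>carrier (component M i).
           f i x \<ominus>\<^bsub>component N i\<^esub> g i x =
             h (\<not> i) (differential M i x) \<oplus>\<^bsub>component N i\<^esub> differential N (\<not> i) (h i x)))"


subsection \<open>The cohomology \<open>H(M)\<close> of \<open>M / \<mm>M\<close>\<close>

definition quot_module :: "('r, 'm, 'z) module_scheme \<Rightarrow> 'm set \<Rightarrow> ('r, 'm set) module" where
  "quot_module M K = \<lparr>carrier = carrier (M A_Mod K), mult = undefined, one = undefined,
     ring.zero = \<one>\<^bsub>M A_Mod K\<^esub>, add = mult (M A_Mod K),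
     smult = (\<lambda>r C. the_elem ((\<lambda>x. K +>\<^bsub>M\<^esub> (r \<odot>\<^bsub>M\<^esub> x)) ` C))\<rparr>"

text \<open>\<open>\<mm>M\<close>, where \<open>\<mm>\<close> is the ideal of \<open>\<rat>[V]\<close> generated by the variables.\<close>

definition max_submodule :: "nat set \<Rightarrow> 'm gmodule \<Rightarrow> 'm set" where
  "max_submodule V M = generate (add_monoid M)
     {p \<odot>\<^bsub>M\<^esub> x | p x. p \<in> Idl\<^bsub>pol_ring V\<^esub> (X ` V) \<and> x \<in> carrier M}"

definition reduced :: "'m factorization \<Rightarrow> bool \<Rightarrow> (mpol, 'm set) module" where
  "reduced M i = quot_module (component M i) (max_submodule (ring_vars M) (component M i))"

definition reduced_differential :: "'m factorization \<Rightarrow> bool \<Rightarrow> 'm set \<Rightarrow> 'm set" where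
  "reduced_differential M i C =
     the_elem ((\<lambda>x. max_submodule (ring_vars M) (component M (\<not> i)) +>\<^bsub>component M (\<not> i)\<^esub> differential M i x) ` C)"

definition cohomology :: "'m factorization \<Rightarrow> bool \<Rightarrow> (mpol, 'm set set) module" where
  "cohomology M i =
     quot_module
       ((reduced M i)\<lparr>carrier := a_kernel (reduced M i) (reduced M (\<not> i)) (reduced_differential M i)\<rparr>)
       (reduced_differential M (\<not> i) ` carrier (reduced M (\<not> i)))"

definition finite_dim_rat :: "(mpol, 'm) module \<Rightarrow> bool" where
  "finite_dim_rat H \<longleftrightarrow>
     (\<exists>F \<subseteq> carrier H. finite F \<and>
        (\<forall>x\<in>carrier H. \<exists>c. x = finsum H (\<lambda>v. cst (c v) \<odot>\<^bsub>H\<^esub> v) F))"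


subsection \<open>The category \<open>hmf\<close>\<close>

definition hmf_object :: "nat set \<Rightarrow> nat \<Rightarrow> mpol \<Rightarrow> 'm factorization \<Rightarrow> bool" where
  "hmf_object V n w M \<longleftrightarrow>
     ring_vars M = V \<and> graded_factorization n w M \<and> (\<forall>i. finite_dim_rat (cohomology M i))"

definition hmf_isomorphic ::
    "nat set \<Rightarrow> nat \<Rightarrow> mpol \<Rightarrow> 'a factorization \<Rightarrow> 'b factorization \<Rightarrow> bool" where
  "hmf_isomorphic V n w M N \<longleftrightarrow>
     hmf_object V n w M \<and> hmf_object V n w N \<and>
     (\<exists>f g. factorization_hom M N f \<and> factorization_hom N M g \<and>
        homotopic n M M (\<lambda>i. g i \<circ> f i) (\<lambda>i. id) \<and>
        homotopic n N N (\<lambda>i. f i \<circ> g i) (\<lambda>i. id))"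


subsection \<open>Constructions\<close>

text \<open>A factorization over \<open>\<rat>[V']\<close> regarded as one over the subring \<open>\<rat>[V]\<close>, for \<open>V \<subseteq> V'\<close>:
  only the ring over which linearity, freeness and \<open>\<mm>\<close> are understood changes.\<close>

definition restrict_scalars :: "nat set \<Rightarrow> 'm factorization \<Rightarrow> 'm factorization" where
  "restrict_scalars V M = M\<lparr>ring_vars := V\<rparr>"

definition shift :: "int \<Rightarrow> 'm factorization \<Rightarrow> 'm factorization" where
  "shift m M = M\<lparr>component := (\<lambda>i. shift_module m (component M i))\<rparr>"

text \<open>Only for factorizations over the same ring.\<close>

definition direct_sum ::
    "'a factorization \<Rightarrow> 'b factorization \<Rightarrow> ('a \<times> 'b) factorization" (infixl \<open>\<oplus>\<^sub>f\<close> 65) where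
  "M \<oplus>\<^sub>f N = \<lparr>ring_vars = ring_vars M,
     component = (\<lambda>i. sum_module (component M i) (component N i)),
     differential = (\<lambda>i (x, y). (differential M i x, differential N i y))\<rparr>"

text \<open>
  Component \<open>i\<close> of the tensor product is \<open>(M\<^sup>0 \<otimes> N\<^sup>i) \<oplus> (M\<^sup>1 \<otimes> N\<^sup>i\<^sup>-\<^sup>1)\<close>.  For its element
  \<open>(s, t)\<close>, the rule \<open>d (m \<otimes> m') = d m \<otimes> m' + (-1)\<^sup>j m \<otimes> d m'\<close> for \<open>m \<in> M\<^sup>j\<close> gives the
  entry \<open>(1 \<otimes> d) s + (d \<otimes> 1) t\<close> in \<open>M\<^sup>0 \<otimes> N\<^sup>i\<^sup>+\<^sup>1\<close> and the entry
  \<open>(d \<otimes> 1) s - (1 \<otimes> d) t\<close> in \<open>M\<^sup>1 \<otimes> N\<^sup>i\<close>.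
\<close>

definition tensor ::
    "'a factorization \<Rightarrow> 'b factorization \<Rightarrow> (('a, 'b) tensor \<times> ('a, 'b) tensor) factorization"
    (infixl \<open>\<otimes>\<^sub>f\<close> 70) where
  "M \<otimes>\<^sub>f N =
     (let V = ring_vars M; U = ring_vars N;
          T = (\<lambda>j k. tensor_module V U (component M j) (component N k));
          tm = (\<lambda>j k. tensor_map (V \<inter> U) (component M j) (component N k)) in
      \<lparr>ring_vars = V \<union> U,
       component = (\<lambda>i. sum_module (T False i) (T True (\<not> i))),
       differential = (\<lambda>i (s, t).
         (tm False (\<not> i) id (differential N i) s \<oplus>\<^bsub>T False (\<not> i)\<^esub> tm False (\<not> i) (differential M True) id t,
          tm True i (differential M False) id s \<ominus>\<^bsub>T True i\<^esub> tm True i id (differential N (\<not> i)) t))\<rparr>)"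

text \<open>\<open>{a, b}\<close> over \<open>\<rat>[V]\<close>, where \<open>k\<close> is the degree of \<open>a\<close>.\<close>

definition koszul :: "nat \<Rightarrow> nat set \<Rightarrow> int \<Rightarrow> mpol \<Rightarrow> mpol \<Rightarrow> mpol factorization" where
  "koszul n V k a b = \<lparr>ring_vars = V,
     component = (\<lambda>i. if i then shift_module (int n + 1 - k) (free_rank1 V) else free_rank1 V),
     differential = (\<lambda>i x. if i then b * x else a * x)\<rparr>"


section \<open>Arcs and wide edges\<close>

definition pi_pol :: "nat \<Rightarrow> nat \<Rightarrow> nat \<Rightarrow> mpol" where
  "pi_pol n i j = exact_quot (X i ^ (n + 1) - X j ^ (n + 1)) (X i - X j)"

definition arc :: "nat \<Rightarrow> nat \<Rightarrow> nat \<Rightarrow> mpol factorization" where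
  "arc n i j = koszul n {i, j} (2 * int n) (pi_pol n i j) (X i - X j)"

text \<open>The two arguments of \<open>g\<close> are the variables \<open>X 0\<close> and \<open>X 1\<close>; in the defining identity
  these also play the role of \<open>x\<close> and \<open>y\<close>.\<close>

definition g_pol :: "nat \<Rightarrow> mpol" where
  "g_pol n = (THE g. g \<in> pols {0, 1} \<and>
     subst (\<lambda>i. if i = 0 then X 0 + X 1 else X 0 * X 1) g = X 0 ^ (n + 1) + X 1 ^ (n + 1))"

definition g_at :: "nat \<Rightarrow> mpol \<Rightarrow> mpol \<Rightarrow> mpol" where
  "g_at n s t = subst (\<lambda>i. if i = 0 then s else t) (g_pol n)"

definition u1 :: "nat \<Rightarrow> mpol \<Rightarrow> mpol \<Rightarrow> mpol \<Rightarrow> mpol \<Rightarrow> mpol" where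
  "u1 n y1 y2 y3 y4 =
     exact_quot (g_at n (y1 + y2) (y1 * y2) - g_at n (y3 + y4) (y1 * y2)) (y1 + y2 - y3 - y4)"

definition u2 :: "nat \<Rightarrow> mpol \<Rightarrow> mpol \<Rightarrow> mpol \<Rightarrow> mpol \<Rightarrow> mpol" where
  "u2 n y1 y2 y3 y4 =
     exact_quot (g_at n (y3 + y4) (y1 * y2) - g_at n (y3 + y4) (y3 * y4)) (y1 * y2 - y3 * y4)"

text \<open>The wide edge with outgoing marks \<open>i, j\<close> and incoming marks \<open>k, l\<close>; \<open>u1\<close> and \<open>u2\<close> have
  degrees \<open>2n\<close> and \<open>2n - 2\<close>.\<close>

type_synonym wide_elt = "(mpol, mpol) tensor \<times> (mpol, mpol) tensor"

definition wide_edge :: "nat \<Rightarrow> nat \<Rightarrow> nat \<Rightarrow> nat \<Rightarrow> nat \<Rightarrow> wide_elt factorization" where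
  "wide_edge n i j k l =
     (let V = {i, j, k, l} in
      shift (- 1)
        (koszul n V (2 * int n) (u1 n (X i) (X j) (X k) (X l)) (X i + X j - X k - X l) \<otimes>\<^sub>f
         koszul n V (2 * int n - 2) (u2 n (X i) (X j) (X k) (X l)) (X i * X j - X k * X l)))"

end

theory Submission
  imports Defs "HOL-Library.Function_Algebras" "HOL-Library.Product_Plus"
begin

text \<open>
  Restricted to the six external variables, each of the four factorizations is a Koszul
  factorization \<open>\<Otimes>{a\<^sub>i, b\<^sub>i}\<close> whose sequence \<open>b\<close> is regular, hence it resolves \<open>Q = S/(b)\<close>: morphisms
  between two such factorizations exist and are determined up to homotopy by their effect on these quotients.
  So it suffices to compare the quotients.  Let \<open>E\<close> be generated by the differences of the elementary symmetric
  polynomials of the outgoing and of the incoming variables, and let \<open>\<Upsilon>\<close> be a Koszul factorization of finite rank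
  that resolves \<open>\<rat>[x\<^sub>1, \<dots>, x\<^sub>6]/E\<close>.  In the quotient of \<open>\<Gamma>\<^sub>1\<close> every element is \<open>\<alpha> + \<beta> z\<close> with
  \<open>z = x\<^sub>8 - x\<^sub>6\<close> and \<open>\<alpha>, \<beta>\<close> in the external variables, and it vanishes iff \<open>\<alpha>\<close> is in \<open>E\<close> and \<open>\<beta>\<close> in the
  ideal of \<open>\<Gamma>\<^sub>4\<close>.  Thus \<open>\<Gamma>\<^sub>1 \<cong> \<Upsilon> \<oplus> \<Gamma>\<^sub>4\<close>.  Exchanging \<open>x\<^sub>1\<close> with \<open>x\<^sub>3\<close> and
  \<open>x\<^sub>4\<close> with \<open>x\<^sub>6\<close> preserves \<open>E\<close> and gives \<open>\<Gamma>\<^sub>3 \<cong> \<Upsilon> \<oplus> \<Gamma>\<^sub>2\<close>, so both sides are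
  isomorphic to \<open>\<Upsilon> \<oplus> \<Gamma>\<^sub>4 \<oplus> \<Gamma>\<^sub>2\<close>, which has finite rank and therefore finite-dimensional cohomology.
\<close>

subsection \<open>Polynomials\<close>

text \<open>A factorization has no exactness of its own, since its differential squares to
  \<open>w\<close>. But the b-half of a Koszul differential lowers exterior degree by one while the
  a-half raises it by one. Modulo higher exterior degree only the b-half is visible, so exactness of
  the ordinary Koszul complex can be used one degree at a time, and the corrections end because
  exterior degree is bounded. The source of a morphism only has to be free; this matters because
  over x1, ..., x6 the factorizations of \<Gamma>1 and \<Gamma>3 have infinite rank.

  The two-term form \<alpha> + \<beta> z comes from the relation (x8 - x1)(x8 - x2) = 0. As z has
  degree 2, the part \<beta> z of a quotient shifted by -3 (one -1 for each wide edge) is shifted by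
  -1, exactly as \<Gamma>4 is.

  Regularity of the symmetric differences themselves is hard to see; \<Upsilon> is therefore built
  on other generators of E, one of them a product of linear forms and one linear.

  Tensor products are given as classes of formal sums, nested for each factor. They are replaced
  once and for all by functions on lists of parities, and results are carried back along the
  coordinate isomorphisms.\<close>

abbreviation lookup :: "('a \<Rightarrow>\<^sub>0 'b::zero) \<Rightarrow> 'a \<Rightarrow> 'b" where "lookup \<equiv> Poly_Mapping.lookup"
abbreviation keys :: "('a \<Rightarrow>\<^sub>0 'b::zero) \<Rightarrow> 'a set" where "keys \<equiv> Poly_Mapping.keys"
abbreviation single :: "'a \<Rightarrow> 'b::zero \<Rightarrow> 'a \<Rightarrow>\<^sub>0 'b" where "single \<equiv> Poly_Mapping.single"

lemma mpol_expand: "(p :: 'a \<Rightarrow>\<^sub>0 'b::comm_monoid_add) = (\<Sum>a\<in>keys p. single a (lookup p a))"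
  by (rule poly_mapping_eqI) (auto simp: lookup_sum lookup_single when_def sum.delta in_keys_iff)

lemma mpol_induct [case_names zero single add]:
  assumes "P 0" and "\<And>a c. a \<in> keys p \<Longrightarrow> P (single a c)"
    and "\<And>q r. P q \<Longrightarrow> P r \<Longrightarrow> P (q + r)"
  shows "P (p :: 'a \<Rightarrow>\<^sub>0 'b::comm_monoid_add)"
proof -
  have "P (\<Sum>a\<in>A. single a (lookup p a))"
    if "finite A" "A \<subseteq> keys p" for A
    using that by (induction A rule: finite_induct) (auto intro: assms)
  from this[OF finite_keys order_refl] show ?thesis
    by (subst mpol_expand)
qed

lemma mono_deg_add: "mono_deg (a + b) = mono_deg a + mono_deg b"
  unfolding mono_deg_def
  by (subst setsum_keys_plus_distrib) (auto simp: algebra_simps)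

lemma mono_deg_single: "mono_deg (single i k) = 2 * int k"
  by (simp add: mono_deg_def)

lemma mono_deg_0 [simp]: "mono_deg 0 = 0"
  by (simp add: mono_deg_def)

lemma cst_add: "cst (c + d) = cst c + cst d" and cst_mult: "cst (c * d) = cst c * cst d"
  and cst_0 [simp]: "cst 0 = 0" and cst_1 [simp]: "cst 1 = 1"
  by (auto simp: cst_def single_add mult_single)

subsubsection \<open>Subrings generated by variables\<close>

lemma pols_iff_single: "single a c \<in> pols V \<longleftrightarrow> c = 0 \<or> keys a \<subseteq> V"
  by (auto simp: pols_def)

lemma pols_0 [simp]: "0 \<in> pols V" and pols_1 [simp]: "1 \<in> pols V"
  by (auto simp: pols_def)

lemma pols_X [simp]: "X i \<in> pols V \<longleftrightarrow> i \<in> V"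
  by (auto simp: X_def pols_iff_single)

lemma pols_cst [simp]: "cst c \<in> pols V"
  by (auto simp: cst_def pols_iff_single)

lemma keys_mono_add: "keys (a + b) = keys a \<union> keys (b :: mono)"
  by (auto simp: in_keys_iff lookup_add)

lemma pols_add: "p \<in> pols V \<Longrightarrow> q \<in> pols V \<Longrightarrow> p + q \<in> pols V"
  using keys_add[of p q] by (auto simp: pols_def)

lemma pols_uminus: "p \<in> pols V \<Longrightarrow> - p \<in> pols V"
  by (auto simp: pols_def)

lemma pols_diff: "p \<in> pols V \<Longrightarrow> q \<in> pols V \<Longrightarrow> p - q \<in> pols V"
  using pols_add[of p V "- q"] by (auto simp: pols_uminus)

lemma pols_mult: "p \<in> pols V \<Longrightarrow> q \<in> pols V \<Longrightarrow> p * q \<in> pols V"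
  using keys_mult[of p q] unfolding pols_def by (fastforce simp: keys_mono_add)

lemma pols_power: "p \<in> pols V \<Longrightarrow> p ^ k \<in> pols V"
  by (induction k) (auto intro: pols_mult)

lemma pols_sum: "(\<And>i. i \<in> A \<Longrightarrow> f i \<in> pols V) \<Longrightarrow> sum f A \<in> pols V"
  by (induction A rule: infinite_finite_induct) (auto intro: pols_add)

lemma pols_numeral [simp]: "numeral k \<in> pols V"
  by (metis cst_def single_numeral pols_cst)

lemmas pols_intros = pols_add pols_diff pols_uminus pols_mult pols_power

lemma pols_mono: "V \<subseteq> U \<Longrightarrow> p \<in> pols V \<Longrightarrow> p \<in> pols U"
  by (auto simp: pols_def)

lemma pols_single_induct [consumes 1, case_names zero single add]:
  assumes "p \<in> pols V" "P 0" "\<And>a c. keys a \<subseteq> V \<Longrightarrow> P (single a c)"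
    and "\<And>q r. P q \<Longrightarrow> P r \<Longrightarrow> P (q + r)"
  shows "P p"
  by (rule mpol_induct) (use assms in \<open>auto simp: pols_def\<close>)

lemma X_power: "X i ^ k = single (single i k) 1"
proof (induction k)
  case (Suc k)
  then show ?case using single_add[of i 1 k] by (simp add: X_def mult_single)
qed simp

lemma single_expand:
  "single a c = cst c * (\<Prod>i\<in>keys a. X i ^ lookup a i)"
proof -
  have "(\<Prod>i\<in>A. X i ^ lookup a i) =
      single (\<Sum>i\<in>A. single i (lookup a i)) 1" if "finite A" for A
    using that by (induction A rule: finite_induct) (auto simp: X_power mult_single)
  then show ?thesis
    by (simp add: cst_def mult_single flip: mpol_expand)
qed

text \<open>Multiplicative statements (substitutions, normal forms modulo an ideal) are checked on
  constants and variables only. Membership in \<open>pols V\<close> is carried along because the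
  cases for sums and products often use it.\<close>

lemma pols_ring_induct [consumes 1, case_names cst X add mult]:
  assumes "p \<in> pols V" "\<And>c. P (cst c)" "\<And>i. i \<in> V \<Longrightarrow> P (X i)"
    and "\<And>q r. q \<in> pols V \<Longrightarrow> r \<in> pols V \<Longrightarrow> P q \<Longrightarrow> P r \<Longrightarrow> P (q + r)"
    and "\<And>q r. q \<in> pols V \<Longrightarrow> r \<in> pols V \<Longrightarrow> P q \<Longrightarrow> P r \<Longrightarrow> P (q * r)"
  shows "P p"
proof -
  define Q where "Q q \<longleftrightarrow> q \<in> pols V \<and> P q" for q
  have Q: "Q (cst c)" "i \<in> V \<Longrightarrow> Q (X i)" "Q q \<Longrightarrow> Q r \<Longrightarrow> Q (q + r)" "Q q \<Longrightarrow> Q r \<Longrightarrow> Q (q * r)"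
    for c i q r
    using assms(2-) by (auto simp: Q_def intro: pols_intros)
  from assms(1) have "Q p"
  proof (induction rule: pols_single_induct)
    case zero
    then show ?case using Q(1)[of 0] by (simp add: cst_def)
  next
    case (single a c)
    have 1: "Q 1" using Q(1)[of 1] by (simp add: cst_def)
    have pw: "Q (X i ^ k)" if "i \<in> V" for i k
      using that by (induction k) (auto intro: 1 Q)
    have "Q (\<Prod>i\<in>A. X i ^ lookup a i)" if "finite A" "A \<subseteq> V" for A
      using that by (induction A rule: finite_induct) (auto intro: 1 pw Q(4))
    from this[OF finite_keys single] show ?case
      by (auto simp: single_expand intro: Q)
  qed (rule Q)
  then show ?thesis by (simp add: Q_def)
qed

subsubsection \<open>Substitution\<close>

definition mono_subst :: "(nat \<Rightarrow> mpol) \<Rightarrow> mono \<Rightarrow> mpol" where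
  "mono_subst \<sigma> a = (\<Prod>i\<in>keys a. \<sigma> i ^ lookup a i)"

lemma mono_subst_eq: "finite A \<Longrightarrow> keys a \<subseteq> A \<Longrightarrow>
    mono_subst \<sigma> a = (\<Prod>i\<in>A. \<sigma> i ^ lookup a i)"
  unfolding mono_subst_def by (intro prod.mono_neutral_left) (auto simp: in_keys_iff)

lemma mono_subst_add: "mono_subst \<sigma> (a + b) = mono_subst \<sigma> a * mono_subst \<sigma> b"
  by (subst (1 2 3) mono_subst_eq[where A = "keys a \<union> keys b"])
    (auto simp: keys_mono_add lookup_add power_add prod.distrib)

lemma subst_single: "subst \<sigma> (single a c) = cst c * mono_subst \<sigma> a"
  by (simp add: subst_def mono_subst_def)

lemma subst_0 [simp]: "subst \<sigma> 0 = 0"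
  by (simp add: subst_def)

lemma subst_add: "subst \<sigma> (p + q) = subst \<sigma> p + subst \<sigma> q"
  unfolding subst_def by (rule setsum_keys_plus_distrib) (auto simp: cst_add algebra_simps)

lemma subst_mult: "subst \<sigma> (p * q) = subst \<sigma> p * subst \<sigma> q"
proof (induction p rule: mpol_induct)
  case (single a c)
  show ?case
    by (induction q rule: mpol_induct)
      (auto simp: mult_single subst_single mono_subst_add cst_mult distrib_left subst_add algebra_simps)
qed (auto simp: distrib_right subst_add)

lemma subst_cst [simp]: "subst \<sigma> (cst c) = cst c"
  by (simp add: cst_def subst_single mono_subst_def mult_single)

lemma subst_1 [simp]: "subst \<sigma> 1 = 1"
  using subst_cst[of \<sigma> 1] by simp

lemma subst_numeral [simp]: "subst \<sigma> (numeral k) = numeral k"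
  by (metis cst_def single_numeral subst_cst)

lemma subst_X [simp]: "subst \<sigma> (X i) = \<sigma> i"
  by (simp add: X_def subst_single mono_subst_def)

lemma subst_uminus: "subst \<sigma> (- p) = - subst \<sigma> p"
  using subst_add[of \<sigma> p "- p"] by (simp add: add_eq_0_iff)

lemma subst_diff: "subst \<sigma> (p - q) = subst \<sigma> p - subst \<sigma> q"
  using subst_add[of \<sigma> p "- q"] by (simp add: subst_uminus)

lemma subst_power: "subst \<sigma> (p ^ k) = subst \<sigma> p ^ k"
  by (induction k) (auto simp: subst_mult)

lemmas subst_hom = subst_add subst_mult subst_diff subst_uminus subst_power

lemma subst_pols: "p \<in> pols V \<Longrightarrow> (\<And>i. i \<in> V \<Longrightarrow> \<sigma> i \<in> pols U) \<Longrightarrow> subst \<sigma> p \<in> pols U"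
  by (induction rule: pols_ring_induct) (auto simp: subst_hom intro: pols_intros)

lemma subst_cong_pols: "p \<in> pols V \<Longrightarrow> (\<And>i. i \<in> V \<Longrightarrow> \<sigma> i = \<tau> i) \<Longrightarrow> subst \<sigma> p = subst \<tau> p"
  by (induction rule: pols_ring_induct) (auto simp: subst_hom)

lemma subst_X_id [simp]: "subst X p = p"
proof -
  have "p \<in> pols UNIV" by (simp add: pols_def)
  then show ?thesis by (induction rule: pols_ring_induct) (auto simp: subst_hom)
qed

lemma subst_upd_fix: "p \<in> pols V \<Longrightarrow> v \<notin> V \<Longrightarrow> subst (X(v := e)) p = p"
  using subst_cong_pols[of p V "X(v := e)" X] by (metis fun_upd_other subst_X_id)

lemma subst_upd_pols: "p \<in> pols V \<Longrightarrow> e \<in> pols V \<Longrightarrow> subst (X(v := e)) p \<in> pols V"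
  by (erule subst_pols) auto

text \<open>Division with remainder by the monic linear polynomial \<open>X v - e\<close>. The
  quotient obeys a twisted product rule, q r - \<sigma>(q) \<sigma>(r) = (q - \<sigma>(q)) r +
  \<sigma>(q) (r - \<sigma>(r)), so it is enough to divide constants and variables.\<close>

lemma subst_upd_dvd:
  assumes "p \<in> pols V" "v \<in> V" "e \<in> pols V"
  obtains s where "s \<in> pols V" "p = subst (X(v := e)) p + (X v - e) * s"
proof -
  define \<sigma> where "\<sigma> = X(v := e)"
  have \<sigma>: "subst \<sigma> q \<in> pols V" if "q \<in> pols V" for q
    using that assms(3) unfolding \<sigma>_def by (rule subst_upd_pols)
  have "\<exists>s\<in>pols V. p - subst \<sigma> p = (X v - e) * s"
    using assms(1)
  proof (induction rule: pols_ring_induct)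
    case (cst c)
    then show ?case by (intro bexI[of _ 0]) auto
  next
    case (X i)
    then show ?case
      by (cases "i = v") (auto simp: \<sigma>_def intro: bexI[of _ 1] bexI[of _ 0])
  next
    case (add q r)
    then obtain s t where st: "s \<in> pols V" "t \<in> pols V" "q - subst \<sigma> q = (X v - e) * s"
      "r - subst \<sigma> r = (X v - e) * t" by blast
    have "q + r - subst \<sigma> (q + r) = (q - subst \<sigma> q) + (r - subst \<sigma> r)"
      by (simp add: subst_add)
    also have "\<dots> = (X v - e) * (s + t)" unfolding st(3,4) by (simp only: distrib_left)
    finally show ?case using st pols_add by blast
  next
    case (mult q r)
    then obtain s t where st: "s \<in> pols V" "t \<in> pols V" "q - subst \<sigma> q = (X v - e) * s"
      "r - subst \<sigma> r = (X v - e) * t" by blast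
    have "q * r - subst \<sigma> (q * r) = (q - subst \<sigma> q) * r + subst \<sigma> q * (r - subst \<sigma> r)"
      by (simp add: subst_mult left_diff_distrib right_diff_distrib)
    also have "\<dots> = (X v - e) * (s * r + subst \<sigma> q * t)"
      unfolding st(3,4) by (simp only: distrib_left mult.assoc mult.left_commute)
    finally show ?case
      using st mult.hyps \<sigma> by (blast intro: pols_add pols_mult)
  qed
  then obtain s where s: "s \<in> pols V" "p - subst \<sigma> p = (X v - e) * s" ..
  have "p = subst \<sigma> p + (X v - e) * s" by (simp only: s(2)[symmetric]) simp
  with s(1) show ?thesis unfolding \<sigma>_def by (rule that)
qed

subsubsection \<open>Gradings\<close>

lemma homogeneous_0 [simp]: "homogeneous k 0"
  by (simp add: homogeneous_def)

lemma homogeneous_single: "homogeneous k (single a c) \<longleftrightarrow> c = 0 \<or> mono_deg a = k"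
  by (auto simp: homogeneous_def)

lemma homogeneous_cst: "homogeneous 0 (cst c)"
  by (simp add: cst_def homogeneous_single)

lemma homogeneous_1 [simp]: "homogeneous 0 1"
  using homogeneous_cst[of 1] by simp

lemma homogeneous_numeral [simp]: "homogeneous 0 (numeral k)"
  by (metis cst_def homogeneous_cst single_numeral)

lemma homogeneous_X [simp]: "homogeneous k (X i) \<longleftrightarrow> k = 2"
  by (auto simp: X_def homogeneous_single mono_deg_single)

lemma homogeneous_add: "homogeneous k p \<Longrightarrow> homogeneous k q \<Longrightarrow> homogeneous k (p + q)"
  using keys_add[of p q] by (auto simp: homogeneous_def)

lemma homogeneous_uminus: "homogeneous k p \<Longrightarrow> homogeneous k (- p)"
  by (auto simp: homogeneous_def)

lemma homogeneous_diff: "homogeneous k p \<Longrightarrow> homogeneous k q \<Longrightarrow> homogeneous k (p - q)"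
  using homogeneous_add[of k p "- q"] by (auto simp: homogeneous_uminus)

lemma homogeneous_mult: "homogeneous j p \<Longrightarrow> homogeneous k q \<Longrightarrow> homogeneous (j + k) (p * q)"
  using keys_mult[of p q] unfolding homogeneous_def by (fastforce simp: mono_deg_add)

lemma homogeneous_mult_eq: "homogeneous j p \<Longrightarrow> homogeneous k q \<Longrightarrow> l = j + k \<Longrightarrow> homogeneous l (p * q)"
  using homogeneous_mult by blast

lemma homogeneous_power: "homogeneous j p \<Longrightarrow> homogeneous (int k * j) (p ^ k)"
  by (induction k) (auto intro: homogeneous_mult_eq simp: algebra_simps)

text \<open>Homogeneous component. Ideal membership and Koszul exactness produce witnesses of no
  definite degree; taking components afterwards makes them homogeneous.\<close>

definition hpart :: "int \<Rightarrow> mpol \<Rightarrow> mpol" where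
  "hpart k = Poly_Mapping.mapp (\<lambda>a c. if mono_deg a = k then c else 0)"

lemma lookup_hpart: "lookup (hpart k p) a = (if mono_deg a = k then lookup p a else 0)"
  by (simp add: hpart_def lookup_mapp when_def in_keys_iff)

lemma hpart_0 [simp]: "hpart k 0 = 0"
  by (rule poly_mapping_eqI) (simp add: lookup_hpart)

lemma hpart_add: "hpart k (p + q) = hpart k p + hpart k q"
  by (rule poly_mapping_eqI) (simp add: lookup_hpart lookup_add)

lemma hpart_diff: "hpart k (p - q) = hpart k p - hpart k q"
  by (rule poly_mapping_eqI) (simp add: lookup_hpart lookup_minus)

lemma hpart_sum: "hpart k (sum f A) = (\<Sum>i\<in>A. hpart k (f i))"
  by (induction A rule: infinite_finite_induct) (auto simp: hpart_add)

lemma hpart_single: "hpart k (single a c) = (if mono_deg a = k then single a c else 0)"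
  by (rule poly_mapping_eqI) (auto simp: lookup_hpart lookup_single when_def)

lemma keys_hpart: "keys (hpart k p) = {a \<in> keys p. mono_deg a = k}"
  by (auto simp: in_keys_iff lookup_hpart split: if_splits)

lemma homogeneous_hpart [simp]: "homogeneous k (hpart k p)"
  by (auto simp: homogeneous_def keys_hpart)

lemma hpart_pols: "p \<in> pols V \<Longrightarrow> hpart k p \<in> pols V"
  by (auto simp: pols_def keys_hpart)

lemma hpart_homogeneous: "homogeneous j p \<Longrightarrow> hpart k p = (if k = j then p else 0)"
  by (rule poly_mapping_eqI) (auto simp: lookup_hpart homogeneous_def in_keys_iff)

lemma homogeneous_iff_hpart: "homogeneous k p \<longleftrightarrow> hpart k p = p"
  by (metis homogeneous_hpart hpart_homogeneous)

lemma hpart_mult: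
  assumes "homogeneous j q" shows "hpart k (q * p) = q * hpart (k - j) p"
proof -
  have *: "hpart k (single a c * p) = single a c * hpart (k - mono_deg a) p" for a c
  proof (induction p rule: mpol_induct)
    case (single b d)
    have "mono_deg a + mono_deg b = k \<longleftrightarrow> mono_deg b = k - mono_deg a" by linarith
    then show ?case by (simp add: mult_single hpart_single mono_deg_add)
  qed (simp_all add: distrib_left hpart_add)
  have "hpart k (q * p) = hpart k (\<Sum>a\<in>keys q. single a (lookup q a) * p)"
    by (subst mpol_expand[of q]) (simp add: sum_distrib_right)
  also have "\<dots> = (\<Sum>a\<in>keys q. single a (lookup q a) * hpart (k - j) p)"
    using assms by (auto simp: hpart_sum * homogeneous_def intro!: sum.cong)
  also have "\<dots> = q * hpart (k - j) p"
    by (subst (3) mpol_expand[of q]) (simp add: sum_distrib_right)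
  finally show ?thesis .
qed

lemma finite_hpart: "finite {k. hpart k p \<noteq> 0}"
proof -
  have "{k. hpart k p \<noteq> 0} \<subseteq> mono_deg ` keys p"
  proof
    fix k assume "k \<in> {k. hpart k p \<noteq> 0}"
    then have "hpart k p \<noteq> 0" by blast
    then obtain a where "a \<in> keys (hpart k p)"
      by (metis all_not_in_conv in_keys_iff lookup_zero poly_mapping_eqI)
    then show "k \<in> mono_deg ` keys p" by (auto simp: keys_hpart)
  qed
  then show ?thesis by (rule finite_subset) simp
qed

lemma sum_hpart:
  assumes "finite K" "{k. hpart k p \<noteq> 0} \<subseteq> K" shows "(\<Sum>k\<in>K. hpart k p) = p"
proof (rule poly_mapping_eqI)
  fix a
  have "mono_deg a \<in> K" if "lookup p a \<noteq> 0"
  proof -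
    have "lookup (hpart (mono_deg a) p) a \<noteq> 0" using that by (simp add: lookup_hpart)
    then have "hpart (mono_deg a) p \<noteq> 0" by (metis lookup_zero)
    then show ?thesis using assms(2) by blast
  qed
  then show "lookup (\<Sum>k\<in>K. hpart k p) a = lookup p a"
    using assms(1) by (auto simp: lookup_sum lookup_hpart sum.delta)
qed

subsubsection \<open>Coefficients with respect to some of the variables\<close>

text \<open>For \<open>a\<close> in the variables \<open>W\<close> this is the coefficient of the
  monomial \<open>a\<close> when \<open>p\<close> is read as a polynomial in \<open>W\<close> over
  the polynomials free of \<open>W\<close>: \<open>map_key\<close> divides by \<open>a\<close>, and
  \<open>mapp\<close> drops the terms that still involve \<open>W\<close>. These coefficients are
  the coordinates of a polynomial ring as a free module over the ring in fewer variables.\<close>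

definition coeff_at :: "nat set \<Rightarrow> mono \<Rightarrow> mpol \<Rightarrow> mpol" where
  "coeff_at W a p = Poly_Mapping.mapp (\<lambda>c x. if keys c \<inter> W = {} then x else 0)
     (Poly_Mapping.map_key (\<lambda>c. c + a) p)"

lemma lookup_coeff_at: "lookup (coeff_at W a p) c =
    (if keys c \<inter> W = {} then lookup p (c + a) else 0)"
proof -
  have "inj (\<lambda>c. c + a)" by (simp add: inj_def)
  then have "lookup (Poly_Mapping.map_key (\<lambda>c. c + a) p) c = lookup p (c + a)" for c
    by (simp add: map_key.rep_eq)
  then show ?thesis
    by (auto simp: coeff_at_def lookup_mapp when_def in_keys_iff)
qed

lemma coeff_at_0 [simp]: "coeff_at W a 0 = 0"
  by (rule poly_mapping_eqI) (simp add: lookup_coeff_at)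

lemma coeff_at_add: "coeff_at W a (p + q) = coeff_at W a p + coeff_at W a q"
  by (rule poly_mapping_eqI) (simp add: lookup_coeff_at lookup_add)

lemma coeff_at_sum: "coeff_at W a (sum f A) = (\<Sum>i\<in>A. coeff_at W a (f i))"
  by (induction A rule: infinite_finite_induct) (auto simp: coeff_at_add)

lemma lookup_mono_restrict: "lookup (mono_restrict V a) i = (if i \<in> V then lookup a i else 0)"
  by (auto simp: mono_restrict_def lookup_sum lookup_single when_def sum.delta in_keys_iff)

lemma mono_restrict_add: "mono_restrict V (a + b) = mono_restrict V a + mono_restrict V b"
  by (rule poly_mapping_eqI) (simp add: lookup_mono_restrict lookup_add)

lemma keys_mono_restrict: "keys (mono_restrict V a) = keys a \<inter> V"
  by (auto simp: in_keys_iff lookup_mono_restrict split: if_splits)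

lemma mono_restrict_split: "mono_restrict V a + mono_restrict (- V) a = a"
  by (rule poly_mapping_eqI) (simp add: lookup_mono_restrict lookup_add)

lemma mono_restrict_id: "keys a \<subseteq> V \<Longrightarrow> mono_restrict V a = a"
  by (rule poly_mapping_eqI) (auto simp: lookup_mono_restrict in_keys_iff)

lemma mono_restrict_disjoint: "keys a \<inter> V = {} \<Longrightarrow> mono_restrict V a = 0"
  by (rule poly_mapping_eqI) (auto simp: lookup_mono_restrict in_keys_iff)

lemma coeff_at_single:
  assumes "keys a \<subseteq> W"
  shows "coeff_at W a (single b s) =
    (if mono_restrict W b = a then single (mono_restrict (- W) b) s else 0)"
proof (rule poly_mapping_eqI)
  fix c
  have "c + a = b \<and> keys c \<inter> W = {} \<longleftrightarrow> mono_restrict W b = a \<and> mono_restrict (- W) b = c"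
  proof (intro iffI conjI; elim conjE)
    assume *: "c + a = b" "keys c \<inter> W = {}"
    then have "keys c \<subseteq> - W" "keys a \<inter> - W = {}" using assms by auto
    with * assms show "mono_restrict W b = a" "mono_restrict (- W) b = c"
      by (auto simp: mono_restrict_add mono_restrict_id mono_restrict_disjoint)
  next
    assume "mono_restrict W b = a" "mono_restrict (- W) b = c"
    then show "c + a = b" "keys c \<inter> W = {}"
      using mono_restrict_split[of W b] keys_mono_restrict[of "- W" b] by (auto simp: add.commute)
  qed
  then show "lookup (coeff_at W a (single b s)) c = lookup
      (if mono_restrict W b = a then single (mono_restrict (- W) b) s else 0) c"
    by (auto simp: lookup_coeff_at lookup_single when_def)
qed

lemma coeff_at_mult:
  assumes "q \<in> pols V" "V \<inter> W = {}" "keys a \<subseteq> W"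
  shows "coeff_at W a (q * p) = q * coeff_at W a p"
  using assms(1)
proof (induction rule: pols_single_induct)
  case (single m r)
  then have "keys m \<subseteq> - W" using assms(2) by auto
  then have "mono_restrict W m = 0" "mono_restrict (- W) m = m"
    by (auto intro!: mono_restrict_id mono_restrict_disjoint)
  then show ?case
  proof (induction p rule: mpol_induct)
    case (single b d)
    then show ?case by (simp add: mult_single coeff_at_single[OF assms(3)] mono_restrict_add)
  qed (simp_all add: distrib_left coeff_at_add)
qed (simp_all add: distrib_right coeff_at_add)

lemma keys_coeff_at: "c \<in> keys (coeff_at W a p) \<longleftrightarrow>
    keys c \<inter> W = {} \<and> c + a \<in> keys p"
  by (simp add: in_keys_iff lookup_coeff_at)

lemma coeff_at_pols: "p \<in> pols V \<Longrightarrow> coeff_at W a p \<in> pols (V - W)"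
  by (fastforce simp: pols_def keys_coeff_at keys_mono_add)

lemma coeff_at_homogeneous: "homogeneous k p \<Longrightarrow> homogeneous (k - mono_deg a) (coeff_at W a p)"
  unfolding homogeneous_def
proof
  fix c assume "\<forall>a\<in>keys p. mono_deg a = k" "c \<in> keys (coeff_at W a p)"
  then have "mono_deg (c + a) = k" by (simp add: keys_coeff_at)
  then show "mono_deg c = k - mono_deg a" by (simp add: mono_deg_add)
qed

lemma lookup_eq_coeff_at:
  "lookup p b = lookup (coeff_at W (mono_restrict W b) p) (mono_restrict (- W) b)"
  using mono_restrict_split[of W b] by (auto simp: lookup_coeff_at keys_mono_restrict add.commute)

lemma coeff_at_eqI:
  assumes "\<And>a. keys a \<subseteq> W \<Longrightarrow> coeff_at W a p = coeff_at W a q" shows "p = q"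
  by (rule poly_mapping_eqI) (subst (1 2) lookup_eq_coeff_at[where W = W], simp add: assms keys_mono_restrict)

lemma homogeneousI_coeff_at:
  assumes "\<And>a. keys a \<subseteq> W \<Longrightarrow> homogeneous (k - mono_deg a) (coeff_at W a p)"
  shows "homogeneous k p"
  unfolding homogeneous_def
proof
  fix b assume "b \<in> keys p"
  then have "mono_restrict (- W) b \<in> keys (coeff_at W (mono_restrict W b) p)"
    unfolding in_keys_iff by (subst (asm) lookup_eq_coeff_at[of p b W])
  then have "mono_deg (mono_restrict (- W) b) = k - mono_deg (mono_restrict W b)"
    using assms[of "mono_restrict W b"] by (auto simp: keys_mono_restrict homogeneous_def)
  then show "mono_deg b = k"
    using mono_deg_add[of "mono_restrict W b" "mono_restrict (- W) b"] by (simp add: mono_restrict_split)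
qed

lemma finite_coeff_at: "finite {a. keys a \<subseteq> W \<and> coeff_at W a p \<noteq> 0}"
proof -
  have "{a. keys a \<subseteq> W \<and> coeff_at W a p \<noteq> 0} \<subseteq> mono_restrict W ` keys p"
  proof clarify
    fix a assume a: "keys a \<subseteq> W" "coeff_at W a p \<noteq> 0"
    then obtain c where "lookup (coeff_at W a p) c \<noteq> 0"
      by (metis lookup_zero poly_mapping_eqI)
    then have "keys c \<inter> W = {}" "c + a \<in> keys p"
      by (auto simp: lookup_coeff_at in_keys_iff split: if_splits)
    with a show "a \<in> mono_restrict W ` keys p"
      by (intro image_eqI[of _ _ "c + a"]) (auto simp: mono_restrict_add mono_restrict_id mono_restrict_disjoint)
  qed
  then show ?thesis by (rule finite_subset) simp
qed

subsection \<open>The polynomials attached to arcs and wide edges\<close>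

lemma exact_quot_eq: "q \<noteq> 0 \<Longrightarrow> r * q = p \<Longrightarrow> exact_quot p q = r"
  unfolding exact_quot_def by (rule the_equality) auto

text \<open>Newton's recursion for the power sums of two quantities with sum \<open>s\<close> and
  product \<open>t\<close>; \<open>psum (n + 1)\<close> will be recognized as the polynomial
  g.\<close>

fun psum :: "nat \<Rightarrow> mpol \<Rightarrow> mpol \<Rightarrow> mpol" where
  "psum 0 s t = 2"
| "psum (Suc 0) s t = s"
| "psum (Suc (Suc k)) s t = s * psum (Suc k) s t - t * psum k s t"

lemma psum_eq: "psum k (x + y) (x * y) = x ^ k + y ^ k"
proof (induction k rule: induct_nat_012)
  case (ge2 k)
  have "(x + y) * (x ^ Suc k + y ^ Suc k) - x * y * (x ^ k + y ^ k) = x ^ Suc (Suc k) + y ^ Suc (Suc k)"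
    by (simp add: algebra_simps)
  then show ?case by (simp only: psum.simps ge2)
qed simp_all

lemma subst_psum: "subst \<sigma> (psum k s t) = psum k (subst \<sigma> s) (subst \<sigma> t)"
  by (induction k rule: induct_nat_012) (simp_all add: subst_hom)

lemma psum_pols: "s \<in> pols V \<Longrightarrow> t \<in> pols V \<Longrightarrow> psum k s t \<in> pols V"
  by (induction k rule: induct_nat_012) (auto intro: pols_intros)

lemma psum_homogeneous:
  assumes "homogeneous 2 s" "homogeneous 4 t" shows "homogeneous (2 * int k) (psum k s t)"
proof (induction k rule: induct_nat_012)
  case (ge2 k)
  have "homogeneous (2 * int (Suc (Suc k))) (s * psum (Suc k) s t)"
    by (rule homogeneous_mult_eq[OF assms(1) ge2(2)]) simp
  moreover have "homogeneous (2 * int (Suc (Suc k))) (t * psum k s t)"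
    by (rule homogeneous_mult_eq[OF assms(2) ge2(1)]) simp
  ultimately show ?case by (simp only: psum.simps homogeneous_diff)
qed (use assms in auto)

text \<open>Algebraic independence of x + y and x y. Setting the second variable to 0 in the image
  recovers the part of \<open>p\<close> free of \<open>X 1\<close>, which is therefore 0; so
  \<open>X 1\<close> divides \<open>p\<close>, and the cofactor is again in the kernel. A nonzero
  \<open>p\<close> cannot be divisible by every power of \<open>X 1\<close>.\<close>

lemma subst_elementary_inj:
  assumes "p \<in> pols {0, 1}" "subst (\<lambda>i. if i = 0 then X 0 + X 1 else X 0 * X 1) p = 0"
  shows "p = 0"
proof (rule ccontr)
  define \<tau> where "\<tau> = (\<lambda>i::nat. if i = 0 then X 0 + X 1 else X 0 * X 1)"
  have X_nz: "X i \<noteq> 0" for i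
    by (simp add: X_def flip: keys_eq_empty)
  have ret: "subst (X(1 := 0)) (subst \<tau> q) = q" if "q \<in> pols {0}" for q
    using that by (induction rule: pols_ring_induct) (simp_all add: subst_hom \<tau>_def)
  have "\<exists>q\<in>pols {0, 1}. subst \<tau> q = 0 \<and> p = X 1 ^ k * q" for k
  proof (induction k)
    case 0
    then show ?case using assms by (auto simp: \<tau>_def)
  next
    case (Suc k)
    then obtain q where q: "q \<in> pols {0, 1}" "subst \<tau> q = 0" "p = X 1 ^ k * q" by blast
    obtain s where s: "s \<in> pols {0, 1}" "q = subst (X(1 := 0)) q + (X 1 - 0) * s"
      using subst_upd_dvd[OF q(1), of 1 0] by auto
    define q0 where "q0 = subst (X(1 := 0)) q"
    have q0: "q0 \<in> pols {0}"
      unfolding q0_def by (rule subst_pols[OF q(1)]) auto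
    have "0 = subst (X(1 := 0)) (subst \<tau> (q0 + X 1 * s))"
      using s(2) q(2) by (simp add: q0_def)
    also have "\<dots> = q0"
      using ret[OF q0] by (simp add: subst_hom \<tau>_def)
    finally have q0: "q = X 1 * s" using s(2) by (simp add: q0_def)
    then have "subst \<tau> (X 1) * subst \<tau> s = 0" using q(2) by (simp only: subst_mult)
    then have "subst \<tau> s = 0" by (simp add: \<tau>_def X_nz)
    then show ?case using s(1) q(3) q0 by (auto simp: mult.assoc)
  qed
  note * = this
  assume "p \<noteq> 0"
  then obtain a where a: "a \<in> keys p"
    by (metis all_not_in_conv keys_eq_empty in_keys_iff lookup_zero poly_mapping_eqI)
  obtain q where "p = X 1 ^ (Suc (lookup a 1)) * q"
    using *[of "Suc (lookup a 1)"] by blast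
  then have "a \<in> keys (single (single 1 (Suc (lookup a 1))) 1 * q)"
    using a by (simp only: X_power)
  then obtain b where "a = single 1 (Suc (lookup a 1)) + b"
    using keys_mult by fastforce
  then have "lookup a 1 = Suc (lookup a 1) + lookup b 1"
    by (metis lookup_add lookup_single_eq)
  then show False by simp
qed

text \<open>Makes the definite description in \<open>g_pol\<close> usable: existence is Newton's
  recursion, uniqueness the algebraic independence just shown.\<close>

lemma g_at_eq: "g_at n s t = psum (n + 1) s t"
proof -
  let ?\<tau> = "\<lambda>i::nat. if i = 0 then X 0 + X 1 else X 0 * X 1"
  have "g_pol n = psum (n + 1) (X 0) (X 1)"
    unfolding g_pol_def
  proof (rule the_equality)
    show *: "psum (n + 1) (X 0) (X 1) \<in> pols {0, 1} \<and>
        subst ?\<tau> (psum (n + 1) (X 0) (X 1)) = X 0 ^ (n + 1) + X 1 ^ (n + 1)"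
      using psum_eq[of "n + 1" "X 0" "X 1"] by (simp add: psum_pols subst_psum del: psum.simps)
    fix g assume g: "g \<in> pols {0, 1} \<and> subst ?\<tau> g = X 0 ^ (n + 1) + X 1 ^ (n + 1)"
    have "g - psum (n + 1) (X 0) (X 1) = 0"
    proof (rule subst_elementary_inj)
      show "g - psum (n + 1) (X 0) (X 1) \<in> pols {0, 1}"
        using * g by (blast intro: pols_diff)
      show "subst ?\<tau> (g - psum (n + 1) (X 0) (X 1)) = 0"
        using * g by (simp only: subst_diff) simp
    qed
    then show "g = psum (n + 1) (X 0) (X 1)" by simp
  qed
  then show ?thesis by (simp add: g_at_def subst_psum)
qed

text \<open>The divided difference in the sum variable satisfies the recursion of
  \<open>psum\<close> with the extra term \<open>psum (Suc k) s t\<close>, which also yields its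
  degree. For k = 0 it is 0, so the formally negative degree does no harm.\<close>

lemma psum_diff_fst:
  assumes "s \<in> pols V" "s' \<in> pols V" "t \<in> pols V" "homogeneous 2 s" "homogeneous 2 s'" "homogeneous 4 t"
  shows "\<exists>r\<in>pols V. homogeneous (2 * int k - 2) r \<and> r * (s - s') = psum k s t - psum k s' t"
proof (induction k rule: induct_nat_012)
  case 0
  then show ?case by (intro bexI[of _ 0]) auto
next
  case 1
  then show ?case by (intro bexI[of _ 1]) auto
next
  case (ge2 k)
  then obtain q r where qr: "q \<in> pols V" "r \<in> pols V" "homogeneous (2 * int k - 2) q"
    "homogeneous (2 * int (Suc k) - 2) r" "q * (s - s') = psum k s t - psum k s' t"
    "r * (s - s') = psum (Suc k) s t - psum (Suc k) s' t" by blast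
  have "(psum (Suc k) s t + s' * r - t * q) * (s - s')
      = psum (Suc k) s t * (s - s') + s' * (r * (s - s')) - t * (q * (s - s'))"
    by (simp add: algebra_simps)
  also have "\<dots> = psum (Suc (Suc k)) s t - psum (Suc (Suc k)) s' t"
    unfolding qr(5,6) by (simp add: algebra_simps)
  finally have "(psum (Suc k) s t + s' * r - t * q) * (s - s') = psum (Suc (Suc k)) s t - psum (Suc (Suc k)) s' t" .
  moreover have "homogeneous (2 * int (Suc (Suc k)) - 2) (psum (Suc k) s t + s' * r - t * q)"
    using psum_homogeneous[OF assms(4,6), of "Suc k"]
    by (intro homogeneous_add homogeneous_diff homogeneous_mult_eq[OF assms(5) qr(4)]
        homogeneous_mult_eq[OF assms(6) qr(3)]) simp_all
  ultimately show ?case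
    using qr assms by (intro bexI[of _ "psum (Suc k) s t + s' * r - t * q"]) (auto intro!: pols_intros psum_pols)
qed

text \<open>The same recursion for the product variable, now with the extra term
  \<open>- psum k s t\<close>; the degree drops by 4, that of the product.\<close>

lemma psum_diff_snd:
  assumes "s \<in> pols V" "t \<in> pols V" "t' \<in> pols V" "homogeneous 2 s" "homogeneous 4 t" "homogeneous 4 t'"
  shows "\<exists>r\<in>pols V. homogeneous (2 * int k - 4) r \<and> r * (t - t') = psum k s t - psum k s t'"
proof (induction k rule: induct_nat_012)
  case 0
  then show ?case by (intro bexI[of _ 0]) auto
next
  case 1
  then show ?case by (intro bexI[of _ 0]) auto
next
  case (ge2 k)
  then obtain q r where qr: "q \<in> pols V" "r \<in> pols V" "homogeneous (2 * int k - 4) q"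
    "homogeneous (2 * int (Suc k) - 4) r" "q * (t - t') = psum k s t - psum k s t'"
    "r * (t - t') = psum (Suc k) s t - psum (Suc k) s t'" by blast
  have "(s * r - psum k s t - t' * q) * (t - t')
      = s * (r * (t - t')) - psum k s t * (t - t') - t' * (q * (t - t'))"
    by (simp add: algebra_simps)
  also have "\<dots> = psum (Suc (Suc k)) s t - psum (Suc (Suc k)) s t'"
    unfolding qr(5,6) by (simp add: algebra_simps)
  finally have "(s * r - psum k s t - t' * q) * (t - t') = psum (Suc (Suc k)) s t - psum (Suc (Suc k)) s t'" .
  moreover have "homogeneous (2 * int (Suc (Suc k)) - 4) (s * r - psum k s t - t' * q)"
    using psum_homogeneous[OF assms(4,5), of k]
    by (intro homogeneous_add homogeneous_diff homogeneous_mult_eq[OF assms(4) qr(4)]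
        homogeneous_mult_eq[OF assms(6) qr(3)]) simp_all
  ultimately show ?case
    using qr assms by (intro bexI[of _ "s * r - psum k s t - t' * q"]) (auto intro!: pols_intros psum_pols)
qed

lemma power_diff_quot:
  assumes "x \<in> pols V" "y \<in> pols V" "homogeneous 2 x" "homogeneous 2 y"
  shows "\<exists>r\<in>pols V. homogeneous (2 * int k) r \<and> r * (x - y) = x ^ (k + 1) - y ^ (k + 1)"
proof (induction k)
  case 0
  then show ?case by (intro bexI[of _ 1]) auto
next
  case (Suc k)
  then obtain r where r: "r \<in> pols V" "homogeneous (2 * int k) r" "r * (x - y) = x ^ (k + 1) - y ^ (k + 1)"
    by blast
  have "(x ^ (k + 1) + y * r) * (x - y) = x ^ (k + 1) * (x - y) + y * (r * (x - y))"
    by (simp add: algebra_simps)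
  also have "\<dots> = x ^ (Suc k + 1) - y ^ (Suc k + 1)"
    unfolding r(3) by (simp add: algebra_simps)
  finally have "(x ^ (k + 1) + y * r) * (x - y) = x ^ (Suc k + 1) - y ^ (Suc k + 1)" .
  moreover have "homogeneous (2 * int (Suc k)) (x ^ (k + 1) + y * r)"
    using homogeneous_power[OF assms(3), of "k + 1"]
    by (intro homogeneous_add homogeneous_mult_eq[OF assms(4) r(2)]) (simp_all add: algebra_simps)
  ultimately show ?case
    using r assms by (intro bexI[of _ "x ^ (k + 1) + y * r"]) (auto intro!: pols_intros)
qed

lemma pi_pol:
  assumes "i \<noteq> j"
  shows "pi_pol n i j \<in> pols {i, j}" "homogeneous (2 * int n) (pi_pol n i j)"
    "pi_pol n i j * (X i - X j) = X i ^ (n + 1) - X j ^ (n + 1)"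
proof -
  obtain r where r: "r \<in> pols {i, j}" "homogeneous (2 * int n) r"
    "r * (X i - X j) = X i ^ (n + 1) - X j ^ (n + 1)"
    using power_diff_quot[of "X i" "{i, j}" "X j" n] by auto
  have "subst (\<lambda>v. if v = i then 1 else 0) (X i - X j) = 1"
    using assms by (simp add: subst_diff)
  then have "X i - X j \<noteq> 0" by (metis subst_0 zero_neq_one)
  then have "pi_pol n i j = r"
    unfolding pi_pol_def using r(3) by (rule exact_quot_eq)
  with r show "pi_pol n i j \<in> pols {i, j}" "homogeneous (2 * int n) (pi_pol n i j)"
    "pi_pol n i j * (X i - X j) = X i ^ (n + 1) - X j ^ (n + 1)" by auto
qed

text \<open>Distinctness of the marks makes the two divisors nonzero: they take the value -1 when
  \<open>X k\<close>, respectively both incoming variables, are set to 1 and the others to 0. The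
  identity telescopes: g at the outgoing marks, g at the mixed point with incoming sum and outgoing
  product, g at the incoming marks.\<close>

lemma u1_u2:
  fixes n i j k l :: nat
  assumes "{i, j} \<inter> {k, l} = {}" "k \<noteq> l"
  defines "a \<equiv> u1 n (X i) (X j) (X k) (X l)" and "b \<equiv> u2 n (X i) (X j) (X k) (X l)"
  shows "a \<in> pols {i, j, k, l}" "homogeneous (2 * int n) a"
    "b \<in> pols {i, j, k, l}" "homogeneous (2 * int n - 2) b"
    "a * (X i + X j - X k - X l) + b * (X i * X j - X k * X l) =
       X i ^ (n + 1) + X j ^ (n + 1) - X k ^ (n + 1) - X l ^ (n + 1)"
proof -
  let ?V = "{i, j, k, l}"
  have h2: "homogeneous 2 (X i + X j)" "homogeneous 2 (X k + X l)"
    by (auto intro: homogeneous_add)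
  have h4: "homogeneous 4 (X i * X j)" "homogeneous 4 (X k * X l)"
    by (rule homogeneous_mult_eq[of 2 _ 2]; simp)+
  have p: "X i + X j \<in> pols ?V" "X k + X l \<in> pols ?V" "X i * X j \<in> pols ?V" "X k * X l \<in> pols ?V"
    by (auto intro: pols_intros)
  obtain r where r: "r \<in> pols ?V" "homogeneous (2 * int (n + 1) - 2) r"
    "r * ((X i + X j) - (X k + X l)) = psum (n + 1) (X i + X j) (X i * X j) - psum (n + 1) (X k + X l) (X i * X j)"
    using psum_diff_fst[OF p(1,2,3) h2 h4(1), of "n + 1"] by blast
  obtain s where s: "s \<in> pols ?V" "homogeneous (2 * int (n + 1) - 4) s"
    "s * (X i * X j - X k * X l) = psum (n + 1) (X k + X l) (X i * X j) - psum (n + 1) (X k + X l) (X k * X l)"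
    using psum_diff_snd[OF p(2,3,4) h2(2) h4, of "n + 1"] by blast
  have "subst (\<lambda>v. if v = k then 1 else 0) (X i + X j - X k - X l) = - 1"
    using assms by (simp add: subst_hom)
  then have nz1: "X i + X j - X k - X l \<noteq> 0" by (metis subst_0 zero_neq_neg_one)
  have "subst (\<lambda>v. if v = k \<or> v = l then 1 else 0) (X i * X j - X k * X l) = - 1"
    using assms by (simp add: subst_hom)
  then have nz2: "X i * X j - X k * X l \<noteq> 0" by (metis subst_0 zero_neq_neg_one)
  have a: "a = r" unfolding a_def u1_def g_at_eq
    by (rule exact_quot_eq[OF nz1]) (simp only: r(3)[symmetric] diff_diff_eq)
  have b: "b = s" unfolding b_def u2_def g_at_eq
    by (rule exact_quot_eq[OF nz2 s(3)])
  show "a \<in> pols ?V" "homogeneous (2 * int n) a" "b \<in> pols ?V" "homogeneous (2 * int n - 2) b"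
    using r s by (auto simp: a b)
  have "a * (X i + X j - X k - X l) + b * (X i * X j - X k * X l) =
      psum (n + 1) (X i + X j) (X i * X j) - psum (n + 1) (X k + X l) (X k * X l)"
    unfolding a b s(3) diff_diff_eq r(3) by simp
  then show "a * (X i + X j - X k - X l) + b * (X i * X j - X k * X l) =
       X i ^ (n + 1) + X j ^ (n + 1) - X k ^ (n + 1) - X l ^ (n + 1)"
    unfolding psum_eq by simp
qed

subsection \<open>Koszul complexes\<close>

fun cnt :: "bool list \<Rightarrow> nat" where
  "cnt [] = 0"
| "cnt (x # xs) = (if x then Suc (cnt xs) else cnt xs)"

definition sg :: "bool list \<Rightarrow> mpol" where
  "sg xs = (if odd (cnt xs) then - 1 else 1)"

type_synonym kpairs = "(int \<times> mpol \<times> mpol) list"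

text \<open>
  The basis of a tensor product of Koszul factorizations \<open>{a, b}\<close> is indexed by the lists of
  parities.  The lists are read from the last tensor factor to the first, so that the sign of a
  factor is determined by the tail of the list.
\<close>

fun kd :: "kpairs \<Rightarrow> (bool list \<Rightarrow> mpol) \<Rightarrow> bool list \<Rightarrow> mpol" where
  "kd [] v zs = 0"
| "kd (p # ps) v [] = 0"
| "kd ((k, a, b) # ps) v (False # zs) = kd ps (\<lambda>xs. v (False # xs)) zs + sg zs * b * v (True # zs)"
| "kd ((k, a, b) # ps) v (True # zs) = kd ps (\<lambda>xs. v (True # xs)) zs + sg zs * a * v (False # zs)"

text \<open>Degree of a basis element: the odd generator of {a, b} lies in R{n + 1 - deg a}, so each
  \<open>True\<close> contributes n + 1 - k.\<close>

fun dl :: "nat \<Rightarrow> kpairs \<Rightarrow> bool list \<Rightarrow> int" where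
  "dl n ((k, a, b) # ps) (x # xs) = (if x then int n + 1 - k else 0) + dl n ps xs"
| "dl n _ _ = 0"

fun potential :: "kpairs \<Rightarrow> mpol" where
  "potential [] = 0"
| "potential ((k, a, b) # ps) = a * b + potential ps"

lemma cnt_append [simp]: "cnt (xs @ ys) = cnt xs + cnt ys"
  by (induction xs) auto

lemma sg_Nil [simp]: "sg [] = 1" and sg_Cons: "sg (x # xs) = (if x then - sg xs else sg xs)"
  by (auto simp: sg_def)

lemma sg_append: "sg (xs @ ys) = sg xs * sg ys"
  by (auto simp: sg_def)

lemma sg_sg [simp]: "sg xs * sg xs = 1" and sg_sg' [simp]: "sg xs * (sg xs * p) = p"
  by (auto simp: sg_def)

lemma sg_pols [simp]: "sg xs \<in> pols V"
  by (auto simp: sg_def intro: pols_uminus)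

lemma sg_homogeneous [simp]: "homogeneous 0 (sg xs)"
  by (auto simp: sg_def intro: homogeneous_uminus)

lemma cnt_replicate_False [simp]: "cnt (replicate l False) = 0"
  by (induction l) auto

lemma sg_replicate_False [simp]: "sg (replicate l False) = 1"
  by (simp add: sg_def)

lemma cnt_eq_0_iff: "cnt xs = 0 \<longleftrightarrow> xs = replicate (length xs) False"
  by (induction xs) auto

lemma kd_cases [case_names Nil Nil2 False True]:
  assumes "\<And>v zs. P [] v zs" "\<And>p ps v. P (p # ps) v []"
    "\<And>k a b ps v zs. (\<And>w. P ps w zs) \<Longrightarrow> P ((k, a, b) # ps) v (False # zs)"
    "\<And>k a b ps v zs. (\<And>w. P ps w zs) \<Longrightarrow> P ((k, a, b) # ps) v (True # zs)"
  shows "P ps v zs"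
proof (induction ps arbitrary: v zs)
  case (Cons p ps v zs)
  obtain k a b where p: "p = (k, a, b)" by (cases p)
  consider "zs = []" | xs where "zs = False # xs" | xs where "zs = True # xs"
    by (metis list.exhaust)
  then show ?case
    by cases (use Cons.IH assms(2-4) in \<open>simp_all add: p\<close>)
qed (rule assms)

lemma kd_add: "kd ps (\<lambda>x. u x + v x) zs = kd ps u zs + kd ps v zs"
proof (induction ps u zs arbitrary: v rule: kd_cases)
  case (False k a b ps u zs)
  then show ?case by (simp add: algebra_simps)
next
  case (True k a b ps u zs)
  then show ?case by (simp add: algebra_simps)
qed simp_all

lemma kd_0 [simp]: "kd ps (\<lambda>x. 0) zs = 0"
  by (induction ps "\<lambda>x::bool list. 0::mpol" zs rule: kd.induct) auto

lemma kd_scale: "kd ps (\<lambda>x. p * v x) zs = p * kd ps v zs"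
  by (induction ps v zs rule: kd_cases) (simp_all add: algebra_simps)

lemma kd_uminus: "kd ps (\<lambda>x. - v x) zs = - kd ps v zs"
  using kd_scale[of ps "- 1" v zs] by simp

lemma kd_diff: "kd ps (\<lambda>x. u x - v x) zs = kd ps u zs - kd ps v zs"
  using kd_add[of ps u "\<lambda>x. - v x" zs] by (simp add: kd_uminus)

text \<open>\<open>kd\<close> reverses parity, hence anticommutes with multiplication by the sign
  \<open>sg\<close>. This is what cancels the cross terms in the square of the differential.\<close>

lemma kd_sg: "kd ps (\<lambda>xs. sg xs * v xs) zs = - sg zs * kd ps v zs"
proof (induction ps v zs rule: kd_cases)
  case (False k a b ps v zs)
  show ?case using False[of "\<lambda>xs. v (False # xs)"] by (simp add: sg_Cons distrib_left mult.assoc)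
next
  case (True k a b ps v zs)
  show ?case using True[of "\<lambda>xs. v (True # xs)"] by (simp add: sg_Cons kd_uminus distrib_left mult.assoc)
qed simp_all

lemma kd_kd: "length zs = length ps \<Longrightarrow> kd ps (kd ps v) zs = potential ps * v zs"
proof (induction ps v zs rule: kd_cases)
  case (False k a b ps v zs)
  have "kd ps (\<lambda>xs. sg xs * b * v (True # xs)) zs = - sg zs * (b * kd ps (\<lambda>xs. v (True # xs)) zs)"
    using kd_sg[of ps "\<lambda>xs. b * v (True # xs)" zs] by (simp add: kd_scale mult.assoc)
  with False show ?case by (simp add: kd_add algebra_simps)
next
  case (True k a b ps v zs)
  have "kd ps (\<lambda>xs. sg xs * a * v (False # xs)) zs = - sg zs * (a * kd ps (\<lambda>xs. v (False # xs)) zs)"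
    using kd_sg[of ps "\<lambda>xs. a * v (False # xs)" zs] by (simp add: kd_scale mult.assoc)
  with True show ?case by (simp add: kd_add algebra_simps)
qed simp_all

text \<open>The Koszul sign rule in list form: the head \<open>ys\<close> belongs to the second
  tensor factor, whose differential carries the sign of the parity \<open>xs\<close> of the first
  factor.\<close>

lemma kd_append:
  "length ys = length qs \<Longrightarrow> kd (qs @ ps) v (ys @ xs) =
     kd ps (\<lambda>xs. v (ys @ xs)) xs + sg xs * kd qs (\<lambda>ys. v (ys @ xs)) ys"
  by (induction qs v ys rule: kd_cases) (simp_all add: sg_append algebra_simps)

lemma dl_append: "length ys = length qs \<Longrightarrow> dl n (qs @ ps) (ys @ xs) = dl n qs ys + dl n ps xs"
proof (induction qs arbitrary: ys)
  case (Cons q qs)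
  then show ?case by (cases q; cases ys) auto
qed simp

lemma potential_append: "potential (qs @ ps) = potential qs + potential ps"
  by (induction qs rule: potential.induct) auto

text \<open>The two halves of the differential. \<open>snd_pairs\<close> keeps the b-part, which
  lowers exterior degree (the number of \<open>True\<close> entries) by one and is the ordinary
  Koszul complex of the sequence b; \<open>fst_pairs\<close> keeps the a-part, which raises it by
  one.\<close>

abbreviation fst_pairs :: "kpairs \<Rightarrow> kpairs" where "fst_pairs \<equiv> map (\<lambda>(k, a, b). (k, a, 0))"
abbreviation snd_pairs :: "kpairs \<Rightarrow> kpairs" where "snd_pairs \<equiv> map (\<lambda>(k, a, b). (k, 0, b))"

lemma kd_split: "kd ps v zs = kd (snd_pairs ps) v zs + kd (fst_pairs ps) v zs"
  by (induction ps v zs rule: kd_cases) simp_all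

lemma kd_cong:
  assumes "\<And>xs. length xs = length zs \<Longrightarrow> odd (cnt xs) \<noteq> odd (cnt zs) \<Longrightarrow> u xs = v xs"
  shows "kd ps u zs = kd ps v zs"
  using assms
proof (induction ps u zs arbitrary: v rule: kd_cases)
  case (False k a b ps u zs)
  have "kd ps (\<lambda>xs. u (False # xs)) zs = kd ps (\<lambda>xs. v (False # xs)) zs"
    by (rule False(1)) (simp add: False(2))
  then show ?case using False(2)[of "True # zs"] by simp
next
  case (True k a b ps u zs)
  have "kd ps (\<lambda>xs. u (True # xs)) zs = kd ps (\<lambda>xs. v (True # xs)) zs"
    by (rule True(1)) (simp add: True(2))
  then show ?case using True(2)[of "False # zs"] by simp
qed simp_all

lemma kd_snd_eq_0:
  assumes "\<And>xs. length xs = length zs \<Longrightarrow> cnt xs = Suc (cnt zs) \<Longrightarrow> v xs = 0"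
  shows "kd (snd_pairs ps) v zs = 0"
  using assms
proof (induction ps v zs rule: kd_cases)
  case (False k a b ps v zs)
  have "kd (snd_pairs ps) (\<lambda>xs. v (False # xs)) zs = 0"
    by (rule False(1)) (simp add: False(2))
  then show ?case using False(2)[of "True # zs"] by simp
next
  case (True k a b ps v zs)
  have "kd (snd_pairs ps) (\<lambda>xs. v (True # xs)) zs = 0"
    by (rule True(1)) (simp add: True(2))
  then show ?case by simp
qed simp_all

lemma kd_fst_eq_0:
  assumes "\<And>xs. length xs = length zs \<Longrightarrow> Suc (cnt xs) = cnt zs \<Longrightarrow> v xs = 0"
  shows "kd (fst_pairs ps) v zs = 0"
  using assms
proof (induction ps v zs rule: kd_cases)
  case (False k a b ps v zs)
  have "kd (fst_pairs ps) (\<lambda>xs. v (False # xs)) zs = 0"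
    by (rule False(1)) (simp add: False(2))
  then show ?case by simp
next
  case (True k a b ps v zs)
  have "kd (fst_pairs ps) (\<lambda>xs. v (True # xs)) zs = 0"
    by (rule True(1)) (simp add: True(2))
  then show ?case using True(2)[of "False # zs"] by simp
qed simp_all

definition graded_pairs :: "nat \<Rightarrow> nat set \<Rightarrow> kpairs \<Rightarrow> bool" where
  "graded_pairs n V ps \<longleftrightarrow> (\<forall>(k, a, b) \<in> set ps. a \<in> pols V \<and> b \<in> pols V \<and>
     homogeneous k a \<and> homogeneous (2 * int n + 2 - k) b)"

lemma graded_pairs_simps [simp]:
  "graded_pairs n V []"
  "graded_pairs n V ((k, a, b) # ps) \<longleftrightarrow> a \<in> pols V \<and> b \<in> pols V \<and>
     homogeneous k a \<and> homogeneous (2 * int n + 2 - k) b \<and> graded_pairs n V ps"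
  "graded_pairs n V (qs @ ps) \<longleftrightarrow> graded_pairs n V qs \<and> graded_pairs n V ps"
  by (simp_all add: graded_pairs_def ball_Un)

lemma graded_pairs_snd: "graded_pairs n V ps \<Longrightarrow> graded_pairs n V (snd_pairs ps)"
  by (auto simp: graded_pairs_def)

lemma graded_pairs_mono: "graded_pairs n V ps \<Longrightarrow> V \<subseteq> U \<Longrightarrow> graded_pairs n U ps"
  unfolding graded_pairs_def using pols_mono[of V U] by fastforce

lemma kd_pols: "graded_pairs n V ps \<Longrightarrow> (\<And>xs. v xs \<in> pols V) \<Longrightarrow> kd ps v zs \<in> pols V"
  by (induction ps v zs rule: kd_cases) (auto intro!: pols_add pols_mult)

text \<open>\<open>kd\<close> is homogeneous of degree n + 1 when the basis element
  \<open>xs\<close> is given degree \<open>dl n ps xs\<close>. Taking components therefore turns any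
  solution of \<open>kd ps y = v\<close> with homogeneous \<open>v\<close> into a homogeneous
  solution.\<close>

lemma kd_hpart: "graded_pairs n V ps \<Longrightarrow>
    hpart (c + (int n + 1) - dl n ps zs) (kd ps v zs) = kd ps (\<lambda>xs. hpart (c - dl n ps xs) (v xs)) zs"
proof (induction ps v zs arbitrary: c rule: kd_cases)
  case (False k a b ps v zs)
  have "homogeneous (2 * int n + 2 - k) (sg zs * b)"
    using False(2) by (intro homogeneous_mult_eq[of 0]) auto
  then have "hpart (c + (int n + 1) - dl n ps zs) (sg zs * b * v (True # zs))
      = sg zs * b * hpart (c + (int n + 1) - dl n ps zs - (2 * int n + 2 - k)) (v (True # zs))"
    by (rule hpart_mult)
  moreover have "c + (int n + 1) - dl n ps zs - (2 * int n + 2 - k) = c - (int n + 1 - k + dl n ps zs)"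
    by simp
  ultimately show ?case using False by (simp add: hpart_add)
next
  case (True k a b ps v zs)
  have "homogeneous k (sg zs * a)"
    using True(2) by (intro homogeneous_mult_eq[of 0]) auto
  then have "hpart (c + k - dl n ps zs) (sg zs * a * v (False # zs))
      = sg zs * a * hpart (c + k - dl n ps zs - k) (v (False # zs))"
    by (rule hpart_mult)
  moreover have "c + k - dl n ps zs - k = c - dl n ((k, a, b) # ps) (False # zs)" by simp
  moreover have "hpart (c + k - dl n ps zs) (kd ps (\<lambda>xs. v (True # xs)) zs)
      = kd ps (\<lambda>xs. hpart (c - dl n ((k, a, b) # ps) (True # xs)) (v (True # xs))) zs"
  proof -
    have "c - (int n + 1 - k) + (int n + 1) - dl n ps zs = c + k - dl n ps zs"
      "c - (int n + 1 - k) - dl n ps xs = c - dl n ((k, a, b) # ps) (True # xs)" for xs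
      by simp_all
    then show ?thesis
      using True(1)[of "c - (int n + 1 - k)" "\<lambda>xs. v (True # xs)"] True(2) by (simp only: graded_pairs_simps)
  qed
  moreover have "c + (int n + 1) - dl n ((k, a, b) # ps) (True # zs) = c + k - dl n ps zs" by simp
  ultimately show ?case by (simp only: kd.simps hpart_add)
qed simp_all

subsection \<open>Regular sequences\<close>

fun idl :: "nat set \<Rightarrow> mpol list \<Rightarrow> mpol set" where
  "idl V [] = {0}"
| "idl V (b # bs) = {b * p + q | p q. p \<in> pols V \<and> q \<in> idl V bs}"

text \<open>Read from the end of the list, since lists of pairs grow at the head: each entry is a
  nonzerodivisor modulo the ideal of the entries after it. The quotient ring may be zero.\<close>

fun regular :: "nat set \<Rightarrow> mpol list \<Rightarrow> bool" where
  "regular V [] \<longleftrightarrow> True"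
| "regular V (b # bs) \<longleftrightarrow> (\<forall>p\<in>pols V. b * p \<in> idl V bs \<longrightarrow> p \<in> idl V bs) \<and> regular V bs"

lemma idl_0 [simp]: "0 \<in> idl V bs"
  by (induction bs) (auto intro!: exI[of _ 0])

lemma idl_ConsI: "r \<in> pols V \<Longrightarrow> s \<in> idl V bs \<Longrightarrow> b * r + s \<in> idl V (b # bs)"
  by auto

lemma idl_add: "p \<in> idl V bs \<Longrightarrow> q \<in> idl V bs \<Longrightarrow> p + q \<in> idl V bs"
proof (induction bs arbitrary: p q)
  case (Cons b bs)
  then obtain r s t u where "p = b * r + s" "q = b * t + u" "r \<in> pols V" "t \<in> pols V" "s \<in> idl V bs" "u \<in> idl V bs"
    by auto
  then have "p + q = b * (r + t) + (s + u)" "b * (r + t) + (s + u) \<in> idl V (b # bs)"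
    using Cons.IH[of s u] by (simp_all only: idl_ConsI pols_add) (simp add: distrib_left)
  then show ?case by (simp only:)
qed simp

lemma idl_mult: "r \<in> pols V \<Longrightarrow> p \<in> idl V bs \<Longrightarrow> r * p \<in> idl V bs"
proof (induction bs arbitrary: p)
  case (Cons b bs)
  then obtain s t where "p = b * s + t" "s \<in> pols V" "t \<in> idl V bs" by auto
  then have "r * p = b * (r * s) + r * t" "b * (r * s) + r * t \<in> idl V (b # bs)"
    using Cons by (simp_all only: idl_ConsI pols_mult) (simp add: distrib_left mult.left_commute)
  then show ?case by (simp only:)
qed simp

lemma idl_mult': "r \<in> pols V \<Longrightarrow> p \<in> idl V bs \<Longrightarrow> p * r \<in> idl V bs"
  using idl_mult[of r V p bs] by (simp add: mult.commute)

lemma idl_uminus: "p \<in> idl V bs \<Longrightarrow> - p \<in> idl V bs"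
  using idl_mult[of "- 1" V p bs] pols_uminus[OF pols_1] by auto

lemma idl_diff: "p \<in> idl V bs \<Longrightarrow> q \<in> idl V bs \<Longrightarrow> p - q \<in> idl V bs"
  using idl_add[of p V bs "- q"] by (auto intro: idl_uminus)

lemma idl_Cons: "p \<in> idl V bs \<Longrightarrow> p \<in> idl V (b # bs)"
  using idl_ConsI[of 0 V p bs b] by simp

lemma idl_gen: "b \<in> set bs \<Longrightarrow> b \<in> idl V bs"
proof (induction bs)
  case (Cons c bs)
  then show ?case using idl_ConsI[of 1 V 0 bs c] idl_Cons[of b V bs c] by auto
qed simp

lemma idl_pols: "set bs \<subseteq> pols V \<Longrightarrow> idl V bs \<subseteq> pols V"
  by (induction bs) (auto intro!: pols_add pols_mult)

lemma idl_induct [consumes 1, case_names zero gen add]: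
  assumes "p \<in> idl V bs" "P 0" "\<And>b r. b \<in> set bs \<Longrightarrow> r \<in> pols V \<Longrightarrow> P (b * r)"
    "\<And>q r. P q \<Longrightarrow> P r \<Longrightarrow> P (q + r)"
  shows "P p"
  using assms(1,3)
proof (induction bs arbitrary: p)
  case (Cons b bs)
  then obtain s t where "p = b * s + t" "s \<in> pols V" "t \<in> idl V bs" by auto
  then show ?case using Cons by (auto intro!: assms(4))
qed (auto intro: assms)

lemma idl_subset: "set bs \<subseteq> idl V cs \<Longrightarrow> idl V bs \<subseteq> idl V cs"
proof
  fix p assume "p \<in> idl V bs" and bs: "set bs \<subseteq> idl V cs"
  then show "p \<in> idl V cs"
    by (induction rule: idl_induct) (auto intro: idl_add idl_mult')
qed

text \<open>Elements of exterior degree \<open>c\<close> in the Koszul complex on \<open>l\<close>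
  generators.\<close>

definition chain :: "nat set \<Rightarrow> nat \<Rightarrow> nat \<Rightarrow> (bool list \<Rightarrow> mpol) set" where
  "chain V l c = {v. \<forall>zs. v zs \<in> pols V \<and> (v zs \<noteq> 0 \<longrightarrow> length zs = l \<and> cnt zs = c)}"

lemma chainD: "v \<in> chain V l c \<Longrightarrow> v zs \<in> pols V" "v \<in> chain V l c \<Longrightarrow> length zs \<noteq> l \<Longrightarrow> v zs = 0"
  "v \<in> chain V l c \<Longrightarrow> cnt zs \<noteq> c \<Longrightarrow> v zs = 0"
  by (auto simp: chain_def)

definition join :: "(bool list \<Rightarrow> mpol) \<Rightarrow> (bool list \<Rightarrow> mpol) \<Rightarrow> bool list \<Rightarrow> mpol" where
  "join u v zs = (case zs of [] \<Rightarrow> 0 | x # xs \<Rightarrow> if x then v xs else u xs)"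

lemma join_simps [simp]: "join u v (False # xs) = u xs" "join u v (True # xs) = v xs"
  by (auto simp: join_def)

lemma join_chain: "u \<in> chain V l (Suc c) \<Longrightarrow> v \<in> chain V l c \<Longrightarrow> join u v \<in> chain V (Suc l) (Suc c)"
  by (auto simp: chain_def join_def split: list.splits)

lemma single_chain: "r \<in> pols V \<Longrightarrow> (\<lambda>xs. if xs = replicate l False then r else 0) \<in> chain V l 0"
  by (auto simp: chain_def)

lemma chain_Cons:
  "v \<in> chain V (Suc l) c \<Longrightarrow> (\<lambda>xs. v (False # xs)) \<in> chain V l c"
  "v \<in> chain V (Suc l) (Suc c) \<Longrightarrow> (\<lambda>xs. v (True # xs)) \<in> chain V l c"
  by (force simp: chain_def)+

text \<open>Into exterior degree 0 only the b-part of the differential arrives, so the boundary of a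
  1-chain there is a combination of the entries b. This identifies the cokernel of the augmentation
  step with the polynomial ring modulo the ideal, whatever the entries a are.\<close>

lemma idl_iff_kd:
  "p \<in> idl V (map (\<lambda>(k, a, b). b) ps) \<longleftrightarrow>
     (\<exists>y\<in>chain V (length ps) 1. kd ps y (replicate (length ps) False) = p)"
proof (induction ps arbitrary: p)
  case Nil
  have "(\<lambda>_. 0) \<in> chain V 0 1" by (simp add: chain_def)
  then show ?case by auto
next
  case (Cons q ps)
  obtain k a b where q: "q = (k, a, b)" by (cases q)
  let ?l = "length ps" let ?z = "replicate ?l False"
  show ?case
  proof
    assume "p \<in> idl V (map (\<lambda>(k, a, b). b) (q # ps))"
    then obtain r s where rs: "p = b * r + s" "r \<in> pols V" "s \<in> idl V (map (\<lambda>(k, a, b). b) ps)"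
      by (auto simp: q)
    then obtain y where y: "y \<in> chain V ?l 1" "kd ps y ?z = s" using Cons by auto
    let ?y = "join y (\<lambda>xs. if xs = ?z then r else 0)"
    have "?y \<in> chain V (length (q # ps)) 1"
      using join_chain[of y V ?l 0, OF _ single_chain[OF rs(2)]] y(1) by simp
    moreover have "kd (q # ps) ?y (replicate (length (q # ps)) False) = p"
      using y(2) by (simp add: q rs(1) add.commute)
    ultimately show "\<exists>y\<in>chain V (length (q # ps)) 1. kd (q # ps) y (replicate (length (q # ps)) False) = p"
      by blast
  next
    assume "\<exists>y\<in>chain V (length (q # ps)) 1. kd (q # ps) y (replicate (length (q # ps)) False) = p"
    then obtain y where y: "y \<in> chain V (Suc ?l) 1" "kd (q # ps) y (False # ?z) = p" by auto
    have "(\<lambda>xs. y (False # xs)) \<in> chain V ?l 1"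
      using y(1) by (rule chain_Cons)
    then have "kd ps (\<lambda>xs. y (False # xs)) ?z \<in> idl V (map (\<lambda>(k, a, b). b) ps)"
      using Cons by blast
    moreover have "y (True # ?z) \<in> pols V" using y(1) by (simp add: chainD)
    ultimately show "p \<in> idl V (map (\<lambda>(k, a, b). b) (q # ps))"
      using idl_ConsI[of "y (True # ?z)" V "kd ps (\<lambda>xs. y (False # xs)) ?z" "map (\<lambda>(k, a, b). b) ps" b] y(2) by (simp add: q add.commute del: idl.simps)
  qed
qed

text \<open>Mapping cone induction. A cycle splits into a part \<open>v0\<close> without and a part
  \<open>v1\<close> with the generator of the head entry b; the cycle condition says that
  \<open>v1\<close> is a cycle and that the boundary of \<open>v0\<close> is b \<open>v1\<close> up
  to sign. A primitive of \<open>v1\<close> comes by induction or, in exterior degree 0, from b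
  being a nonzerodivisor modulo the other entries.\<close>

lemma koszul_exact:
  assumes "graded_pairs n V ps" "\<forall>(k, a, b)\<in>set ps. a = 0" "regular V (map (\<lambda>(k, a, b). b) ps)"
    "v \<in> chain V (length ps) (Suc c)" "\<And>zs. length zs = length ps \<Longrightarrow> kd ps v zs = 0"
  shows "\<exists>y\<in>chain V (length ps) (Suc (Suc c)). \<forall>zs. length zs = length ps \<longrightarrow> kd ps y zs = v zs"
  using assms
proof (induction ps arbitrary: v c)
  case Nil
  have "v zs = 0" for zs using Nil(4) by (cases zs) (auto simp: chain_def)
  moreover have "(\<lambda>_. 0) \<in> chain V 0 (Suc (Suc c))" by (simp add: chain_def)
  ultimately show ?case by auto
next
  case (Cons q ps)
  obtain k b where q: "q = (k, 0, b)" using Cons.prems(2) by (cases q) auto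
  let ?l = "length ps" let ?z = "replicate ?l False"
  let ?bs = "map (\<lambda>(k, a, b). b) ps"
  have snd: "snd_pairs ps = ps" using Cons.prems(2) by (auto intro!: map_idI)
  have b: "b \<in> pols V" "graded_pairs n V ps" using Cons.prems(1) by (auto simp: q)
  have nzd: "p \<in> idl V ?bs" if "p \<in> pols V" "b * p \<in> idl V ?bs" for p
    using Cons.prems(3) that by (simp add: q)
  define v0 where "v0 = (\<lambda>xs. v (False # xs))"
  define v1 where "v1 = (\<lambda>xs. v (True # xs))"
  have v0: "v0 \<in> chain V ?l (Suc c)" and v1: "v1 \<in> chain V ?l c"
    using Cons.prems(4) by (auto simp: v0_def v1_def intro: chain_Cons)
  have d1: "kd ps v1 zs = 0" if "length zs = ?l" for zs
    using Cons.prems(5)[of "True # zs"] that by (simp add: q v1_def)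
  have d0: "kd ps v0 zs = - (sg zs * b * v1 zs)" if "length zs = ?l" for zs
    using Cons.prems(5)[of "False # zs"] that by (simp add: q v0_def v1_def eq_neg_iff_add_eq_0)
  have IH: "\<exists>y\<in>chain V ?l (Suc (Suc c)). \<forall>zs. length zs = ?l \<longrightarrow> kd ps y zs = v zs"
    if "v \<in> chain V ?l (Suc c)" "\<And>zs. length zs = ?l \<Longrightarrow> kd ps v zs = 0" for v c
    using Cons.IH[OF b(2) _ _ that] Cons.prems(2,3) by (simp add: q)
  have "\<exists>y\<in>chain V ?l (Suc c). \<forall>zs. length zs = ?l \<longrightarrow> kd ps y zs = v1 zs"
  proof (cases c)
    case (Suc c')
    then show ?thesis using IH[of v1 c'] v1 d1 by auto
  next
    \<comment> \<open>Now \<open>v1\<close> is a single polynomial. Its product with b is, up to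
      sign, a boundary, hence in the ideal of the remaining entries, and regularity removes the
      factor b.\<close>
    case 0
    have "kd ps v0 ?z \<in> idl V ?bs" using v0 0 by (auto simp: idl_iff_kd)
    then have "b * v1 ?z \<in> idl V ?bs" using d0[of ?z] idl_uminus by fastforce
    then have "v1 ?z \<in> idl V ?bs" using nzd v1 by (auto simp: chainD)
    then obtain y where y: "y \<in> chain V ?l 1" "kd ps y ?z = v1 ?z" by (auto simp: idl_iff_kd)
    have "kd ps y zs = v1 zs" if "length zs = ?l" for zs
    proof (cases "cnt zs = 0")
      case True
      then show ?thesis using y that by (simp add: cnt_eq_0_iff)
    next
      case False
      then have "kd (snd_pairs ps) y zs = 0"
        by (intro kd_snd_eq_0 chainD(3)[OF y(1)]) simp
      then show ?thesis using False chainD(3)[OF v1, of zs] 0 by (simp only: snd) simp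
    qed
    then show ?thesis using y 0 by auto
  qed
  then obtain y1 where y1: "y1 \<in> chain V ?l (Suc c)" "\<And>zs. length zs = ?l \<Longrightarrow> kd ps y1 zs = v1 zs"
    by blast
  \<comment> \<open>With the primitive \<open>y1\<close> of \<open>v1\<close> the remaining part
    \<open>v0\<close> is corrected to a cycle for the shorter list.\<close>
  define u where "u = (\<lambda>zs. v0 zs - sg zs * (b * y1 zs))"
  have "u \<in> chain V ?l (Suc c)"
    unfolding chain_def mem_Collect_eq
  proof (intro allI conjI impI)
    fix zs
    show "u zs \<in> pols V" using v0 y1(1) b by (auto simp: u_def chainD intro!: pols_diff pols_mult)
    assume "u zs \<noteq> 0"
    then have "v0 zs \<noteq> 0 \<or> y1 zs \<noteq> 0" by (auto simp: u_def)
    then show "length zs = ?l" "cnt zs = Suc c" using v0 y1(1) by (auto simp: chain_def)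
  qed
  moreover have "kd ps u zs = 0" if "length zs = ?l" for zs
    unfolding u_def kd_diff kd_sg kd_scale using d0[OF that] y1(2)[OF that] by simp
  ultimately obtain y0 where y0: "y0 \<in> chain V ?l (Suc (Suc c))"
    "\<And>zs. length zs = ?l \<Longrightarrow> kd ps y0 zs = u zs" using IH by blast
  have "kd (q # ps) (join y0 y1) zs = v zs" if zs: "length zs = Suc ?l" for zs
  proof -
    obtain x xs where "zs = x # xs" "length xs = ?l" using zs by (cases zs) auto
    then show ?thesis
      using y0(2)[of xs] y1(2)[of xs] by (cases x) (auto simp: q u_def v0_def v1_def)
  qed
  then show ?case using join_chain[OF y0(1) y1(1)] by auto
qed

subsection \<open>Modules in coordinates\<close>

text \<open>The free module on a finite \<open>B\<close>, with the basis element z in degree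
  \<open>\<delta> z\<close>. Finiteness of supports is left to \<open>B\<close>.\<close>

definition fmod :: "nat set \<Rightarrow> 'i set \<Rightarrow> ('i \<Rightarrow> int) \<Rightarrow> ('i \<Rightarrow> mpol) gmodule" where
  "fmod V B \<delta> = \<lparr>carrier = {v. \<forall>z. v z \<in> pols V \<and> (v z \<noteq> 0 \<longrightarrow> z \<in> B)}, mult = undefined, one = undefined,
     ring.zero = 0, add = (+), smult = (\<lambda>p v z. p * v z),
     deg_part = (\<lambda>k. {v. \<forall>z. v z \<in> pols V \<and> (v z \<noteq> 0 \<longrightarrow> z \<in> B) \<and> homogeneous (k - \<delta> z) (v z)})\<rparr>"

text \<open>Isomorphism of graded modules with nothing presupposed about \<open>M\<close>: closure
  of \<open>M\<close> and its degree parts are asserted here, and the module laws are pulled back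
  from \<open>N\<close>.\<close>

definition miso :: "nat set \<Rightarrow> 'a gmodule \<Rightarrow> 'b gmodule \<Rightarrow> ('a \<Rightarrow> 'b) \<Rightarrow> bool" where
  "miso V M N \<phi> \<longleftrightarrow> bij_betw \<phi> (carrier M) (carrier N) \<and> \<zero>\<^bsub>M\<^esub> \<in> carrier M \<and> \<phi> \<zero>\<^bsub>M\<^esub> = \<zero>\<^bsub>N\<^esub> \<and>
     (\<forall>x\<in>carrier M. \<forall>y\<in>carrier M. x \<oplus>\<^bsub>M\<^esub> y \<in> carrier M \<and> \<phi> (x \<oplus>\<^bsub>M\<^esub> y) = \<phi> x \<oplus>\<^bsub>N\<^esub> \<phi> y) \<and>
     (\<forall>p\<in>pols V. \<forall>x\<in>carrier M. p \<odot>\<^bsub>M\<^esub> x \<in> carrier M \<and> \<phi> (p \<odot>\<^bsub>M\<^esub> x) = p \<odot>\<^bsub>N\<^esub> \<phi> x) \<and>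
     (\<forall>k. deg_part M k = {x \<in> carrier M. \<phi> x \<in> deg_part N k})"

lemma misoD:
  assumes "miso V M N \<phi>"
  shows "bij_betw \<phi> (carrier M) (carrier N)" "\<zero>\<^bsub>M\<^esub> \<in> carrier M" "\<phi> \<zero>\<^bsub>M\<^esub> = \<zero>\<^bsub>N\<^esub>"
    "x \<in> carrier M \<Longrightarrow> \<phi> x \<in> carrier N"
    "x \<in> carrier M \<Longrightarrow> y \<in> carrier M \<Longrightarrow> x \<oplus>\<^bsub>M\<^esub> y \<in> carrier M"
    "x \<in> carrier M \<Longrightarrow> y \<in> carrier M \<Longrightarrow> \<phi> (x \<oplus>\<^bsub>M\<^esub> y) = \<phi> x \<oplus>\<^bsub>N\<^esub> \<phi> y"
    "p \<in> pols V \<Longrightarrow> x \<in> carrier M \<Longrightarrow> p \<odot>\<^bsub>M\<^esub> x \<in> carrier M"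
    "p \<in> pols V \<Longrightarrow> x \<in> carrier M \<Longrightarrow> \<phi> (p \<odot>\<^bsub>M\<^esub> x) = p \<odot>\<^bsub>N\<^esub> \<phi> x"
    "x \<in> deg_part M k \<longleftrightarrow> x \<in> carrier M \<and> \<phi> x \<in> deg_part N k"
    "x \<in> carrier M \<Longrightarrow> y \<in> carrier M \<Longrightarrow> \<phi> x = \<phi> y \<Longrightarrow> x = y"
    "u \<in> carrier N \<Longrightarrow> inv_into (carrier M) \<phi> u \<in> carrier M"
    "u \<in> carrier N \<Longrightarrow> \<phi> (inv_into (carrier M) \<phi> u) = u"
  using assms unfolding miso_def
  by (auto simp: bij_betw_def inj_on_def inv_into_into f_inv_into_f)

lemma miso_inv:
  assumes "miso V M N \<phi>" "x \<in> carrier M"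
  shows "inv_into (carrier M) \<phi> (\<phi> x) = x"
  using assms by (auto simp: miso_def bij_betw_def)

lemma miso_abelian_group:
  assumes m: "miso V M N \<phi>" and N: "abelian_group N"
  shows "abelian_group M"
proof (rule abelian_groupI)
  interpret N: abelian_group N by (rule N)
  note inj = misoD(10)[OF m]
  fix x y z assume xyz: "x \<in> carrier M" "y \<in> carrier M" "z \<in> carrier M"
  note c = misoD(4)[OF m]
  show "x \<oplus>\<^bsub>M\<^esub> y \<in> carrier M" by (simp add: xyz misoD(5)[OF m])
  show "x \<oplus>\<^bsub>M\<^esub> y \<oplus>\<^bsub>M\<^esub> z = x \<oplus>\<^bsub>M\<^esub> (y \<oplus>\<^bsub>M\<^esub> z)"
    by (rule inj) (simp_all add: xyz misoD(5,6)[OF m] c N.a_assoc)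
  show "x \<oplus>\<^bsub>M\<^esub> y = y \<oplus>\<^bsub>M\<^esub> x"
    by (rule inj) (simp_all add: xyz misoD(5,6)[OF m] c N.a_comm)
  show "\<zero>\<^bsub>M\<^esub> \<oplus>\<^bsub>M\<^esub> x = x"
    by (rule inj) (simp_all add: xyz misoD(2,3,5,6)[OF m] c)
  let ?y = "inv_into (carrier M) \<phi> (\<ominus>\<^bsub>N\<^esub> \<phi> x)"
  have y: "?y \<in> carrier M" "\<phi> ?y = \<ominus>\<^bsub>N\<^esub> \<phi> x" using xyz c by (auto intro!: misoD[OF m])
  have "?y \<oplus>\<^bsub>M\<^esub> x = \<zero>\<^bsub>M\<^esub>"
    by (rule inj) (simp_all add: xyz y misoD(2,3,5,6)[OF m] c N.l_neg)
  then show "\<exists>y\<in>carrier M. y \<oplus>\<^bsub>M\<^esub> x = \<zero>\<^bsub>M\<^esub>" using y by blast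
qed (rule misoD(2)[OF m])

lemma fmod_simps [simp]:
  "v \<in> carrier (fmod V B \<delta>) \<longleftrightarrow> (\<forall>z. v z \<in> pols V \<and> (v z \<noteq> 0 \<longrightarrow> z \<in> B))"
  "v \<in> deg_part (fmod V B \<delta>) k \<longleftrightarrow> (\<forall>z. v z \<in> pols V \<and> (v z \<noteq> 0 \<longrightarrow> z \<in> B) \<and> homogeneous (k - \<delta> z) (v z))"
  "\<zero>\<^bsub>fmod V B \<delta>\<^esub> = 0" "u \<oplus>\<^bsub>fmod V B \<delta>\<^esub> v = u + v" "p \<odot>\<^bsub>fmod V B \<delta>\<^esub> v = (\<lambda>z. p * v z)"
  by (auto simp: fmod_def)

lemma fmod_abelian_group: "abelian_group (fmod V B \<delta>)"
proof (rule abelian_groupI)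
  fix u v assume u: "u \<in> carrier (fmod V B \<delta>)" and v: "v \<in> carrier (fmod V B \<delta>)"
  have "u z + v z \<noteq> 0 \<Longrightarrow> u z \<noteq> 0 \<or> v z \<noteq> 0" for z by auto
  with u v show "u \<oplus>\<^bsub>fmod V B \<delta>\<^esub> v \<in> carrier (fmod V B \<delta>)"
    by (simp add: pols_add) blast
  show "\<exists>w\<in>carrier (fmod V B \<delta>). w \<oplus>\<^bsub>fmod V B \<delta>\<^esub> u = \<zero>\<^bsub>fmod V B \<delta>\<^esub>"
    using u by (intro bexI[of _ "- u"]) (auto intro: pols_uminus)
qed (auto simp: add_ac)

lemma fmod_add_closed: "u \<in> carrier (fmod V B \<delta>) \<Longrightarrow> v \<in> carrier (fmod V B \<delta>) \<Longrightarrow> u + v \<in> carrier (fmod V B \<delta>)"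
  using abelian_groupE(1)[OF fmod_abelian_group, of u V B \<delta> v] by (simp del: fmod_simps(1))

lemma miso_uminus:
  assumes m: "miso V M (fmod V B \<delta>) \<phi>" and x: "x \<in> carrier M"
  shows "\<ominus>\<^bsub>M\<^esub> x \<in> carrier M" "\<phi> (\<ominus>\<^bsub>M\<^esub> x) = - \<phi> x"
proof -
  interpret M: abelian_group M by (rule miso_abelian_group[OF m fmod_abelian_group])
  show *: "\<ominus>\<^bsub>M\<^esub> x \<in> carrier M" using x by simp
  have "\<phi> (\<ominus>\<^bsub>M\<^esub> x \<oplus>\<^bsub>M\<^esub> x) = 0" using x by (simp add: M.l_neg misoD(3)[OF m])
  then have "\<phi> (\<ominus>\<^bsub>M\<^esub> x) + \<phi> x = 0" by (simp add: misoD(6)[OF m * x])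
  then show "\<phi> (\<ominus>\<^bsub>M\<^esub> x) = - \<phi> x" by (simp add: eq_neg_iff_add_eq_0)
qed

definition sgl :: "'i \<Rightarrow> mpol \<Rightarrow> 'i \<Rightarrow> mpol" where
  "sgl z p = (\<lambda>y. if y = z then p else 0)"

lemma sgl_simps [simp]: "sgl z p z = p" "y \<noteq> z \<Longrightarrow> sgl z p y = 0" "sgl z 0 = 0"
  by (auto simp: sgl_def)

lemma sgl_add: "sgl z (p + q) = sgl z p + sgl z q"
  by (auto simp: sgl_def)

lemma sgl_fmod: "p \<in> pols V \<Longrightarrow> z \<in> B \<Longrightarrow> sgl z p \<in> carrier (fmod V B \<delta>)"
  by (auto simp: sgl_def)

lemma sum_fun_apply: "(sum f A) x = (\<Sum>i\<in>A. f i x)"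
  by (induction A rule: infinite_finite_induct) auto

lemma fmod_expand:
  assumes "v \<in> carrier (fmod V B \<delta>)" "finite B"
  shows "v = (\<Sum>z\<in>B. \<Sum>a\<in>keys (v z). sgl z (single a (lookup (v z) a)))"
proof
  fix y
  have "(\<Sum>z\<in>B. \<Sum>a\<in>keys (v z). sgl z (single a (lookup (v z) a))) y
      = (\<Sum>z\<in>B. if y = z then (\<Sum>a\<in>keys (v z). single a (lookup (v z) a)) else 0)"
    by (auto simp: sum_fun_apply sgl_def intro!: sum.cong)
  also have "\<dots> = (if y \<in> B then v y else 0)"
    using assms(2) by (simp add: sum.delta flip: mpol_expand)
  also have "\<dots> = v y" using assms(1) by auto
  finally show "v y = (\<Sum>z\<in>B. \<Sum>a\<in>keys (v z). sgl z (single a (lookup (v z) a))) y" ..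
qed

lemma sum_closed:
  assumes "P 0" "\<And>x y. P x \<Longrightarrow> P y \<Longrightarrow> P (x + y)" "\<And>i. i \<in> I \<Longrightarrow> P (f i)"
  shows "P (sum f I)"
  using assms(3) by (induction I rule: infinite_finite_induct) (auto intro: assms(1,2))

lemma fmod_induct [consumes 2, case_names zero sgl add]:
  assumes v: "v \<in> carrier (fmod V B \<delta>)" "finite B" and "P 0"
    and s: "\<And>z a c. z \<in> B \<Longrightarrow> keys a \<subseteq> V \<Longrightarrow> P (sgl z (single a c))"
    and a: "\<And>u v. u \<in> carrier (fmod V B \<delta>) \<Longrightarrow> v \<in> carrier (fmod V B \<delta>) \<Longrightarrow> P u \<Longrightarrow> P v \<Longrightarrow> P (u + v)"
  shows "P v"
proof -
  define Q where "Q u \<longleftrightarrow> u \<in> carrier (fmod V B \<delta>) \<and> P u" for u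
  have Q0: "Q 0" using assms(3) by (simp add: Q_def)
  have Qadd: "Q u \<Longrightarrow> Q v \<Longrightarrow> Q (u + v)" for u v
    using a fmod_add_closed[of u V B \<delta> v] unfolding Q_def by blast
  have "Q (sgl z (single a (lookup (v z) a)))"
    if "z \<in> B" "a \<in> keys (v z)" for z a
  proof -
    have "v z \<in> pols V" using v(1) by simp
    then have "keys a \<subseteq> V" using that by (simp add: pols_def)
    then show ?thesis
      using s that by (auto simp: Q_def pols_iff_single simp del: fmod_simps(1) intro!: sgl_fmod)
  qed
  then have "Q (\<Sum>z\<in>B. \<Sum>a\<in>keys (v z). sgl z (single a (lookup (v z) a)))"
    by (intro sum_closed[where P = Q] Q0 Qadd)
  then show ?thesis using fmod_expand[OF v] by (simp add: Q_def)
qed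

subsection \<open>Tensor products in coordinates\<close>

text \<open>Coordinates of x \<otimes> y. The first \<open>q\<close> entries of an index belong to
  the second factor, because index lists run from the last tensor factor to the first.\<close>

definition outer :: "nat \<Rightarrow> (bool list \<Rightarrow> mpol) \<Rightarrow> (bool list \<Rightarrow> mpol) \<Rightarrow> bool list \<Rightarrow> mpol" where
  "outer q u v zs = u (drop q zs) * v (take q zs)"

text \<open>Additive extension of the bilinear coordinate map to formal sums of pairs. Its kernel
  will be exactly \<open>tensor_rel\<close>, so that \<open>tau\<close>, which evaluates it at an
  arbitrary representative, gives coordinates on the tensor product.\<close>

definition theta :: "nat \<Rightarrow> ('a \<Rightarrow> bool list \<Rightarrow> mpol) \<Rightarrow> ('b \<Rightarrow> bool list \<Rightarrow> mpol) \<Rightarrow>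
    ('a \<times> 'b \<Rightarrow>\<^sub>0 int) \<Rightarrow> bool list \<Rightarrow> mpol" where
  "theta q \<alpha> \<beta> c zs =
     (\<Sum>w\<in>keys c. of_int (lookup c w) * outer q (\<alpha> (fst w)) (\<beta> (snd w)) zs)"

definition tau :: "nat \<Rightarrow> ('a \<Rightarrow> bool list \<Rightarrow> mpol) \<Rightarrow> ('b \<Rightarrow> bool list \<Rightarrow> mpol) \<Rightarrow>
    ('a, 'b) tensor \<Rightarrow> bool list \<Rightarrow> mpol" where
  "tau q \<alpha> \<beta> C = theta q \<alpha> \<beta> (SOME c. c \<in> C)"

lemma theta_add: "theta q \<alpha> \<beta> (c + d) = theta q \<alpha> \<beta> c + theta q \<alpha> \<beta> d"
proof
  fix zs
  have "theta q \<alpha> \<beta> (c + d) zs = theta q \<alpha> \<beta> c zs + theta q \<alpha> \<beta> d zs"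
    unfolding theta_def by (rule setsum_keys_plus_distrib) (auto simp: algebra_simps)
  then show "theta q \<alpha> \<beta> (c + d) zs = (theta q \<alpha> \<beta> c + theta q \<alpha> \<beta> d) zs" by simp
qed

lemma theta_0 [simp]: "theta q \<alpha> \<beta> 0 = 0"
  by (auto simp: theta_def)

lemma theta_uminus: "theta q \<alpha> \<beta> (- c) = - theta q \<alpha> \<beta> c"
  using theta_add[of q \<alpha> \<beta> "- c" c] by (simp add: eq_neg_iff_add_eq_0)

lemma theta_diff: "theta q \<alpha> \<beta> (c - d) = theta q \<alpha> \<beta> c - theta q \<alpha> \<beta> d"
  using theta_add[of q \<alpha> \<beta> c "- d"] by (simp add: theta_uminus)

lemma theta_sum: "theta q \<alpha> \<beta> (sum f I) = (\<Sum>i\<in>I. theta q \<alpha> \<beta> (f i))"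
  by (induction I rule: infinite_finite_induct) (simp_all add: theta_add)

lemma theta_frag_of: "theta q \<alpha> \<beta> (frag_of (x, y)) = outer q (\<alpha> x) (\<beta> y)"
  by (auto simp: theta_def)

lemma outer_add:
  "outer q (u + u') v = outer q u v + outer q u' v" "outer q u (v + v') = outer q u v + outer q u v'"
  by (auto simp: outer_def fun_eq_iff algebra_simps)

lemma outer_0 [simp]: "outer q 0 v = 0" "outer q u 0 = 0"
  by (auto simp: outer_def fun_eq_iff)

lemma outer_sgl:
  "length ys = q \<Longrightarrow> outer q (sgl xs p) (sgl ys r) = sgl (ys @ xs) (p * r)"
  by (auto simp: outer_def sgl_def fun_eq_iff) (metis append_take_drop_id)

text \<open>Both factors have coordinates over their own variables. The aim is that their tensor
  product over the shared variables is free over the polynomials in \<open>V \<union> U\<close>, on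
  the product of the two bases.\<close>

locale tensor_coords =
  fixes V U :: "nat set" and M :: "'a gmodule" and N :: "'b gmodule"
    and \<alpha> :: "'a \<Rightarrow> bool list \<Rightarrow> mpol" and \<beta> :: "'b \<Rightarrow> bool list \<Rightarrow> mpol"
    and Bx By :: "bool list set" and \<delta>x \<delta>y :: "bool list \<Rightarrow> int" and q :: nat
  assumes \<alpha>: "miso V M (fmod V Bx \<delta>x) \<alpha>" and \<beta>: "miso U N (fmod U By \<delta>y) \<beta>"
    and fin: "finite Bx" "finite By" and len: "\<And>ys. ys \<in> By \<Longrightarrow> length ys = q"
begin

abbreviation G where "G \<equiv> pairs_group M N"
abbreviation K where "K \<equiv> tensor_rel (V \<inter> U) M N"
abbreviation \<theta> where "\<theta> \<equiv> theta q \<alpha> \<beta>"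

lemma in_G: "c \<in> carrier G \<longleftrightarrow> keys c \<subseteq> carrier M \<times> carrier N"
  by (simp add: pairs_group_def)

lemma comm_group_G: "comm_group G"
  by (simp add: pairs_group_def abelian_free_Abelian_group)

lemma G_ops [simp]: "c \<otimes>\<^bsub>G\<^esub> d = c + d" "\<one>\<^bsub>G\<^esub> = 0" "c \<in> carrier G \<Longrightarrow> inv\<^bsub>G\<^esub> c = - c"
  by (auto simp: pairs_group_def)

lemma G_closed: "c \<in> carrier G \<Longrightarrow> d \<in> carrier G \<Longrightarrow> c + d \<in> carrier G" "0 \<in> carrier G"
  "c \<in> carrier G \<Longrightarrow> - c \<in> carrier G" "c \<in> carrier G \<Longrightarrow> d \<in> carrier G \<Longrightarrow> c - d \<in> carrier G"
  "x \<in> carrier M \<Longrightarrow> y \<in> carrier N \<Longrightarrow> frag_of (x, y) \<in> carrier G"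
  using keys_add[of c d] keys_diff[of c d] by (auto simp: in_G)

lemma G_induct [consumes 1, case_names zero diff frag]:
  assumes "c \<in> carrier G" "P 0"
    and "\<And>c d. c \<in> carrier G \<Longrightarrow> d \<in> carrier G \<Longrightarrow> P c \<Longrightarrow> P d \<Longrightarrow> P (c - d)"
    and "\<And>x y. x \<in> carrier M \<Longrightarrow> y \<in> carrier N \<Longrightarrow> P (frag_of (x, y))"
  shows "P c"
proof (rule free_Abelian_group_induct)
  show "keys c \<subseteq> carrier M \<times> carrier N" using assms(1) by (simp add: in_G)
qed (use assms in \<open>auto simp: in_G\<close>)

lemma subgroup_K: "subgroup K G"
proof -
  interpret comm_group G by (rule comm_group_G)
  show ?thesis
    unfolding tensor_rel_def
    by (rule generate_is_subgroup) (auto intro!: G_closed misoD[OF \<alpha>] misoD[OF \<beta>] intro: pols_mono[of "V \<inter> U"])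
qed

lemma K_closed: "c \<in> K \<Longrightarrow> d \<in> K \<Longrightarrow> c + d \<in> K" "0 \<in> K" "c \<in> K \<Longrightarrow> - c \<in> K" "c \<in> K \<Longrightarrow> c \<in> carrier G"
  using subgroup.m_closed[OF subgroup_K, of c d] subgroup.one_closed[OF subgroup_K]
    subgroup.m_inv_closed[OF subgroup_K, of c] subgroup.mem_carrier[OF subgroup_K, of c] by auto

definition eqv where "eqv c d \<longleftrightarrow> c - d \<in> K"

lemma eqv_refl [simp]: "eqv c c"
  by (simp add: eqv_def K_closed)

lemma eqv_sym: "eqv c d \<Longrightarrow> eqv d c"
  using K_closed(3)[of "c - d"] by (simp add: eqv_def)

lemma eqv_trans [trans]: "eqv c d \<Longrightarrow> eqv d e \<Longrightarrow> eqv c e"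
  using K_closed(1)[of "c - d" "d - e"] by (simp add: eqv_def)

lemma eqv_add: "eqv c d \<Longrightarrow> eqv c' d' \<Longrightarrow> eqv (c + c') (d + d')"
  using K_closed(1)[of "c - d" "c' - d'"] by (simp add: eqv_def algebra_simps)

lemma eqv_sum: "(\<And>i. i \<in> I \<Longrightarrow> eqv (f i) (g i)) \<Longrightarrow> eqv (sum f I) (sum g I)"
  by (induction I rule: infinite_finite_induct) (auto intro: eqv_add)

lemma eqv_0I: "eqv c (c + c) \<Longrightarrow> eqv c 0"
  using K_closed(3)[of "- c"] by (simp add: eqv_def)

lemma eqv_rels:
  "x \<in> carrier M \<Longrightarrow> x' \<in> carrier M \<Longrightarrow> y \<in> carrier N \<Longrightarrow>
     eqv (frag_of (x \<oplus>\<^bsub>M\<^esub> x', y)) (frag_of (x, y) + frag_of (x', y))"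
  "x \<in> carrier M \<Longrightarrow> y \<in> carrier N \<Longrightarrow> y' \<in> carrier N \<Longrightarrow>
     eqv (frag_of (x, y \<oplus>\<^bsub>N\<^esub> y')) (frag_of (x, y) + frag_of (x, y'))"
  "p \<in> pols (V \<inter> U) \<Longrightarrow> x \<in> carrier M \<Longrightarrow> y \<in> carrier N \<Longrightarrow>
     eqv (frag_of (p \<odot>\<^bsub>M\<^esub> x, y)) (frag_of (x, p \<odot>\<^bsub>N\<^esub> y))"
  unfolding eqv_def tensor_rel_def diff_diff_eq[symmetric] by (rule generate.incl; blast)+

abbreviation a' where "a' \<equiv> inv_into (carrier M) \<alpha>"
abbreviation b' where "b' \<equiv> inv_into (carrier N) \<beta>"
abbreviation FM where "FM \<equiv> carrier (fmod V Bx \<delta>x)"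
abbreviation FN where "FN \<equiv> carrier (fmod U By \<delta>y)"

lemma a'_carrier: "u \<in> FM \<Longrightarrow> a' u \<in> carrier M" and b'_carrier: "v \<in> FN \<Longrightarrow> b' v \<in> carrier N"
  by (rule misoD(11)[OF \<alpha>], assumption) (rule misoD(11)[OF \<beta>])

lemma a'_add: "u \<in> FM \<Longrightarrow> u' \<in> FM \<Longrightarrow> a' (u + u') = a' u \<oplus>\<^bsub>M\<^esub> a' u'"
  using fmod_add_closed[of u V Bx \<delta>x u']
  by (intro misoD(10)[OF \<alpha>]) (simp_all add: misoD[OF \<alpha>] del: fmod_simps(1))

lemma b'_add: "v \<in> FN \<Longrightarrow> v' \<in> FN \<Longrightarrow> b' (v + v') = b' v \<oplus>\<^bsub>N\<^esub> b' v'"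
  using fmod_add_closed[of v U By \<delta>y v']
  by (intro misoD(10)[OF \<beta>]) (simp_all add: misoD[OF \<beta>] del: fmod_simps(1))

lemma fmod_smult_closed: "p \<in> pols W \<Longrightarrow> u \<in> carrier (fmod W B \<delta>) \<Longrightarrow> (\<lambda>z. p * u z) \<in> carrier (fmod W B \<delta>)"
  by (auto intro: pols_mult)

lemma a'_smult: "p \<in> pols V \<Longrightarrow> u \<in> FM \<Longrightarrow> a' (\<lambda>z. p * u z) = p \<odot>\<^bsub>M\<^esub> a' u"
  using fmod_smult_closed[of p V u Bx \<delta>x]
  by (intro misoD(10)[OF \<alpha>]) (simp_all add: misoD[OF \<alpha>] del: fmod_simps(1))

lemma b'_smult: "p \<in> pols U \<Longrightarrow> v \<in> FN \<Longrightarrow> b' (\<lambda>z. p * v z) = p \<odot>\<^bsub>N\<^esub> b' v"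
  using fmod_smult_closed[of p U v By \<delta>y]
  by (intro misoD(10)[OF \<beta>]) (simp_all add: misoD[OF \<beta>] del: fmod_simps(1))

definition Bxy where "Bxy = {zs. take q zs \<in> By \<and> drop q zs \<in> Bx}"

lemma finite_Bxy: "finite Bxy"
proof -
  have "Bxy \<subseteq> (\<lambda>(ys, xs). ys @ xs) ` (By \<times> Bx)"
  proof
    fix zs assume "zs \<in> Bxy"
    then show "zs \<in> (\<lambda>(ys, xs). ys @ xs) ` (By \<times> Bx)"
      by (intro image_eqI[of _ _ "(take q zs, drop q zs)"]) (auto simp: Bxy_def)
  qed
  then show ?thesis by (rule finite_subset) (simp add: fin)
qed

lemma append_Bxy: "xs \<in> Bx \<Longrightarrow> ys \<in> By \<Longrightarrow> ys @ xs \<in> Bxy"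
  using len[of ys] by (simp add: Bxy_def)

text \<open>Normal form of a monomial at a basis element: the coefficient and the variables in
  \<open>V\<close> go to the left factor, the other variables to the right. This is the splitting by
  which the scalar action on the tensor product is defined. \<open>kap\<close> adds such terms up
  and inverts \<open>\<theta>\<close> modulo the relations.\<close>

definition kap1 where "kap1 zs a c =
  frag_of (a' (sgl (drop q zs) (single (mono_restrict V a) c)),
           b' (sgl (take q zs) (single (mono_restrict (- V) a) 1)))"

definition kapp where "kapp zs p = (\<Sum>a\<in>keys p. kap1 zs a (lookup p a))"

definition kap where "kap w = (\<Sum>zs\<in>Bxy. kapp zs (w zs))"

lemma kap1_args:
  assumes "zs \<in> Bxy" "keys a \<subseteq> V \<union> U"
  shows "sgl (drop q zs) (single (mono_restrict V a) c) \<in> FM"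
    "sgl (take q zs) (single (mono_restrict (- V) a) d) \<in> FN"
  using assms by (auto intro!: sgl_fmod simp: Bxy_def pols_iff_single keys_mono_restrict simp del: fmod_simps(1))

lemma kap1_G: "zs \<in> Bxy \<Longrightarrow> keys a \<subseteq> V \<union> U \<Longrightarrow> kap1 zs a c \<in> carrier G"
  unfolding kap1_def by (intro G_closed(5) a'_carrier b'_carrier kap1_args)

lemma sgl_single_add: "sgl z (single a (c + d)) = sgl z (single a c) + sgl z (single a d)"
  by (simp add: single_add sgl_add)

lemma kap1_add:
  assumes "zs \<in> Bxy" "keys a \<subseteq> V \<union> U"
  shows "eqv (kap1 zs a (c + d)) (kap1 zs a c + kap1 zs a d)"
  unfolding kap1_def sgl_single_add a'_add[OF kap1_args(1)[OF assms] kap1_args(1)[OF assms]]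
  by (intro eqv_rels a'_carrier b'_carrier kap1_args assms)

lemma kap1_0: "zs \<in> Bxy \<Longrightarrow> keys a \<subseteq> V \<union> U \<Longrightarrow> eqv (kap1 zs a 0) 0"
  using kap1_add[of zs a 0 0] by (auto intro: eqv_0I)

lemma kapp_superset:
  assumes "zs \<in> Bxy" "finite S" "keys p \<subseteq> S" "\<And>a. a \<in> S \<Longrightarrow> keys a \<subseteq> V \<union> U"
  shows "eqv (\<Sum>a\<in>S. kap1 zs a (lookup p a)) (kapp zs p)"
proof -
  have "(\<Sum>a\<in>S. kap1 zs a (lookup p a)) =
      (\<Sum>a\<in>S - keys p. kap1 zs a (lookup p a)) + kapp zs p"
    unfolding kapp_def using assms by (simp add: sum.subset_diff)
  moreover have "eqv (\<Sum>a\<in>S - keys p. kap1 zs a (lookup p a)) (\<Sum>a\<in>S - keys p. 0)"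
    using assms by (intro eqv_sum) (auto simp: in_keys_iff intro!: kap1_0)
  ultimately show ?thesis using eqv_add[OF _ eqv_refl, of _ 0 "kapp zs p"] by simp
qed

lemma kapp_add:
  assumes "zs \<in> Bxy" "p \<in> pols (V \<union> U)" "r \<in> pols (V \<union> U)"
  shows "eqv (kapp zs (p + r)) (kapp zs p + kapp zs r)"
proof -
  let ?S = "keys p \<union> keys r"
  have S: "keys a \<subseteq> V \<union> U" if "a \<in> ?S" for a
    using assms that by (auto simp: pols_def)
  note sup = kapp_superset[OF assms(1) _ _ S]
  have "eqv (kapp zs (p + r)) (\<Sum>a\<in>?S. kap1 zs a (lookup (p + r) a))"
    by (rule eqv_sym, rule sup) (use keys_add[of p r] in auto)
  also have "eqv \<dots> (\<Sum>a\<in>?S. kap1 zs a (lookup p a) + kap1 zs a (lookup r a))"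
    unfolding lookup_add by (intro eqv_sum kap1_add assms S)
  also have "eqv \<dots> (kapp zs p + kapp zs r)"
    unfolding sum.distrib by (intro eqv_add sup) auto
  finally show ?thesis .
qed

lemma kap_add:
  assumes "\<And>zs. w zs \<in> pols (V \<union> U)" "\<And>zs. w' zs \<in> pols (V \<union> U)"
  shows "eqv (kap (w + w')) (kap w + kap w')"
  unfolding kap_def sum.distrib[symmetric] plus_fun_apply by (intro eqv_sum kapp_add assms)

lemma kap_0 [simp]: "kap 0 = 0" "kap (\<lambda>z. 0) = 0"
  by (simp_all add: kap_def kapp_def)

lemma kap_sgl:
  assumes "zs \<in> Bxy" "keys a \<subseteq> V \<union> U"
  shows "eqv (kap (sgl zs (single a c))) (kap1 zs a c)"
proof -
  have "kap (sgl zs (single a c)) = (\<Sum>z\<in>Bxy. if z = zs then kapp zs (single a c) else 0)"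
    unfolding kap_def by (intro sum.cong) (auto simp: sgl_def kapp_def)
  also have "\<dots> = kapp zs (single a c)"
    using assms finite_Bxy by simp
  finally show ?thesis
    using eqv_sym[OF kap1_0[OF assms]] by (cases "c = 0") (auto simp: kapp_def)
qed

lemma outer_pols: "u \<in> FM \<Longrightarrow> v \<in> FN \<Longrightarrow> outer q u v zs \<in> pols (V \<union> U)"
  unfolding outer_def by (intro pols_mult) (auto intro: pols_mono[of V] pols_mono[of U])

text \<open>Both sides are biadditive modulo the relations, which reduces the claim to monomials at
  basis elements. There they differ only in which factor holds the coefficient and the shared
  variables of the right-hand monomial, and these may be moved across the tensor sign.\<close>

lemma eqv_kap_outer:
  assumes "u \<in> FM" "v \<in> FN"
  shows "eqv (frag_of (a' u, b' v)) (kap (outer q u v))"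
  using assms(1) fin(1)
proof (induction rule: fmod_induct)
  case zero
  have "a' 0 = a' 0 \<oplus>\<^bsub>M\<^esub> a' 0" using a'_add[of 0 0] by simp
  then have "eqv (frag_of (a' 0, b' v)) (frag_of (a' 0, b' v) + frag_of (a' 0, b' v))"
    using eqv_rels(1)[of "a' 0" "a' 0" "b' v"] a'_carrier[of 0] b'_carrier[OF assms(2)] by simp
  then have "eqv (frag_of (a' 0, b' v)) (kap (outer q 0 v))" by (simp add: eqv_0I)
  then show ?case by (simp add: zero_fun_def)
next
  case (add u u')
  have "eqv (frag_of (a' (u + u'), b' v)) (frag_of (a' u, b' v) + frag_of (a' u', b' v))"
    unfolding a'_add[OF add.hyps] by (intro eqv_rels a'_carrier b'_carrier add.hyps assms)
  also have "eqv \<dots> (kap (outer q u v) + kap (outer q u' v))"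
    by (intro eqv_add add.IH)
  also have "eqv \<dots> (kap (outer q (u + u') v))"
    unfolding outer_add using outer_pols assms(2) add.hyps by (intro eqv_sym[OF kap_add]) auto
  finally show ?case .
next
  case (sgl xs a c)
  have x: "sgl xs (single a c) \<in> FM" for c
    using sgl by (intro sgl_fmod) (auto simp: pols_iff_single)
  show ?case
    using assms(2) fin(2)
  proof (induction rule: fmod_induct)
    case zero
    let ?x = "a' (sgl xs (single a c))"
    have "b' 0 = b' 0 \<oplus>\<^bsub>N\<^esub> b' 0" using b'_add[of 0 0] by simp
    then have "eqv (frag_of (?x, b' 0)) (frag_of (?x, b' 0) + frag_of (?x, b' 0))"
      using eqv_rels(2)[of ?x "b' 0" "b' 0"] a'_carrier[OF x] b'_carrier[of 0] by simp
    then have "eqv (frag_of (?x, b' 0)) (kap (outer q (sgl xs (single a c)) 0))" by (simp add: eqv_0I)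
    then show ?case by (simp add: zero_fun_def)
  next
    case (add v v')
    let ?u = "sgl xs (single a c)"
    have "eqv (frag_of (a' ?u, b' (v + v'))) (frag_of (a' ?u, b' v) + frag_of (a' ?u, b' v'))"
      unfolding b'_add[OF add.hyps] by (intro eqv_rels a'_carrier b'_carrier add.hyps x)
    also have "eqv \<dots> (kap (outer q ?u v) + kap (outer q ?u v'))"
      by (intro eqv_add add.IH)
    also have "eqv \<dots> (kap (outer q ?u (v + v')))"
      unfolding outer_add using outer_pols[OF x] add.hyps by (intro eqv_sym[OF kap_add]) auto
    finally show ?case .
  next
    case (sgl ys b d)
    \<comment> \<open>The part of \<open>b\<close> in \<open>V\<close> uses shared variables only,
      since \<open>b\<close> lives in \<open>U\<close>; with the coefficient \<open>d\<close> it is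
      moved to the left factor.\<close>
    define e where "e = mono_restrict V b"
    define f where "f = mono_restrict (- V) b"
    let ?p = "single e d"
    have keys: "keys e \<subseteq> V \<inter> U" "keys f \<subseteq> U"
      using sgl by (auto simp: e_def f_def keys_mono_restrict)
    then have p: "?p \<in> pols (V \<inter> U)" "?p \<in> pols V" "?p \<in> pols U"
      by (auto simp: pols_iff_single)
    have y: "sgl ys (single f 1) \<in> FN"
      using keys sgl by (intro sgl_fmod) (auto simp: pols_iff_single)
    have len': "length ys = q" using sgl len by blast
    have ab: "mono_restrict V (a + b) = e + a" "mono_restrict (- V) (a + b) = f"
    proof -
      have "mono_restrict V a = a" "mono_restrict (- V) a = 0"
        using \<open>keys a \<subseteq> V\<close> by (auto intro!: mono_restrict_id mono_restrict_disjoint)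
      then show "mono_restrict V (a + b) = e + a" "mono_restrict (- V) (a + b) = f"
        by (simp_all add: mono_restrict_add e_def f_def add.commute)
    qed
    have 1: "?p \<odot>\<^bsub>M\<^esub> a' (sgl xs (single a c)) = a' (sgl xs (single (e + a) (c * d)))"
      unfolding a'_smult[OF p(2) x, symmetric]
      by (rule arg_cong[where f = a']) (auto simp: sgl_def fun_eq_iff mult_single ac_simps)
    have 2: "?p \<odot>\<^bsub>N\<^esub> b' (sgl ys (single f 1)) = b' (sgl ys (single b d))"
      unfolding b'_smult[OF p(3) y, symmetric] using mono_restrict_split[of V b]
      by (intro arg_cong[where f = b']) (auto simp: sgl_def fun_eq_iff mult_single e_def f_def)
    have "eqv (frag_of (a' (sgl xs (single a c)), b' (sgl ys (single b d))))
        (kap1 (ys @ xs) (a + b) (c * d))"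
      unfolding kap1_def ab
      using len' eqv_sym[OF eqv_rels(3)[OF p(1) a'_carrier[OF x[of c]] b'_carrier[OF y], unfolded 1 2]] by simp
    also have "eqv \<dots> (kap (sgl (ys @ xs) (single (a + b) (c * d))))"
      using sgl \<open>keys a \<subseteq> V\<close> \<open>xs \<in> Bx\<close>
      by (intro eqv_sym[OF kap_sgl] append_Bxy) (auto simp: keys_mono_add)
    finally show ?case by (simp add: outer_sgl[OF len'] mult_single)
  qed
qed

lemma outer_\<alpha>\<beta>_pols: "x \<in> carrier M \<Longrightarrow> y \<in> carrier N \<Longrightarrow> outer q (\<alpha> x) (\<beta> y) zs \<in> pols (V \<union> U)"
  by (intro outer_pols misoD(4)[OF \<alpha>] misoD(4)[OF \<beta>])

lemma theta_pols: "c \<in> carrier G \<Longrightarrow> \<theta> c zs \<in> pols (V \<union> U)"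
  by (induction rule: G_induct) (simp_all add: theta_diff pols_diff theta_frag_of outer_\<alpha>\<beta>_pols)

text \<open>Every formal sum is congruent to a normal form that depends only on its coordinates.
  Together with \<open>theta_K\<close> this shows that coordinates detect congruence.\<close>

lemma eqv_kap_theta: "c \<in> carrier G \<Longrightarrow> eqv c (kap (\<theta> c))"
proof (induction rule: G_induct)
  case (diff x y)
  have "eqv (kap (\<theta> x)) (kap (\<theta> (x - y)) + kap (\<theta> y))"
    using kap_add[of "\<theta> (x - y)" "\<theta> y"] theta_pols[OF G_closed(4)[OF diff.hyps]] theta_pols[OF diff.hyps(2)]
    by (simp add: theta_diff)
  then have "eqv x (kap (\<theta> (x - y)) + y)"
    using eqv_trans[OF diff.IH(1)] eqv_trans[OF _ eqv_add[OF eqv_refl eqv_sym[OF diff.IH(2)]]] by blast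
  then show ?case by (simp add: eqv_def algebra_simps)
next
  case (frag x y)
  show ?case
    using eqv_kap_outer[OF misoD(4)[OF \<alpha> frag(1)] misoD(4)[OF \<beta> frag(2)]] frag
    by (simp add: theta_frag_of miso_inv[OF \<alpha>] miso_inv[OF \<beta>])
qed simp

lemma theta_K: "c \<in> K \<Longrightarrow> \<theta> c = 0"
  unfolding tensor_rel_def
proof (induction rule: generate.induct)
  case (incl h)
  then show ?case
    by (elim UnE CollectE exE conjE)
      (simp_all add: theta_diff theta_frag_of misoD[OF \<alpha>] misoD[OF \<beta>] outer_add pols_mono[of "V \<inter> U" V] pols_mono[of "V \<inter> U" U],
       auto simp: outer_def fun_eq_iff misoD[OF \<alpha>] misoD[OF \<beta>] pols_mono[of "V \<inter> U" V] pols_mono[of "V \<inter> U" U])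
next
  case (inv h)
  then have "h \<in> K" unfolding tensor_rel_def by (rule generate.incl)
  then have "h \<in> carrier G" by (rule K_closed)
  from inv have "\<theta> h = 0"
    by (elim UnE CollectE exE conjE)
      (simp_all add: theta_diff theta_frag_of misoD[OF \<alpha>] misoD[OF \<beta>] outer_add pols_mono[of "V \<inter> U" V] pols_mono[of "V \<inter> U" U],
       auto simp: outer_def fun_eq_iff misoD[OF \<alpha>] misoD[OF \<beta>] pols_mono[of "V \<inter> U" V] pols_mono[of "V \<inter> U" U])
  then show ?case using \<open>h \<in> carrier G\<close> by (simp add: theta_uminus)
qed (simp_all add: theta_add)

lemma K_iff: "c \<in> carrier G \<Longrightarrow> c \<in> K \<longleftrightarrow> \<theta> c = 0"
  using theta_K eqv_kap_theta[of c] by (auto simp: eqv_def)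

abbreviation T where "T \<equiv> tensor_module V U M N"
abbreviation cls where "cls c \<equiv> K #>\<^bsub>G\<^esub> c"
abbreviation \<tau> where "\<tau> \<equiv> tau q \<alpha> \<beta>"
abbreviation \<delta> where "\<delta> zs \<equiv> \<delta>x (drop q zs) + \<delta>y (take q zs)"
abbreviation FT where "FT \<equiv> fmod (V \<union> U) Bxy \<delta>"

lemma normal_K: "K \<lhd> G"
  using comm_group.subgroup_imp_normal[OF comm_group_G subgroup_K] .

lemma cls_eq: "cls c = {k + c | k. k \<in> K}"
  by (auto simp: r_coset_def)

lemma mem_cls: "c \<in> carrier G \<Longrightarrow> d \<in> cls c \<Longrightarrow> d \<in> carrier G \<and> \<theta> d = \<theta> c"
  by (auto simp: cls_eq theta_add theta_K intro: G_closed K_closed)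

lemma self_mem_cls: "c \<in> cls c"
  by (auto simp: cls_eq intro!: exI[of _ 0] K_closed)

lemma tau_cls: "c \<in> carrier G \<Longrightarrow> \<tau> (cls c) = \<theta> c"
  unfolding tau_def using mem_cls[of c] someI[of "\<lambda>d. d \<in> cls c", OF self_mem_cls] by blast

lemma cls_eqI: "c \<in> carrier G \<Longrightarrow> d \<in> carrier G \<Longrightarrow> \<theta> c = \<theta> d \<Longrightarrow> cls c = cls d"
proof -
  have *: "cls c \<subseteq> cls d" if "c \<in> carrier G" "d \<in> carrier G" "\<theta> c = \<theta> d" for c d
  proof
    fix e assume "e \<in> cls c"
    then obtain k where "e = k + c" "k \<in> K" by (auto simp: cls_eq)
    moreover have "c - d \<in> K" using that by (simp add: K_iff G_closed theta_diff)
    ultimately show "e \<in> cls d"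
      by (auto simp: cls_eq intro!: exI[of _ "k + (c - d)"] K_closed)
  qed
  assume "c \<in> carrier G" "d \<in> carrier G" "\<theta> c = \<theta> d"
  then show ?thesis using *[of c d] *[of d c] by auto
qed

lemma T_simps [simp]:
  "carrier T = cls ` carrier G" "\<zero>\<^bsub>T\<^esub> = K" "C \<oplus>\<^bsub>T\<^esub> D = C <#>\<^bsub>G\<^esub> D"
  by (simp_all add: tensor_module_def Let_def tensor_group_def carrier_FactGroup)

lemma tensor_group_simps [simp]:
  "carrier (tensor_group (V \<inter> U) M N) = cls ` carrier G" "\<one>\<^bsub>tensor_group (V \<inter> U) M N\<^esub> = K"
  "C \<otimes>\<^bsub>tensor_group (V \<inter> U) M N\<^esub> D = C <#>\<^bsub>G\<^esub> D"
  by (simp_all add: tensor_group_def carrier_FactGroup)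

lemma comm_group_T: "comm_group (tensor_group (V \<inter> U) M N)"
  unfolding tensor_group_def by (rule comm_group.abelian_FactGroup[OF comm_group_G subgroup_K])

lemma cls_add: "c \<in> carrier G \<Longrightarrow> d \<in> carrier G \<Longrightarrow> cls c <#>\<^bsub>G\<^esub> cls d = cls (c + d)"
  using normal.rcos_sum[OF normal_K, of c d] by simp

lemma cls_0: "cls 0 = K"
  by (auto simp: cls_eq)

lemma kap_G: "(\<And>zs. w zs \<in> pols (V \<union> U)) \<Longrightarrow> kap w \<in> carrier G"
  unfolding kap_def kapp_def
  by (intro sum_closed[where P = "\<lambda>c. c \<in> carrier G"] G_closed kap1_G) (auto simp: pols_def)

lemma theta_kap1:
  assumes "zs \<in> Bxy" "keys a \<subseteq> V \<union> U"
  shows "\<theta> (kap1 zs a c) = sgl zs (single a c)"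
proof -
  have "length (take q zs) = q" using assms(1) len[of "take q zs"] by (simp add: Bxy_def)
  then show ?thesis
    unfolding kap1_def theta_frag_of misoD(12)[OF \<alpha> kap1_args(1)[OF assms]] misoD(12)[OF \<beta> kap1_args(2)[OF assms]]
    by (simp add: outer_sgl mult_single mono_restrict_split del: length_take)
qed

lemma theta_kap:
  assumes "w \<in> carrier FT" shows "\<theta> (kap w) = w"
proof -
  have k: "keys a \<subseteq> V \<union> U" if "a \<in> keys (w zs)" for a zs
    using assms that by (auto simp: pols_def)
  have "\<theta> (kap w) = (\<Sum>zs\<in>Bxy. \<Sum>a\<in>keys (w zs). sgl zs (single a (lookup (w zs) a)))"
    unfolding kap_def kapp_def theta_sum by (intro sum.cong refl theta_kap1 k)
  then show ?thesis using fmod_expand[OF assms finite_Bxy] by simp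
qed

lemma theta_FT: "c \<in> carrier G \<Longrightarrow> \<theta> c \<in> carrier FT"
proof (induction rule: G_induct)
  case (diff c d)
  have "\<theta> c z - \<theta> d z \<noteq> 0 \<Longrightarrow> \<theta> c z \<noteq> 0 \<or> \<theta> d z \<noteq> 0" for z by auto
  with diff.IH show ?case by (simp add: theta_diff pols_diff) blast
next
  case (frag x y)
  have "\<alpha> x \<in> FM" "\<beta> y \<in> FN" using frag misoD(4)[OF \<alpha>] misoD(4)[OF \<beta>] by blast+
  then show ?case using outer_pols by (auto simp: theta_frag_of) (auto simp: outer_def Bxy_def)
qed simp

lemma tau_add: "C \<in> carrier T \<Longrightarrow> D \<in> carrier T \<Longrightarrow> C \<oplus>\<^bsub>T\<^esub> D \<in> carrier T \<and> \<tau> (C \<oplus>\<^bsub>T\<^esub> D) = \<tau> C + \<tau> D"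
  by (auto simp: cls_add tau_cls theta_add G_closed)

lemma tau_finprod:
  assumes "finite S" "\<And>a. a \<in> S \<Longrightarrow> F a \<in> carrier T"
  shows "finprod (tensor_group (V \<inter> U) M N) F S \<in> carrier T \<and>
    \<tau> (finprod (tensor_group (V \<inter> U) M N) F S) = (\<Sum>a\<in>S. \<tau> (F a))"
proof -
  interpret comm_group "tensor_group (V \<inter> U) M N" by (rule comm_group_T)
  show ?thesis using assms
proof (induction S rule: finite_induct)
  case empty
  have "K \<in> cls ` carrier G" "\<tau> K = 0"
    using tau_cls[of 0] G_closed(2) by (auto simp: cls_0 intro!: image_eqI[of _ _ 0])
  then show ?case by (simp add: zero_fun_def)
next
  case (insert a S)
  have "finprod (tensor_group (V \<inter> U) M N) F (insert a S) = F a <#>\<^bsub>G\<^esub> finprod (tensor_group (V \<inter> U) M N) F S"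
    using insert by (subst finprod_insert) auto
  then show ?case using insert tau_add[of "F a" "finprod (tensor_group (V \<inter> U) M N) F S"] by simp
qed
qed

lemma tau_bij: "bij_betw \<tau> (carrier T) (carrier FT)"
proof (rule bij_betwI')
  fix C D assume "C \<in> carrier T" "D \<in> carrier T"
  then obtain c d where "C = cls c" "D = cls d" "c \<in> carrier G" "d \<in> carrier G" by auto
  then show "\<tau> C = \<tau> D \<longleftrightarrow> C = D" by (metis tau_cls cls_eqI)
next
  fix C assume "C \<in> carrier T"
  then obtain c where "C = cls c" "c \<in> carrier G" by auto
  then show "\<tau> C \<in> carrier FT" using theta_FT by (simp add: tau_cls del: fmod_simps)
next
  fix w assume w: "w \<in> carrier FT"
  then have "kap w \<in> carrier G" by (intro kap_G) simp
  then show "\<exists>C\<in>carrier T. w = \<tau> C"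
    using theta_kap[OF w] by (intro bexI[of _ "cls (kap w)"]) (simp_all add: tau_cls)
qed

end

text \<open>\<open>tensor_map\<close> picks the only element of the image of a coset. Here
  \<open>H\<close> is f \<otimes> g written in coordinates: as it is additive and correct on pure
  tensors, all representatives of a class have images with equal coordinates, hence in a single
  class.\<close>

lemma tensor_map_cls:
  assumes 1: "tensor_coords V U M N \<alpha> \<beta> Bx By \<delta>x \<delta>y q" and 2: "tensor_coords V U M' N' \<alpha>' \<beta>' Bx' By' \<delta>x' \<delta>y' q"
    and f: "\<And>x. x \<in> carrier M \<Longrightarrow> f x \<in> carrier M'" and g: "\<And>y. y \<in> carrier N \<Longrightarrow> g y \<in> carrier N'"
    and H: "\<And>u v. H (u + v) = H u + H v"
      "\<And>x y. x \<in> carrier M \<Longrightarrow> y \<in> carrier N \<Longrightarrow> outer q (\<alpha>' (f x)) (\<beta>' (g y)) = H (outer q (\<alpha> x) (\<beta> y))"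
    and C: "C \<in> carrier (tensor_module V U M N)"
  shows "tensor_map (V \<inter> U) M' N' f g C \<in> carrier (tensor_module V U M' N') \<and>
    tau q \<alpha>' \<beta>' (tensor_map (V \<inter> U) M' N' f g C) = H (tau q \<alpha> \<beta> C)"
proof -
  interpret A: tensor_coords V U M N \<alpha> \<beta> Bx By \<delta>x \<delta>y q by (rule 1)
  interpret B: tensor_coords V U M' N' \<alpha>' \<beta>' Bx' By' \<delta>x' \<delta>y' q by (rule 2)
  let ?e = "frag_extend (\<lambda>(x, y). frag_of (f x, g y))"
  have "H 0 = 0" using H(1)[of 0 0] by simp
  have Hm: "H (- u) = - H u" for u using H(1)[of "- u" u] \<open>H 0 = 0\<close> by (simp add: eq_neg_iff_add_eq_0)
  then have Hd: "H (u - v) = H u - H v" for u v using H(1)[of u "- v"] by simp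
  have *: "?e c \<in> carrier B.G \<and> B.\<theta> (?e c) = H (A.\<theta> c)" if "c \<in> carrier A.G" for c
    using that
  proof (induction rule: A.G_induct)
    case zero
    show ?case using \<open>H 0 = 0\<close> B.G_closed(2) by (simp add: zero_fun_def)
  next
    case (diff c d)
    then show ?case
      using B.G_closed(4)[of "?e c" "?e d"] by (simp only: frag_extend_diff theta_diff Hd simp_thms)
  next
    case (frag x y)
    then show ?case by (simp add: theta_frag_of H(2) B.G_closed f g)
  qed
  obtain c where c: "C = A.cls c" "c \<in> carrier A.G" using C by auto
  have "(\<lambda>c. B.cls (?e c)) ` C = {B.cls (?e c)}"
  proof
    show "(\<lambda>c. B.cls (?e c)) ` C \<subseteq> {B.cls (?e c)}"
    proof clarify
      fix d assume "d \<in> C"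
      then have "d \<in> carrier A.G \<and> A.\<theta> d = A.\<theta> c" using A.mem_cls[OF c(2)] c(1) by blast
      then have "B.cls (?e d) = B.cls (?e c)" using * c(2) by (intro B.cls_eqI) auto
      then show "B.cls (?e d) = B.cls (?e c)" .
    qed
    show "{B.cls (?e c)} \<subseteq> (\<lambda>c. B.cls (?e c)) ` C"
      using A.self_mem_cls[of c] by (simp add: c(1))
  qed
  then have "tensor_map (V \<inter> U) M' N' f g C = B.cls (?e c)"
    unfolding tensor_map_def by simp
  then show ?thesis using *[OF c(2)] by (simp add: B.tau_cls c A.tau_cls)
qed

context tensor_coords
begin

text \<open>Each term of \<open>p\<close> acts through a left and a right factor; in coordinates the
  two parts multiply back to the term.\<close>

lemma tau_smult:
  assumes p: "p \<in> pols (V \<union> U)" and C: "C \<in> carrier T"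
  shows "p \<odot>\<^bsub>T\<^esub> C \<in> carrier T \<and> \<tau> (p \<odot>\<^bsub>T\<^esub> C) = (\<lambda>z. p * \<tau> C z)"
proof -
  define F where "F a = tensor_map (V \<inter> U) M N
    (\<lambda>x. single (mono_restrict V a) (lookup p a) \<odot>\<^bsub>M\<^esub> x)
    (\<lambda>y. single (mono_restrict (- V) a) 1 \<odot>\<^bsub>N\<^esub> y) C" for a
  have F: "F a \<in> carrier T \<and> \<tau> (F a) = (\<lambda>z. single a (lookup p a) * \<tau> C z)"
    if "a \<in> keys p" for a
  proof -
    have "keys a \<subseteq> V \<union> U" using p that by (auto simp: pols_def)
    then have k: "single (mono_restrict V a) c \<in> pols V" "single (mono_restrict (- V) a) c \<in> pols U" for c
      by (auto simp: pols_iff_single keys_mono_restrict)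
    have s: "single a c = single (mono_restrict V a) c * single (mono_restrict (- V) a) 1" for c :: rat
      by (simp add: mult_single mono_restrict_split)
    show ?thesis
      unfolding F_def
      by (rule tensor_map_cls[OF tensor_coords_axioms tensor_coords_axioms,
            where H = "\<lambda>u z. single a (lookup p a) * u z"])
        (use C in \<open>simp_all add: k misoD[OF \<alpha>] misoD[OF \<beta>] fun_eq_iff distrib_left distrib_right s outer_def ac_simps\<close>)
  qed
  have eq: "p \<odot>\<^bsub>T\<^esub> C = finprod (tensor_group (V \<inter> U) M N) F (keys p)"
    by (simp add: tensor_module_def Let_def F_def[abs_def])
  have fp: "finprod (tensor_group (V \<inter> U) M N) F (keys p) \<in> carrier T \<and>
    \<tau> (finprod (tensor_group (V \<inter> U) M N) F (keys p)) = (\<Sum>a\<in>keys p. \<tau> (F a))"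
    by (rule tau_finprod) (use F in auto)
  have "(\<Sum>a\<in>keys p. \<tau> (F a)) = (\<Sum>a\<in>keys p. (\<lambda>z. single a (lookup p a) * \<tau> C z))"
    by (intro sum.cong) (use F in auto)
  also have "\<dots> = (\<lambda>z. p * \<tau> C z)"
  proof
    fix z
    have "p * \<tau> C z = (\<Sum>a\<in>keys p. single a (lookup p a)) * \<tau> C z"
      by (simp flip: mpol_expand)
    then show "(\<Sum>a\<in>keys p. (\<lambda>z. single a (lookup p a) * \<tau> C z)) z = p * \<tau> C z"
      by (simp add: sum_fun_apply sum_distrib_right)
  qed
  finally show ?thesis using fp by (simp only: eq)
qed

lemma theta_hom_degree:
  assumes "x \<in> deg_part M i" "y \<in> deg_part N j"
  shows "\<theta> (frag_of (x, y)) \<in> deg_part FT (i + j)"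
proof -
  have x: "\<alpha> x \<in> deg_part (fmod V Bx \<delta>x) i" "x \<in> carrier M" and y: "\<beta> y \<in> deg_part (fmod U By \<delta>y) j" "y \<in> carrier N"
    using assms by (simp_all add: misoD(9)[OF \<alpha>] misoD(9)[OF \<beta>] del: fmod_simps)
  have "homogeneous (i + j - \<delta> zs) (outer q (\<alpha> x) (\<beta> y) zs)" for zs
    unfolding outer_def
    by (rule homogeneous_mult_eq[of "i - \<delta>x (drop q zs)" _ "j - \<delta>y (take q zs)"]) (use x y in auto)
  then show ?thesis
    using theta_FT[OF G_closed(5)[OF x(2) y(2)]] by (simp add: theta_frag_of)
qed

text \<open>The degree part is given by generators. That it is large enough follows from the normal
  form, which writes an element with homogeneous coordinates as a sum of pure tensors of homogeneous
  elements.\<close>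

lemma deg_part_T: "deg_part T k = {C \<in> carrier T. \<tau> C \<in> deg_part FT k}"
proof -
  define S where "S = {pure_tensor (V \<inter> U) M N x y | i j x y. x \<in> deg_part M i \<and> y \<in> deg_part N j \<and> i + j = k}"
  let ?T = "tensor_group (V \<inter> U) M N"
  interpret T: comm_group ?T by (rule comm_group_T)
  have S: "s \<in> carrier T \<and> \<tau> s \<in> deg_part FT k" if s: "s \<in> S" for s
  proof -
    obtain i j x y where *: "s = cls (frag_of (x, y))" "x \<in> deg_part M i" "y \<in> deg_part N j" "i + j = k"
      using s unfolding S_def pure_tensor_def by blast
    then have "x \<in> carrier M" "y \<in> carrier N" by (simp_all add: misoD(9)[OF \<alpha>] misoD(9)[OF \<beta>])
    then show ?thesis
      using theta_hom_degree[OF *(2,3)] * G_closed(5)[of x y] by (simp add: tau_cls del: fmod_simps)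
  qed
  have dp: "deg_part T k = generate ?T S"
    by (simp add: tensor_module_def Let_def S_def)
  have "C \<in> carrier T \<and> \<tau> C \<in> deg_part FT k" if "C \<in> generate ?T S" for C
    using that
  proof (induction rule: generate.induct)
    case one
    have "K \<in> cls ` carrier G" "\<tau> K = 0"
      using tau_cls[of 0] G_closed(2) by (auto simp: cls_0 intro!: image_eqI[of _ _ 0])
    then show ?case by simp
  next
    case (incl h)
    then show ?case by (rule S)
  next
    case (inv h)
    then have h: "h \<in> carrier T" "\<tau> h \<in> deg_part FT k" using S by auto
    then have i: "inv\<^bsub>?T\<^esub> h \<in> carrier T"
      using T.inv_closed[of h] by (simp only: tensor_group_simps T_simps)
    have "K = inv\<^bsub>?T\<^esub> h \<oplus>\<^bsub>T\<^esub> h" using h T.l_inv[of h] by simp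
    moreover have "\<tau> K = 0" using tau_cls[of 0] G_closed(2) by (simp add: cls_0)
    ultimately have "\<tau> (inv\<^bsub>?T\<^esub> h) + \<tau> h = 0" using tau_add[OF i h(1)] by simp
    then have "\<tau> (inv\<^bsub>?T\<^esub> h) = - \<tau> h" by (simp add: eq_neg_iff_add_eq_0)
    then show ?case using i h(2) by (auto intro: pols_uminus homogeneous_uminus)
  next
    case (eng h1 h2)
    have "\<tau> h1 z + \<tau> h2 z \<noteq> 0 \<Longrightarrow> \<tau> h1 z \<noteq> 0 \<or> \<tau> h2 z \<noteq> 0" for z by auto
    then show ?case using eng.IH tau_add[of h1 h2]
      by (simp add: pols_add homogeneous_add) blast
  qed
  moreover have "C \<in> generate ?T S" if C: "C \<in> carrier T" "\<tau> C \<in> deg_part FT k" for C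
  proof -
    define w where "w = \<tau> C"
    have w: "w \<in> carrier FT" using C(2) by (auto simp: w_def)
    have wp: "\<And>zs. w zs \<in> pols (V \<union> U)" using w by simp
    obtain c where c: "C = cls c" "c \<in> carrier G" using C by auto
    have "\<theta> c = \<theta> (kap w)"
      using c theta_kap[OF w] tau_cls[OF c(2)] by (simp add: w_def)
    then have "C = cls (kap w)"
      unfolding c(1) by (rule cls_eqI[OF c(2) kap_G[OF wp]])
    moreover have "kap w \<in> carrier G \<and> cls (kap w) \<in> generate ?T S"
      unfolding kap_def kapp_def
    proof (rule sum_closed[where P = "\<lambda>c. c \<in> carrier G \<and> cls c \<in> generate ?T S"])
      show 0: "0 \<in> carrier G \<and> cls 0 \<in> generate ?T S"
        using generate.one[of ?T S] by (simp add: cls_0 G_closed)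
      show add: "c + d \<in> carrier G \<and> cls (c + d) \<in> generate ?T S"
        if "c \<in> carrier G \<and> cls c \<in> generate ?T S" "d \<in> carrier G \<and> cls d \<in> generate ?T S" for c d
        using that generate.eng[of "cls c" ?T S "cls d"] by (simp add: G_closed cls_add)
      fix zs assume zs: "zs \<in> Bxy"
      show "(\<Sum>a\<in>keys (w zs). kap1 zs a (lookup (w zs) a)) \<in> carrier G \<and>
        cls (\<Sum>a\<in>keys (w zs). kap1 zs a (lookup (w zs) a)) \<in> generate ?T S"
      proof (rule sum_closed[where P = "\<lambda>c. c \<in> carrier G \<and> cls c \<in> generate ?T S"])
        fix a assume a: "a \<in> keys (w zs)"
        then have k: "keys a \<subseteq> V \<union> U" using wp[of zs] by (auto simp: pols_def)
        have "homogeneous (k - \<delta> zs) (w zs)" using C(2) by (simp add: w_def)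
        then have "mono_deg a = k - \<delta> zs" using a by (simp add: homogeneous_def)
        then have deg: "(mono_deg (mono_restrict V a) + \<delta>x (drop q zs)) + (mono_deg (mono_restrict (- V) a) + \<delta>y (take q zs)) = k"
          using mono_deg_add[of "mono_restrict V a" "mono_restrict (- V) a"] by (simp add: mono_restrict_split)
        let ?u = "sgl (drop q zs) (single (mono_restrict V a) (lookup (w zs) a))"
        let ?v = "sgl (take q zs) (single (mono_restrict (- V) a) 1)"
        have uv: "?u \<in> FM" "?v \<in> FN" by (rule kap1_args[OF zs k])+
        have "?u \<in> deg_part (fmod V Bx \<delta>x) (mono_deg (mono_restrict V a) + \<delta>x (drop q zs))"
          using uv(1) by (auto simp: sgl_def homogeneous_single)
        then have u: "a' ?u \<in> deg_part M (mono_deg (mono_restrict V a) + \<delta>x (drop q zs))"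
          using uv by (simp add: misoD(9,11,12)[OF \<alpha>] del: fmod_simps)
        have "?v \<in> deg_part (fmod U By \<delta>y) (mono_deg (mono_restrict (- V) a) + \<delta>y (take q zs))"
          using uv(2) by (auto simp: sgl_def homogeneous_single)
        then have v: "b' ?v \<in> deg_part N (mono_deg (mono_restrict (- V) a) + \<delta>y (take q zs))"
          using uv by (simp add: misoD(9,11,12)[OF \<beta>] del: fmod_simps)
        have "cls (kap1 zs a (lookup (w zs) a)) \<in> S"
          unfolding S_def kap1_def pure_tensor_def using u v deg by blast
        then show "kap1 zs a (lookup (w zs) a) \<in> carrier G \<and>
            cls (kap1 zs a (lookup (w zs) a)) \<in> generate ?T S"
          by (intro conjI kap1_G zs k generate.incl)
      qed (rule 0, erule (1) add)
    qed
    ultimately show ?thesis by simp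
  qed
  ultimately show ?thesis unfolding dp by blast
qed

theorem miso_tensor: "miso (V \<union> U) T FT \<tau>"
  unfolding miso_def
proof (intro conjI ballI allI)
  have K: "K \<in> cls ` carrier G" "\<tau> K = 0"
    using tau_cls[of 0] G_closed(2) by (auto simp: cls_0 intro!: image_eqI[of _ _ 0])
  then show "\<zero>\<^bsub>T\<^esub> \<in> carrier T" "\<tau> \<zero>\<^bsub>T\<^esub> = \<zero>\<^bsub>FT\<^esub>" by simp_all
qed (use tau_bij tau_add tau_smult deg_part_T in \<open>auto simp del: T_simps\<close>)

end

subsection \<open>Factorizations in coordinates\<close>

definition fiso :: "'a factorization \<Rightarrow> 'b factorization \<Rightarrow> (bool \<Rightarrow> 'a \<Rightarrow> 'b) \<Rightarrow> bool" where
  "fiso M N \<phi> \<longleftrightarrow> ring_vars M = ring_vars N \<and>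
     (\<forall>i. miso (ring_vars M) (component M i) (component N i) (\<phi> i)) \<and>
     (\<forall>i. \<forall>x\<in>carrier (component M i). differential M i x \<in> carrier (component M (\<not> i)) \<and>
        \<phi> (\<not> i) (differential M i x) = differential N i (\<phi> i x))"

definition BL :: "nat \<Rightarrow> bool \<Rightarrow> bool list set" where
  "BL l i = {xs. length xs = l \<and> odd (cnt xs) = i}"

definition kosz :: "nat \<Rightarrow> nat set \<Rightarrow> int \<Rightarrow> kpairs \<Rightarrow> (bool list \<Rightarrow> mpol) factorization" where
  "kosz n V m ps = \<lparr>ring_vars = V, component = (\<lambda>i. fmod V (BL (length ps) i) (\<lambda>xs. m + dl n ps xs)),
     differential = (\<lambda>i. kd ps)\<rparr>"

lemma kosz_simps [simp]:
  "ring_vars (kosz n V m ps) = V"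
  "component (kosz n V m ps) i = fmod V (BL (length ps) i) (\<lambda>xs. m + dl n ps xs)"
  "differential (kosz n V m ps) i = kd ps"
  by (simp_all add: kosz_def)

lemma finite_BL: "finite (BL l i)"
  by (rule finite_subset[OF _ finite_lists_length_eq[of "UNIV :: bool set" l]]) (auto simp: BL_def)

lemma miso_deg_cong:
  assumes "miso V M (fmod V B \<delta>) \<phi>" "\<And>z. z \<in> B \<Longrightarrow> \<delta> z = \<delta>' z"
  shows "miso V M (fmod V B \<delta>') \<phi>"
proof -
  have "homogeneous (k - \<delta> z) (v z) \<longleftrightarrow> homogeneous (k - \<delta>' z) (v z)" if "v z \<noteq> 0 \<longrightarrow> z \<in> B" for v z k
    using that assms(2) by (cases "v z = 0") auto
  then have "v \<in> deg_part (fmod V B \<delta>) k \<longleftrightarrow> v \<in> deg_part (fmod V B \<delta>') k" for v k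
    unfolding fmod_simps by blast
  then show ?thesis
    using assms(1) unfolding miso_def by (auto simp: fmod_def)
qed

lemma sum_module_simps [simp]:
  "carrier (sum_module M N) = carrier M \<times> carrier N" "\<zero>\<^bsub>sum_module M N\<^esub> = (\<zero>\<^bsub>M\<^esub>, \<zero>\<^bsub>N\<^esub>)"
  "(x, y) \<oplus>\<^bsub>sum_module M N\<^esub> (x', y') = (x \<oplus>\<^bsub>M\<^esub> x', y \<oplus>\<^bsub>N\<^esub> y')"
  "p \<odot>\<^bsub>sum_module M N\<^esub> (x, y) = (p \<odot>\<^bsub>M\<^esub> x, p \<odot>\<^bsub>N\<^esub> y)"
  "deg_part (sum_module M N) k = deg_part M k \<times> deg_part N k"
  by (simp_all add: sum_module_def)

text \<open>A direct sum over disjoint index sets is realized by adding functions instead of pairing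
  them. In this way the two summands of a component of a tensor product become one function on lists
  of fixed parity.\<close>

lemma miso_sum_fmod:
  assumes 1: "miso V M (fmod V B \<delta>) \<phi>" and 2: "miso V N (fmod V C \<delta>) \<psi>" and BC: "B \<inter> C = {}"
  shows "miso V (sum_module M N) (fmod V (B \<union> C) \<delta>) (\<lambda>(x, y). \<phi> x + \<psi> y)"
  unfolding miso_def
proof (intro conjI ballI allI)
  have \<phi>: "\<phi> x z = 0" if "x \<in> carrier M" "z \<notin> B" for x z
    using misoD(4)[OF 1 that(1)] that(2) by auto
  have \<psi>: "\<psi> y z = 0" if "y \<in> carrier N" "z \<notin> C" for y z
    using misoD(4)[OF 2 that(1)] that(2) by auto
  have L: "(\<phi> x + \<psi> y) z = (if z \<in> B then \<phi> x z else \<psi> y z)" if "x \<in> carrier M" "y \<in> carrier N" for x y z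
    using \<phi>[OF that(1)] \<psi>[OF that(2)] BC by auto
  have c\<phi>: "\<phi> x z \<in> pols V" if "x \<in> carrier M" for x z
    using misoD(4)[OF 1 that] by simp
  have c\<psi>: "\<psi> y z \<in> pols V" if "y \<in> carrier N" for y z
    using misoD(4)[OF 2 that] by simp
  show "bij_betw (\<lambda>(x, y). \<phi> x + \<psi> y) (carrier (sum_module M N)) (carrier (fmod V (B \<union> C) \<delta>))"
  proof (rule bij_betwI')
    fix u v assume "u \<in> carrier (sum_module M N)" "v \<in> carrier (sum_module M N)"
    then obtain x y x' y' where uv: "u = (x, y)" "v = (x', y')" "x \<in> carrier M" "y \<in> carrier N" "x' \<in> carrier M" "y' \<in> carrier N"
      by auto
    have "x = x' \<and> y = y'" if eq: "\<phi> x + \<psi> y = \<phi> x' + \<psi> y'"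
    proof
      have *: "(if z \<in> B then \<phi> x z else \<psi> y z) = (if z \<in> B then \<phi> x' z else \<psi> y' z)" for z
        unfolding L[OF uv(3,4), symmetric] L[OF uv(5,6), symmetric] eq ..
      have "\<phi> x z = \<phi> x' z" for z
        using *[of z] \<phi>[OF uv(3), of z] \<phi>[OF uv(5), of z] by (cases "z \<in> B") simp_all
      then show "x = x'" by (intro misoD(10)[OF 1]) (auto simp: uv)
      have "\<psi> y z = \<psi> y' z" for z
      proof (cases "z \<in> B")
        case True
        then have "z \<notin> C" using BC by blast
        then show ?thesis using \<psi>[OF uv(4)] \<psi>[OF uv(6)] by simp
      next
        case False
        then show ?thesis using *[of z] by simp
      qed
      then show "y = y'" by (intro misoD(10)[OF 2]) (auto simp: uv)
    qed
    then show "(case u of (x, y) \<Rightarrow> \<phi> x + \<psi> y) = (case v of (x, y) \<Rightarrow> \<phi> x + \<psi> y) \<longleftrightarrow> u = v"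
      by (auto simp: uv)
  next
    fix u assume "u \<in> carrier (sum_module M N)"
    then obtain x y where u: "u = (x, y)" "x \<in> carrier M" "y \<in> carrier N" by auto
    have "(\<phi> x + \<psi> y) z \<in> pols V \<and> ((\<phi> x + \<psi> y) z \<noteq> 0 \<longrightarrow> z \<in> B \<union> C)" for z
      unfolding L[OF u(2,3)] using c\<phi>[OF u(2)] c\<psi>[OF u(3)] \<psi>[OF u(3), of z] by auto
    then show "(case u of (x, y) \<Rightarrow> \<phi> x + \<psi> y) \<in> carrier (fmod V (B \<union> C) \<delta>)"
      unfolding u(1) fmod_simps prod.case by blast
  next
    fix w assume w: "w \<in> carrier (fmod V (B \<union> C) \<delta>)"
    define u where "u = (\<lambda>z. if z \<in> B then w z else 0)"
    define v where "v = (\<lambda>z. if z \<in> C then w z else 0)"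
    have uv: "u \<in> carrier (fmod V B \<delta>)" "v \<in> carrier (fmod V C \<delta>)" using w by (auto simp: u_def v_def)
    have "w = u + v" using w BC by (auto simp: u_def v_def fun_eq_iff)
    then show "\<exists>x\<in>carrier (sum_module M N). w = (case x of (x, y) \<Rightarrow> \<phi> x + \<psi> y)"
      using uv by (intro bexI[of _ "(inv_into (carrier M) \<phi> u, inv_into (carrier N) \<psi> v)"])
        (simp_all add: misoD[OF 1] misoD[OF 2] del: fmod_simps)
  qed
  show "deg_part (sum_module M N) k = {x \<in> carrier (sum_module M N). (case x of (x, y) \<Rightarrow> \<phi> x + \<psi> y) \<in> deg_part (fmod V (B \<union> C) \<delta>) k}" for k
  proof -
    have "x \<in> deg_part M k \<and> y \<in> deg_part N k \<longleftrightarrow> \<phi> x + \<psi> y \<in> deg_part (fmod V (B \<union> C) \<delta>) k"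
      if "x \<in> carrier M" "y \<in> carrier N" for x y
    proof -
      have "\<phi> x + \<psi> y \<in> deg_part (fmod V (B \<union> C) \<delta>) k \<longleftrightarrow>
          (\<forall>z. homogeneous (k - \<delta> z) (if z \<in> B then \<phi> x z else \<psi> y z))"
      proof -
        have "(if z \<in> B then \<phi> x z else \<psi> y z) \<in> pols V \<and> ((if z \<in> B then \<phi> x z else \<psi> y z) \<noteq> 0 \<longrightarrow> z \<in> B \<union> C)" for z
          using c\<phi>[OF that(1)] c\<psi>[OF that(2)] \<psi>[OF that(2), of z] by auto
        then show ?thesis unfolding fmod_simps L[OF that] by blast
      qed
      also have "\<dots> \<longleftrightarrow> (\<forall>z. homogeneous (k - \<delta> z) (\<phi> x z)) \<and> (\<forall>z. homogeneous (k - \<delta> z) (\<psi> y z))"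
      proof -
        have "homogeneous (k - \<delta> z) (if z \<in> B then \<phi> x z else \<psi> y z) \<longleftrightarrow>
            homogeneous (k - \<delta> z) (\<phi> x z) \<and> homogeneous (k - \<delta> z) (\<psi> y z)" for z
        proof (cases "z \<in> B")
          case True
          then have "z \<notin> C" using BC by blast
          then show ?thesis using True \<psi>[OF that(2), of z] by simp
        next
          case False
          then show ?thesis using \<phi>[OF that(1), of z] by simp
        qed
        then show ?thesis by blast
      qed
      also have "\<dots> \<longleftrightarrow> x \<in> deg_part M k \<and> y \<in> deg_part N k"
        unfolding misoD(9)[OF 1] misoD(9)[OF 2] fmod_simps
        using that c\<phi> c\<psi> \<phi> \<psi> by blast
      finally show ?thesis by blast
    qed
    moreover have "deg_part M k \<subseteq> carrier M" "deg_part N k \<subseteq> carrier N"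
      by (auto simp: misoD(9)[OF 1] misoD(9)[OF 2])
    ultimately show ?thesis by (auto simp del: fmod_simps)
  qed
qed (auto simp: misoD[OF 1] misoD[OF 2] fun_eq_iff algebra_simps)

lemma outer_kd_right: "outer q u (kd qs v) zs = kd qs (\<lambda>ys. outer q u v (ys @ drop q zs)) (take q zs)"
proof -
  have "kd qs (\<lambda>ys. outer q u v (ys @ drop q zs)) (take q zs) = kd qs (\<lambda>ys. u (drop q zs) * v ys) (take q zs)"
    by (rule kd_cong) (cases "q \<le> length zs"; simp add: outer_def)
  then show ?thesis by (simp add: outer_def kd_scale)
qed

lemma kd_Nil_list: "kd ps v [] = 0"
  by (cases ps) auto

lemma outer_kd_left: "outer q (kd ps u) v zs = kd ps (\<lambda>xs. outer q u v (take q zs @ xs)) (drop q zs)"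
proof (cases "q \<le> length zs")
  case True
  then have "kd ps (\<lambda>xs. outer q u v (take q zs @ xs)) (drop q zs) = kd ps (\<lambda>xs. v (take q zs) * u xs) (drop q zs)"
    by (intro kd_cong) (simp add: outer_def)
  then show ?thesis by (simp add: outer_def kd_scale)
qed (simp add: outer_def kd_Nil_list)

lemma kd_support:
  assumes "\<And>xs. v xs \<noteq> 0 \<Longrightarrow> xs \<in> BL l i" "kd ps v zs \<noteq> 0" shows "zs \<in> BL l (\<not> i)"
proof (rule ccontr)
  assume z: "zs \<notin> BL l (\<not> i)"
  have "kd ps v zs = kd ps (\<lambda>_. 0) zs"
  proof (rule kd_cong)
    fix xs :: "bool list" assume "length xs = length zs" "odd (cnt xs) \<noteq> odd (cnt zs)"
    with z have "xs \<notin> BL l i" by (auto simp: BL_def)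
    then show "v xs = 0" using assms(1) by blast
  qed
  with assms(2) show False by simp
qed

text \<open>Tensor products concatenate the lists of pairs, the second factor in front, and add the
  shifts. Since \<open>M\<close> and \<open>N\<close> may be any factorizations with Koszul
  coordinates, the result can be iterated over all factors of a graph.\<close>

theorem fiso_tensor:
  assumes M: "fiso M (kosz n V m ps) \<phi>" and N: "fiso N (kosz n U m' qs) \<psi>"
  defines "q \<equiv> length qs"
  shows "fiso (M \<otimes>\<^sub>f N) (kosz n (V \<union> U) (m + m') (qs @ ps))
    (\<lambda>i (s, t). tau q (\<phi> False) (\<psi> i) s + tau q (\<phi> True) (\<psi> (\<not> i)) t)"
proof -
  define p where "p = length ps"
  define \<delta>x where "\<delta>x = (\<lambda>xs. m + dl n ps xs)"
  define \<delta>y where "\<delta>y = (\<lambda>ys. m' + dl n qs ys)"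
  define \<delta> where "\<delta> = (\<lambda>zs. m + m' + dl n (qs @ ps) zs)"
  have V: "ring_vars M = V" and U: "ring_vars N = U"
    using M N by (auto simp: fiso_def)
  have mM: "miso V (component M j) (fmod V (BL p j) \<delta>x) (\<phi> j)" for j
    using M V by (simp add: fiso_def p_def \<delta>x_def)
  have mN: "miso U (component N k) (fmod U (BL q k) \<delta>y) (\<psi> k)" for k
    using N U by (simp add: fiso_def q_def \<delta>y_def)
  have dM: "differential M j x \<in> carrier (component M (\<not> j))" "\<phi> (\<not> j) (differential M j x) = kd ps (\<phi> j x)"
    if "x \<in> carrier (component M j)" for j x
    using M that by (auto simp: fiso_def)
  have dN: "differential N k y \<in> carrier (component N (\<not> k))" "\<psi> (\<not> k) (differential N k y) = kd qs (\<psi> k y)"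
    if "y \<in> carrier (component N k)" for k y
    using N that by (auto simp: fiso_def)
  have tc: "tensor_coords V U (component M j) (component N k) (\<phi> j) (\<psi> k) (BL p j) (BL q k) \<delta>x \<delta>y q" for j k
    using mM mN finite_BL by unfold_locales (auto simp: BL_def)
  define T where "T j k = tensor_module V U (component M j) (component N k)" for j k
  define B where "B j k = {zs. take q zs \<in> BL q k \<and> drop q zs \<in> BL p j}" for j k
  let ?W = "V \<union> U"
  have mT0: "miso ?W (T j k) (fmod ?W (B j k) (\<lambda>zs. \<delta>x (drop q zs) + \<delta>y (take q zs))) (tau q (\<phi> j) (\<psi> k))" for j k
    using tensor_coords.miso_tensor[OF tc[of j k]] tensor_coords.Bxy_def[OF tc[of j k]]
    by (simp add: T_def B_def)
  have len: "zs \<in> B j k \<longleftrightarrow> length zs = p + q \<and> odd (cnt (drop q zs)) = j \<and> odd (cnt (take q zs)) = k" for zs j k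
    by (auto simp: B_def BL_def)
  have mT: "miso ?W (T j k) (fmod ?W (B j k) \<delta>) (tau q (\<phi> j) (\<psi> k))" for j k
  proof (rule miso_deg_cong[OF mT0])
    fix zs assume "zs \<in> B j k"
    then have "length (take q zs) = length qs" by (simp add: len q_def)
    then have "dl n (qs @ ps) (take q zs @ drop q zs) = dl n qs (take q zs) + dl n ps (drop q zs)"
      by (rule dl_append)
    then show "\<delta>x (drop q zs) + \<delta>y (take q zs) = \<delta> zs" by (simp add: \<delta>x_def \<delta>y_def \<delta>_def)
  qed
  have cnt: "cnt zs = cnt (take q zs) + cnt (drop q zs)" for zs
    using cnt_append[of "take q zs" "drop q zs"] by simp
  have BU: "B False i \<union> B True (\<not> i) = BL (length (qs @ ps)) i" for i
  proof (rule Set.set_eqI)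
    fix zs
    have "odd (cnt zs) \<longleftrightarrow> odd (cnt (take q zs)) \<noteq> odd (cnt (drop q zs))"
      by (subst cnt) auto
    then show "zs \<in> B False i \<union> B True (\<not> i) \<longleftrightarrow> zs \<in> BL (length (qs @ ps)) i"
      unfolding Un_iff len BL_def mem_Collect_eq length_append p_def q_def[symmetric] by (cases i) auto
  qed
  have BD: "B False i \<inter> B True (\<not> i) = {}" for i by (auto simp: len)
  have comp: "component (M \<otimes>\<^sub>f N) i = sum_module (T False i) (T True (\<not> i))" for i
    by (simp add: tensor_def Let_def T_def V U)
  \<comment> \<open>\<open>H1\<close> and \<open>H2\<close> are d \<otimes> 1 and 1 \<otimes> d in
    coordinates, without signs.\<close>
  define H1 where "H1 w = (\<lambda>zs. kd ps (\<lambda>xs. w (take q zs @ xs)) (drop q zs))" for w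
  define H2 where "H2 w = (\<lambda>zs. kd qs (\<lambda>ys. w (ys @ drop q zs)) (take q zs))" for w
  have H_add: "H1 (u + v) = H1 u + H1 v" "H2 (u + v) = H2 u + H2 v" for u v
    by (auto simp: H1_def H2_def fun_eq_iff kd_add)
  have outer_H: "outer q u (kd qs v) = H2 (outer q u v)" "outer q (kd ps u) v = H1 (outer q u v)" for u v
    by (auto simp: H1_def H2_def fun_eq_iff outer_kd_left outer_kd_right)
  have right: "tensor_map (V \<inter> U) (component M j) (component N (\<not> k)) id (differential N k) C \<in> carrier (T j (\<not> k)) \<and>
      tau q (\<phi> j) (\<psi> (\<not> k)) (tensor_map (V \<inter> U) (component M j) (component N (\<not> k)) id (differential N k) C) =
      H2 (tau q (\<phi> j) (\<psi> k) C)" if "C \<in> carrier (T j k)" for j k C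
    unfolding T_def
    by (rule tensor_map_cls[OF tc[of j k] tc[of j "\<not> k"], where H = H2])
      (use that in \<open>simp_all add: T_def H_add dN outer_H\<close>)
  have left: "tensor_map (V \<inter> U) (component M (\<not> j)) (component N k) (differential M j) id C \<in> carrier (T (\<not> j) k) \<and>
      tau q (\<phi> (\<not> j)) (\<psi> k) (tensor_map (V \<inter> U) (component M (\<not> j)) (component N k) (differential M j) id C) =
      H1 (tau q (\<phi> j) (\<psi> k) C)" if "C \<in> carrier (T j k)" for j k C
    unfolding T_def
    by (rule tensor_map_cls[OF tc[of j k] tc[of "\<not> j" k], where H = H1])
      (use that in \<open>simp_all add: T_def H_add dM outer_H\<close>)
  have diff: "differential (M \<otimes>\<^sub>f N) i (s, t) \<in> carrier (component (M \<otimes>\<^sub>f N) (\<not> i)) \<and>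
     (case differential (M \<otimes>\<^sub>f N) i (s, t) of (s, t) \<Rightarrow> tau q (\<phi> False) (\<psi> (\<not> i)) s + tau q (\<phi> True) (\<psi> (\<not> \<not> i)) t) =
     kd (qs @ ps) (tau q (\<phi> False) (\<psi> i) s + tau q (\<phi> True) (\<psi> (\<not> i)) t)"
    if s: "s \<in> carrier (T False i)" and t: "t \<in> carrier (T True (\<not> i))" for i s t
  proof -
    define s1 where "s1 = tensor_map (V \<inter> U) (component M False) (component N (\<not> i)) id (differential N i) s"
    define s2 where "s2 = tensor_map (V \<inter> U) (component M False) (component N (\<not> i)) (differential M True) id t"
    define t1 where "t1 = tensor_map (V \<inter> U) (component M True) (component N i) (differential M False) id s"
    define t2 where "t2 = tensor_map (V \<inter> U) (component M True) (component N i) id (differential N (\<not> i)) t"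
    define A where "A = tau q (\<phi> False) (\<psi> i) s"
    define C where "C = tau q (\<phi> True) (\<psi> (\<not> i)) t"
    have s1: "s1 \<in> carrier (T False (\<not> i))" "tau q (\<phi> False) (\<psi> (\<not> i)) s1 = H2 A"
      using right[OF s] by (auto simp: s1_def A_def)
    have s2: "s2 \<in> carrier (T False (\<not> i))" "tau q (\<phi> False) (\<psi> (\<not> i)) s2 = H1 C"
      using left[OF t] by (auto simp: s2_def C_def)
    have t1: "t1 \<in> carrier (T True i)" "tau q (\<phi> True) (\<psi> i) t1 = H1 A"
      using left[OF s] by (auto simp: t1_def A_def)
    have t2: "t2 \<in> carrier (T True i)" "tau q (\<phi> True) (\<psi> i) t2 = H2 C"
      using right[OF t] by (auto simp: t2_def C_def)
    have d: "differential (M \<otimes>\<^sub>f N) i (s, t) = (s1 \<oplus>\<^bsub>T False (\<not> i)\<^esub> s2, t1 \<ominus>\<^bsub>T True i\<^esub> t2)"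
      by (simp add: tensor_def Let_def V U T_def s1_def s2_def t1_def t2_def)
    note um = miso_uminus[OF mT t2(1)]
    have 1: "s1 \<oplus>\<^bsub>T False (\<not> i)\<^esub> s2 \<in> carrier (T False (\<not> i))" "t1 \<ominus>\<^bsub>T True i\<^esub> t2 \<in> carrier (T True i)"
      using s1 s2 t1 um unfolding a_minus_def by (auto intro!: misoD(5)[OF mT])
    have 2: "tau q (\<phi> False) (\<psi> (\<not> i)) (s1 \<oplus>\<^bsub>T False (\<not> i)\<^esub> s2) = H2 A + H1 C"
      using misoD(6)[OF mT s1(1) s2(1)] s1 s2 by simp
    have 3: "tau q (\<phi> True) (\<psi> i) (t1 \<ominus>\<^bsub>T True i\<^esub> t2) = H1 A + - H2 C"
      unfolding a_minus_def misoD(6)[OF mT t1(1) um(1)] um(2) t1(2) t2(2) by simp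
    have A: "A zs \<noteq> 0 \<Longrightarrow> zs \<in> B False i" for zs using misoD(4)[OF mT s] by (simp add: A_def)
    have C: "C zs \<noteq> 0 \<Longrightarrow> zs \<in> B True (\<not> i)" for zs using misoD(4)[OF mT t] by (simp add: C_def)
    \<comment> \<open>\<open>A\<close> is supported where the first factor is even and
      \<open>C\<close> where it is odd, so the sign in \<open>kd_append\<close> is + on
      \<open>H2 A\<close> and - on \<open>H2 C\<close>, as in the definition of the tensor
      differential. Indices shorter than \<open>q\<close> lie outside both supports.\<close>
    have "(H2 A + H1 C) + (H1 A + - H2 C) = kd (qs @ ps) (A + C)"
    proof
      fix zs
      have z1: "H2 A zs = 0" if "odd (cnt (drop q zs)) \<or> length zs < q"
      proof -
        have "H2 A zs = kd qs (\<lambda>_. 0) (take q zs)"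
          unfolding H2_def by (rule kd_cong) (use A that in \<open>force simp: len\<close>)
        then show ?thesis by simp
      qed
      have z2: "H2 C zs = 0" if "even (cnt (drop q zs)) \<or> length zs < q"
      proof -
        have "H2 C zs = kd qs (\<lambda>_. 0) (take q zs)"
          unfolding H2_def by (rule kd_cong) (use C that in \<open>force simp: len\<close>)
        then show ?thesis by simp
      qed
      show "((H2 A + H1 C) + (H1 A + - H2 C)) zs = kd (qs @ ps) (A + C) zs"
      proof (cases "q \<le> length zs")
        case True
        have "kd (qs @ ps) (A + C) (take q zs @ drop q zs) = H1 (A + C) zs + sg (drop q zs) * H2 (A + C) zs"
          using True by (subst kd_append) (auto simp: q_def H1_def H2_def)
        also have "\<dots> = H1 A zs + H1 C zs + sg (drop q zs) * (H2 A zs + H2 C zs)"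
          by (simp add: H_add)
        finally show ?thesis using z1 z2 by (auto simp: sg_def)
      next
        case False
        have "kd (qs @ ps) (A + C) zs = kd (qs @ ps) (\<lambda>_. 0) zs"
        proof (rule kd_cong)
          fix xs :: "bool list" assume "length xs = length zs"
          then have "xs \<notin> B False i" "xs \<notin> B True (\<not> i)" using False by (auto simp: len)
          then have "A xs = 0" "C xs = 0" using A C by blast+
          then show "(A + C) xs = 0" by simp
        qed
        moreover have "H1 w zs = 0" for w using False by (simp add: H1_def kd_Nil_list)
        ultimately show ?thesis using z1 z2 False by simp
      qed
    qed
    then show ?thesis using 1 by (simp add: d comp 2 3 A_def C_def)
  qed
  show ?thesis
    unfolding fiso_def
  proof (intro conjI allI ballI)
    show "ring_vars (M \<otimes>\<^sub>f N) = ring_vars (kosz n ?W (m + m') (qs @ ps))"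
      by (simp add: tensor_def Let_def V U)
    show "miso (ring_vars (M \<otimes>\<^sub>f N)) (component (M \<otimes>\<^sub>f N) i) (component (kosz n ?W (m + m') (qs @ ps)) i)
       (\<lambda>(s, t). tau q (\<phi> False) (\<psi> i) s + tau q (\<phi> True) (\<psi> (\<not> i)) t)" for i
      using miso_sum_fmod[OF mT mT BD, of i] unfolding BU comp
      by (simp add: \<delta>_def) (simp add: tensor_def Let_def V U)
  next
    fix i x assume "x \<in> carrier (component (M \<otimes>\<^sub>f N) i)"
    then obtain s t where x: "x = (s, t)" "s \<in> carrier (T False i)" "t \<in> carrier (T True (\<not> i))"
      by (auto simp: comp)
    show "differential (M \<otimes>\<^sub>f N) i x \<in> carrier (component (M \<otimes>\<^sub>f N) (\<not> i))"
      using diff[OF x(2,3)] x(1) by simp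
    show "(case differential (M \<otimes>\<^sub>f N) i x of (s, t) \<Rightarrow> tau q (\<phi> False) (\<psi> (\<not> i)) s + tau q (\<phi> True) (\<psi> (\<not> \<not> i)) t) =
      differential (kosz n ?W (m + m') (qs @ ps)) i (case x of (s, t) \<Rightarrow> tau q (\<phi> False) (\<psi> i) s + tau q (\<phi> True) (\<psi> (\<not> i)) t)"
      using diff[OF x(2,3)] x(1) by simp
  qed
qed

lemma fiso_koszul:
  "fiso (koszul n V k a b) (kosz n V 0 [(k, a, b)]) (\<lambda>i. sgl [i])" if "a \<in> pols V" "b \<in> pols V"
proof -
  have BL: "xs \<in> BL (length [(k, a, b)]) i \<longleftrightarrow> xs = [i]" for xs i
    by (cases xs) (auto simp: BL_def)
  have kdF: "kd [(k, a, b)] (sgl [False] x) = sgl [True] (a * x)" for x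
  proof
    fix zs show "kd [(k, a, b)] (sgl [False] x) zs = sgl [True] (a * x) zs"
    proof -
      consider "zs = []" | xs where "zs = False # xs" | xs where "zs = True # xs" by (metis list.exhaust)
      then show ?thesis by cases (auto simp: sgl_def)
    qed
  qed
  have kdT: "kd [(k, a, b)] (sgl [True] x) = sgl [False] (b * x)" for x
  proof
    fix zs show "kd [(k, a, b)] (sgl [True] x) zs = sgl [False] (b * x) zs"
    proof -
      consider "zs = []" | xs where "zs = False # xs" | xs where "zs = True # xs" by (metis list.exhaust)
      then show ?thesis by cases (auto simp: sgl_def)
    qed
  qed
  have c: "carrier (component (koszul n V k a b) i) = pols V" for i
    by (simp add: koszul_def shift_module_def free_rank1_def)
  have bij: "bij_betw (sgl [i]) (pols V) (carrier (fmod V (BL (length [(k, a, b)]) i) \<delta>))" for i \<delta>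
  proof (rule bij_betwI')
    show "sgl [i] p = sgl [i] r \<longleftrightarrow> p = r" for p r by (metis sgl_simps(1))
    show "p \<in> pols V \<Longrightarrow> sgl [i] p \<in> carrier (fmod V (BL (length [(k, a, b)]) i) \<delta>)" for p
      unfolding fmod_simps BL by (auto simp: sgl_def)
    show "\<exists>p\<in>pols V. v = sgl [i] p" if "v \<in> carrier (fmod V (BL (length [(k, a, b)]) i) \<delta>)" for v
      using that unfolding fmod_simps BL by (intro bexI[of _ "v [i]"]) (auto simp: sgl_def fun_eq_iff)
  qed
  show ?thesis
    unfolding fiso_def c
  proof (intro conjI allI ballI)
    show "ring_vars (koszul n V k a b) = ring_vars (kosz n V 0 [(k, a, b)])" by (simp add: koszul_def)
    show "miso (ring_vars (koszul n V k a b)) (component (koszul n V k a b) i) (component (kosz n V 0 [(k, a, b)]) i) (sgl [i])" for i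
      unfolding miso_def c
    proof (intro conjI ballI allI)
      show "bij_betw (sgl [i]) (pols V) (carrier (component (kosz n V 0 [(k, a, b)]) i))"
        unfolding kosz_simps by (rule bij)
      show "deg_part (component (koszul n V k a b) i) j =
          {x \<in> pols V. sgl [i] x \<in> deg_part (component (kosz n V 0 [(k, a, b)]) i) j}" for j
        unfolding kosz_simps fmod_simps BL
        by (auto simp: koszul_def shift_module_def free_rank1_def sgl_def)
    qed (auto simp: koszul_def shift_module_def free_rank1_def sgl_add intro: pols_intros, auto simp: sgl_def fun_eq_iff)
  next
    fix i x assume x: "x \<in> pols V"
    show "differential (koszul n V k a b) i x \<in> pols V"
      using x that by (auto simp: koszul_def intro: pols_mult)
    show "sgl [\<not> i] (differential (koszul n V k a b) i x) = differential (kosz n V 0 [(k, a, b)]) i (sgl [i] x)"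
      by (cases i) (simp_all add: koszul_def kdF kdT del: kd.simps)
  qed
qed

lemma fiso_shift: "fiso M (kosz n V m ps) \<phi> \<Longrightarrow> fiso (shift r M) (kosz n V (m + r) ps) \<phi>"
  unfolding fiso_def
proof (elim conjE, intro conjI allI)
  assume h: "\<forall>i. miso (ring_vars M) (component M i) (component (kosz n V m ps) i) (\<phi> i)"
  show "miso (ring_vars (shift r M)) (component (shift r M) i) (component (kosz n V (m + r) ps) i) (\<phi> i)" for i
    using h[rule_format, of i] unfolding miso_def
    by (simp add: shift_def shift_module_def fmod_def algebra_simps)
qed (simp_all add: shift_def shift_module_def)

lemma fiso_restrict:
  assumes "fiso M N \<phi>" "W \<subseteq> ring_vars M"
  shows "fiso (restrict_scalars W M) (restrict_scalars W N) \<phi>"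
  using assms pols_mono[OF assms(2)] unfolding fiso_def miso_def restrict_scalars_def by simp

lemma fiso_sum:
  assumes "fiso M M' \<phi>" "fiso N N' \<psi>" "ring_vars M = ring_vars N"
  shows "fiso (M \<oplus>\<^sub>f N) (M' \<oplus>\<^sub>f N') (\<lambda>i. map_prod (\<phi> i) (\<psi> i))"
  using assms unfolding fiso_def
  by (auto simp: direct_sum_def miso_def intro!: bij_betw_map_prod)

subsection \<open>Free graded modules\<close>

text \<open>The free module on an arbitrary set, with finite supports: after restriction of scalars
  the monomials in the internal variables make bases infinite.\<close>

definition fsmod :: "nat set \<Rightarrow> 'i set \<Rightarrow> ('i \<Rightarrow> int) \<Rightarrow> ('i \<Rightarrow> mpol) gmodule" where
  "fsmod V B \<delta> = \<lparr>carrier = {v. (\<forall>z. v z \<in> pols V \<and> (v z \<noteq> 0 \<longrightarrow> z \<in> B)) \<and> finite {z. v z \<noteq> 0}},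
     mult = undefined, one = undefined,
     ring.zero = 0, add = (+), smult = (\<lambda>p v z. p * v z),
     deg_part = (\<lambda>k. {v. (\<forall>z. v z \<in> pols V \<and> (v z \<noteq> 0 \<longrightarrow> z \<in> B)) \<and> finite {z. v z \<noteq> 0} \<and>
       (\<forall>z. homogeneous (k - \<delta> z) (v z))})\<rparr>"

lemma fsmod_carrierI:
  "(\<And>z. v z \<in> pols V \<and> (v z \<noteq> 0 \<longrightarrow> z \<in> B)) \<Longrightarrow> finite {z. v z \<noteq> 0} \<Longrightarrow> v \<in> carrier (fsmod V B \<delta>)"
  by (simp add: fsmod_def)

lemma fsmod_carrierD:
  assumes "v \<in> carrier (fsmod V B \<delta>)"
  shows "v z \<in> pols V" "v z \<noteq> 0 \<Longrightarrow> z \<in> B" "finite {z. v z \<noteq> 0}"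
  using assms by (auto simp: fsmod_def)

lemma cring_pol_ring: "cring (pol_ring V)"
proof (rule cringI)
  show "abelian_group (pol_ring V)"
  proof (rule abelian_groupI)
    fix x assume "x \<in> carrier (pol_ring V)"
    then show "\<exists>y\<in>carrier (pol_ring V). y \<oplus>\<^bsub>pol_ring V\<^esub> x = \<zero>\<^bsub>pol_ring V\<^esub>"
      by (intro bexI[of _ "- x"]) (auto simp: pol_ring_def pols_uminus)
  qed (auto simp: pol_ring_def pols_add algebra_simps)
  show "comm_monoid (pol_ring V)"
    by (rule comm_monoidI) (auto simp: pol_ring_def pols_mult algebra_simps)
qed (auto simp: pol_ring_def algebra_simps)

text \<open>Everything demanded of a free graded module is pulled back from the coordinate module:
  the module laws, the unique homogeneous decomposition and a homogeneous basis.\<close>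

locale coord_module =
  fixes V :: "nat set" and M :: "'m gmodule" and B :: "'i set" and \<delta> :: "'i \<Rightarrow> int" and \<phi> :: "'m \<Rightarrow> 'i \<Rightarrow> mpol"
  assumes m: "miso V M (fsmod V B \<delta>) \<phi>"
begin

lemma coord:
  "x \<in> carrier M \<Longrightarrow> \<phi> x z \<in> pols V" "x \<in> carrier M \<Longrightarrow> z \<notin> B \<Longrightarrow> \<phi> x z = 0"
  "x \<in> carrier M \<Longrightarrow> finite {z. \<phi> x z \<noteq> 0}"
  using misoD(4)[OF m] by (auto simp: fsmod_def)

lemma coord_ops:
  "\<phi> \<zero>\<^bsub>M\<^esub> z = 0"
  "x \<in> carrier M \<Longrightarrow> y \<in> carrier M \<Longrightarrow> \<phi> (x \<oplus>\<^bsub>M\<^esub> y) z = \<phi> x z + \<phi> y z"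
  "p \<in> pols V \<Longrightarrow> x \<in> carrier M \<Longrightarrow> \<phi> (p \<odot>\<^bsub>M\<^esub> x) z = p * \<phi> x z"
  using misoD(3,6,8)[OF m] by (simp_all add: fsmod_def)

lemma closed:
  "\<zero>\<^bsub>M\<^esub> \<in> carrier M" "x \<in> carrier M \<Longrightarrow> y \<in> carrier M \<Longrightarrow> x \<oplus>\<^bsub>M\<^esub> y \<in> carrier M"
  "p \<in> pols V \<Longrightarrow> x \<in> carrier M \<Longrightarrow> p \<odot>\<^bsub>M\<^esub> x \<in> carrier M"
  by (rule misoD[OF m]; assumption)+

lemma coord_eqI: "x \<in> carrier M \<Longrightarrow> y \<in> carrier M \<Longrightarrow> (\<And>z. \<phi> x z = \<phi> y z) \<Longrightarrow> x = y"
  by (rule misoD(10)[OF m]) auto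

lemma deg_part_iff: "x \<in> deg_part M k \<longleftrightarrow> x \<in> carrier M \<and> (\<forall>z. homogeneous (k - \<delta> z) (\<phi> x z))"
  using misoD(4)[OF m] unfolding misoD(9)[OF m] by (auto simp: fsmod_def)

definition of_coord :: "('i \<Rightarrow> mpol) \<Rightarrow> 'm" where
  "of_coord v = inv_into (carrier M) \<phi> v"

lemma of_coord:
  assumes "\<And>z. v z \<in> pols V" "\<And>z. z \<notin> B \<Longrightarrow> v z = 0" "finite {z. v z \<noteq> 0}"
  shows "of_coord v \<in> carrier M" "\<phi> (of_coord v) = v"
proof -
  have "v \<in> carrier (fsmod V B \<delta>)" using assms by (auto simp: fsmod_def)
  then show "of_coord v \<in> carrier M" "\<phi> (of_coord v) = v"
    unfolding of_coord_def by (rule misoD[OF m])+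
qed

lemma abelian_group: "abelian_group M"
proof (rule abelian_groupI)
  fix x y z assume xyz: "x \<in> carrier M" "y \<in> carrier M" "z \<in> carrier M"
  then show "x \<oplus>\<^bsub>M\<^esub> y \<in> carrier M" by (simp add: closed)
  show "x \<oplus>\<^bsub>M\<^esub> y \<oplus>\<^bsub>M\<^esub> z = x \<oplus>\<^bsub>M\<^esub> (y \<oplus>\<^bsub>M\<^esub> z)" "x \<oplus>\<^bsub>M\<^esub> y = y \<oplus>\<^bsub>M\<^esub> x" "\<zero>\<^bsub>M\<^esub> \<oplus>\<^bsub>M\<^esub> x = x"
    using xyz by (auto intro!: coord_eqI simp: closed coord_ops add_ac)
  have n: "of_coord (\<lambda>z. - \<phi> x z) \<in> carrier M" "\<phi> (of_coord (\<lambda>z. - \<phi> x z)) = (\<lambda>z. - \<phi> x z)"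
    using xyz coord[of x] by (auto intro!: of_coord pols_uminus)
  have "of_coord (\<lambda>z. - \<phi> x z) \<oplus>\<^bsub>M\<^esub> x = \<zero>\<^bsub>M\<^esub>"
    using xyz n by (intro coord_eqI) (simp_all add: closed coord_ops)
  then show "\<exists>y\<in>carrier M. y \<oplus>\<^bsub>M\<^esub> x = \<zero>\<^bsub>M\<^esub>" using n by blast
qed (rule closed)

lemma a_inv: "x \<in> carrier M \<Longrightarrow> \<ominus>\<^bsub>M\<^esub> x \<in> carrier M \<and> \<phi> (\<ominus>\<^bsub>M\<^esub> x) z = - \<phi> x z"
proof -
  assume x: "x \<in> carrier M"
  interpret M: abelian_group M by (rule abelian_group)
  have "\<phi> (\<ominus>\<^bsub>M\<^esub> x \<oplus>\<^bsub>M\<^esub> x) z = 0" using x by (simp only: M.l_neg coord_ops)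
  then show ?thesis using x by (simp add: coord_ops eq_neg_iff_add_eq_0)
qed

lemma module: "module (pol_ring V) M"
  by (rule moduleI[OF cring_pol_ring abelian_group])
    (auto simp: pol_ring_def closed intro!: coord_eqI simp: coord_ops pols_add pols_mult algebra_simps)

lemma finsum:
  assumes "finite A" "\<And>a. a \<in> A \<Longrightarrow> f a \<in> carrier M"
  shows "finsum M f A \<in> carrier M \<and> \<phi> (finsum M f A) z = (\<Sum>a\<in>A. \<phi> (f a) z)"
proof -
  interpret abelian_group M by (rule abelian_group)
  show ?thesis using assms
  proof (induction A rule: finite_induct)
    case (insert a A)
    then have "finsum M f (insert a A) = f a \<oplus>\<^bsub>M\<^esub> finsum M f A"
      by (intro finsum_insert) auto
    then show ?case using insert by (simp add: coord_ops)
  qed (simp add: coord_ops)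
qed

lemma sum_hpart_shift:
  assumes "finite K" "\<And>k. hpart (k - d) p \<noteq> 0 \<Longrightarrow> k \<in> K" shows "(\<Sum>k\<in>K. hpart (k - d) p) = p"
proof -
  have "(\<Sum>k\<in>K. hpart (k - d) p) = (\<Sum>k\<in>(\<lambda>k. k - d) ` K. hpart k p)"
    by (subst sum.reindex) (auto simp: inj_on_def)
  also have "\<dots> = p"
  proof (rule sum_hpart)
    show "{k. hpart k p \<noteq> 0} \<subseteq> (\<lambda>k. k - d) ` K"
    proof
      fix k assume "k \<in> {k. hpart k p \<noteq> 0}"
      then show "k \<in> (\<lambda>k. k - d) ` K" using assms(2)[of "k + d"] by (intro image_eqI[of _ _ "k + d"]) auto
    qed
  qed (use assms(1) in simp)
  finally show ?thesis .
qed

lemma graded_decomposition: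
  assumes x: "x \<in> carrier M"
  shows "\<exists>!c. (\<forall>k. c k \<in> deg_part M k) \<and> finite {k. c k \<noteq> \<zero>\<^bsub>M\<^esub>} \<and> x = finsum M c {k. c k \<noteq> \<zero>\<^bsub>M\<^esub>}"
proof (rule ex1I)
  define c where "c k = of_coord (\<lambda>z. hpart (k - \<delta> z) (\<phi> x z))" for k
  have "finite {z. hpart (k - \<delta> z) (\<phi> x z) \<noteq> 0}" for k
    by (rule finite_subset[OF _ coord(3)[OF x]]) auto
  then have c: "c k \<in> carrier M" "\<phi> (c k) = (\<lambda>z. hpart (k - \<delta> z) (\<phi> x z))" for k
    unfolding c_def using coord[OF x] by (auto intro!: of_coord hpart_pols)
  have nz: "c k \<noteq> \<zero>\<^bsub>M\<^esub> \<longleftrightarrow> (\<exists>z. hpart (k - \<delta> z) (\<phi> x z) \<noteq> 0)" for k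
    using coord_eqI[OF c(1)[of k] closed(1)] coord_ops(1) c(2)[of k] by metis
  have "{k. c k \<noteq> \<zero>\<^bsub>M\<^esub>} \<subseteq> (\<Union>z\<in>{z. \<phi> x z \<noteq> 0}. (\<lambda>k. k + \<delta> z) ` {k. hpart k (\<phi> x z) \<noteq> 0})"
  proof
    fix k assume "k \<in> {k. c k \<noteq> \<zero>\<^bsub>M\<^esub>}"
    then obtain z where z: "hpart (k - \<delta> z) (\<phi> x z) \<noteq> 0" by (auto simp: nz)
    then have "\<phi> x z \<noteq> 0" by auto
    with z show "k \<in> (\<Union>z\<in>{z. \<phi> x z \<noteq> 0}. (\<lambda>k. k + \<delta> z) ` {k. hpart k (\<phi> x z) \<noteq> 0})"
      by (intro UN_I[of z] image_eqI[of _ _ "k - \<delta> z"]) auto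
  qed
  then have fin: "finite {k. c k \<noteq> \<zero>\<^bsub>M\<^esub>}"
    by (rule finite_subset) (use coord(3)[OF x] finite_hpart in auto)
  have "x = finsum M c {k. c k \<noteq> \<zero>\<^bsub>M\<^esub>}"
  proof (rule coord_eqI[OF x])
    show "finsum M c {k. c k \<noteq> \<zero>\<^bsub>M\<^esub>} \<in> carrier M" using finsum[OF fin] c by blast
    fix z
    have "\<phi> (finsum M c {k. c k \<noteq> \<zero>\<^bsub>M\<^esub>}) z = (\<Sum>k\<in>{k. c k \<noteq> \<zero>\<^bsub>M\<^esub>}. hpart (k - \<delta> z) (\<phi> x z))"
      using finsum[OF fin, of c z] c by simp
    also have "\<dots> = \<phi> x z"
      by (rule sum_hpart_shift[OF fin]) (auto simp: nz)
    finally show "\<phi> x z = \<phi> (finsum M c {k. c k \<noteq> \<zero>\<^bsub>M\<^esub>}) z" ..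
  qed
  then show "(\<forall>k. c k \<in> deg_part M k) \<and> finite {k. c k \<noteq> \<zero>\<^bsub>M\<^esub>} \<and> x = finsum M c {k. c k \<noteq> \<zero>\<^bsub>M\<^esub>}"
    using fin c by (auto simp: deg_part_iff)
  fix c' assume c': "(\<forall>k. c' k \<in> deg_part M k) \<and> finite {k. c' k \<noteq> \<zero>\<^bsub>M\<^esub>} \<and> x = finsum M c' {k. c' k \<noteq> \<zero>\<^bsub>M\<^esub>}"
  let ?K = "{k. c' k \<noteq> \<zero>\<^bsub>M\<^esub>}"
  have cc: "c' k \<in> carrier M" "homogeneous (k - \<delta> z) (\<phi> (c' k) z)" for k z
    using c' by (simp_all add: deg_part_iff)
  have fK: "finite ?K" using c' by blast
  have xs: "\<phi> x z = (\<Sum>k\<in>?K. \<phi> (c' k) z)" for z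
    using finsum[OF fK, of c' z] c' cc by simp
  show "c' = c"
  proof
    fix j
    show "c' j = c j"
    proof (rule coord_eqI[OF cc(1) c(1)])
      fix z
      have "\<phi> (c j) z = (\<Sum>k\<in>?K. hpart (j - \<delta> z) (\<phi> (c' k) z))"
        by (simp add: c xs hpart_sum)
      also have "\<dots> = (\<Sum>k\<in>?K. if k = j then \<phi> (c' j) z else 0)"
        by (intro sum.cong refl) (auto simp: hpart_homogeneous[OF cc(2)])
      also have "\<dots> = \<phi> (c' j) z"
        using fK by (auto simp: sum.delta coord_ops)
      finally show "\<phi> (c' j) z = \<phi> (c j) z" ..
    qed
  qed
qed

lemma deg_part_subgroup: "subgroup (deg_part M k) (add_monoid M)"
proof -
  interpret abelian_group M by (rule abelian_group)
  show ?thesis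
  proof (rule add.subgroupI)
    show "deg_part M k \<subseteq> carrier M" by (auto simp: deg_part_iff)
    have "\<zero>\<^bsub>M\<^esub> \<in> deg_part M k" by (simp add: deg_part_iff coord_ops)
    then show "deg_part M k \<noteq> {}" by blast
    fix x y assume xy: "x \<in> deg_part M k" "y \<in> deg_part M k"
    then show "\<ominus>\<^bsub>M\<^esub> x \<in> deg_part M k"
      using a_inv[of x] by (auto simp: deg_part_iff homogeneous_uminus)
    show "x \<oplus>\<^bsub>M\<^esub> y \<in> deg_part M k"
      using xy by (auto simp: deg_part_iff coord_ops homogeneous_add)
  qed
qed

lemma smult_deg_part: "p \<in> pols V \<Longrightarrow> x \<in> deg_part M k \<Longrightarrow> homogeneous j p \<Longrightarrow> p \<odot>\<^bsub>M\<^esub> x \<in> deg_part M (j + k)"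
  unfolding deg_part_iff by (auto simp: closed coord_ops intro!: homogeneous_mult_eq)

lemma graded_module: "graded_module V M"
  unfolding graded_module_def
  using module deg_part_subgroup smult_deg_part graded_decomposition by blast

definition bas :: "'i \<Rightarrow> 'm" where "bas z = of_coord (sgl z 1)"

lemma bas: "z \<in> B \<Longrightarrow> bas z \<in> carrier M" "z \<in> B \<Longrightarrow> \<phi> (bas z) = sgl z 1" "z \<in> B \<Longrightarrow> bas z \<in> deg_part M (\<delta> z)"
proof -
  assume z: "z \<in> B"
  have "{y. sgl z 1 y \<noteq> 0} \<subseteq> {z}" by (auto simp: sgl_def)
  then have *: "finite {y. sgl z 1 y \<noteq> 0}" by (rule finite_subset) simp
  show "bas z \<in> carrier M" "\<phi> (bas z) = sgl z 1"
    unfolding bas_def using z * by (auto intro!: of_coord simp: sgl_def)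
  then show "bas z \<in> deg_part M (\<delta> z)" by (auto simp: deg_part_iff sgl_def)
qed

lemma inj_bas: "inj_on bas B"
  by (rule inj_onI) (metis bas(2) sgl_simps zero_neq_one)

lemma module_basis: "module_basis V M (bas ` B)"
  unfolding module_basis_def
proof (intro conjI ballI)
  show "bas ` B \<subseteq> carrier M" using bas by auto
  fix x assume x: "x \<in> carrier M"
  have val: "\<phi> (finsum M (\<lambda>b. c b \<odot>\<^bsub>M\<^esub> b) {b. c b \<noteq> 0}) z = (if z \<in> B then c (bas z) else 0)"
    "finsum M (\<lambda>b. c b \<odot>\<^bsub>M\<^esub> b) {b. c b \<noteq> 0} \<in> carrier M"
    if c: "c \<in> bas ` B \<rightarrow> pols V" "\<forall>b. b \<notin> bas ` B \<longrightarrow> c b = 0" "finite {b. c b \<noteq> 0}" for c z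
  proof -
    have b: "b \<in> {b. c b \<noteq> 0} \<Longrightarrow> b \<in> bas ` B \<and> c b \<in> pols V \<and> b \<in> carrier M" for b
    proof -
      have "bas ` B \<subseteq> carrier M" using bas(1) by auto
      then show "b \<in> {b. c b \<noteq> 0} \<Longrightarrow> b \<in> bas ` B \<and> c b \<in> pols V \<and> b \<in> carrier M"
        using c by blast
    qed
    have "\<phi> (finsum M (\<lambda>b. c b \<odot>\<^bsub>M\<^esub> b) {b. c b \<noteq> 0}) z = (\<Sum>b\<in>{b. c b \<noteq> 0}. \<phi> (c b \<odot>\<^bsub>M\<^esub> b) z)"
      using finsum[OF c(3), of "\<lambda>b. c b \<odot>\<^bsub>M\<^esub> b" z] b closed by blast
    also have "\<dots> = (\<Sum>b\<in>{b. c b \<noteq> 0}. if z \<in> B \<and> b = bas z then c b else 0)"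
    proof (rule sum.cong[OF refl])
      fix b assume "b \<in> {b. c b \<noteq> 0}"
      with b obtain y where y: "y \<in> B" "b = bas y" "c b \<in> pols V" "b \<in> carrier M" by blast
      then show "\<phi> (c b \<odot>\<^bsub>M\<^esub> b) z = (if z \<in> B \<and> b = bas z then c b else 0)"
        using inj_onD[OF inj_bas, of y z] by (auto simp: coord_ops bas(2) sgl_def)
    qed
    also have "\<dots> = (if z \<in> B then c (bas z) else 0)" using c(3) by auto
    finally show "\<phi> (finsum M (\<lambda>b. c b \<odot>\<^bsub>M\<^esub> b) {b. c b \<noteq> 0}) z = (if z \<in> B then c (bas z) else 0)" .
    show "finsum M (\<lambda>b. c b \<odot>\<^bsub>M\<^esub> b) {b. c b \<noteq> 0} \<in> carrier M"
      using finsum[OF c(3), of "\<lambda>b. c b \<odot>\<^bsub>M\<^esub> b"] b closed by blast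
  qed
  define c where "c b = (if b \<in> bas ` B then \<phi> x (inv_into B bas b) else 0)" for b
  have cb: "c (bas z) = \<phi> x z" if "z \<in> B" for z
    using that inj_bas by (auto simp: c_def)
  have c1: "c \<in> bas ` B \<rightarrow> pols V" "\<forall>b. b \<notin> bas ` B \<longrightarrow> c b = 0"
    using coord(1)[OF x] by (auto simp: c_def)
  have "{b. c b \<noteq> 0} \<subseteq> bas ` {z. \<phi> x z \<noteq> 0}"
  proof
    fix b assume b: "b \<in> {b. c b \<noteq> 0}"
    then obtain z where "z \<in> B" "b = bas z" using c1(2) by blast
    then show "b \<in> bas ` {z. \<phi> x z \<noteq> 0}" using b cb by auto
  qed
  then have c2: "finite {b. c b \<noteq> 0}" by (rule finite_subset) (use coord(3)[OF x] in simp)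
  note v = val[OF c1 c2]
  show "\<exists>!c. c \<in> bas ` B \<rightarrow> pols V \<and> (\<forall>b. b \<notin> bas ` B \<longrightarrow> c b = 0) \<and> finite {b. c b \<noteq> 0} \<and>
       x = finsum M (\<lambda>b. c b \<odot>\<^bsub>M\<^esub> b) {b. c b \<noteq> 0}"
  proof (rule ex1I[of _ c])
    have "x = finsum M (\<lambda>b. c b \<odot>\<^bsub>M\<^esub> b) {b. c b \<noteq> 0}"
      by (rule coord_eqI[OF x v(2)]) (use cb coord(2)[OF x] in \<open>auto simp: v(1)\<close>)
    then show "c \<in> bas ` B \<rightarrow> pols V \<and> (\<forall>b. b \<notin> bas ` B \<longrightarrow> c b = 0) \<and> finite {b. c b \<noteq> 0} \<and>
       x = finsum M (\<lambda>b. c b \<odot>\<^bsub>M\<^esub> b) {b. c b \<noteq> 0}" using c1 c2 by blast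
    fix c' assume c': "c' \<in> bas ` B \<rightarrow> pols V \<and> (\<forall>b. b \<notin> bas ` B \<longrightarrow> c' b = 0) \<and> finite {b. c' b \<noteq> 0} \<and>
       x = finsum M (\<lambda>b. c' b \<odot>\<^bsub>M\<^esub> b) {b. c' b \<noteq> 0}"
    have "c' (bas z) = \<phi> x z" if "z \<in> B" for z
      using val(1)[of c' z] c' that by metis
    note c'b = this
    show "c' = c"
    proof
      fix b
      show "c' b = c b"
      proof (cases "b \<in> bas ` B")
        case True
        then obtain z where "z \<in> B" "b = bas z" by blast
        then show ?thesis by (simp only: c'b cb)
      next
        case False
        then show ?thesis using c' c1(2) by simp
      qed
    qed
  qed
qed

lemma free_graded_module: "free_graded_module V M"
  unfolding free_graded_module_def
  using graded_module module_basis bas(3) by (intro conjI exI[of _ "bas ` B"]) auto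

lemma expand:
  assumes "x \<in> carrier M"
  shows "x = finsum M (\<lambda>z. \<phi> x z \<odot>\<^bsub>M\<^esub> bas z) {z. \<phi> x z \<noteq> 0}"
proof -
  have c: "z \<in> {z. \<phi> x z \<noteq> 0} \<Longrightarrow> z \<in> B \<and> \<phi> x z \<in> pols V \<and> bas z \<in> carrier M" for z
    using coord[OF assms] bas by blast
  then have *: "finsum M (\<lambda>z. \<phi> x z \<odot>\<^bsub>M\<^esub> bas z) {z. \<phi> x z \<noteq> 0} \<in> carrier M"
    "\<phi> (finsum M (\<lambda>z. \<phi> x z \<odot>\<^bsub>M\<^esub> bas z) {z. \<phi> x z \<noteq> 0}) y = (\<Sum>z\<in>{z. \<phi> x z \<noteq> 0}. \<phi> (\<phi> x z \<odot>\<^bsub>M\<^esub> bas z) y)" for y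
    using finsum[OF coord(3)[OF assms], of "\<lambda>z. \<phi> x z \<odot>\<^bsub>M\<^esub> bas z"] closed by blast+
  have "(\<Sum>z\<in>{z. \<phi> x z \<noteq> 0}. \<phi> (\<phi> x z \<odot>\<^bsub>M\<^esub> bas z) y) = (\<Sum>z\<in>{z. \<phi> x z \<noteq> 0}. if z = y then \<phi> x y else 0)" for y
    by (intro sum.cong refl) (use c in \<open>auto simp: coord_ops bas(2) sgl_def\<close>)
  also have "\<dots> y = \<phi> x y" for y using coord(3)[OF assms] by auto
  finally show ?thesis by (intro coord_eqI[OF assms *(1)]) (simp add: *(2))
qed

lemma span_induct:
  assumes "x \<in> carrier M" "P \<zero>\<^bsub>M\<^esub>"
    and "\<And>x y. x \<in> carrier M \<Longrightarrow> y \<in> carrier M \<Longrightarrow> P x \<Longrightarrow> P y \<Longrightarrow> P (x \<oplus>\<^bsub>M\<^esub> y)"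
    and "\<And>p z. p \<in> pols V \<Longrightarrow> z \<in> B \<Longrightarrow> P (p \<odot>\<^bsub>M\<^esub> bas z)"
  shows "P x"
proof -
  interpret abelian_group M by (rule abelian_group)
  have "P (finsum M (\<lambda>z. \<phi> x z \<odot>\<^bsub>M\<^esub> bas z) S)" if "finite S" "S \<subseteq> {z. \<phi> x z \<noteq> 0}" for S
    using that
  proof (induction S rule: finite_induct)
    case (insert z S)
    have c: "z \<in> {z. \<phi> x z \<noteq> 0} \<Longrightarrow> z \<in> B \<and> \<phi> x z \<in> pols V \<and> \<phi> x z \<odot>\<^bsub>M\<^esub> bas z \<in> carrier M" for z
      using coord[OF assms(1)] bas closed by blast
    have "finsum M (\<lambda>z. \<phi> x z \<odot>\<^bsub>M\<^esub> bas z) (insert z S) = (\<phi> x z \<odot>\<^bsub>M\<^esub> bas z) \<oplus>\<^bsub>M\<^esub> finsum M (\<lambda>z. \<phi> x z \<odot>\<^bsub>M\<^esub> bas z) S"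
      using insert c by (intro finsum_insert) auto
    moreover have "finsum M (\<lambda>z. \<phi> x z \<odot>\<^bsub>M\<^esub> bas z) S \<in> carrier M"
      using insert c by (intro finsum_closed) auto
    ultimately show ?case using insert c[of z] assms(3,4) by auto
  qed (use assms(2) in simp)
  from this[OF coord(3)[OF assms(1)] order_refl] show ?thesis
    using expand[OF assms(1)] by simp
qed

end

text \<open>Basis indices over the external variables: an exterior basis element together with a
  monomial in the internal variables. A fixed index type allows \<open>gfree\<close> to quantify
  over the basis.\<close>

type_synonym idx = "bool list \<times> mono"

definition gfree :: "nat set \<Rightarrow> 'm gmodule \<Rightarrow> bool" where
  "gfree V M \<longleftrightarrow> (\<exists>(B :: idx set) \<delta> \<phi>. miso V M (fsmod V B \<delta>) \<phi>)"

definition gfree_finite :: "nat set \<Rightarrow> 'm gmodule \<Rightarrow> bool" where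
  "gfree_finite V M \<longleftrightarrow> (\<exists>(B :: idx set) \<delta> \<phi>. finite B \<and> miso V M (fsmod V B \<delta>) \<phi>)"

lemma miso_trans:
  assumes "miso V M N \<phi>" "miso V N P \<psi>" shows "miso V M P (\<psi> \<circ> \<phi>)"
  using assms unfolding miso_def
  by (auto intro: bij_betw_trans bij_betw_apply simp: bij_betw_apply)

lemma gfree_free: "gfree V M \<Longrightarrow> free_graded_module V M"
  using coord_module.free_graded_module[OF coord_module.intro] by (auto simp: gfree_def)

lemma gfree_module: "gfree V M \<Longrightarrow> module (pol_ring V) M"
  using coord_module.module[OF coord_module.intro] by (auto simp: gfree_def)

lemma gfree_miso: "miso V M N \<phi> \<Longrightarrow> gfree V N \<Longrightarrow> gfree V M"
  unfolding gfree_def using miso_trans by blast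

text \<open>The disjoint union of the two bases stays inside \<open>idx\<close>: the list of
  parities is prefixed with a tag, \<open>False\<close> for \<open>M\<close> and \<open>True\<close>
  for \<open>N\<close>. This closes \<open>gfree\<close> under direct sums.\<close>

lemma miso_sum_fsmod:
  fixes B C :: "idx set"
  assumes 1: "miso V M (fsmod V B \<delta>) \<phi>" and 2: "miso V N (fsmod V C \<epsilon>) \<psi>"
  defines "D \<equiv> {(x # xs, a) | x xs a. (xs, a) \<in> (if x then C else B)}"
  shows "miso V (sum_module M N)
    (fsmod V D (\<lambda>(zs, a). if hd zs then \<epsilon> (tl zs, a) else \<delta> (tl zs, a)))
    (\<lambda>(x, y) (zs, a). if zs = [] then 0 else if hd zs then \<psi> y (tl zs, a) else \<phi> x (tl zs, a))"
    (is "miso V _ (fsmod V D ?\<delta>) ?\<phi>")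
proof -
  interpret A: coord_module V M B \<delta> \<phi> by (rule coord_module.intro[OF 1])
  interpret B: coord_module V N C \<epsilon> \<psi> by (rule coord_module.intro[OF 2])
  have ev [simp]: "?\<phi> (x, y) ([], a) = 0" "?\<phi> (x, y) (True # zs, a) = \<psi> y (zs, a)" "?\<phi> (x, y) (False # zs, a) = \<phi> x (zs, a)"
    for x y a zs by auto
  have all: "(\<forall>z. P z) \<longleftrightarrow> (\<forall>a. P ([], a)) \<and> (\<forall>zs a. P (True # zs, a)) \<and> (\<forall>zs a. P (False # zs, a))"
    for P :: "idx \<Rightarrow> bool"
    by (metis (full_types) list.exhaust surj_pair)
  have D: "(True # zs, a) \<in> D \<longleftrightarrow> (zs, a) \<in> C" "(False # zs, a) \<in> D \<longleftrightarrow> (zs, a) \<in> B" "([], a) \<notin> D" for zs a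
    by (auto simp: D_def)
  have fin: "finite {z. ?\<phi> (x, y) z \<noteq> 0}" if "x \<in> carrier M" "y \<in> carrier N" for x y
  proof -
    have "{z. ?\<phi> (x, y) z \<noteq> 0} \<subseteq> (\<lambda>(zs, a). (False # zs, a)) ` {z. \<phi> x z \<noteq> 0} \<union> (\<lambda>(zs, a). (True # zs, a)) ` {z. \<psi> y z \<noteq> 0}"
    proof
      fix z :: idx assume z: "z \<in> {z. ?\<phi> (x, y) z \<noteq> 0}"
      obtain zs a where za: "z = (zs, a)" by (cases z)
      consider "zs = []" | ys where "zs = False # ys" | ys where "zs = True # ys" by (metis list.exhaust)
      then show "z \<in> (\<lambda>(zs, a). (False # zs, a)) ` {z. \<phi> x z \<noteq> 0} \<union> (\<lambda>(zs, a). (True # zs, a)) ` {z. \<psi> y z \<noteq> 0}"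
        by cases (use z za in \<open>auto intro: image_eqI[rotated]\<close>)
    qed
    then show ?thesis
      by (rule finite_subset) (use A.coord(3) B.coord(3) that in auto)
  qed
  have mem: "?\<phi> (x, y) \<in> carrier (fsmod V D ?\<delta>)" if "x \<in> carrier M" "y \<in> carrier N" for x y
  proof -
    have nz: "\<phi> x z \<noteq> 0 \<Longrightarrow> z \<in> B" "\<psi> y z \<noteq> 0 \<Longrightarrow> z \<in> C" for z
      using A.coord(2)[OF that(1)] B.coord(2)[OF that(2)] by blast+
    have "?\<phi> (x, y) z \<in> pols V \<and> (?\<phi> (x, y) z \<noteq> 0 \<longrightarrow> z \<in> D)" for z
    proof -
      obtain zs a where za: "z = (zs, a)" by (cases z)
      consider "zs = []" | ys where "zs = False # ys" | ys where "zs = True # ys" by (metis list.exhaust)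
      then show ?thesis
        by cases (use A.coord(1)[OF that(1)] B.coord(1)[OF that(2)] nz in \<open>auto simp: za D\<close>)
    qed
    then show ?thesis using fin[OF that] by (rule fsmod_carrierI)
  qed
  show ?thesis
    unfolding miso_def
  proof (intro conjI ballI allI)
    show "bij_betw ?\<phi> (carrier (sum_module M N)) (carrier (fsmod V D ?\<delta>))"
    proof (rule bij_betwI')
      fix u v assume "u \<in> carrier (sum_module M N)" "v \<in> carrier (sum_module M N)"
      then obtain x y x' y' where uv: "u = (x, y)" "v = (x', y')" "x \<in> carrier M" "y \<in> carrier N" "x' \<in> carrier M" "y' \<in> carrier N"
        by auto
      have "x = x' \<and> y = y'" if eq: "?\<phi> (x, y) = ?\<phi> (x', y')"
      proof
        have "\<phi> x (zs, a) = \<phi> x' (zs, a)" for zs a using fun_cong[OF eq, of "(False # zs, a)"] by simp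
        then show "x = x'" using uv by (intro A.coord_eqI) auto
        have "\<psi> y (zs, a) = \<psi> y' (zs, a)" for zs a using fun_cong[OF eq, of "(True # zs, a)"] by simp
        then show "y = y'" using uv by (intro B.coord_eqI) auto
      qed
      then show "?\<phi> u = ?\<phi> v \<longleftrightarrow> u = v" by (auto simp only: uv)
    next
      fix u assume "u \<in> carrier (sum_module M N)"
      then show "?\<phi> u \<in> carrier (fsmod V D ?\<delta>)" using mem by (cases u) auto
    next
      fix w assume w: "w \<in> carrier (fsmod V D ?\<delta>)"
      have wp: "w z \<in> pols V" "w z \<noteq> 0 \<Longrightarrow> z \<in> D" "finite {z. w z \<noteq> 0}" for z
        using fsmod_carrierD[OF w] by blast+
      define u where "u = (\<lambda>(zs, a). w (False # zs, a))"
      define v where "v = (\<lambda>(zs, a). w (True # zs, a))"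
      have f: "finite {z. u z \<noteq> 0}" "finite {z. v z \<noteq> 0}"
      proof -
        have "{z. u z \<noteq> 0} \<subseteq> (\<lambda>(zs, a). (tl zs, a)) ` {z. w z \<noteq> 0}"
          by (force simp: u_def intro: image_eqI[of _ _ "(False # _, _)"])
        then show "finite {z. u z \<noteq> 0}" by (rule finite_subset) (use wp(3) in simp)
        have "{z. v z \<noteq> 0} \<subseteq> (\<lambda>(zs, a). (tl zs, a)) ` {z. w z \<noteq> 0}"
          by (force simp: v_def intro: image_eqI[of _ _ "(True # _, _)"])
        then show "finite {z. v z \<noteq> 0}" by (rule finite_subset) (use wp(3) in simp)
      qed
      have x: "A.of_coord u \<in> carrier M" "\<phi> (A.of_coord u) = u"
      proof -
        have "u z \<in> pols V" "u z \<noteq> 0 \<longrightarrow> z \<in> B" for z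
          by (cases z; use wp(1) wp(2)[of "(False # fst z, snd z)"] in \<open>simp add: u_def D\<close>)+
        then show "A.of_coord u \<in> carrier M" "\<phi> (A.of_coord u) = u"
          using A.of_coord[of u] f(1) by blast+
      qed
      have y: "B.of_coord v \<in> carrier N" "\<psi> (B.of_coord v) = v"
      proof -
        have "v z \<in> pols V" "v z \<noteq> 0 \<longrightarrow> z \<in> C" for z
          by (cases z; use wp(1) wp(2)[of "(True # fst z, snd z)"] in \<open>simp add: v_def D\<close>)+
        then show "B.of_coord v \<in> carrier N" "\<psi> (B.of_coord v) = v"
          using B.of_coord[of v] f(2) by blast+
      qed
      have "w = ?\<phi> (A.of_coord u, B.of_coord v)"
      proof
        fix z :: idx
        obtain zs a where za: "z = (zs, a)" by (cases z)
        consider "zs = []" | ys where "zs = False # ys" | ys where "zs = True # ys" by (metis list.exhaust)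
        then show "w z = ?\<phi> (A.of_coord u, B.of_coord v) z"
        proof cases
          case 1
          then show ?thesis using wp(2)[of "([], a)"] D(3) by (auto simp: za)
        next
          case (2 ys)
          have "u (ys, a) = w z" by (simp add: u_def za 2)
          then show ?thesis by (simp add: za 2 x)
        next
          case (3 ys)
          have "v (ys, a) = w z" by (simp add: v_def za 3)
          then show ?thesis by (simp add: za 3 y)
        qed
      qed
      then show "\<exists>x\<in>carrier (sum_module M N). w = ?\<phi> x" using x y by (intro bexI[of _ "(A.of_coord u, B.of_coord v)"]) auto
    qed
    show "deg_part (sum_module M N) k = {x \<in> carrier (sum_module M N). ?\<phi> x \<in> deg_part (fsmod V D ?\<delta>) k}" for k
    proof -
      have "x \<in> deg_part M k \<and> y \<in> deg_part N k \<longleftrightarrow> ?\<phi> (x, y) \<in> deg_part (fsmod V D ?\<delta>) k"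
        if "x \<in> carrier M" "y \<in> carrier N" for x y
      proof -
        have "?\<phi> (x, y) \<in> deg_part (fsmod V D ?\<delta>) k \<longleftrightarrow> (\<forall>z. homogeneous (k - ?\<delta> z) (?\<phi> (x, y) z))"
          using mem[OF that] by (auto simp: fsmod_def)
        also have "\<dots> \<longleftrightarrow> (\<forall>zs a. homogeneous (k - \<epsilon> (zs, a)) (\<psi> y (zs, a))) \<and> (\<forall>zs a. homogeneous (k - \<delta> (zs, a)) (\<phi> x (zs, a)))"
          by (subst all) simp
        also have "\<dots> \<longleftrightarrow> x \<in> deg_part M k \<and> y \<in> deg_part N k"
          using that by (auto simp: A.deg_part_iff B.deg_part_iff)
        finally show ?thesis by blast
      qed
      moreover have "deg_part M k \<subseteq> carrier M" "deg_part N k \<subseteq> carrier N"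
        by (auto simp: A.deg_part_iff B.deg_part_iff)
      ultimately show ?thesis by auto
    qed
  next
    show "?\<phi> \<zero>\<^bsub>sum_module M N\<^esub> = \<zero>\<^bsub>fsmod V D ?\<delta>\<^esub>"
      by (auto simp: fsmod_def fun_eq_iff A.coord_ops B.coord_ops)
    fix u v assume "u \<in> carrier (sum_module M N)" "v \<in> carrier (sum_module M N)"
    then show "u \<oplus>\<^bsub>sum_module M N\<^esub> v \<in> carrier (sum_module M N)"
      "?\<phi> (u \<oplus>\<^bsub>sum_module M N\<^esub> v) = ?\<phi> u \<oplus>\<^bsub>fsmod V D ?\<delta>\<^esub> ?\<phi> v"
      by (auto simp: fsmod_def fun_eq_iff A.coord_ops B.coord_ops A.closed B.closed)
  next
    fix p u assume "p \<in> pols V" "u \<in> carrier (sum_module M N)"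
    then show "p \<odot>\<^bsub>sum_module M N\<^esub> u \<in> carrier (sum_module M N)"
      "?\<phi> (p \<odot>\<^bsub>sum_module M N\<^esub> u) = p \<odot>\<^bsub>fsmod V D ?\<delta>\<^esub> ?\<phi> u"
      by (auto simp: fsmod_def fun_eq_iff A.coord_ops B.coord_ops A.closed B.closed)
  qed (simp add: A.closed B.closed)
qed

lemma gfree_sum: "gfree V M \<Longrightarrow> gfree V N \<Longrightarrow> gfree V (sum_module M N)"
  unfolding gfree_def using miso_sum_fsmod by blast

lemma gfree_finite_sum:
  assumes "gfree_finite V M" "gfree_finite V N" shows "gfree_finite V (sum_module M N)"
proof -
  obtain B C :: "idx set" and \<delta> \<epsilon> \<phi> \<psi> where *: "finite B" "miso V M (fsmod V B \<delta>) \<phi>"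
    "finite C" "miso V N (fsmod V C \<epsilon>) \<psi>"
    using assms unfolding gfree_finite_def by blast
  have "{(x # xs, a) | x xs a. (xs, a) \<in> (if x then C else B)} \<subseteq>
      (\<lambda>(xs, a). (True # xs, a)) ` C \<union> (\<lambda>(xs, a). (False # xs, a)) ` B"
    by (auto split: if_splits intro: image_eqI[rotated])
  then have "finite {(x # xs, a) | x xs a. (xs, a) \<in> (if x then C else B)}"
    by (rule finite_subset) (use * in simp)
  with miso_sum_fsmod[OF *(2,4)] show ?thesis unfolding gfree_finite_def by blast
qed

text \<open>The polynomials in \<open>V\<close> are free over those in \<open>W\<close>, on the
  monomials in \<open>V - W\<close>; such a monomial raises the degree of a basis element by its own
  degree.\<close>

lemma miso_fmod_fsmod:
  fixes B :: "bool list set"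
  assumes W: "W \<subseteq> V" and B: "finite B"
  shows "miso W (fmod V B \<delta>) (fsmod W {(xs, a). xs \<in> B \<and> keys a \<subseteq> V - W} (\<lambda>(xs, a). \<delta> xs + mono_deg a))
    (\<lambda>v (xs, a). if keys a \<subseteq> V - W then coeff_at (V - W) a (v xs) else 0)"
    (is "miso W _ (fsmod W ?B ?\<delta>) ?\<phi>")
proof -
  let ?U = "V - W"
  have VW: "V - ?U = W" "W \<inter> ?U = {}" using W by auto
  have fin: "finite {z. ?\<phi> v z \<noteq> 0}" if "v \<in> carrier (fmod V B \<delta>)" for v
  proof -
    have "{z. ?\<phi> v z \<noteq> 0} \<subseteq> (SIGMA xs:B. {a. keys a \<subseteq> ?U \<and> coeff_at ?U a (v xs) \<noteq> 0})"
    proof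
      fix z assume *: "z \<in> {z. ?\<phi> v z \<noteq> 0}"
      obtain xs a where z: "z = (xs, a)" by (cases z)
      from * have a: "keys a \<subseteq> ?U" "coeff_at ?U a (v xs) \<noteq> 0" by (auto simp: z split: if_splits)
      then have "v xs \<noteq> 0" by auto
      then show "z \<in> (SIGMA xs:B. {a. keys a \<subseteq> ?U \<and> coeff_at ?U a (v xs) \<noteq> 0})"
        using that a by (simp add: z)
    qed
    then show ?thesis by (rule finite_subset) (use B finite_coeff_at in auto)
  qed
  have mem: "?\<phi> v \<in> carrier (fsmod W ?B ?\<delta>)" if "v \<in> carrier (fmod V B \<delta>)" for v
  proof (rule fsmod_carrierI)
    fix z :: idx
    obtain xs a where z: "z = (xs, a)" by (cases z)
    have "v xs \<in> pols V" "v xs \<noteq> 0 \<Longrightarrow> xs \<in> B" using that by simp_all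
    then have "coeff_at ?U a (v xs) \<in> pols W" "coeff_at ?U a (v xs) \<noteq> 0 \<Longrightarrow> xs \<in> B"
      using coeff_at_pols[of "v xs" V ?U] unfolding VW by (cases "v xs = 0"; auto)+
    then show "?\<phi> v z \<in> pols W \<and> (?\<phi> v z \<noteq> 0 \<longrightarrow> z \<in> ?B)" by (auto simp: z)
  qed (rule fin[OF that])
  show ?thesis
    unfolding miso_def
  proof (intro conjI ballI allI)
    show "bij_betw ?\<phi> (carrier (fmod V B \<delta>)) (carrier (fsmod W ?B ?\<delta>))"
    proof (rule bij_betwI')
      fix u v assume "u \<in> carrier (fmod V B \<delta>)" "v \<in> carrier (fmod V B \<delta>)"
      have "u xs = v xs" if eq: "?\<phi> u = ?\<phi> v" for xs
      proof (rule coeff_at_eqI[where W = ?U])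
        fix a :: mono assume "keys a \<subseteq> ?U"
        then show "coeff_at ?U a (u xs) = coeff_at ?U a (v xs)" using fun_cong[OF eq, of "(xs, a)"] by simp
      qed
      then show "?\<phi> u = ?\<phi> v \<longleftrightarrow> u = v" by blast
    next
      fix v assume "v \<in> carrier (fmod V B \<delta>)"
      then show "?\<phi> v \<in> carrier (fsmod W ?B ?\<delta>)" by (rule mem)
    next
      fix f assume fc: "f \<in> carrier (fsmod W ?B ?\<delta>)"
      have f: "\<And>z. f z \<in> pols W" "\<And>z. f z \<noteq> 0 \<Longrightarrow> z \<in> ?B" "finite {z. f z \<noteq> 0}"
        using fsmod_carrierD[OF fc] by blast+
      have ffin: "finite {a. f (xs, a) \<noteq> 0}" for xs
        by (rule finite_subset[of _ "snd ` {z. f z \<noteq> 0}"]) (use f(3) in \<open>auto intro: image_eqI[rotated]\<close>)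
      define v where "v xs = (\<Sum>a\<in>{a. f (xs, a) \<noteq> 0}. f (xs, a) * single a 1)" for xs
      have "v xs \<in> pols V" for xs
        unfolding v_def using f(2) pols_mono[OF W f(1)]
        by (intro pols_sum pols_mult) (fastforce simp: pols_iff_single)+
      moreover have "v xs \<noteq> 0 \<Longrightarrow> xs \<in> B" for xs
        unfolding v_def using f(2) by (auto dest: sum.not_neutral_contains_not_neutral)
      ultimately have v: "v \<in> carrier (fmod V B \<delta>)" by simp
      have "f z = ?\<phi> v z" for z
      proof -
        obtain xs b where z: "z = (xs, b)" by (cases z)
        show ?thesis
        proof (cases "keys b \<subseteq> ?U")
          case True
          have "coeff_at ?U b (v xs) = (\<Sum>a\<in>{a. f (xs, a) \<noteq> 0}. if a = b then f (xs, b) else 0)"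
            unfolding v_def coeff_at_sum
          proof (rule sum.cong[OF refl])
            fix a assume "a \<in> {a. f (xs, a) \<noteq> 0}"
            then have "keys a \<subseteq> ?U" using f(2) by blast
            then have "mono_restrict ?U a = a" "mono_restrict (- ?U) a = 0"
              by (auto intro!: mono_restrict_id mono_restrict_disjoint)
            then show "coeff_at ?U b (f (xs, a) * single a 1) = (if a = b then f (xs, b) else 0)"
              by (cases "a = b") (simp_all add: coeff_at_mult[OF f(1) VW(2) True] coeff_at_single[OF True])
          qed
          also have "\<dots> = f (xs, b)" using ffin[of xs] by auto
          finally show ?thesis using True by (simp add: z)
        next
          case False
          then have "f (xs, b) = 0" using f(2)[of "(xs, b)"] by auto
          then show ?thesis using False by (simp add: z)
        qed
      qed
      then have "f = ?\<phi> v" by (rule ext)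
      with v show "\<exists>v\<in>carrier (fmod V B \<delta>). f = ?\<phi> v" by blast
    qed
    show "deg_part (fmod V B \<delta>) k = {v \<in> carrier (fmod V B \<delta>). ?\<phi> v \<in> deg_part (fsmod W ?B ?\<delta>) k}" for k
    proof -
      have "(\<forall>xs. homogeneous (k - \<delta> xs) (v xs)) \<longleftrightarrow> ?\<phi> v \<in> deg_part (fsmod W ?B ?\<delta>) k"
        if "v \<in> carrier (fmod V B \<delta>)" for v
      proof -
        have "?\<phi> v \<in> deg_part (fsmod W ?B ?\<delta>) k \<longleftrightarrow> (\<forall>z. homogeneous (k - ?\<delta> z) (?\<phi> v z))"
          using mem[OF that] by (auto simp: fsmod_def)
        also have "\<dots> \<longleftrightarrow> (\<forall>xs a. keys a \<subseteq> ?U \<longrightarrow> homogeneous (k - \<delta> xs - mono_deg a) (coeff_at ?U a (v xs)))"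
          by (simp add: diff_diff_eq)
        also have "\<dots> \<longleftrightarrow> (\<forall>xs. homogeneous (k - \<delta> xs) (v xs))"
          using homogeneousI_coeff_at[of ?U] coeff_at_homogeneous by blast
        finally show ?thesis by blast
      qed
      moreover have "v \<in> deg_part (fmod V B \<delta>) k \<longleftrightarrow> v \<in> carrier (fmod V B \<delta>) \<and> (\<forall>xs. homogeneous (k - \<delta> xs) (v xs))" for v
        by auto
      ultimately show ?thesis by blast
    qed
  next
    show "\<zero>\<^bsub>fmod V B \<delta>\<^esub> \<in> carrier (fmod V B \<delta>)" "?\<phi> \<zero>\<^bsub>fmod V B \<delta>\<^esub> = \<zero>\<^bsub>fsmod W ?B ?\<delta>\<^esub>"
      by (auto simp: fsmod_def fun_eq_iff)
    fix u v assume uv: "u \<in> carrier (fmod V B \<delta>)" "v \<in> carrier (fmod V B \<delta>)"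
    show "u \<oplus>\<^bsub>fmod V B \<delta>\<^esub> v \<in> carrier (fmod V B \<delta>)"
      using fmod_add_closed[OF uv] by (simp del: fmod_simps(1))
    show "?\<phi> (u \<oplus>\<^bsub>fmod V B \<delta>\<^esub> v) = ?\<phi> u \<oplus>\<^bsub>fsmod W ?B ?\<delta>\<^esub> ?\<phi> v"
      by (auto simp: fsmod_def fun_eq_iff coeff_at_add)
  next
    fix p v assume p: "p \<in> pols W" and v: "v \<in> carrier (fmod V B \<delta>)"
    show "p \<odot>\<^bsub>fmod V B \<delta>\<^esub> v \<in> carrier (fmod V B \<delta>)"
      using v pols_mono[OF W p] by (auto intro: pols_mult)
    show "?\<phi> (p \<odot>\<^bsub>fmod V B \<delta>\<^esub> v) = p \<odot>\<^bsub>fsmod W ?B ?\<delta>\<^esub> ?\<phi> v"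
      by (auto simp: fsmod_def fun_eq_iff coeff_at_mult[OF p VW(2)])
  qed
qed

lemma gfree_fmod: "finite B \<Longrightarrow> W \<subseteq> V \<Longrightarrow> gfree W (fmod V (B :: bool list set) \<delta>)"
  unfolding gfree_def using miso_fmod_fsmod by blast

lemma gfree_finite_fmod: "finite B \<Longrightarrow> gfree_finite V (fmod V (B :: bool list set) \<delta>)"
  unfolding gfree_finite_def
proof (intro exI conjI)
  assume B: "finite B"
  show "miso V (fmod V B \<delta>) (fsmod V {(xs, a). xs \<in> B \<and> keys a \<subseteq> V - V} (\<lambda>(xs, a). \<delta> xs + mono_deg a))
    (\<lambda>v (xs, a). if keys a \<subseteq> V - V then coeff_at (V - V) a (v xs) else 0)"
    using B by (intro miso_fmod_fsmod) auto
  have "{(xs, a). xs \<in> B \<and> keys (a :: mono) \<subseteq> V - V} = B \<times> {0}" by auto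
  then show "finite {(xs, a). xs \<in> B \<and> keys (a :: mono) \<subseteq> V - V}" using B by simp
qed

subsection \<open>Resolved factorizations\<close>

text \<open>A free module whose sum and zero are those of the type class, so that ordinary algebra
  and \<open>sum\<close> replace the record operations. The coordinate modules and their direct sums
  have this form.\<close>

definition cmod :: "nat set \<Rightarrow> 'm::ab_group_add gmodule \<Rightarrow> bool" where
  "cmod V M \<longleftrightarrow> gfree V M \<and> (\<forall>x y. x \<oplus>\<^bsub>M\<^esub> y = x + y) \<and> \<zero>\<^bsub>M\<^esub> = 0"

lemma cmodD:
  fixes M :: "'m::ab_group_add gmodule"
  assumes "cmod V M"
  shows "x \<oplus>\<^bsub>M\<^esub> y = x + y" "\<zero>\<^bsub>M\<^esub> = 0" "0 \<in> carrier M"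
    "x \<in> carrier M \<Longrightarrow> y \<in> carrier M \<Longrightarrow> x + y \<in> carrier M"
    "x \<in> carrier M \<Longrightarrow> - x \<in> carrier M"
    "x \<in> carrier M \<Longrightarrow> \<ominus>\<^bsub>M\<^esub> x = - x"
    "p \<in> pols V \<Longrightarrow> x \<in> carrier M \<Longrightarrow> p \<odot>\<^bsub>M\<^esub> x \<in> carrier M"
    "p \<in> pols V \<Longrightarrow> q \<in> pols V \<Longrightarrow> x \<in> carrier M \<Longrightarrow> (p + q) \<odot>\<^bsub>M\<^esub> x = p \<odot>\<^bsub>M\<^esub> x + q \<odot>\<^bsub>M\<^esub> x"
    "p \<in> pols V \<Longrightarrow> x \<in> carrier M \<Longrightarrow> y \<in> carrier M \<Longrightarrow> p \<odot>\<^bsub>M\<^esub> (x + y) = p \<odot>\<^bsub>M\<^esub> x + p \<odot>\<^bsub>M\<^esub> y"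
    "p \<in> pols V \<Longrightarrow> q \<in> pols V \<Longrightarrow> x \<in> carrier M \<Longrightarrow> (p * q) \<odot>\<^bsub>M\<^esub> x = p \<odot>\<^bsub>M\<^esub> (q \<odot>\<^bsub>M\<^esub> x)"
    "x \<in> carrier M \<Longrightarrow> 1 \<odot>\<^bsub>M\<^esub> x = x"
    "x \<in> carrier M \<Longrightarrow> 0 \<odot>\<^bsub>M\<^esub> x = 0"
    "p \<in> pols V \<Longrightarrow> p \<odot>\<^bsub>M\<^esub> 0 = 0"
    "x \<in> carrier M \<Longrightarrow> (- 1) \<odot>\<^bsub>M\<^esub> x = - x"
    "x \<in> deg_part M k \<Longrightarrow> x \<in> carrier M"
    "0 \<in> deg_part M k"
    "x \<in> deg_part M k \<Longrightarrow> y \<in> deg_part M k \<Longrightarrow> x + y \<in> deg_part M k"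
    "x \<in> deg_part M k \<Longrightarrow> - x \<in> deg_part M k"
    "p \<in> pols V \<Longrightarrow> homogeneous j p \<Longrightarrow> x \<in> deg_part M k \<Longrightarrow> p \<odot>\<^bsub>M\<^esub> x \<in> deg_part M (j + k)"
proof -
  obtain B :: "idx set" and \<delta> \<phi> where "miso V M (fsmod V B \<delta>) \<phi>"
    using assms by (auto simp: cmod_def gfree_def)
  then interpret coord_module V M B \<delta> \<phi> by (rule coord_module.intro)
  interpret M: module "pol_ring V" M by (rule module)
  have add: "x \<oplus>\<^bsub>M\<^esub> y = x + y" and zero: "\<zero>\<^bsub>M\<^esub> = 0" for x y
    using assms by (simp_all add: cmod_def)
  have P: "p \<in> carrier (pol_ring V) \<longleftrightarrow> p \<in> pols V" "p \<oplus>\<^bsub>pol_ring V\<^esub> q = p + q" "p \<otimes>\<^bsub>pol_ring V\<^esub> q = p * q"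
    "\<one>\<^bsub>pol_ring V\<^esub> = 1" for p q by (simp_all add: pol_ring_def)
  have minus: "\<ominus>\<^bsub>M\<^esub> x = - x" if "x \<in> carrier M" for x
  proof -
    have "\<ominus>\<^bsub>M\<^esub> x + x = 0" using M.l_neg[OF that] by (simp add: add zero)
    then show ?thesis by (simp add: eq_neg_iff_add_eq_0)
  qed
  show "x \<oplus>\<^bsub>M\<^esub> y = x + y" "\<zero>\<^bsub>M\<^esub> = 0" "0 \<in> carrier M"
    using closed(1) by (simp_all add: add zero)
  show "x \<in> carrier M \<Longrightarrow> y \<in> carrier M \<Longrightarrow> x + y \<in> carrier M"
    using closed(2)[of x y] by (simp add: add)
  show *: "x \<in> carrier M \<Longrightarrow> - x \<in> carrier M" for x
    using minus[of x] M.a_inv_closed[of x] by simp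
  show "x \<in> carrier M \<Longrightarrow> \<ominus>\<^bsub>M\<^esub> x = - x" by (rule minus)
  show pc: "p \<in> pols V \<Longrightarrow> x \<in> carrier M \<Longrightarrow> p \<odot>\<^bsub>M\<^esub> x \<in> carrier M" for p x
    by (rule closed)
  show ld: "p \<in> pols V \<Longrightarrow> q \<in> pols V \<Longrightarrow> x \<in> carrier M \<Longrightarrow> (p + q) \<odot>\<^bsub>M\<^esub> x = p \<odot>\<^bsub>M\<^esub> x + q \<odot>\<^bsub>M\<^esub> x" for p q x
    using M.smult_l_distr[of p q x] by (simp add: P add)
  show rd: "p \<in> pols V \<Longrightarrow> x \<in> carrier M \<Longrightarrow> y \<in> carrier M \<Longrightarrow> p \<odot>\<^bsub>M\<^esub> (x + y) = p \<odot>\<^bsub>M\<^esub> x + p \<odot>\<^bsub>M\<^esub> y" for p x y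
    using M.smult_r_distr[of p x y] by (simp add: P add)
  show "p \<in> pols V \<Longrightarrow> q \<in> pols V \<Longrightarrow> x \<in> carrier M \<Longrightarrow> (p * q) \<odot>\<^bsub>M\<^esub> x = p \<odot>\<^bsub>M\<^esub> (q \<odot>\<^bsub>M\<^esub> x)"
    using M.smult_assoc1[of p q x] by (simp add: P)
  show 1: "x \<in> carrier M \<Longrightarrow> 1 \<odot>\<^bsub>M\<^esub> x = x" for x
    using M.smult_one[of x] by (simp add: P)
  show 0: "x \<in> carrier M \<Longrightarrow> 0 \<odot>\<^bsub>M\<^esub> x = 0" for x
    using ld[of 0 0 x] by simp
  show "p \<in> pols V \<Longrightarrow> p \<odot>\<^bsub>M\<^esub> 0 = 0"
    using rd[of p 0 0] closed(1) by (simp add: zero)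
  show "x \<in> carrier M \<Longrightarrow> (- 1) \<odot>\<^bsub>M\<^esub> x = - x"
    using ld[of "- 1" 1 x] 0[of x] 1[of x] pols_uminus[OF pols_1, of V] by (simp add: eq_neg_iff_add_eq_0)
  have sub: "subgroup (deg_part M k) (add_monoid M)" for k by (rule deg_part_subgroup)
  show dc: "x \<in> deg_part M k \<Longrightarrow> x \<in> carrier M" for x k by (simp add: deg_part_iff)
  show "0 \<in> deg_part M k" using subgroup.one_closed[OF sub] by (simp add: zero)
  show "x \<in> deg_part M k \<Longrightarrow> y \<in> deg_part M k \<Longrightarrow> x + y \<in> deg_part M k"
    using subgroup.m_closed[OF sub, of x k y] by (simp add: add)
  show "x \<in> deg_part M k \<Longrightarrow> - x \<in> deg_part M k"
    using a_inv[of x] by (auto simp: deg_part_iff minus homogeneous_uminus *)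
  show "p \<in> pols V \<Longrightarrow> homogeneous j p \<Longrightarrow> x \<in> deg_part M k \<Longrightarrow> p \<odot>\<^bsub>M\<^esub> x \<in> deg_part M (j + k)"
    by (rule smult_deg_part)
qed

lemma cmod_diff: "cmod V M \<Longrightarrow> x \<in> carrier M \<Longrightarrow> y \<in> carrier M \<Longrightarrow> x - y \<in> carrier M"
  using cmodD(4)[of V M x "- y"] cmodD(5)[of V M y] by simp

lemma cmod_a_minus: "cmod V M \<Longrightarrow> y \<in> carrier M \<Longrightarrow> x \<ominus>\<^bsub>M\<^esub> y = x - y"
  by (simp add: a_minus_def cmodD)

lemma lin_maps_iff:
  assumes "cmod V M" "cmod V N"
  shows "f \<in> lin_maps V k M N \<longleftrightarrow> (\<forall>x\<in>carrier M. f x \<in> carrier N) \<and>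
    (\<forall>x\<in>carrier M. \<forall>y\<in>carrier M. f (x + y) = f x + f y) \<and>
    (\<forall>p\<in>pols V. \<forall>x\<in>carrier M. f (p \<odot>\<^bsub>M\<^esub> x) = p \<odot>\<^bsub>N\<^esub> f x) \<and>
    (\<forall>j. \<forall>x\<in>deg_part M j. f x \<in> deg_part N (j + k))"
  unfolding lin_maps_def hom_def by (auto simp: cmodD[OF assms(1)] cmodD[OF assms(2)] Pi_def image_subset_iff)

lemma lin_mapsD:
  assumes "f \<in> lin_maps V k M N" "cmod V M" "cmod V N"
  shows "x \<in> carrier M \<Longrightarrow> f x \<in> carrier N"
    "x \<in> carrier M \<Longrightarrow> y \<in> carrier M \<Longrightarrow> f (x + y) = f x + f y"
    "p \<in> pols V \<Longrightarrow> x \<in> carrier M \<Longrightarrow> f (p \<odot>\<^bsub>M\<^esub> x) = p \<odot>\<^bsub>N\<^esub> f x"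
    "x \<in> deg_part M j \<Longrightarrow> f x \<in> deg_part N (j + k)"
    "f 0 = 0"
    "x \<in> carrier M \<Longrightarrow> f (- x) = - f x"
    "x \<in> carrier M \<Longrightarrow> y \<in> carrier M \<Longrightarrow> f (x - y) = f x - f y"
proof -
  note l = assms(1)[unfolded lin_maps_iff[OF assms(2,3)]]
  note c = cmodD[OF assms(2)]
  show "x \<in> carrier M \<Longrightarrow> f x \<in> carrier N"
    "p \<in> pols V \<Longrightarrow> x \<in> carrier M \<Longrightarrow> f (p \<odot>\<^bsub>M\<^esub> x) = p \<odot>\<^bsub>N\<^esub> f x"
    "x \<in> deg_part M j \<Longrightarrow> f x \<in> deg_part N (j + k)" using l by blast+
  show add: "x \<in> carrier M \<Longrightarrow> y \<in> carrier M \<Longrightarrow> f (x + y) = f x + f y" for x y using l by blast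
  show 0: "f 0 = 0" using add[of 0 0] c(3) by simp
  show neg: "x \<in> carrier M \<Longrightarrow> f (- x) = - f x" for x
    using add[of "- x" x] 0 c(5)[of x] by (simp add: eq_neg_iff_add_eq_0)
  show "x \<in> carrier M \<Longrightarrow> y \<in> carrier M \<Longrightarrow> f (x - y) = f x - f y"
    using add[of x "- y"] neg[of y] c(5)[of y] by simp
qed

lemma lin_maps_add:
  assumes "f \<in> lin_maps V k M N" "g \<in> lin_maps V k M N" "cmod V M" "cmod V N"
  shows "(\<lambda>x. f x + g x) \<in> lin_maps V k M N"
  unfolding lin_maps_iff[OF assms(3,4)]
proof (intro conjI ballI allI)
  note f = lin_mapsD[OF assms(1,3,4)] and g = lin_mapsD[OF assms(2-4)] and cN = cmodD[OF assms(4)]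
  show "f x + g x \<in> carrier N" if "x \<in> carrier M" for x by (intro cN(4) f(1) g(1) that)
  show "f (x + y) + g (x + y) = f x + g x + (f y + g y)" if "x \<in> carrier M" "y \<in> carrier M" for x y
    by (simp add: f(2)[OF that] g(2)[OF that] add_ac)
  show "f (p \<odot>\<^bsub>M\<^esub> x) + g (p \<odot>\<^bsub>M\<^esub> x) = p \<odot>\<^bsub>N\<^esub> (f x + g x)" if "p \<in> pols V" "x \<in> carrier M" for p x
    by (simp only: f(3)[OF that] g(3)[OF that] cN(9)[OF that(1) f(1)[OF that(2)] g(1)[OF that(2)]])
  show "f x + g x \<in> deg_part N (j + k)" if "x \<in> deg_part M j" for x j by (intro cN(17) f(4) g(4) that)
qed

lemma cmod_smult_uminus: "cmod V M \<Longrightarrow> p \<in> pols V \<Longrightarrow> x \<in> carrier M \<Longrightarrow> p \<odot>\<^bsub>M\<^esub> (- x) = - (p \<odot>\<^bsub>M\<^esub> x)"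
  using cmodD(9)[of V M p "- x" x] cmodD(5)[of V M x] cmodD(13)[of V M p] by (simp add: eq_neg_iff_add_eq_0)

lemma lin_maps_uminus:
  assumes "f \<in> lin_maps V k M N" "cmod V M" "cmod V N"
  shows "(\<lambda>x. - f x) \<in> lin_maps V k M N"
  unfolding lin_maps_iff[OF assms(2,3)]
proof (intro conjI ballI allI)
  note f = lin_mapsD[OF assms] and cN = cmodD[OF assms(3)]
  show "- f x \<in> carrier N" if "x \<in> carrier M" for x by (intro cN(5) f(1) that)
  show "- f (x + y) = - f x + - f y" if "x \<in> carrier M" "y \<in> carrier M" for x y
    by (simp add: f(2)[OF that])
  show "- f (p \<odot>\<^bsub>M\<^esub> x) = p \<odot>\<^bsub>N\<^esub> (- f x)" if "p \<in> pols V" "x \<in> carrier M" for p x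
    by (simp only: f(3)[OF that] cmod_smult_uminus[OF assms(3) that(1) f(1)[OF that(2)]])
  show "- f x \<in> deg_part N (j + k)" if "x \<in> deg_part M j" for x j by (intro cN(18) f(4) that)
qed

lemma lin_maps_0: "cmod V M \<Longrightarrow> cmod V N \<Longrightarrow> (\<lambda>x. 0) \<in> lin_maps V k M N"
  by (auto simp: lin_maps_iff cmodD)

lemma lin_maps_comp:
  assumes "f \<in> lin_maps V j M N" "g \<in> lin_maps V k N P"
  shows "(\<lambda>x. g (f x)) \<in> lin_maps V (j + k) M P"
proof -
  have "g (f x) \<in> deg_part P (i + (j + k))" if "x \<in> deg_part M i" for i x
  proof -
    have "f x \<in> deg_part N (i + j)" using assms(1) that unfolding lin_maps_def by blast
    then have "g (f x) \<in> deg_part P (i + j + k)" using assms(2) unfolding lin_maps_def by blast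
    then show ?thesis by (simp add: add.assoc)
  qed
  then show ?thesis
    using assms unfolding lin_maps_def hom_def by (auto simp: Pi_def)
qed

lemma lin_maps_id: "(\<lambda>x. x) \<in> lin_maps V 0 M M"
  by (auto simp: lin_maps_def hom_def)

section \<open>Submodules and the extension of linear maps from a homogeneous basis\<close>

definition submod :: "nat set \<Rightarrow> 'm::ab_group_add gmodule \<Rightarrow> 'm set \<Rightarrow> bool" where
  "submod V M S \<longleftrightarrow> S \<subseteq> carrier M \<and> 0 \<in> S \<and> (\<forall>x\<in>S. \<forall>y\<in>S. x + y \<in> S) \<and> (\<forall>p\<in>pols V. \<forall>x\<in>S. p \<odot>\<^bsub>M\<^esub> x \<in> S)"

lemma submodD:
  assumes "submod V M S"
  shows "x \<in> S \<Longrightarrow> x \<in> carrier M" "0 \<in> S" "x \<in> S \<Longrightarrow> y \<in> S \<Longrightarrow> x + y \<in> S"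
    "p \<in> pols V \<Longrightarrow> x \<in> S \<Longrightarrow> p \<odot>\<^bsub>M\<^esub> x \<in> S"
  using assms unfolding submod_def by blast+

lemma submod_uminus: "cmod V M \<Longrightarrow> submod V M S \<Longrightarrow> x \<in> S \<Longrightarrow> - x \<in> S"
  using submodD(4)[of V M S "- 1" x] cmodD(14)[of V M x] submodD(1)[of V M S x] pols_uminus[OF pols_1, of V] by simp

lemma submod_diff: "cmod V M \<Longrightarrow> submod V M S \<Longrightarrow> x \<in> S \<Longrightarrow> y \<in> S \<Longrightarrow> x - y \<in> S"
  using submodD(3)[of V M S x "- y"] submod_uminus[of V M S y] by simp

lemma submod_sum: "submod V M S \<Longrightarrow> (\<And>i. i \<in> I \<Longrightarrow> f i \<in> S) \<Longrightarrow> sum f I \<in> S"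
  by (rule sum_closed[where P = "\<lambda>x. x \<in> S"]) (auto dest: submodD)

text \<open>Projectivity of free modules in relational form. For each basis element a homogeneous
  \<open>R\<close>-related partner in \<open>S\<close> is chosen; compatibility of \<open>R\<close>
  with sums and scalars carries the relation to the linear extension. A relation serves both for
  lifting along a quotient and for solving equations modulo a filtration step.\<close>

lemma extend_linear:
  fixes P :: "'a::ab_group_add gmodule" and N :: "'b::ab_group_add gmodule"
  assumes P: "cmod V P" and N: "cmod V N" and S: "submod V N S"
    and R: "\<And>x k. x \<in> deg_part P k \<Longrightarrow> \<exists>y\<in>deg_part N (k + j). y \<in> S \<and> R x y"
    and R_add: "\<And>x x' y y'. x \<in> carrier P \<Longrightarrow> x' \<in> carrier P \<Longrightarrow> y \<in> S \<Longrightarrow> y' \<in> S \<Longrightarrow> R x y \<Longrightarrow> R x' y' \<Longrightarrow> R (x + x') (y + y')"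
    and R_mult: "\<And>p x y. p \<in> pols V \<Longrightarrow> x \<in> carrier P \<Longrightarrow> y \<in> S \<Longrightarrow> R x y \<Longrightarrow> R (p \<odot>\<^bsub>P\<^esub> x) (p \<odot>\<^bsub>N\<^esub> y)"
  shows "\<exists>h\<in>lin_maps V j P N. \<forall>x\<in>carrier P. h x \<in> S \<and> R x (h x)"
proof -
  obtain B :: "idx set" and \<delta> \<phi> where "miso V P (fsmod V B \<delta>) \<phi>"
    using P by (auto simp: cmod_def gfree_def)
  then interpret coord_module V P B \<delta> \<phi> by (rule coord_module.intro)
  note cP = cmodD[OF P] and cN = cmodD[OF N] and sS = submodD[OF S]
  have "\<forall>z. \<exists>y. z \<in> B \<longrightarrow> y \<in> deg_part N (\<delta> z + j) \<and> y \<in> S \<and> R (bas z) y"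
    using R bas(3) by meson
  then obtain Y where Y: "\<And>z. z \<in> B \<Longrightarrow> Y z \<in> deg_part N (\<delta> z + j)" "\<And>z. z \<in> B \<Longrightarrow> Y z \<in> S" "\<And>z. z \<in> B \<Longrightarrow> R (bas z) (Y z)"
    by metis
  define h where "h x = (\<Sum>z\<in>{z. \<phi> x z \<noteq> 0}. \<phi> x z \<odot>\<^bsub>N\<^esub> Y z)" for x
  have hA: "h x = (\<Sum>z\<in>A. \<phi> x z \<odot>\<^bsub>N\<^esub> Y z)" if "x \<in> carrier P" "finite A" "{z. \<phi> x z \<noteq> 0} \<subseteq> A" "A \<subseteq> B" for x A
    unfolding h_def
  proof (rule sum.mono_neutral_left)
    show "\<forall>z\<in>A - {z. \<phi> x z \<noteq> 0}. \<phi> x z \<odot>\<^bsub>N\<^esub> Y z = 0"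
    proof
      fix z assume "z \<in> A - {z. \<phi> x z \<noteq> 0}"
      then have "\<phi> x z = 0" "z \<in> B" using that by auto
      then have "\<phi> x z = 0" "Y z \<in> carrier N" by (simp_all add: sS(1)[OF Y(2)])
      then show "\<phi> x z \<odot>\<^bsub>N\<^esub> Y z = 0" using cN(12) by simp
    qed
  qed (use that in auto)
  have supB: "{z. \<phi> x z \<noteq> 0} \<subseteq> B" if "x \<in> carrier P" for x using coord(2)[OF that] by auto
  have tS: "\<phi> x z \<odot>\<^bsub>N\<^esub> Y z \<in> S" if "x \<in> carrier P" "z \<in> B" for x z
    using that coord(1) Y(2) sS(4) by blast
  have hS: "h x \<in> S" if "x \<in> carrier P" for x
    unfolding h_def using tS that supB by (intro submod_sum[OF S]) blast
  have h_add: "h (x + y) = h x + h y" if x: "x \<in> carrier P" and y: "y \<in> carrier P" for x y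
  proof -
    let ?A = "{z. \<phi> x z \<noteq> 0} \<union> {z. \<phi> y z \<noteq> 0}"
    have xy: "x + y \<in> carrier P" using x y cP(4) by blast
    have e: "\<phi> (x + y) z = \<phi> x z + \<phi> y z" for z
      using coord_ops(2)[OF x y, of z] by (simp add: cP(1))
    have A: "finite ?A" "?A \<subseteq> B" using supB x y coord(3) by auto
    have "h (x + y) = (\<Sum>z\<in>?A. \<phi> (x + y) z \<odot>\<^bsub>N\<^esub> Y z)"
      by (rule hA[OF xy A(1) _ A(2)]) (auto simp: e)
    also have "\<dots> = (\<Sum>z\<in>?A. \<phi> x z \<odot>\<^bsub>N\<^esub> Y z + \<phi> y z \<odot>\<^bsub>N\<^esub> Y z)"
      unfolding e using coord(1) x y A(2) Y(2) sS(1) by (intro sum.cong refl cN(8)) blast+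
    also have "\<dots> = h x + h y"
      unfolding sum.distrib using hA[OF x A(1) _ A(2)] hA[OF y A(1) _ A(2)] by auto
    finally show ?thesis .
  qed
  have h_smult: "h (p \<odot>\<^bsub>P\<^esub> x) = p \<odot>\<^bsub>N\<^esub> h x" if p: "p \<in> pols V" and x: "x \<in> carrier P" for p x
  proof -
    let ?A = "{z. \<phi> x z \<noteq> 0}"
    have px: "p \<odot>\<^bsub>P\<^esub> x \<in> carrier P" using p x by (rule closed)
    have e: "\<phi> (p \<odot>\<^bsub>P\<^esub> x) z = p * \<phi> x z" for z using p x by (rule coord_ops)
    have "h (p \<odot>\<^bsub>P\<^esub> x) = (\<Sum>z\<in>?A. \<phi> (p \<odot>\<^bsub>P\<^esub> x) z \<odot>\<^bsub>N\<^esub> Y z)"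
      by (rule hA[OF px coord(3)[OF x] _ supB[OF x]]) (auto simp: e)
    also have "\<dots> = (\<Sum>z\<in>?A. p \<odot>\<^bsub>N\<^esub> (\<phi> x z \<odot>\<^bsub>N\<^esub> Y z))"
      unfolding e using coord(1)[OF x] supB[OF x] Y(2) sS(1) p by (intro sum.cong refl cN(10)) blast+
    also have "\<dots> = p \<odot>\<^bsub>N\<^esub> (\<Sum>z\<in>?A. \<phi> x z \<odot>\<^bsub>N\<^esub> Y z)"
    proof -
      have "(\<Sum>z\<in>A. p \<odot>\<^bsub>N\<^esub> (\<phi> x z \<odot>\<^bsub>N\<^esub> Y z)) = p \<odot>\<^bsub>N\<^esub> (\<Sum>z\<in>A. \<phi> x z \<odot>\<^bsub>N\<^esub> Y z)" if "finite A" "A \<subseteq> B" for A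
        using that
      proof (induction A rule: finite_induct)
        case empty
        then show ?case using cN(13)[OF p] by simp
      next
        case (insert z A)
        have "\<phi> x z \<odot>\<^bsub>N\<^esub> Y z \<in> carrier N" "(\<Sum>z\<in>A. \<phi> x z \<odot>\<^bsub>N\<^esub> Y z) \<in> carrier N"
        proof -
          have "\<And>y. y \<in> insert z A \<Longrightarrow> \<phi> x y \<odot>\<^bsub>N\<^esub> Y y \<in> S" using insert.prems tS[OF x] by blast
          then show "\<phi> x z \<odot>\<^bsub>N\<^esub> Y z \<in> carrier N" "(\<Sum>z\<in>A. \<phi> x z \<odot>\<^bsub>N\<^esub> Y z) \<in> carrier N"
            by (blast intro: sS(1) submod_sum[OF S])+
        qed
        then show ?case using insert cN(9)[OF p] by simp
      qed
      then show ?thesis using coord(3)[OF x] supB[OF x] by blast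
    qed
    finally show ?thesis by (simp add: h_def)
  qed
  have h_deg: "h x \<in> deg_part N (k + j)" if x: "x \<in> deg_part P k" for x k
    unfolding h_def
  proof (rule sum_closed[where P = "\<lambda>y. y \<in> deg_part N (k + j)"])
    fix z assume "z \<in> {z. \<phi> x z \<noteq> 0}"
    then have z: "z \<in> B" using supB[of x] x unfolding deg_part_iff by blast
    have "x \<in> carrier P" "homogeneous (k - \<delta> z) (\<phi> x z)" using x unfolding deg_part_iff by blast+
    then have "\<phi> x z \<odot>\<^bsub>N\<^esub> Y z \<in> deg_part N ((k - \<delta> z) + (\<delta> z + j))"
      by (intro cN(19) coord(1) Y(1) z)
    then show "\<phi> x z \<odot>\<^bsub>N\<^esub> Y z \<in> deg_part N (k + j)" by simp
  qed (use cN(16,17) in blast)+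
  have lin: "h \<in> lin_maps V j P N"
    unfolding lin_maps_iff[OF P N] using hS sS(1) h_add h_smult h_deg by blast
  have hb: "h (bas z) = Y z" if "z \<in> B" for z
  proof -
    have "h (bas z) = (\<Sum>y\<in>{z}. \<phi> (bas z) y \<odot>\<^bsub>N\<^esub> Y y)"
    proof (rule hA[OF bas(1)[OF that]])
      show "{y. \<phi> (bas z) y \<noteq> 0} \<subseteq> {z}" unfolding bas(2)[OF that] by (auto simp: sgl_def)
    qed (use that in simp_all)
    then show ?thesis by (simp add: bas(2)[OF that] cN(11)[OF sS(1)[OF Y(2)[OF that]]])
  qed
  have "h x \<in> S \<and> R x (h x)" if x: "x \<in> carrier P" for x
  proof -
    have "x \<in> carrier P \<and> R x (h x)"
      using x
    proof (induction rule: span_induct[consumes 1, case_names zero add smult])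
      case zero
      obtain y where "y \<in> deg_part N (0 + j)" "y \<in> S" "R 0 y" using R[of 0 0] cP(16) by blast
      then have "R (0 \<odot>\<^bsub>P\<^esub> 0) (0 \<odot>\<^bsub>N\<^esub> y)" using cP(3) by (intro R_mult) auto
      moreover have "0 \<odot>\<^bsub>P\<^esub> (0 :: 'a) = 0" "0 \<odot>\<^bsub>N\<^esub> y = 0" using cP(3,12) cN(12) \<open>y \<in> S\<close> sS(1) by blast+
      moreover have "h 0 = 0" using h_add[of 0 0] cP(3) by simp
      ultimately show ?case using cP(2,3) by simp
    next
      case (add x y)
      then show ?case using cP(1,4) h_add hS R_add[of x y "h x" "h y"] by simp
    next
      case (smult p z)
      note b = bas(1)[OF smult(2)]
      have "R (bas z) (h (bas z))" using Y(3)[OF smult(2)] by (simp only: hb[OF smult(2)])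
      from R_mult[OF smult(1) b hS[OF b] this] show ?case
        by (simp only: h_smult[OF smult(1) b] closed(3)[OF smult(1) b] simp_thms)
    qed
    then show ?thesis using hS by blast
  qed
  with lin show ?thesis by blast
qed

section \<open>Homotopies and morphisms into filtered factorizations\<close>

definition cfact :: "nat \<Rightarrow> mpol \<Rightarrow> nat set \<Rightarrow> 'm::ab_group_add factorization \<Rightarrow> bool" where
  "cfact n w V M \<longleftrightarrow> ring_vars M = V \<and> w \<in> pols V \<and> (\<forall>i. cmod V (component M i)) \<and>
     (\<forall>i. differential M i \<in> lin_maps V (int n + 1) (component M i) (component M (\<not> i))) \<and>
     (\<forall>i. \<forall>x\<in>carrier (component M i). differential M (\<not> i) (differential M i x) = w \<odot>\<^bsub>component M i\<^esub> x)"

text \<open>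
  The filtration \<open>F\<close> abstracts the filtration of a Koszul factorization by exterior degree, with
  \<open>F 0\<close> the kernel of the augmentation to the module that is resolved.
\<close>

definition resolved :: "nat \<Rightarrow> mpol \<Rightarrow> nat set \<Rightarrow> 'm::ab_group_add factorization \<Rightarrow> (nat \<Rightarrow> bool \<Rightarrow> 'm set) \<Rightarrow> bool" where
  "resolved n w V M F \<longleftrightarrow> cfact n w V M \<and>
     (\<forall>k i. submod V (component M i) (F k i)) \<and> (\<forall>k i. F (Suc k) i \<subseteq> F k i) \<and> (\<exists>N. \<forall>i. F N i = {0}) \<and>
     F 0 True = carrier (component M True) \<and> (\<forall>x\<in>carrier (component M True). differential M True x \<in> F 0 False) \<and>
     (\<forall>k i j x. x \<in> F k i \<longrightarrow> x \<in> deg_part (component M i) j \<longrightarrow> differential M i x \<in> F k (\<not> i) \<longrightarrow>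
        (\<exists>y\<in>F (Suc k) (\<not> i). y \<in> deg_part (component M (\<not> i)) (j - int n - 1) \<and> x - differential M (\<not> i) y \<in> F (Suc k) i))"

lemma resolvedD:
  assumes "resolved n w V M F"
  shows "cfact n w V M" "submod V (component M i) (F k i)" "F (Suc k) i \<subseteq> F k i" "\<exists>N. \<forall>i. F N i = {0}"
    "F 0 True = carrier (component M True)" "x \<in> carrier (component M True) \<Longrightarrow> differential M True x \<in> F 0 False"
    "x \<in> F k i \<Longrightarrow> x \<in> deg_part (component M i) j \<Longrightarrow> differential M i x \<in> F k (\<not> i) \<Longrightarrow>
       \<exists>y\<in>F (Suc k) (\<not> i). y \<in> deg_part (component M (\<not> i)) (j - int n - 1) \<and> x - differential M (\<not> i) y \<in> F (Suc k) i"
  using assms unfolding resolved_def by blast+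

lemma cfactD:
  assumes "cfact n w V M"
  shows "ring_vars M = V" "w \<in> pols V" "cmod V (component M i)"
    "differential M i \<in> lin_maps V (int n + 1) (component M i) (component M (\<not> i))"
    "x \<in> carrier (component M i) \<Longrightarrow> differential M (\<not> i) (differential M i x) = w \<odot>\<^bsub>component M i\<^esub> x"
  using assms unfolding cfact_def by blast+

text \<open>The sign belonging to parity p. It lets one argument cover homotopies between morphisms
  (p even) and the correction of a linear map to a morphism (p odd).\<close>

definition psgn :: "bool \<Rightarrow> 'm::ab_group_add \<Rightarrow> 'm" where
  "psgn p x = (if p then - x else x)"

lemma psgn_simps [simp]: "psgn p 0 = 0" "psgn p (x + y) = psgn p x + psgn p y" "psgn p (x - y) = psgn p x - psgn p y"
  "psgn p (psgn p x) = x" "psgn False x = x" "psgn True x = - x"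
  by (auto simp: psgn_def)

lemma lin_maps_psgn: "f \<in> lin_maps V k M N \<Longrightarrow> cmod V M \<Longrightarrow> cmod V N \<Longrightarrow> (\<lambda>x. psgn p (f x)) \<in> lin_maps V k M N"
  using lin_maps_uminus[of f V k M N] by (cases p) simp_all

lemma lin_maps_diff:
  "f \<in> lin_maps V k M N \<Longrightarrow> g \<in> lin_maps V k M N \<Longrightarrow> cmod V M \<Longrightarrow> cmod V N \<Longrightarrow> (\<lambda>x. f x - g x) \<in> lin_maps V k M N"
  using lin_maps_add[of f V k M N "\<lambda>x. - g x"] lin_maps_uminus[of g V k M N] by simp

lemma psgn_submod: "cmod V M \<Longrightarrow> submod V M S \<Longrightarrow> x \<in> S \<Longrightarrow> psgn p x \<in> S"
  by (auto simp: psgn_def submod_uminus)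

lemma psgn_closed: "cmod V M \<Longrightarrow> x \<in> carrier M \<Longrightarrow> psgn p x \<in> carrier M"
  by (simp add: psgn_def cmodD(5))

text \<open>
  A cocycle of parity \<open>p\<close> from a free factorization is pushed down the filtration one step at
  a time.
\<close>

lemma null_homotopy:
  fixes P :: "'a::ab_group_add factorization" and K :: "'b::ab_group_add factorization"
  assumes P: "cfact n w V P" and K: "resolved n w V K F"
    and f: "\<And>i. f i \<in> lin_maps V j (component P i) (component K (i \<noteq> p))"
    and fF: "\<And>i x. x \<in> carrier (component P i) \<Longrightarrow> f i x \<in> F k (i \<noteq> p)"
    and comm: "\<And>i x. x \<in> carrier (component P i) \<Longrightarrow>
      differential K (i \<noteq> p) (f i x) = psgn p (f (\<not> i) (differential P i x))"
  shows "\<exists>h. (\<forall>i. h i \<in> lin_maps V (j - int n - 1) (component P i) (component K (i = p))) \<and>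
    (\<forall>i. \<forall>x\<in>carrier (component P i). h i x \<in> F 0 (i = p) \<and>
       f i x = differential K (i = p) (h i x) + psgn p (h (\<not> i) (differential P i x)))"
proof -
  obtain N where N: "\<And>i. F N i = {0}" using resolvedD(4)[OF K] by blast
  note cP = cfactD[OF P] and cK = cfactD[OF resolvedD(1)[OF K]] and sub = resolvedD(2)[OF K]
  have anti: "k \<le> l \<Longrightarrow> F l i \<subseteq> F k i" for k l i
    using resolvedD(3)[OF K] by (induction l) (auto simp: le_Suc_eq)
  have dPc: "x \<in> carrier (component P i) \<Longrightarrow> differential P i x \<in> carrier (component P (\<not> i))" for i x
    using lin_mapsD(1)[OF cP(4) cP(3) cP(3)] .
  show ?thesis
    using f fF comm
  \<comment> \<open>Induction on the distance to the step where the filtration is zero; once it is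
    reached, \<open>f\<close> itself vanishes.\<close>
  proof (induction "N - k" arbitrary: k f)
    case 0
    then have "F k i \<subseteq> {0}" for i using anti[of N k i] N by simp
    then have "f i x = 0" if "x \<in> carrier (component P i)" for i x
      using 0(3)[OF that] by blast
    then show ?case
      using lin_maps_0[OF cP(3) cK(3)] submodD(2)[OF sub] lin_mapsD(5)[OF cK(4) cK(3) cK(3)]
      by (intro exI[of _ "\<lambda>i x. 0"]) simp
  next
    case (Suc l)
    note f = Suc.prems(1) and fF = Suc.prems(2) and comm = Suc.prems(3)
    note fl = lin_mapsD[OF f cP(3) cK(3)]
    have nn: "(\<not> (i \<noteq> p)) = (i = p)" "((\<not> i) \<noteq> p) = (i = p)" "((\<not> i) = p) = (i \<noteq> p)" for i by auto
    \<comment> \<open>By the cocycle condition the differential sends \<open>f i x\<close> into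
      \<open>F k\<close> again, which is the premise of the approximation property in
      \<open>resolved\<close>. It applies to homogeneous elements, and \<open>extend_linear\<close>
      makes the choice linear.\<close>
    have "\<exists>h\<in>lin_maps V (j - int n - 1) (component P i) (component K (i = p)).
        \<forall>x\<in>carrier (component P i). h x \<in> F (Suc k) (i = p) \<and> f i x - differential K (i = p) (h x) \<in> F (Suc k) (i \<noteq> p)" for i
    proof (rule extend_linear[where R = "\<lambda>x y. f i x - differential K (i = p) y \<in> F (Suc k) (i \<noteq> p)", OF cP(3) cK(3) sub])
      note dK = lin_mapsD[OF cK(4)[of "i = p"] cK(3) cK(3), unfolded nn]
      note Fc = submodD(1)[OF sub[where i = "i = p"]]
      fix x d assume x: "x \<in> deg_part (component P i) d"
      have xc: "x \<in> carrier (component P i)" using cmodD(15)[OF cP(3) x] .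
      have "differential K (i \<noteq> p) (f i x) \<in> F k (\<not> (i \<noteq> p))"
        unfolding comm[OF xc] using fF[OF dPc[OF xc]] psgn_submod[OF cK(3) sub] by (simp add: nn)
      from resolvedD(7)[OF K fF[OF xc] fl(4)[OF x] this]
      show "\<exists>y\<in>deg_part (component K (i = p)) (d + (j - int n - 1)). y \<in> F (Suc k) (i = p) \<and>
          f i x - differential K (i = p) y \<in> F (Suc k) (i \<noteq> p)"
        unfolding nn by (auto simp: algebra_simps)
    next
      note dK = lin_mapsD[OF cK(4)[of "i = p"] cK(3) cK(3), unfolded nn]
      note Fc = submodD(1)[OF sub[where i = "i = p"]]
      {
        fix x x' y y' assume *: "x \<in> carrier (component P i)" "x' \<in> carrier (component P i)"
          "y \<in> F (Suc k) (i = p)" "y' \<in> F (Suc k) (i = p)"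
          "f i x - differential K (i = p) y \<in> F (Suc k) (i \<noteq> p)" "f i x' - differential K (i = p) y' \<in> F (Suc k) (i \<noteq> p)"
        have "f i (x + x') - differential K (i = p) (y + y') =
            (f i x - differential K (i = p) y) + (f i x' - differential K (i = p) y')"
          by (simp add: fl(2)[OF *(1,2)] dK(2)[OF Fc[OF *(3)] Fc[OF *(4)]])
        then show "f i (x + x') - differential K (i = p) (y + y') \<in> F (Suc k) (i \<noteq> p)"
          using submodD(3)[OF sub *(5,6)] by simp
      next
        fix q x y assume *: "q \<in> pols V" "x \<in> carrier (component P i)" "y \<in> F (Suc k) (i = p)"
          "f i x - differential K (i = p) y \<in> F (Suc k) (i \<noteq> p)"
        have d: "differential K (i = p) y \<in> carrier (component K (i \<noteq> p))" using dK(1) Fc *(3) by blast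
        have "f i (q \<odot>\<^bsub>component P i\<^esub> x) - differential K (i = p) (q \<odot>\<^bsub>component K (i = p)\<^esub> y) =
            q \<odot>\<^bsub>component K (i \<noteq> p)\<^esub> (f i x + - differential K (i = p) y)"
          unfolding cmodD(9)[OF cK(3) *(1) fl(1)[OF *(2)] cmodD(5)[OF cK(3) d]] cmod_smult_uminus[OF cK(3) *(1) d]
          by (simp add: fl(3)[OF *(1,2)] dK(3)[OF *(1) Fc[OF *(3)]])
        then show "f i (q \<odot>\<^bsub>component P i\<^esub> x) - differential K (i = p) (q \<odot>\<^bsub>component K (i = p)\<^esub> y) \<in> F (Suc k) (i \<noteq> p)"
          using submodD(4)[OF sub *(1,4)] by simp
      }
    qed
    then obtain h where h: "\<And>i. h i \<in> lin_maps V (j - int n - 1) (component P i) (component K (i = p))"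
      "\<And>i x. x \<in> carrier (component P i) \<Longrightarrow> h i x \<in> F (Suc k) (i = p)"
      "\<And>i x. x \<in> carrier (component P i) \<Longrightarrow> f i x - differential K (i = p) (h i x) \<in> F (Suc k) (i \<noteq> p)"
      by metis
    note hl = lin_mapsD[OF h(1) cP(3) cK(3)]
    have h': "h (\<not> i) \<in> lin_maps V (j - int n - 1) (component P (\<not> i)) (component K (i \<noteq> p))" for i
      using h(1)[of "\<not> i"] unfolding nn .
    have dK': "differential K (i = p) \<in> lin_maps V (int n + 1) (component K (i = p)) (component K (i \<noteq> p))" for i
      using cK(4)[of "i = p"] unfolding nn .
    \<comment> \<open>The remainder after this approximation lies one filtration step further and is
      again a cocycle of parity \<open>p\<close>: the two terms in which \<open>w\<close> appears
      cancel.\<close>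
    define f' where "f' i x = f i x - (differential K (i = p) (h i x) + psgn p (h (\<not> i) (differential P i x)))" for i x
    have "f' i \<in> lin_maps V j (component P i) (component K (i \<noteq> p))" for i
    proof -
      have "(\<lambda>x. differential K (i = p) (h i x)) \<in> lin_maps V ((j - int n - 1) + (int n + 1)) (component P i) (component K (i \<noteq> p))"
        by (rule lin_maps_comp[OF h(1) dK'])
      moreover have "(\<lambda>x. h (\<not> i) (differential P i x)) \<in> lin_maps V ((int n + 1) + (j - int n - 1)) (component P i) (component K (i \<noteq> p))"
        by (rule lin_maps_comp[OF cP(4) h'])
      ultimately show ?thesis
        unfolding f'_def by (intro lin_maps_diff lin_maps_add lin_maps_psgn f cP(3) cK(3)) simp_all
    qed
    moreover have "f' i x \<in> F (Suc k) (i \<noteq> p)" if x: "x \<in> carrier (component P i)" for i x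
    proof -
      have "psgn p (h (\<not> i) (differential P i x)) \<in> F (Suc k) (i \<noteq> p)"
        using h(2)[OF dPc[OF x]] psgn_submod[OF cK(3) sub] by (simp add: nn)
      from submod_diff[OF cK(3) sub h(3)[OF x] this] show ?thesis
        by (simp add: f'_def diff_diff_eq)
    qed
    moreover have "differential K (i \<noteq> p) (f' i x) = psgn p (f' (\<not> i) (differential P i x))"
      if x: "x \<in> carrier (component P i)" for i x
    proof -
      note dx = dPc[OF x]
      have hx: "h i x \<in> carrier (component K (i = p))" by (rule hl(1)[OF x])
      have hdx: "h (\<not> i) (differential P i x) \<in> carrier (component K (i \<noteq> p))" using hl(1)[OF dx] unfolding nn .
      have phdx: "psgn p (h (\<not> i) (differential P i x)) \<in> carrier (component K (i \<noteq> p))"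
        by (rule psgn_closed[OF cK(3) hdx])
      have dh: "differential K (i = p) (h i x) \<in> carrier (component K (i \<noteq> p))"
        using lin_mapsD(1)[OF dK' cK(3) cK(3) hx] .
      note d = lin_mapsD[OF cK(4)[of "i \<noteq> p"] cK(3) cK(3), unfolded nn]
      have dps: "differential K (i \<noteq> p) (psgn p y) = psgn p (differential K (i \<noteq> p) y)"
        if "y \<in> carrier (component K (i \<noteq> p))" for y
        by (cases p) (use d(6)[OF that] in simp_all)
      have "differential K (i \<noteq> p) (f' i x) = psgn p (f (\<not> i) (differential P i x)) -
          (w \<odot>\<^bsub>component K (i = p)\<^esub> h i x + psgn p (differential K (i \<noteq> p) (h (\<not> i) (differential P i x))))"
        unfolding f'_def d(7)[OF fl(1)[OF x] cmodD(4)[OF cK(3) dh phdx]] d(2)[OF dh phdx] dps[OF hdx] comm[OF x]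
        using cK(5)[OF hx] by (simp add: nn)
      moreover have "h i (differential P (\<not> i) (differential P i x)) = w \<odot>\<^bsub>component K (i = p)\<^esub> h i x"
        unfolding cP(5)[OF x] by (rule hl(3)[OF cP(2) x])
      ultimately show ?thesis
        unfolding f'_def by (simp add: nn add.commute)
    qed
    ultimately obtain h2 where h2: "\<And>i. h2 i \<in> lin_maps V (j - int n - 1) (component P i) (component K (i = p))"
      "\<And>i x. x \<in> carrier (component P i) \<Longrightarrow> h2 i x \<in> F 0 (i = p)"
      "\<And>i x. x \<in> carrier (component P i) \<Longrightarrow> f' i x = differential K (i = p) (h2 i x) + psgn p (h2 (\<not> i) (differential P i x))"
      using Suc.hyps(1)[of "Suc k" f'] Suc.hyps(2) by force
    note h2l = lin_mapsD[OF h2(1) cP(3) cK(3)]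
    show ?case
    proof (intro exI[of _ "\<lambda>i x. h i x + h2 i x"] conjI allI ballI)
      show "(\<lambda>x. h i x + h2 i x) \<in> lin_maps V (j - int n - 1) (component P i) (component K (i = p))" for i
        by (intro lin_maps_add h(1) h2(1) cP(3) cK(3))
      fix i x assume x: "x \<in> carrier (component P i)"
      show "h i x + h2 i x \<in> F 0 (i = p)"
        using h(2)[OF x] h2(2)[OF x] anti[of 0 "Suc k" "i = p"] submodD(3)[OF sub] by blast
      have "differential K (i = p) (h i x + h2 i x) = differential K (i = p) (h i x) + differential K (i = p) (h2 i x)"
        by (rule lin_mapsD(2)[OF dK' cK(3) cK(3) hl(1)[OF x] h2l(1)[OF x]])
      then show "f i x = differential K (i = p) (h i x + h2 i x) +
          psgn p (h (\<not> i) (differential P i x) + h2 (\<not> i) (differential P i x))"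
        using h2(3)[OF x] by (simp add: f'_def algebra_simps)
    qed
  qed
qed

lemma factorization_homI:
  assumes "cfact n w V M"
    and "\<And>i. f i \<in> lin_maps V 0 (component M i) (component N i)"
    and "\<And>i x. x \<in> carrier (component M i) \<Longrightarrow> f (\<not> i) (differential M i x) = differential N i (f i x)"
  shows "factorization_hom M N f"
  using assms cfactD(1)[OF assms(1)] unfolding factorization_hom_def by blast

lemma factorization_homD:
  assumes "factorization_hom M N f" "cfact n w V M"
  shows "f i \<in> lin_maps V 0 (component M i) (component N i)"
    "x \<in> carrier (component M i) \<Longrightarrow> f (\<not> i) (differential M i x) = differential N i (f i x)"
  using assms cfactD(1)[OF assms(2)] unfolding factorization_hom_def by blast+

text \<open>\<open>R\<close> encodes a map from the even part of \<open>P\<close> to the even part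
  of \<open>K\<close> modulo \<open>F 0\<close> that kills boundaries. It is lifted linearly on the
  even part and by 0 on the odd part. The failure to commute with the differentials is an odd
  cocycle with values in \<open>F 0\<close>, and its null homotopy is subtracted.\<close>

lemma lift_morphism:
  fixes P :: "'a::ab_group_add factorization" and K :: "'b::ab_group_add factorization"
  assumes P: "cfact n w V P" and K: "resolved n w V K F"
    and R: "\<And>x k. x \<in> deg_part (component P False) k \<Longrightarrow> \<exists>y\<in>deg_part (component K False) k. R x y"
    and R_add: "\<And>x x' y y'. x \<in> carrier (component P False) \<Longrightarrow> x' \<in> carrier (component P False) \<Longrightarrow>
       y \<in> carrier (component K False) \<Longrightarrow> y' \<in> carrier (component K False) \<Longrightarrow> R x y \<Longrightarrow> R x' y' \<Longrightarrow> R (x + x') (y + y')"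
    and R_mult: "\<And>p x y. p \<in> pols V \<Longrightarrow> x \<in> carrier (component P False) \<Longrightarrow> y \<in> carrier (component K False) \<Longrightarrow>
       R x y \<Longrightarrow> R (p \<odot>\<^bsub>component P False\<^esub> x) (p \<odot>\<^bsub>component K False\<^esub> y)"
    and R_F: "\<And>x y y'. x \<in> carrier (component P False) \<Longrightarrow> y \<in> carrier (component K False) \<Longrightarrow> y' \<in> F 0 False \<Longrightarrow> R x y \<Longrightarrow> R x (y + y')"
    and R_d: "\<And>x y. x \<in> carrier (component P True) \<Longrightarrow> y \<in> carrier (component K False) \<Longrightarrow> R (differential P True x) y \<Longrightarrow> y \<in> F 0 False"
  shows "\<exists>f. factorization_hom P K f \<and> (\<forall>x\<in>carrier (component P False). R x (f False x))"
proof -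
  note cP = cfactD[OF P] and cK = cfactD[OF resolvedD(1)[OF K]] and sub = resolvedD(2)[OF K]
  have S: "submod V (component K False) (carrier (component K False))"
    using cmodD[OF cK(3)] by (simp add: submod_def)
  have "\<exists>h\<in>lin_maps V 0 (component P False) (component K False).
      \<forall>x\<in>carrier (component P False). h x \<in> carrier (component K False) \<and> R x (h x)"
  proof (rule extend_linear[where R = R, OF cP(3) cK(3) S])
    fix x k assume x: "x \<in> deg_part (component P False) k"
    then show "\<exists>y\<in>deg_part (component K False) (k + 0). y \<in> carrier (component K False) \<and> R x y"
      using R[OF x] cmodD(15)[OF cK(3)] by auto
  qed (use R_add R_mult in blast)+
  then obtain \<phi> where \<phi>: "\<phi> \<in> lin_maps V 0 (component P False) (component K False)"
    "\<And>x. x \<in> carrier (component P False) \<Longrightarrow> \<phi> x \<in> carrier (component K False) \<and> R x (\<phi> x)" by blast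
  define f0 where "f0 i = (if i then (\<lambda>x. 0) else \<phi>)" for i
  have f0: "f0 i \<in> lin_maps V 0 (component P i) (component K i)" for i
    using \<phi>(1) lin_maps_0[OF cP(3) cK(3)] by (cases i) (simp_all add: f0_def)
  note f0l = lin_mapsD[OF f0 cP(3) cK(3)] and dP = lin_mapsD[OF cP(4) cP(3) cP(3)] and dK = lin_mapsD[OF cK(4) cK(3) cK(3)]
  \<comment> \<open>The defect of \<open>f0\<close>. It takes values in \<open>F 0\<close>: in the
    odd component this is no condition, and in the even component it holds because \<open>R\<close>
    relates boundaries only to members of \<open>F 0\<close>.\<close>
  define D where "D i x = differential K i (f0 i x) - f0 (\<not> i) (differential P i x)" for i x
  have D: "D i \<in> lin_maps V (int n + 1) (component P i) (component K (\<not> i))" for i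
    using lin_maps_diff[OF lin_maps_comp[OF f0 cK(4), simplified] lin_maps_comp[OF cP(4) f0, simplified] cP(3) cK(3), of i]
    by (simp add: D_def[abs_def])
  have DF: "D i x \<in> F 0 (\<not> i)" if x: "x \<in> carrier (component P i)" for i x
  proof (cases i)
    case True
    have "\<phi> (differential P True x) \<in> F 0 False"
      using R_d \<phi>(2) dP(1)[of x True] x True by auto
    then show ?thesis
      using submod_uminus[OF cK(3) sub] dK(5)[of True] True by (simp add: D_def f0_def)
  next
    case False
    then show ?thesis using lin_mapsD(1)[OF D cP(3) cK(3) x] resolvedD(5)[OF K] by simp
  qed
  have comm: "differential K (\<not> i) (D i x) = - D (\<not> i) (differential P i x)" if x: "x \<in> carrier (component P i)" for i x
  proof -
    have "differential K (\<not> i) (D i x) = w \<odot>\<^bsub>component K i\<^esub> f0 i x - differential K (\<not> i) (f0 (\<not> i) (differential P i x))"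
      unfolding D_def using dK(7)[OF dK(1)[OF f0l(1)[OF x]] f0l(1)[OF dP(1)[OF x]]] cK(5)[OF f0l(1)[OF x]] by simp
    moreover have "f0 i (differential P (\<not> i) (differential P i x)) = w \<odot>\<^bsub>component K i\<^esub> f0 i x"
      unfolding cP(5)[OF x] by (rule f0l(3)[OF cP(2) x])
    ultimately show ?thesis by (simp add: D_def)
  qed
  have "\<exists>h. (\<forall>i. h i \<in> lin_maps V 0 (component P i) (component K i)) \<and> (\<forall>i. \<forall>x\<in>carrier (component P i).
      h i x \<in> F 0 i \<and> D i x = differential K i (h i x) - h (\<not> i) (differential P i x))"
    using null_homotopy[OF P K, of D "int n + 1" True 0] D DF comm by simp
  then obtain h where h: "\<And>i. h i \<in> lin_maps V 0 (component P i) (component K i)"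
    "\<And>i x. x \<in> carrier (component P i) \<Longrightarrow> h i x \<in> F 0 i"
    "\<And>i x. x \<in> carrier (component P i) \<Longrightarrow> D i x = differential K i (h i x) - h (\<not> i) (differential P i x)"
    by blast
  note hl = lin_mapsD[OF h(1) cP(3) cK(3)]
  define f where "f i x = f0 i x - h i x" for i x
  have "factorization_hom P K f"
  proof (rule factorization_homI[OF P])
    show "f i \<in> lin_maps V 0 (component P i) (component K i)" for i
      unfolding f_def by (rule lin_maps_diff[OF f0 h(1) cP(3) cK(3)])
    show "f (\<not> i) (differential P i x) = differential K i (f i x)" if x: "x \<in> carrier (component P i)" for i x
      using h(3)[OF x] unfolding f_def D_def dK(7)[OF f0l(1)[OF x] hl(1)[OF x]] by (simp add: algebra_simps)
  qed
  moreover have "R x (f False x)" if x: "x \<in> carrier (component P False)" for x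
    using R_F[OF x _ submod_uminus[OF cK(3) sub h(2)[OF x]], of "\<phi> x"] \<phi>(2)[OF x] by (simp add: f_def f0_def)
  ultimately show ?thesis by blast
qed

definition heq :: "nat \<Rightarrow> 'a factorization \<Rightarrow> 'b factorization \<Rightarrow> bool" where
  "heq n M N \<longleftrightarrow> (\<exists>f g. factorization_hom M N f \<and> factorization_hom N M g \<and>
     homotopic n M M (\<lambda>i. g i \<circ> f i) (\<lambda>i. id) \<and> homotopic n N N (\<lambda>i. f i \<circ> g i) (\<lambda>i. id))"

text \<open>The difference of g f and the identity is an even cocycle. Its even values are in
  \<open>F 0\<close> by assumption and its odd values because the odd part of \<open>F 0\<close> is
  everything, so \<open>null_homotopy\<close> applies.\<close>

lemma homotopic_id:
  fixes M :: "'a::ab_group_add factorization" and N :: "'b::ab_group_add factorization"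
  assumes M: "resolved n w V M F" and N: "cfact n w V N"
    and f: "factorization_hom M N f" and g: "factorization_hom N M g"
    and gf: "\<And>x. x \<in> carrier (component M False) \<Longrightarrow> g False (f False x) - x \<in> F 0 False"
  shows "homotopic n M M (\<lambda>i. g i \<circ> f i) (\<lambda>i. id)"
proof -
  note cf = resolvedD(1)[OF M]
  note cM = cfactD[OF cf] and cN = cfactD[OF N]
  note f = factorization_homD[OF f cf] and g = factorization_homD[OF g N]
  note dM = lin_mapsD[OF cM(4) cM(3) cM(3)]
  define e where "e i x = g i (f i x) - x" for i x
  have e: "e i \<in> lin_maps V 0 (component M i) (component M i)" for i
    using lin_maps_diff[OF lin_maps_comp[OF f(1) g(1), simplified] lin_maps_id[of V] cM(3) cM(3)]
    by (simp add: e_def[abs_def])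
  note el = lin_mapsD[OF e cM(3) cM(3)]
  have fc: "x \<in> carrier (component M i) \<Longrightarrow> f i x \<in> carrier (component N i)" for i x
    by (rule lin_mapsD(1)[OF f(1) cM(3) cN(3)])
  have gc: "y \<in> carrier (component N i) \<Longrightarrow> g i y \<in> carrier (component M i)" for i y
    by (rule lin_mapsD(1)[OF g(1) cN(3) cM(3)])
  have 1: "e i x \<in> F 0 i" if x: "x \<in> carrier (component M i)" for i x
    using gf[of x] el(1)[OF x] resolvedD(5)[OF M] x by (cases i) (simp_all add: e_def)
  have 2: "differential M i (e i x) = e (\<not> i) (differential M i x)" if x: "x \<in> carrier (component M i)" for i x
    using dM(7)[OF gc[OF fc[OF x]] x] g(2)[OF fc[OF x]] f(2)[OF x] by (simp add: e_def)
  have "\<exists>h. (\<forall>i. h i \<in> lin_maps V (- int n - 1) (component M i) (component M (\<not> i))) \<and> (\<forall>i. \<forall>x\<in>carrier (component M i).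
      h i x \<in> F 0 (\<not> i) \<and> e i x = differential M (\<not> i) (h i x) + h (\<not> i) (differential M i x))"
    using null_homotopy[OF cf M, of e 0 False 0] e 1 2 by simp
  then obtain h where h: "\<And>i. h i \<in> lin_maps V (- int n - 1) (component M i) (component M (\<not> i))"
    "\<And>i x. x \<in> carrier (component M i) \<Longrightarrow> e i x = differential M (\<not> i) (h i x) + h (\<not> i) (differential M i x)"
    by blast
  show ?thesis
    unfolding homotopic_def cM(1)
  proof (intro exI[of _ h] conjI allI ballI)
    fix i x assume x: "x \<in> carrier (component M i)"
    show "(g i \<circ> f i) x \<ominus>\<^bsub>component M i\<^esub> id x =
      h (\<not> i) (differential M i x) \<oplus>\<^bsub>component M i\<^esub> differential M (\<not> i) (h i x)"
      using h(2)[OF x] cmod_a_minus[OF cM(3) x] by (simp add: cmodD(1)[OF cM(3)] e_def add.commute)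
  qed (rule h)
qed

text \<open>\<open>R\<close> is the graph of an isomorphism between the even parts modulo
  \<open>F 0\<close> and \<open>G 0\<close>, given as a relation so that no map between quotients
  has to be constructed. It is lifted in both directions, and each round trip agrees with the
  identity modulo step 0 of the filtration.\<close>

theorem heq_resolved:
  fixes M :: "'a::ab_group_add factorization" and N :: "'b::ab_group_add factorization"
  assumes M: "resolved n w V M F" and N: "resolved n w V N G"
    and R1: "\<And>x k. x \<in> deg_part (component M False) k \<Longrightarrow> \<exists>y\<in>deg_part (component N False) k. R x y"
    and R2: "\<And>y k. y \<in> deg_part (component N False) k \<Longrightarrow> \<exists>x\<in>deg_part (component M False) k. R x y"
    and R_add: "\<And>x x' y y'. x \<in> carrier (component M False) \<Longrightarrow> x' \<in> carrier (component M False) \<Longrightarrow>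
       y \<in> carrier (component N False) \<Longrightarrow> y' \<in> carrier (component N False) \<Longrightarrow> R x y \<Longrightarrow> R x' y' \<Longrightarrow> R (x + x') (y + y')"
    and R_mult: "\<And>p x y. p \<in> pols V \<Longrightarrow> x \<in> carrier (component M False) \<Longrightarrow> y \<in> carrier (component N False) \<Longrightarrow>
       R x y \<Longrightarrow> R (p \<odot>\<^bsub>component M False\<^esub> x) (p \<odot>\<^bsub>component N False\<^esub> y)"
    and R_F: "\<And>x y. x \<in> F 0 False \<Longrightarrow> y \<in> G 0 False \<Longrightarrow> R x y"
    and R_l: "\<And>x y. x \<in> F 0 False \<Longrightarrow> y \<in> carrier (component N False) \<Longrightarrow> R x y \<Longrightarrow> y \<in> G 0 False"
    and R_r: "\<And>x y. x \<in> carrier (component M False) \<Longrightarrow> y \<in> G 0 False \<Longrightarrow> R x y \<Longrightarrow> x \<in> F 0 False"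
  shows "heq n M N"
proof -
  note cfM = resolvedD(1)[OF M] and cfN = resolvedD(1)[OF N]
  note cM = cfactD[OF cfM] and cN = cfactD[OF cfN]
  note sM = resolvedD(2)[OF M] and sN = resolvedD(2)[OF N]
  have R_minus: "R (x - x') (y - y')" if *: "x \<in> carrier (component M False)" "x' \<in> carrier (component M False)"
      "y \<in> carrier (component N False)" "y' \<in> carrier (component N False)" "R x y" "R x' y'" for x x' y y'
  proof -
    have "R (- x') (- y')"
      using R_mult[OF _ *(2,4,6), of "- 1"] cmodD(14)[OF cM(3) *(2)] cmodD(14)[OF cN(3) *(4)]
        pols_uminus[OF pols_1, of V] by simp
    then show ?thesis
      using R_add[OF *(1) cmodD(5)[OF cM(3) *(2)] *(3) cmodD(5)[OF cN(3) *(4)] *(5)] by simp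
  qed
  have "\<exists>f. factorization_hom M N f \<and> (\<forall>x\<in>carrier (component M False). R x (f False x))"
  proof (rule lift_morphism[OF cfM N])
    fix x y y' assume *: "x \<in> carrier (component M False)" "y \<in> carrier (component N False)" "y' \<in> G 0 False" "R x y"
    show "R x (y + y')"
      using R_add[OF *(1) cmodD(3)[OF cM(3)] *(2) submodD(1)[OF sN *(3)] *(4) R_F[OF submodD(2)[OF sM] *(3)]] by simp
  next
    fix x y assume "x \<in> carrier (component M True)" "y \<in> carrier (component N False)" "R (differential M True x) y"
    then show "y \<in> G 0 False" using resolvedD(6)[OF M] R_l by blast
  qed (use R1 R_add R_mult in blast)+
  then obtain f where f: "factorization_hom M N f" "\<And>x. x \<in> carrier (component M False) \<Longrightarrow> R x (f False x)" by blast
  have "\<exists>g. factorization_hom N M g \<and> (\<forall>y\<in>carrier (component N False). R (g False y) y)"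
  proof (rule lift_morphism[where R = "\<lambda>y x. R x y", OF cfN M])
    fix y x x' assume *: "y \<in> carrier (component N False)" "x \<in> carrier (component M False)" "x' \<in> F 0 False" "R x y"
    show "R (x + x') y"
      using R_add[OF *(2) submodD(1)[OF sM *(3)] *(1) cmodD(3)[OF cN(3)] *(4) R_F[OF *(3) submodD(2)[OF sN]]] by simp
  next
    fix y x assume "y \<in> carrier (component N True)" "x \<in> carrier (component M False)" "R x (differential N True y)"
    then show "x \<in> F 0 False" using resolvedD(6)[OF N] R_r by blast
  qed (use R2 R_add R_mult in blast)+
  then obtain g where g: "factorization_hom N M g" "\<And>y. y \<in> carrier (component N False) \<Longrightarrow> R (g False y) y" by blast
  have fc: "x \<in> carrier (component M False) \<Longrightarrow> f False x \<in> carrier (component N False)" for x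
    by (rule lin_mapsD(1)[OF factorization_homD(1)[OF f(1) cfM] cM(3) cN(3)])
  have gc: "y \<in> carrier (component N False) \<Longrightarrow> g False y \<in> carrier (component M False)" for y
    by (rule lin_mapsD(1)[OF factorization_homD(1)[OF g(1) cfN] cN(3) cM(3)])
  have "g False (f False x) - x \<in> F 0 False" if x: "x \<in> carrier (component M False)" for x
  proof (rule R_r)
    show "g False (f False x) - x \<in> carrier (component M False)"
      by (intro cmod_diff[OF cM(3)] gc fc x)
    show "R (g False (f False x) - x) 0"
      using R_minus[OF gc[OF fc[OF x]] x fc[OF x] fc[OF x] g(2)[OF fc[OF x]] f(2)[OF x]] by simp
  qed (rule submodD(2)[OF sN])
  moreover have "f False (g False y) - y \<in> G 0 False" if y: "y \<in> carrier (component N False)" for y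
  proof (rule R_l)
    show "f False (g False y) - y \<in> carrier (component N False)"
      by (intro cmod_diff[OF cN(3)] gc fc y)
    show "R 0 (f False (g False y) - y)"
      using R_minus[OF gc[OF y] gc[OF y] fc[OF gc[OF y]] y f(2)[OF gc[OF y]] g(2)[OF y]] by simp
  qed (rule submodD(2)[OF sM])
  ultimately show ?thesis
    unfolding heq_def using homotopic_id[OF M cfN f(1) g(1)] homotopic_id[OF N cfM g(1) f(1)] f(1) g(1) by blast
qed

subsection \<open>Koszul factorizations of regular sequences\<close>

lemma cnt_le_length: "cnt xs \<le> length xs"
  by (induction xs) auto

lemma chain_hpart:
  assumes "y \<in> chain V l c" shows "(\<lambda>xs. hpart (g xs) (y xs)) \<in> chain V l c"
  unfolding chain_def mem_Collect_eq
proof (intro allI conjI impI)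
  fix xs
  show "hpart (g xs) (y xs) \<in> pols V" using assms by (intro hpart_pols chainD(1))
  assume "hpart (g xs) (y xs) \<noteq> 0"
  then have "y xs \<noteq> 0" by auto
  then show "length xs = l" "cnt xs = c" using assms by (auto simp: chain_def)
qed

lemma dl_snd_pairs: "dl n (snd_pairs ps) xs = dl n ps xs"
  by (induction n ps xs rule: dl.induct) auto

lemma cmod_fmod: "finite B \<Longrightarrow> W \<subseteq> V \<Longrightarrow> cmod W (fmod V (B :: bool list set) \<delta>)"
  by (simp add: cmod_def gfree_fmod)

lemma cfact_kosz:
  assumes ps: "graded_pairs n V ps" and w: "potential ps = w" "w \<in> pols W" and W: "W \<subseteq> V"
  shows "cfact n w W (restrict_scalars W (kosz n V m ps))"
proof -
  let ?C = "\<lambda>i. fmod V (BL (length ps) i) (\<lambda>xs. m + dl n ps xs)"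
  have cm: "cmod W (?C i)" for i by (rule cmod_fmod[OF finite_BL W])
  have car: "kd ps v \<in> carrier (?C (\<not> i))" if "v \<in> carrier (?C i)" for v i
    using that kd_support[of v "length ps" i ps] kd_pols[OF ps, of v] by simp
  have "kd ps \<in> lin_maps W (int n + 1) (?C i) (?C (\<not> i))" for i
    unfolding lin_maps_iff[OF cm cm]
  proof (intro conjI ballI allI)
    show "kd ps v \<in> carrier (?C (\<not> i))" if "v \<in> carrier (?C i)" for v by (rule car[OF that])
    show "kd ps (u + v) = kd ps u + kd ps v" for u v
      by (rule ext) (simp add: plus_fun_def kd_add)
    show "kd ps (p \<odot>\<^bsub>?C i\<^esub> v) = p \<odot>\<^bsub>?C (\<not> i)\<^esub> kd ps v" for p v
      by (rule ext) (simp add: kd_scale)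
    fix j v assume v: "v \<in> deg_part (?C i) j"
    have hv: "hpart (j - m - dl n ps xs) (v xs) = v xs" for xs
      using v by (simp add: diff_diff_eq flip: homogeneous_iff_hpart)
    have "homogeneous (j - m + (int n + 1) - dl n ps zs) (kd ps v zs)" for zs
      unfolding homogeneous_iff_hpart kd_hpart[OF ps] hv ..
    then have "homogeneous (j + (int n + 1) - (m + dl n ps zs)) (kd ps v zs)" for zs
      by (simp add: algebra_simps)
    moreover have "v \<in> carrier (?C i)" using v by simp
    ultimately show "kd ps v \<in> deg_part (?C (\<not> i)) (j + (int n + 1))"
      using car[of v i] by simp
  qed
  moreover have "kd ps (kd ps v) = w \<odot>\<^bsub>?C i\<^esub> v" if v: "v \<in> carrier (?C i)" for v i
  proof
    fix zs
    show "kd ps (kd ps v) zs = (w \<odot>\<^bsub>?C i\<^esub> v) zs"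
    proof (cases "length zs = length ps")
      case True
      then show ?thesis by (simp add: kd_kd w)
    next
      case False
      have "kd ps (kd ps v) \<in> carrier (?C i)" using car[OF car[OF v]] by simp
      then have "kd ps (kd ps v) zs = 0" "v zs = 0" using False v by (auto simp: BL_def)
      then show ?thesis by simp
    qed
  qed
  ultimately show ?thesis
    using cm w by (simp add: cfact_def restrict_scalars_def del: fmod_simps)
qed

text \<open>Step 0 is the kernel of the augmentation; step k + 1 consists of the elements supported
  in exterior degree greater than k. The odd part of step 0 is everything, because exterior degree 0
  is even.\<close>

definition kfilt :: "nat \<Rightarrow> nat set \<Rightarrow> int \<Rightarrow> kpairs \<Rightarrow> nat \<Rightarrow> bool \<Rightarrow> (bool list \<Rightarrow> mpol) set" where
  "kfilt n V m ps k i = {v \<in> carrier (component (kosz n V m ps) i). (case k of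
     0 \<Rightarrow> i \<or> v (replicate (length ps) False) \<in> idl V (map (\<lambda>(k, a, b). b) ps)
   | Suc k \<Rightarrow> \<forall>xs. cnt xs \<le> k \<longrightarrow> v xs = 0)}"

text \<open>Past step 0, regularity enters through \<open>koszul_exact\<close>: if an element and
  its boundary lie in the same filtration step, the lowest exterior component is a cycle for the
  b-part, hence a boundary for it. The a-part of the differential of a primitive lands in higher
  exterior degree, where the next step allows it. At step 0 the ideal provides the primitive
  directly.\<close>

theorem resolved_kosz:
  assumes ps: "graded_pairs n V ps" and w: "potential ps = w" "w \<in> pols W" and W: "W \<subseteq> V"
    and reg: "regular V (map (\<lambda>(k, a, b). b) ps)"
  shows "resolved n w W (restrict_scalars W (kosz n V m ps)) (kfilt n V m ps)"
proof -
  let ?C = "\<lambda>i. fmod V (BL (length ps) i) (\<lambda>xs. m + dl n ps xs)"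
  let ?I = "idl V (map (\<lambda>(k, a, b). b) ps)"
  let ?l = "length ps" let ?z = "replicate ?l False"
  let ?F = "kfilt n V m ps"
  have cf: "cfact n w W (restrict_scalars W (kosz n V m ps))"
    by (rule cfact_kosz[OF ps w W])
  note d = lin_mapsD[OF cfactD(4)[OF cf] cfactD(3)[OF cf] cfactD(3)[OF cf], unfolded restrict_scalars_def, simplified]
  have cm: "cmod W (?C i)" for i by (rule cmod_fmod[OF finite_BL W])
  have comp: "component (restrict_scalars W (kosz n V m ps)) i = ?C i" "differential (restrict_scalars W (kosz n V m ps)) i = kd ps" for i
    by (simp_all add: restrict_scalars_def)
  have dc: "kd ps v \<in> carrier (?C (\<not> i))" if "v \<in> carrier (?C i)" for v i
    using lin_mapsD(1)[OF cfactD(4)[OF cf] cfactD(3)[OF cf] cfactD(3)[OF cf], of v i] that unfolding comp .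
  have F0: "v \<in> ?F 0 i \<longleftrightarrow> v \<in> carrier (?C i) \<and> (i \<or> v ?z \<in> ?I)" for v i
    by (simp add: kfilt_def)
  have FS: "v \<in> ?F (Suc k) i \<longleftrightarrow> v \<in> carrier (?C i) \<and> (\<forall>xs. cnt xs \<le> k \<longrightarrow> v xs = 0)" for v i k
    by (simp add: kfilt_def)
  have sub: "submod W (?C i) (?F k i)" for k i
  proof (cases k)
    case 0
    show ?thesis unfolding submod_def 0
    proof (intro conjI ballI)
      show "?F 0 i \<subseteq> carrier (?C i)" using F0 by blast
      show "0 \<in> ?F 0 i" unfolding F0 using cmodD(3)[OF cm] by simp
      show "u + v \<in> ?F 0 i" if "u \<in> ?F 0 i" "v \<in> ?F 0 i" for u v
        using that cmodD(4)[OF cm, of u i v] idl_add unfolding F0 plus_fun_apply by blast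
      show "p \<odot>\<^bsub>?C i\<^esub> v \<in> ?F 0 i" if "p \<in> pols W" "v \<in> ?F 0 i" for p v
        using that cmodD(7)[OF cm, of p v i] idl_mult[OF pols_mono[OF W that(1)]] unfolding F0 fmod_simps(5) by blast
    qed
  next
    case (Suc k)
    show ?thesis unfolding submod_def Suc
    proof (intro conjI ballI)
      show "?F (Suc k) i \<subseteq> carrier (?C i)" using FS by blast
      show "0 \<in> ?F (Suc k) i" unfolding FS using cmodD(3)[OF cm] by simp
      show "u + v \<in> ?F (Suc k) i" if "u \<in> ?F (Suc k) i" "v \<in> ?F (Suc k) i" for u v
        using that cmodD(4)[OF cm, of u i v] unfolding FS plus_fun_apply by simp
      show "p \<odot>\<^bsub>?C i\<^esub> v \<in> ?F (Suc k) i" if "p \<in> pols W" "v \<in> ?F (Suc k) i" for p v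
        using that cmodD(7)[OF cm, of p v i] unfolding FS by simp
    qed
  qed
  have outside: "v xs = 0" if "v \<in> carrier (?C i)" "length xs \<noteq> ?l \<or> odd (cnt xs) \<noteq> i" for v xs i
    using that by (auto simp: BL_def)
  have dec: "?F (Suc k) i \<subseteq> ?F k i" for k i
    by (cases k) (auto simp: F0 FS simp del: fmod_simps)
  have fin: "?F (Suc ?l) i = {0}" for i
  proof -
    have "v = 0" if v: "v \<in> ?F (Suc ?l) i" for v
    proof
      fix xs show "v xs = 0 xs"
        using v outside[of v i xs] cnt_le_length[of xs] unfolding FS by (cases "length xs = ?l") auto
    qed
    then show ?thesis using submodD(2)[OF sub] by blast
  qed
  have top: "?F 0 True = carrier (?C True)" using F0 by blast
  have aug: "kd ps v \<in> ?F 0 False" if v: "v \<in> carrier (?C True)" for v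
  proof -
    \<comment> \<open>Only the part of exterior degree 1 can reach exterior degree 0.\<close>
    define u where "u = (\<lambda>xs. if cnt xs = 1 then v xs else 0)"
    have "u \<in> chain V ?l 1" using v by (auto simp: u_def chain_def BL_def)
    then have "kd ps u ?z \<in> ?I" unfolding idl_iff_kd by blast
    moreover have "kd (snd_pairs ps) (\<lambda>xs. v xs - u xs) ?z = 0"
      by (rule kd_snd_eq_0) (simp add: u_def)
    moreover have "kd (fst_pairs ps) (\<lambda>xs. v xs - u xs) ?z = 0"
      by (rule kd_fst_eq_0) simp
    ultimately have "kd ps u ?z \<in> ?I" "kd ps (\<lambda>xs. v xs - u xs) ?z = 0"
      by (simp_all add: kd_split[of ps "\<lambda>xs. v xs - u xs"])
    then have "kd ps v ?z \<in> ?I" by (simp add: kd_diff)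
    then show ?thesis using dc[OF v] unfolding F0 by (simp del: fmod_simps)
  qed
  have step: "\<exists>y\<in>?F (Suc k) (\<not> i). y \<in> deg_part (?C (\<not> i)) (j - int n - 1) \<and> x - kd ps y \<in> ?F (Suc k) i"
    if x: "x \<in> ?F k i" "x \<in> deg_part (?C i) j" "kd ps x \<in> ?F k (\<not> i)" for k i j x
  proof -
    have xc: "x \<in> carrier (?C i)" using submodD(1)[OF sub x(1)] .
    have triv: ?thesis if "x \<in> ?F (Suc k) i"
      using that submodD(2)[OF sub] cmodD(16)[OF cm] by (intro bexI[of _ 0]) (auto simp: zero_fun_def fun_diff_def simp del: fmod_simps)
    have hx: "hpart (j - m - dl n ps xs) (x xs) = x xs" for xs
      using x(2) by (simp add: diff_diff_eq flip: homogeneous_iff_hpart)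
    show ?thesis
    proof (cases k)
      case 0
      show ?thesis
      proof (cases i)
        case True
        have "x \<in> ?F (Suc k) i"
          unfolding 0 FS using xc outside[OF xc] True by auto
        then show ?thesis by (rule triv)
      next
        case False
        have "x ?z \<in> ?I" using x(1) 0 False by (simp add: F0 del: fmod_simps)
        then obtain y where y: "y \<in> chain V ?l 1" "kd ps y ?z = x ?z" unfolding idl_iff_kd by blast
        \<comment> \<open>Ideal membership gives a witness without degree; its component of the
          required degree is a solution too, because \<open>x\<close> is homogeneous.\<close>
        define y' where "y' = (\<lambda>xs. hpart (j - int n - 1 - m - dl n ps xs) (y xs))"
        have "y' \<in> chain V ?l 1" unfolding y'_def by (rule chain_hpart[OF y(1)])
        then have y'c: "y' \<in> carrier (?C True)" by (auto simp: chain_def BL_def)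
        have y'0: "cnt xs \<noteq> 1 \<Longrightarrow> y' xs = 0" for xs using chainD(3)[OF y(1)] by (simp add: y'_def)
        have "kd ps y' ?z = hpart (j - int n - 1 - m + (int n + 1) - dl n ps ?z) (kd ps y ?z)"
          unfolding y'_def kd_hpart[OF ps] ..
        also have "\<dots> = x ?z" using hx[of ?z] y(2) by (simp add: algebra_simps)
        finally have d0: "kd ps y' ?z = x ?z" .
        have xd: "x - kd ps y' \<in> carrier (?C False)"
          using cmod_diff[OF cm, of x False "kd ps y'"] xc dc[OF y'c] False by (simp del: fmod_simps)
        have "(x - kd ps y') xs = 0" if "cnt xs \<le> 0" for xs
          using d0 outside[OF xd, of xs] cnt_eq_0_iff[of xs] that by (cases "length xs = ?l") auto
        then have "x - kd ps y' \<in> ?F (Suc k) False" unfolding 0 FS using xd by blast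
        then have "x - kd ps y' \<in> ?F (Suc k) i" using False by simp
        moreover have "y' \<in> ?F (Suc k) (\<not> i)" unfolding 0 FS using y'c y'0 False by simp
        moreover have "y' \<in> deg_part (?C (\<not> i)) (j - int n - 1)"
          using y'c False by (simp add: y'_def diff_diff_eq add.assoc)
        ultimately show ?thesis by blast
      qed
    next
      case (Suc c)
      have x0: "x xs = 0" if "cnt xs \<le> c" for xs using x(1) that unfolding Suc FS by blast
      show ?thesis
      \<comment> \<open>All exterior degrees in component \<open>i\<close> have the same parity, so
        if c + 1 has the wrong one, the element already lies in the next step.\<close>
      proof (cases "odd (Suc c) = i")
        case False
        have "x xs = 0" if "cnt xs \<le> Suc c" for xs
          using x0[of xs] outside[OF xc, of xs] False that by (cases "cnt xs = Suc c") auto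
        then have "x \<in> ?F (Suc k) i" unfolding Suc FS using xc by blast
        then show ?thesis by (rule triv)
      next
        case True
        define v where "v = (\<lambda>xs. if cnt xs = Suc c then x xs else 0)"
        have v: "v \<in> chain V ?l (Suc c)" using xc by (auto simp: v_def chain_def BL_def)
        have kv: "kd (snd_pairs ps) v zs = 0" if "length zs = ?l" for zs
        proof (cases "cnt zs = c")
          case True
          have "kd (snd_pairs ps) (\<lambda>xs. x xs - v xs) zs = 0"
            by (rule kd_snd_eq_0) (simp add: v_def True)
          moreover have "kd (fst_pairs ps) x zs = 0"
            by (rule kd_fst_eq_0) (simp add: x0 True)
          moreover have "kd ps x zs = 0" using x(3) True unfolding Suc FS by blast
          ultimately show ?thesis using kd_split[of ps x zs] by (simp add: kd_diff)
        next
          case False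
          then show ?thesis by (intro kd_snd_eq_0) (simp add: v_def)
        qed
        have "\<exists>y\<in>chain V ?l (Suc (Suc c)). \<forall>zs. length zs = ?l \<longrightarrow> kd (snd_pairs ps) y zs = v zs"
          using koszul_exact[OF graded_pairs_snd[OF ps], of v c] reg v kv
          by (auto simp: comp_def case_prod_unfold)
        then obtain y where y: "y \<in> chain V ?l (Suc (Suc c))" "\<And>zs. length zs = ?l \<Longrightarrow> kd (snd_pairs ps) y zs = v zs"
          by blast
        define y' where "y' = (\<lambda>xs. hpart (j - int n - 1 - m - dl n ps xs) (y xs))"
        have "y' \<in> chain V ?l (Suc (Suc c))" unfolding y'_def by (rule chain_hpart[OF y(1)])
        then have y'c: "y' \<in> carrier (?C (\<not> i))" using True by (auto simp: chain_def BL_def)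
        have y'0: "cnt xs \<noteq> Suc (Suc c) \<Longrightarrow> y' xs = 0" for xs using chainD(3)[OF y(1)] by (simp add: y'_def)
        have ky: "kd (snd_pairs ps) y' zs = v zs" if "length zs = ?l" for zs
        proof -
          have "kd (snd_pairs ps) y' zs = hpart (j - int n - 1 - m + (int n + 1) - dl n ps zs) (kd (snd_pairs ps) y zs)"
            using kd_hpart[OF graded_pairs_snd[OF ps], of "j - int n - 1 - m" zs y] by (simp add: y'_def dl_snd_pairs)
          also have "\<dots> = v zs" using hx[of zs] y(2)[OF that] by (simp add: v_def algebra_simps)
          finally show ?thesis .
        qed
        have xd: "x - kd ps y' \<in> carrier (?C i)"
          using cmod_diff[OF cm xc, of "kd ps y'"] dc[OF y'c] by (simp del: fmod_simps)
        have "(x - kd ps y') zs = 0" if "cnt zs \<le> Suc c" for zs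
        proof (cases "length zs = ?l")
          case True
          have "kd (fst_pairs ps) y' zs = 0"
            by (rule kd_fst_eq_0) (use that in \<open>auto intro: y'0\<close>)
          then have "kd ps y' zs = v zs" using kd_split[of ps y' zs] ky[OF True] by simp
          then show ?thesis using x0[of zs] that by (auto simp: v_def)
        qed (use outside[OF xd] in blast)
        then have "x - kd ps y' \<in> ?F (Suc k) i" unfolding Suc FS using xd by blast
        moreover have "y' \<in> ?F (Suc k) (\<not> i)" unfolding Suc FS using y'c y'0 by auto
        moreover have "y' \<in> deg_part (?C (\<not> i)) (j - int n - 1)"
          using y'c by (simp add: y'_def diff_diff_eq add.assoc)
        ultimately show ?thesis by blast
      qed
    qed
  qed
  show ?thesis
    unfolding resolved_def comp
    by (intro conjI allI impI ballI, rule cf, rule sub, rule dec, rule exI[of _ "Suc ?l"], rule allI, rule fin,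
        rule top, erule aug, rule step; assumption)
qed

section \<open>Direct sums of resolved factorizations\<close>

lemma cmod_sum: "cmod V M \<Longrightarrow> cmod V N \<Longrightarrow> cmod V (sum_module M N)"
  unfolding cmod_def by (auto simp: gfree_sum zero_prod_def)

lemma direct_sum_simps [simp]:
  "ring_vars (M \<oplus>\<^sub>f N) = ring_vars M" "component (M \<oplus>\<^sub>f N) i = sum_module (component M i) (component N i)"
  "differential (M \<oplus>\<^sub>f N) i (x, y) = (differential M i x, differential N i y)"
  by (simp_all add: direct_sum_def)

lemma cfact_sum:
  assumes M: "cfact n w V M" and N: "cfact n w V N" shows "cfact n w V (M \<oplus>\<^sub>f N)"
proof -
  note cM = cfactD[OF M] and cN = cfactD[OF N]
  note dM = lin_mapsD[OF cM(4) cM(3) cM(3)] and dN = lin_mapsD[OF cN(4) cN(3) cN(3)]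
  have cm: "cmod V (sum_module (component M i) (component N i))" for i
    by (rule cmod_sum[OF cM(3) cN(3)])
  have "differential (M \<oplus>\<^sub>f N) i \<in> lin_maps V (int n + 1) (sum_module (component M i) (component N i))
      (sum_module (component M (\<not> i)) (component N (\<not> i)))" for i
    unfolding lin_maps_iff[OF cm cm] by (auto simp: dM dN)
  then show ?thesis
    unfolding cfact_def using cm by (auto simp: cM(1,2,5) cN(5))
qed

lemma resolved_sum:
  assumes M: "resolved n w V M F" and N: "resolved n w V N G"
  shows "resolved n w V (M \<oplus>\<^sub>f N) (\<lambda>k i. F k i \<times> G k i)"
proof -
  obtain k l where kl: "\<forall>i. F k i = {0}" "\<forall>i. G l i = {0}"
    using resolvedD(4)[OF M] resolvedD(4)[OF N] by blast
  have aF: "F (k + j) i \<subseteq> F k i" for j i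
    using resolvedD(3)[OF M] by (induction j) auto
  have aG: "G (l + j) i \<subseteq> G l i" for j i
    using resolvedD(3)[OF N] by (induction j) auto
  have "F (k + l) i = {0}" "G (k + l) i = {0}" for i
    using aF[of l i] aG[of k i] kl submodD(2)[OF resolvedD(2)[OF M, of i "k + l"]] submodD(2)[OF resolvedD(2)[OF N, of i "k + l"]]
    by (auto simp: add.commute)
  then have fin: "\<exists>N. \<forall>i. F N i \<times> G N i = {0}" by (intro exI[of _ "k + l"]) (auto simp: zero_prod_def)
  have sub: "submod V (component (M \<oplus>\<^sub>f N) i) (F k i \<times> G k i)" for k i
    using resolvedD(2)[OF M, of i k] resolvedD(2)[OF N, of i k] unfolding submod_def by (auto simp: zero_prod_def)
  have step: "\<exists>y\<in>F (Suc k) (\<not> i) \<times> G (Suc k) (\<not> i). y \<in> deg_part (component (M \<oplus>\<^sub>f N) (\<not> i)) (j - int n - 1) \<and>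
      x - differential (M \<oplus>\<^sub>f N) (\<not> i) y \<in> F (Suc k) i \<times> G (Suc k) i"
    if h: "x \<in> F k i \<times> G k i" "x \<in> deg_part (component (M \<oplus>\<^sub>f N) i) j" "differential (M \<oplus>\<^sub>f N) i x \<in> F k (\<not> i) \<times> G k (\<not> i)" for k i j x
  proof -
    obtain a b where x: "x = (a, b)" by (cases x)
    obtain c d where "c \<in> F (Suc k) (\<not> i)" "c \<in> deg_part (component M (\<not> i)) (j - int n - 1)" "a - differential M (\<not> i) c \<in> F (Suc k) i"
      "d \<in> G (Suc k) (\<not> i)" "d \<in> deg_part (component N (\<not> i)) (j - int n - 1)" "b - differential N (\<not> i) d \<in> G (Suc k) i"
      using resolvedD(7)[OF M, of a k i j] resolvedD(7)[OF N, of b k i j] h by (auto simp: x)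
    then show ?thesis by (intro bexI[of _ "(c, d)"]) (auto simp: x)
  qed
  have cf: "cfact n w V (M \<oplus>\<^sub>f N)" by (rule cfact_sum[OF resolvedD(1)[OF M] resolvedD(1)[OF N]])
  have dec: "F (Suc k) i \<times> G (Suc k) i \<subseteq> F k i \<times> G k i" for k i
    using resolvedD(3)[OF M] resolvedD(3)[OF N] by (intro Sigma_mono)
  have top: "F 0 True \<times> G 0 True = carrier (component (M \<oplus>\<^sub>f N) True)"
    by (simp add: resolvedD(5)[OF M] resolvedD(5)[OF N])
  have aug: "\<forall>x\<in>carrier (component (M \<oplus>\<^sub>f N) True). differential (M \<oplus>\<^sub>f N) True x \<in> F 0 False \<times> G 0 False"
    using resolvedD(6)[OF M] resolvedD(6)[OF N] by auto
  show ?thesis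
    unfolding resolved_def
    by (intro conjI allI impI, rule cf, rule sub, rule dec, rule fin, rule top, rule aug, rule step; assumption)
qed

subsection \<open>Transport along isomorphisms\<close>

lemma lin_maps_cong:
  assumes "f \<in> lin_maps V k M N" "\<And>x. x \<in> carrier M \<Longrightarrow> g x = f x" "\<And>j. deg_part M j \<subseteq> carrier M"
    "\<And>x y. x \<in> carrier M \<Longrightarrow> y \<in> carrier M \<Longrightarrow> x \<oplus>\<^bsub>M\<^esub> y \<in> carrier M"
    "\<And>p x. p \<in> pols V \<Longrightarrow> x \<in> carrier M \<Longrightarrow> p \<odot>\<^bsub>M\<^esub> x \<in> carrier M"
  shows "g \<in> lin_maps V k M N"
proof -
  have "g ` deg_part M j = f ` deg_part M j" for j
    using assms(2,3) by (intro image_cong refl) blast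
  then show ?thesis
    using assms(1,2,4,5) unfolding lin_maps_def hom_def by (auto simp: Pi_def)
qed

lemma miso_lin_maps:
  assumes m: "miso V M N \<phi>" shows "\<phi> \<in> lin_maps V 0 M N"
  unfolding lin_maps_def hom_def using misoD[OF m] by (auto simp: Pi_def)

lemma miso_inverse:
  assumes m: "miso V M N \<phi>" and N: "cmod V N"
  shows "miso V N M (inv_into (carrier M) \<phi>)"
proof -
  note cN = cmodD[OF N] and mD = misoD[OF m]
  let ?\<psi> = "inv_into (carrier M) \<phi>"
  have b: "bij_betw ?\<psi> (carrier N) (carrier M)" using mD(1) by (rule bij_betw_inv_into)
  have 0: "?\<psi> 0 = \<zero>\<^bsub>M\<^esub>" using miso_inv[OF m mD(2)] mD(3) cN(2) by simp
  have add: "?\<psi> (u + v) = ?\<psi> u \<oplus>\<^bsub>M\<^esub> ?\<psi> v" if "u \<in> carrier N" "v \<in> carrier N" for u v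
    by (rule mD(10)) (simp_all add: that mD(5,6,11,12) cN(1,4))
  have mult: "?\<psi> (p \<odot>\<^bsub>N\<^esub> u) = p \<odot>\<^bsub>M\<^esub> ?\<psi> u" if "p \<in> pols V" "u \<in> carrier N" for p u
    by (rule mD(10)) (simp_all add: that mD(7,8,11,12) cN(7))
  have "deg_part N k = {u \<in> carrier N. ?\<psi> u \<in> deg_part M k}" for k
    using mD(9,11,12) cN(15)[of _ k] by auto
  then show ?thesis
    unfolding miso_def using b 0 add mult cN(1-4,7) by simp
qed

lemma miso_cmod_abelian_group: "miso V M N \<phi> \<Longrightarrow> cmod V N \<Longrightarrow> abelian_group M"
  using miso_abelian_group gfree_module[of V N] module.axioms(2) unfolding cmod_def by blast

lemma miso_a_minus:
  assumes m: "miso V M N \<phi>" and N: "cmod V N" and x: "x \<in> carrier M" and y: "y \<in> carrier M"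
  shows "x \<ominus>\<^bsub>M\<^esub> y \<in> carrier M" "\<phi> (x \<ominus>\<^bsub>M\<^esub> y) = \<phi> x - \<phi> y"
proof -
  interpret M: abelian_group M by (rule miso_cmod_abelian_group[OF m N])
  note cN = cmodD[OF N] and mD = misoD[OF m]
  have "\<phi> (\<ominus>\<^bsub>M\<^esub> y \<oplus>\<^bsub>M\<^esub> y) = 0" using y by (simp add: M.l_neg mD(3) cN(2))
  then have "\<phi> (\<ominus>\<^bsub>M\<^esub> y) = - \<phi> y"
    using mD(6)[of "\<ominus>\<^bsub>M\<^esub> y" y] y by (simp add: cN(1) eq_neg_iff_add_eq_0)
  then show "x \<ominus>\<^bsub>M\<^esub> y \<in> carrier M" "\<phi> (x \<ominus>\<^bsub>M\<^esub> y) = \<phi> x - \<phi> y"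
    using x y mD(6)[of x "\<ominus>\<^bsub>M\<^esub> y"] by (simp_all add: a_minus_def cN(1))
qed

lemma fisoD:
  assumes "fiso M M' \<phi>" "cfact n w V M'"
  shows "ring_vars M = V" "miso V (component M i) (component M' i) (\<phi> i)"
    "x \<in> carrier (component M i) \<Longrightarrow> differential M i x \<in> carrier (component M (\<not> i))"
    "x \<in> carrier (component M i) \<Longrightarrow> \<phi> (\<not> i) (differential M i x) = differential M' i (\<phi> i x)"
  using assms cfactD(1)[OF assms(2)] unfolding fiso_def by auto

lemma fiso_differential_lin:
  assumes M: "fiso M M' \<phi>" and M': "cfact n w V M'"
  shows "differential M i \<in> lin_maps V (int n + 1) (component M i) (component M (\<not> i))"
proof (rule lin_maps_cong)
  note mi = fisoD(2)[OF M M']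
  note inv = miso_lin_maps[OF miso_inverse[OF mi cfactD(3)[OF M']]]
  show "(\<lambda>x. inv_into (carrier (component M (\<not> i))) (\<phi> (\<not> i)) (differential M' i (\<phi> i x))) \<in>
      lin_maps V (int n + 1) (component M i) (component M (\<not> i))"
    using lin_maps_comp[OF lin_maps_comp[OF miso_lin_maps[OF mi] cfactD(4)[OF M']] inv] by simp
  show "differential M i x = inv_into (carrier (component M (\<not> i))) (\<phi> (\<not> i)) (differential M' i (\<phi> i x))"
    if "x \<in> carrier (component M i)" for x
    using miso_inv[OF mi fisoD(3)[OF M M' that]] fisoD(4)[OF M M' that] by simp
qed (use misoD(5,7,9)[OF fisoD(2)[OF M M']] in blast)+

lemma fiso_graded_factorization:
  assumes M: "fiso M M' \<phi>" and M': "cfact n w V M'" and V: "finite V" and w: "homogeneous (2 * (int n + 1)) w"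
  shows "graded_factorization n w M"
  unfolding graded_factorization_def fisoD(1)[OF M M']
proof (intro conjI allI ballI)
  note mi = fisoD(2)[OF M M']
  show "w \<in> pols V" by (rule cfactD(2)[OF M'])
  show "free_graded_module V (component M i)" for i
    using gfree_free[OF gfree_miso[OF mi]] cfactD(3)[OF M'] by (simp add: cmod_def)
  show "differential M i \<in> lin_maps V (int n + 1) (component M i) (component M (\<not> i))" for i
    by (rule fiso_differential_lin[OF M M'])
  fix i x assume x: "x \<in> carrier (component M i)"
  note dx = fisoD(3)[OF M M' x]
  have "\<phi> i (differential M (\<not> i) (differential M i x)) = \<phi> i (w \<odot>\<^bsub>component M i\<^esub> x)"
    using fisoD(4)[OF M M' dx] fisoD(4)[OF M M' x] cfactD(5)[OF M' misoD(4)[OF mi x]] misoD(8)[OF mi cfactD(2)[OF M'] x]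
    by simp
  then show "differential M (\<not> i) (differential M i x) = w \<odot>\<^bsub>component M i\<^esub> x"
    using fisoD(3)[OF M M' dx] misoD(7)[OF mi cfactD(2)[OF M'] x] by (intro misoD(10)[OF mi]) simp_all
qed (use V w in auto)

text \<open>Morphisms and homotopies are conjugated with the coordinate isomorphisms. This carries
  the comparison made in coordinates back to factorizations built from tensor classes.\<close>

lemma heq_transport:
  assumes M: "fiso M M' \<phi>" and M': "cfact n w V M'" and N: "fiso N N' \<psi>" and N': "cfact n w V N'"
    and h: "heq n M' N'"
  shows "heq n M N"
proof -
  have main: "factorization_hom A B (\<lambda>i x. inv_into (carrier (component B i)) (\<beta> i) (f i (\<alpha> i x)))"
    if A: "fiso A A' \<alpha>" and A': "cfact n w V A'" and B: "fiso B B' \<beta>" and B': "cfact n w V B'"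
      and f: "factorization_hom A' B' f"
    for A :: "'x factorization" and A' :: "'y::ab_group_add factorization" and \<alpha>
      and B :: "'u factorization" and B' :: "'v::ab_group_add factorization" and \<beta> f
    unfolding factorization_hom_def fisoD(1)[OF A A']
  proof (intro conjI allI ballI)
    note ma = fisoD(2)[OF A A'] and mb = fisoD(2)[OF B B']
    note fl = factorization_homD(1)[OF f A']
    show "(\<lambda>x. inv_into (carrier (component B i)) (\<beta> i) (f i (\<alpha> i x))) \<in> lin_maps V 0 (component A i) (component B i)" for i
      using lin_maps_comp[OF lin_maps_comp[OF miso_lin_maps[OF ma] fl] miso_lin_maps[OF miso_inverse[OF mb cfactD(3)[OF B']]]]
      by simp
    fix i x assume x: "x \<in> carrier (component A i)"
    have fx: "f i (\<alpha> i x) \<in> carrier (component B' i)"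
      by (rule lin_mapsD(1)[OF fl cfactD(3)[OF A'] cfactD(3)[OF B'] misoD(4)[OF ma x]])
    have fdx: "f (\<not> i) (\<alpha> (\<not> i) (differential A i x)) \<in> carrier (component B' (\<not> i))"
      by (rule lin_mapsD(1)[OF fl cfactD(3)[OF A'] cfactD(3)[OF B'] misoD(4)[OF ma fisoD(3)[OF A A' x]]])
    note y = misoD(11,12)[OF mb fx]
    show "inv_into (carrier (component B (\<not> i))) (\<beta> (\<not> i)) (f (\<not> i) (\<alpha> (\<not> i) (differential A i x))) =
        differential B i (inv_into (carrier (component B i)) (\<beta> i) (f i (\<alpha> i x)))"
    proof (rule misoD(10)[OF mb misoD(11)[OF mb fdx] fisoD(3)[OF B B' y(1)]])
      show "\<beta> (\<not> i) (inv_into (carrier (component B (\<not> i))) (\<beta> (\<not> i)) (f (\<not> i) (\<alpha> (\<not> i) (differential A i x)))) =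
          \<beta> (\<not> i) (differential B i (inv_into (carrier (component B i)) (\<beta> i) (f i (\<alpha> i x))))"
        using misoD(12)[OF mb fdx] fisoD(4)[OF B B' y(1)] y(2) fisoD(4)[OF A A' x]
          factorization_homD(2)[OF f A' misoD(4)[OF ma x]] by simp
    qed
  qed
  have homot: "homotopic n A A (\<lambda>i. (\<lambda>y. inv_into (carrier (component A i)) (\<alpha> i) (g i (\<beta> i y))) \<circ>
        (\<lambda>x. inv_into (carrier (component B i)) (\<beta> i) (f i (\<alpha> i x)))) (\<lambda>i. id)"
    if A: "fiso A A' \<alpha>" and A': "cfact n w V A'" and B: "fiso B B' \<beta>" and B': "cfact n w V B'"
      and f: "factorization_hom A' B' f" and g: "factorization_hom B' A' g"
      and h: "homotopic n A' A' (\<lambda>i. g i \<circ> f i) (\<lambda>i. id)"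
    for A :: "'x factorization" and A' :: "'y::ab_group_add factorization" and \<alpha>
      and B :: "'u factorization" and B' :: "'v::ab_group_add factorization" and \<beta> f g
  proof -
    note ma = fisoD(2)[OF A A'] and mb = fisoD(2)[OF B B']
    note cA = cfactD(3)[OF A'] and cB = cfactD(3)[OF B']
    obtain h where h: "\<And>i. h i \<in> lin_maps V (- int n - 1) (component A' i) (component A' (\<not> i))"
      "\<And>i x. x \<in> carrier (component A' i) \<Longrightarrow> (g i \<circ> f i) x \<ominus>\<^bsub>component A' i\<^esub> id x =
             h (\<not> i) (differential A' i x) \<oplus>\<^bsub>component A' i\<^esub> differential A' (\<not> i) (h i x)"
      using h unfolding homotopic_def cfactD(1)[OF A'] by blast
    define k where "k i x = inv_into (carrier (component A (\<not> i))) (\<alpha> (\<not> i)) (h i (\<alpha> i x))" for i x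
    note hl = lin_mapsD[OF h(1) cA cA]
    show ?thesis
      unfolding homotopic_def fisoD(1)[OF A A']
    proof (intro exI[of _ k] conjI allI ballI)
      show "k i \<in> lin_maps V (- int n - 1) (component A i) (component A (\<not> i))" for i
        using lin_maps_comp[OF lin_maps_comp[OF miso_lin_maps[OF ma] h(1)] miso_lin_maps[OF miso_inverse[OF ma cA]]]
        by (simp add: k_def[abs_def])
      fix i x assume x: "x \<in> carrier (component A i)"
      have ax: "\<alpha> i x \<in> carrier (component A' i)" by (rule misoD(4)[OF ma x])
      have fx: "f i (\<alpha> i x) \<in> carrier (component B' i)"
        by (rule lin_mapsD(1)[OF factorization_homD(1)[OF f A'] cA cB ax])
      have gfx: "g i (f i (\<alpha> i x)) \<in> carrier (component A' i)"
        by (rule lin_mapsD(1)[OF factorization_homD(1)[OF g B'] cB cA fx])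
      let ?y = "inv_into (carrier (component A i)) (\<alpha> i) (g i (f i (\<alpha> i x)))"
      note y = misoD(11,12)[OF ma gfx]
      have kc: "k i x \<in> carrier (component A (\<not> i))" and ak: "\<alpha> (\<not> i) (k i x) = h i (\<alpha> i x)"
        unfolding k_def by (rule misoD(11)[OF ma hl(1)[OF ax]], rule misoD(12)[OF ma hl(1)[OF ax]])
      note dx = fisoD(3)[OF A A' x]
      have kd: "k (\<not> i) (differential A i x) \<in> carrier (component A i)"
        "\<alpha> i (k (\<not> i) (differential A i x)) = h (\<not> i) (differential A' i (\<alpha> i x))"
        using misoD(11)[OF ma hl(1)[OF misoD(4)[OF ma dx]]] misoD(12)[OF ma hl(1)[OF misoD(4)[OF ma dx]]]
          fisoD(4)[OF A A' x] by (simp_all add: k_def)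
      have dk: "differential A (\<not> i) (k i x) \<in> carrier (component A i)"
        "\<alpha> i (differential A (\<not> i) (k i x)) = differential A' (\<not> i) (h i (\<alpha> i x))"
        using fisoD(3)[OF A A' kc] fisoD(4)[OF A A' kc] ak by simp_all
      have e: "((\<lambda>y. inv_into (carrier (component A i)) (\<alpha> i) (g i (\<beta> i y))) \<circ>
        (\<lambda>x. inv_into (carrier (component B i)) (\<beta> i) (f i (\<alpha> i x)))) x = ?y"
        by (simp add: misoD(12)[OF mb fx])
      show "((\<lambda>y. inv_into (carrier (component A i)) (\<alpha> i) (g i (\<beta> i y))) \<circ>
        (\<lambda>x. inv_into (carrier (component B i)) (\<beta> i) (f i (\<alpha> i x)))) x \<ominus>\<^bsub>component A i\<^esub> id x =
        k (\<not> i) (differential A i x) \<oplus>\<^bsub>component A i\<^esub> differential A (\<not> i) (k i x)"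
        unfolding e id_apply
      proof (rule misoD(10)[OF ma miso_a_minus(1)[OF ma cA y(1) x] misoD(5)[OF ma kd(1) dk(1)]])
        show "\<alpha> i (?y \<ominus>\<^bsub>component A i\<^esub> x) =
            \<alpha> i (k (\<not> i) (differential A i x) \<oplus>\<^bsub>component A i\<^esub> differential A (\<not> i) (k i x))"
          unfolding miso_a_minus(2)[OF ma cA y(1) x] misoD(6)[OF ma kd(1) dk(1)] y(2) kd(2) dk(2)
          using h(2)[OF ax] cmod_a_minus[OF cA ax] by simp
      qed
    qed
  qed
  obtain f g where fg: "factorization_hom M' N' f" "factorization_hom N' M' g"
    "homotopic n M' M' (\<lambda>i. g i \<circ> f i) (\<lambda>i. id)" "homotopic n N' N' (\<lambda>i. f i \<circ> g i) (\<lambda>i. id)"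
    using h unfolding heq_def by blast
  show ?thesis
    unfolding heq_def
    using main[OF M M' N N' fg(1)] main[OF N N' M M' fg(2)] homot[OF M M' N N' fg(1,2,3)] homot[OF N N' M M' fg(2,1,4)]
    by blast
qed

subsection \<open>Finite-dimensional cohomology\<close>

text \<open>Additivity of the action of constants in both arguments. It passes to quotients and to
  the subquotient that defines cohomology, and constants are the scalars that occur in
  \<open>finite_dim_rat\<close>.\<close>

definition rat_mod :: "(mpol, 'm, 'z) module_scheme \<Rightarrow> bool" where
  "rat_mod A \<longleftrightarrow> abelian_group A \<and> (\<forall>c. \<forall>x\<in>carrier A. cst c \<odot>\<^bsub>A\<^esub> x \<in> carrier A) \<and>
     (\<forall>c. \<forall>x\<in>carrier A. \<forall>y\<in>carrier A. cst c \<odot>\<^bsub>A\<^esub> (x \<oplus>\<^bsub>A\<^esub> y) = cst c \<odot>\<^bsub>A\<^esub> x \<oplus>\<^bsub>A\<^esub> cst c \<odot>\<^bsub>A\<^esub> y) \<and>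
     (\<forall>c d. \<forall>x\<in>carrier A. cst (c + d) \<odot>\<^bsub>A\<^esub> x = cst c \<odot>\<^bsub>A\<^esub> x \<oplus>\<^bsub>A\<^esub> cst d \<odot>\<^bsub>A\<^esub> x)"

lemma rat_modD:
  assumes "rat_mod A"
  shows "abelian_group A" "x \<in> carrier A \<Longrightarrow> cst c \<odot>\<^bsub>A\<^esub> x \<in> carrier A"
    "x \<in> carrier A \<Longrightarrow> y \<in> carrier A \<Longrightarrow> cst c \<odot>\<^bsub>A\<^esub> (x \<oplus>\<^bsub>A\<^esub> y) = cst c \<odot>\<^bsub>A\<^esub> x \<oplus>\<^bsub>A\<^esub> cst c \<odot>\<^bsub>A\<^esub> y"
    "x \<in> carrier A \<Longrightarrow> cst (c + d) \<odot>\<^bsub>A\<^esub> x = cst c \<odot>\<^bsub>A\<^esub> x \<oplus>\<^bsub>A\<^esub> cst d \<odot>\<^bsub>A\<^esub> x"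
  using assms unfolding rat_mod_def by blast+

lemma module_rat_mod: "module (pol_ring V) M \<Longrightarrow> rat_mod M"
proof -
  assume "module (pol_ring V) M"
  then interpret module "pol_ring V" M .
  have c: "cst c \<in> carrier (pol_ring V)" for c by (simp add: pol_ring_def)
  have "cst (c + d) = cst c \<oplus>\<^bsub>pol_ring V\<^esub> cst d" for c d by (simp add: pol_ring_def cst_add)
  then show ?thesis
    unfolding rat_mod_def using c by (auto simp: smult_l_distr smult_r_distr M.abelian_group_axioms)
qed

locale rat_quot =
  fixes A :: "(mpol, 'm, 'z) module_scheme" and K :: "'m set"
  assumes A: "rat_mod A" and K: "subgroup K (add_monoid A)" and cK: "\<And>c k. k \<in> K \<Longrightarrow> cst c \<odot>\<^bsub>A\<^esub> k \<in> K"
begin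

sublocale A: abelian_group A by (rule rat_modD[OF A])

abbreviation \<pi> where "\<pi> x \<equiv> K +>\<^bsub>A\<^esub> x"
abbreviation Q where "Q \<equiv> quot_module A K"

lemma K_closed: "k \<in> K \<Longrightarrow> k \<in> carrier A" "\<zero>\<^bsub>A\<^esub> \<in> K" "k \<in> K \<Longrightarrow> l \<in> K \<Longrightarrow> k \<oplus>\<^bsub>A\<^esub> l \<in> K" "k \<in> K \<Longrightarrow> \<ominus>\<^bsub>A\<^esub> k \<in> K"
  using subgroup.mem_carrier[OF K] subgroup.one_closed[OF K] subgroup.m_closed[OF K] subgroup.m_inv_closed[OF K]
  by (auto simp: a_inv_def)

lemma \<pi>_eq: "\<pi> x = {k \<oplus>\<^bsub>A\<^esub> x | k. k \<in> K}"
  by (auto simp: a_r_coset_def r_coset_def)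

lemma \<pi>_eqI: "x \<in> carrier A \<Longrightarrow> k \<in> K \<Longrightarrow> \<pi> (k \<oplus>\<^bsub>A\<^esub> x) = \<pi> x"
proof
  assume x: "x \<in> carrier A" "k \<in> K"
  have "l \<oplus>\<^bsub>A\<^esub> (k \<oplus>\<^bsub>A\<^esub> x) = (l \<oplus>\<^bsub>A\<^esub> k) \<oplus>\<^bsub>A\<^esub> x" if "l \<in> K" for l
    using x that K_closed by (simp add: A.a_assoc)
  then show "\<pi> (k \<oplus>\<^bsub>A\<^esub> x) \<subseteq> \<pi> x" using x K_closed(3) unfolding \<pi>_eq by blast
  have "l \<oplus>\<^bsub>A\<^esub> x = (l \<oplus>\<^bsub>A\<^esub> \<ominus>\<^bsub>A\<^esub> k) \<oplus>\<^bsub>A\<^esub> (k \<oplus>\<^bsub>A\<^esub> x)" if "l \<in> K" for l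
    using x that K_closed(1) by (simp add: A.a_assoc A.r_neg1)
  then show "\<pi> x \<subseteq> \<pi> (k \<oplus>\<^bsub>A\<^esub> x)" using x K_closed(3,4) unfolding \<pi>_eq by blast
qed

lemma self_\<pi>: "x \<in> carrier A \<Longrightarrow> x \<in> \<pi> x"
  using K_closed(2) unfolding \<pi>_eq by (auto intro!: exI[of _ "\<zero>\<^bsub>A\<^esub>"])

lemma \<pi>_K_iff: "x \<in> carrier A \<Longrightarrow> \<pi> x = K \<longleftrightarrow> x \<in> K"
proof
  assume x: "x \<in> carrier A"
  show "x \<in> K" if "\<pi> x = K" using self_\<pi>[OF x] that by simp
  assume xK: "x \<in> K"
  have z: "k \<oplus>\<^bsub>A\<^esub> \<zero>\<^bsub>A\<^esub> = k" if "k \<in> K" for k using K_closed(1)[OF that] by simp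
  have "\<pi> \<zero>\<^bsub>A\<^esub> = K"
    unfolding \<pi>_eq
  proof (rule Set.set_eqI)
    fix y show "y \<in> {k \<oplus>\<^bsub>A\<^esub> \<zero>\<^bsub>A\<^esub> |k. k \<in> K} \<longleftrightarrow> y \<in> K" 
      unfolding mem_Collect_eq
    proof
      assume "\<exists>k. y = k \<oplus>\<^bsub>A\<^esub> \<zero>\<^bsub>A\<^esub> \<and> k \<in> K"
      then obtain k where "y = k \<oplus>\<^bsub>A\<^esub> \<zero>\<^bsub>A\<^esub>" "k \<in> K" by (elim exE conjE)
      then show "y \<in> K" by (simp only: z)
    next
      assume "y \<in> K" then show "\<exists>k. y = k \<oplus>\<^bsub>A\<^esub> \<zero>\<^bsub>A\<^esub> \<and> k \<in> K" using z[of y] by (intro exI[of _ y]) simp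
    qed
  qed
  then show "\<pi> x = K" using \<pi>_eqI[of "\<zero>\<^bsub>A\<^esub>" x] xK x by simp
qed

lemma Q_carrier: "carrier Q = \<pi> ` carrier A"
  by (auto simp: quot_module_def A_FactGroup_def FactGroup_def RCOSETS_def a_r_coset_def)

lemma Q_zero: "\<zero>\<^bsub>Q\<^esub> = K"
  by (simp add: quot_module_def A_FactGroup_def FactGroup_def)

lemma Q_add: "x \<in> carrier A \<Longrightarrow> y \<in> carrier A \<Longrightarrow> \<pi> x \<oplus>\<^bsub>Q\<^esub> \<pi> y = \<pi> (x \<oplus>\<^bsub>A\<^esub> y)"
proof -
  assume "x \<in> carrier A" "y \<in> carrier A"
  moreover have "K \<lhd> add_monoid A" using comm_group.subgroup_imp_normal[OF A.a_comm_group K] .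
  ultimately show ?thesis
    using normal.rcos_sum[of K "add_monoid A" x y]
    by (simp add: quot_module_def A_FactGroup_def FactGroup_def a_r_coset_def)
qed

lemma Q_smult: "x \<in> carrier A \<Longrightarrow> cst c \<odot>\<^bsub>Q\<^esub> \<pi> x = \<pi> (cst c \<odot>\<^bsub>A\<^esub> x)"
proof -
  assume x: "x \<in> carrier A"
  have "(\<lambda>x. \<pi> (cst c \<odot>\<^bsub>A\<^esub> x)) ` \<pi> x = {\<pi> (cst c \<odot>\<^bsub>A\<^esub> x)}"
  proof
    show "(\<lambda>x. \<pi> (cst c \<odot>\<^bsub>A\<^esub> x)) ` \<pi> x \<subseteq> {\<pi> (cst c \<odot>\<^bsub>A\<^esub> x)}"
    proof
      fix C assume "C \<in> (\<lambda>x. \<pi> (cst c \<odot>\<^bsub>A\<^esub> x)) ` \<pi> x"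
      then obtain k where k: "k \<in> K" "C = \<pi> (cst c \<odot>\<^bsub>A\<^esub> (k \<oplus>\<^bsub>A\<^esub> x))" unfolding \<pi>_eq[of x] by blast
      then show "C \<in> {\<pi> (cst c \<odot>\<^bsub>A\<^esub> x)}"
        using rat_modD(3)[OF A K_closed(1)[OF k(1)] x] \<pi>_eqI[OF rat_modD(2)[OF A x] cK[OF k(1)]] by simp
    qed
    show "{\<pi> (cst c \<odot>\<^bsub>A\<^esub> x)} \<subseteq> (\<lambda>x. \<pi> (cst c \<odot>\<^bsub>A\<^esub> x)) ` \<pi> x" using self_\<pi>[OF x] by blast
  qed
  then show ?thesis by (simp add: quot_module_def)
qed

lemma Q_rat_mod: "rat_mod Q"
  unfolding rat_mod_def
proof (intro conjI allI ballI)
  show "abelian_group Q"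
  proof (rule abelian_groupI)
    fix C D E assume "C \<in> carrier Q" "D \<in> carrier Q" "E \<in> carrier Q"
    then obtain x y z where *: "C = \<pi> x" "D = \<pi> y" "E = \<pi> z" "x \<in> carrier A" "y \<in> carrier A" "z \<in> carrier A"
      unfolding Q_carrier by blast
    show "C \<oplus>\<^bsub>Q\<^esub> D \<in> carrier Q" using * unfolding Q_carrier by (simp add: Q_add)
    show "C \<oplus>\<^bsub>Q\<^esub> D \<oplus>\<^bsub>Q\<^esub> E = C \<oplus>\<^bsub>Q\<^esub> (D \<oplus>\<^bsub>Q\<^esub> E)" using * by (simp add: Q_add A.a_assoc)
    show "C \<oplus>\<^bsub>Q\<^esub> D = D \<oplus>\<^bsub>Q\<^esub> C" using * by (simp add: Q_add A.a_comm)
    have "\<pi> \<zero>\<^bsub>A\<^esub> = K" using \<pi>_K_iff[of "\<zero>\<^bsub>A\<^esub>"] K_closed(2) by simp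
    then show "\<zero>\<^bsub>Q\<^esub> \<oplus>\<^bsub>Q\<^esub> C = C" using * Q_add[of "\<zero>\<^bsub>A\<^esub>" x] by (simp add: Q_zero)
    have "\<pi> (\<ominus>\<^bsub>A\<^esub> x) \<oplus>\<^bsub>Q\<^esub> C = \<zero>\<^bsub>Q\<^esub>"
      using * Q_add[of "\<ominus>\<^bsub>A\<^esub> x" x] \<open>\<pi> \<zero>\<^bsub>A\<^esub> = K\<close> by (simp add: Q_zero A.l_neg)
    then show "\<exists>D\<in>carrier Q. D \<oplus>\<^bsub>Q\<^esub> C = \<zero>\<^bsub>Q\<^esub>" using * unfolding Q_carrier by blast
  next
    have "\<pi> \<zero>\<^bsub>A\<^esub> = K" using \<pi>_K_iff[of "\<zero>\<^bsub>A\<^esub>"] K_closed(2) by simp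
    then show "\<zero>\<^bsub>Q\<^esub> \<in> carrier Q" unfolding Q_carrier Q_zero by (metis A.zero_closed imageI)
  qed
  fix C D c d assume "C \<in> carrier Q" "D \<in> carrier Q"
  then obtain x y where *: "C = \<pi> x" "D = \<pi> y" "x \<in> carrier A" "y \<in> carrier A" unfolding Q_carrier by blast
  show "cst c \<odot>\<^bsub>Q\<^esub> (C \<oplus>\<^bsub>Q\<^esub> D) = cst c \<odot>\<^bsub>Q\<^esub> C \<oplus>\<^bsub>Q\<^esub> cst c \<odot>\<^bsub>Q\<^esub> D"
    using * by (simp add: Q_add Q_smult rat_modD(2,3)[OF A])
next
  fix C c d assume "C \<in> carrier Q"
  then obtain x where *: "C = \<pi> x" "x \<in> carrier A" unfolding Q_carrier by blast
  show "cst c \<odot>\<^bsub>Q\<^esub> C \<in> carrier Q" using * unfolding Q_carrier by (simp add: Q_smult rat_modD(2)[OF A])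
  show "cst (c + d) \<odot>\<^bsub>Q\<^esub> C = cst c \<odot>\<^bsub>Q\<^esub> C \<oplus>\<^bsub>Q\<^esub> cst d \<odot>\<^bsub>Q\<^esub> C"
    using * by (simp add: Q_add Q_smult rat_modD(2,4)[OF A])
qed

end

text \<open>\<open>finite_dim_rat\<close> asks for a spanning set, while the family \<open>b\<close>
  may repeat itself; the coefficients of equal members are collected.\<close>

lemma finite_dim_ratI:
  assumes H: "rat_mod H" and S: "finite S" "\<And>s. s \<in> S \<Longrightarrow> b s \<in> carrier H"
    and P: "\<And>x. x \<in> carrier H \<Longrightarrow> \<exists>q. x = finsum H (\<lambda>s. cst (q s) \<odot>\<^bsub>H\<^esub> b s) S"
  shows "finite_dim_rat H"
proof -
  interpret abelian_group H by (rule rat_modD[OF H])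
  let ?F = "b ` S"
  have Fc: "v \<in> ?F \<Longrightarrow> v \<in> carrier H" for v using S(2) by blast
  have c0: "cst 0 \<odot>\<^bsub>H\<^esub> x = \<zero>\<^bsub>H\<^esub>" if "x \<in> carrier H" for x
  proof -
    have "cst 0 \<odot>\<^bsub>H\<^esub> x = cst 0 \<odot>\<^bsub>H\<^esub> x \<oplus>\<^bsub>H\<^esub> cst 0 \<odot>\<^bsub>H\<^esub> x"
      using rat_modD(4)[OF H that, of 0 0] by (simp del: cst_0)
    then show ?thesis using rat_modD(2)[OF H that, of 0] by (simp del: cst_0)
  qed
  have fs: "\<exists>c. finsum H (\<lambda>s. cst (q s) \<odot>\<^bsub>H\<^esub> b s) T = finsum H (\<lambda>v. cst (c v) \<odot>\<^bsub>H\<^esub> v) ?F"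
    if "finite T" "T \<subseteq> S" for q T
    using that
  proof (induction T rule: finite_induct)
    case empty
    have "finsum H (\<lambda>v. cst 0 \<odot>\<^bsub>H\<^esub> v) ?F = finsum H (\<lambda>v. \<zero>\<^bsub>H\<^esub>) ?F"
      using Fc c0 by (intro finsum_cong') auto
    then show ?case by (intro exI[of _ "\<lambda>_. 0"]) (simp del: cst_0)
  next
    case (insert t T)
    then obtain c where c: "finsum H (\<lambda>s. cst (q s) \<odot>\<^bsub>H\<^esub> b s) T = finsum H (\<lambda>v. cst (c v) \<odot>\<^bsub>H\<^esub> v) ?F" by auto
    have bt: "b t \<in> carrier H" "b t \<in> ?F" using insert S(2) by auto
    have "finsum H (\<lambda>s. cst (q s) \<odot>\<^bsub>H\<^esub> b s) (insert t T) =
        cst (q t) \<odot>\<^bsub>H\<^esub> b t \<oplus>\<^bsub>H\<^esub> finsum H (\<lambda>s. cst (q s) \<odot>\<^bsub>H\<^esub> b s) T"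
      using insert S(2) rat_modD(2)[OF H] by (intro finsum_insert) auto
    also have "cst (q t) \<odot>\<^bsub>H\<^esub> b t = finsum H (\<lambda>v. if b t = v then cst (q t) \<odot>\<^bsub>H\<^esub> v else \<zero>\<^bsub>H\<^esub>) ?F"
      using S(1) bt Fc rat_modD(2)[OF H] by (subst add.finprod_singleton) auto
    also have "\<dots> = finsum H (\<lambda>v. cst (if b t = v then q t else 0) \<odot>\<^bsub>H\<^esub> v) ?F"
      using Fc rat_modD(2)[OF H] c0 by (intro finsum_cong') (auto simp del: cst_0)
    also have "\<dots> \<oplus>\<^bsub>H\<^esub> finsum H (\<lambda>s. cst (q s) \<odot>\<^bsub>H\<^esub> b s) T =
        finsum H (\<lambda>v. cst (if b t = v then q t else 0) \<odot>\<^bsub>H\<^esub> v \<oplus>\<^bsub>H\<^esub> cst (c v) \<odot>\<^bsub>H\<^esub> v) ?F"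
      unfolding c using Fc rat_modD(2)[OF H] by (intro finsum_addf[symmetric]) auto
    also have "\<dots> = finsum H (\<lambda>v. cst ((if b t = v then q t else 0) + c v) \<odot>\<^bsub>H\<^esub> v) ?F"
      using Fc rat_modD(2,4)[OF H] by (intro finsum_cong') auto
    finally show ?case by (rule exI[of _ "\<lambda>v. (if b t = v then q t else 0) + c v"])
  qed
  have "\<exists>c. x = finsum H (\<lambda>v. cst (c v) \<odot>\<^bsub>H\<^esub> v) ?F" if xc: "x \<in> carrier H" for x
  proof -
    obtain q where "x = finsum H (\<lambda>s. cst (q s) \<odot>\<^bsub>H\<^esub> b s) S" using P[OF xc] by blast
    with fs[OF S(1) order_refl, of q] show ?thesis by simp
  qed
  then show ?thesis
    unfolding finite_dim_rat_def using S(1) Fc by (intro exI[of _ ?F]) auto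
qed

text \<open>Gaussian elimination, one coordinate of \<open>B\<close> at a time: a member of the
  subspace \<open>Z\<close> with nonzero coordinate serves as pivot, and the induction continues
  with the members of \<open>Z\<close> whose coordinate vanishes. \<open>S\<close> then spans
  \<open>Z\<close> up to elements all of whose coordinates in \<open>B\<close> are zero.\<close>

lemma finite_span:
  fixes M :: "'m::ab_group_add gmodule" and cc :: "'m \<Rightarrow> 'i \<Rightarrow> rat"
  assumes M: "cmod V M"
    and add: "\<And>x y z. x \<in> carrier M \<Longrightarrow> y \<in> carrier M \<Longrightarrow> cc (x + y) z = cc x z + cc y z"
    and mult: "\<And>c x z. x \<in> carrier M \<Longrightarrow> cc (cst c \<odot>\<^bsub>M\<^esub> x) z = c * cc x z"
    and B: "finite B"
    and Z: "Z \<subseteq> carrier M" "0 \<in> Z" "\<And>x y. x \<in> Z \<Longrightarrow> y \<in> Z \<Longrightarrow> x + y \<in> Z" "\<And>c x. x \<in> Z \<Longrightarrow> cst c \<odot>\<^bsub>M\<^esub> x \<in> Z"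
  shows "\<exists>S\<subseteq>Z. finite S \<and> (\<forall>u\<in>Z. \<exists>q. \<forall>z\<in>B. cc (u - (\<Sum>s\<in>S. cst (q s) \<odot>\<^bsub>M\<^esub> s)) z = 0)"
  using B Z
proof (induction B arbitrary: Z rule: finite_induct)
  case empty
  then show ?case by (intro exI[of _ "{}"]) auto
next
  case (insert b B)
  define Z' where "Z' = {u \<in> Z. cc u b = 0}"
  have cc0: "cc 0 z = 0" for z using add[of 0 0 z] cmodD(3)[OF M] by simp
  have "\<exists>S\<subseteq>Z'. finite S \<and> (\<forall>u\<in>Z'. \<exists>q. \<forall>z\<in>B. cc (u - (\<Sum>s\<in>S. cst (q s) \<odot>\<^bsub>M\<^esub> s)) z = 0)"
  proof (rule insert.IH)
    show "Z' \<subseteq> carrier M" "0 \<in> Z'" using insert.prems(1,2) cc0 by (auto simp: Z'_def)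
    show "x + y \<in> Z'" if "x \<in> Z'" "y \<in> Z'" for x y
      using that insert.prems(1,3) add[of x y b] by (auto simp: Z'_def)
    show "cst c \<odot>\<^bsub>M\<^esub> x \<in> Z'" if "x \<in> Z'" for c x
      using that insert.prems(1,4) mult[of x c b] by (auto simp: Z'_def)
  qed
  then obtain S where S: "S \<subseteq> Z'" "finite S" "\<And>u. u \<in> Z' \<Longrightarrow> \<exists>q. \<forall>z\<in>B. cc (u - (\<Sum>s\<in>S. cst (q s) \<odot>\<^bsub>M\<^esub> s)) z = 0"
    by blast
  have ZC: "x \<in> Z \<Longrightarrow> x \<in> carrier M" for x using insert.prems(1) by blast
  have Sc: "cst c \<odot>\<^bsub>M\<^esub> s \<in> Z'" if "s \<in> S" for s c
  proof -
    have "s \<in> Z" "cc s b = 0" using that S(1) by (auto simp: Z'_def)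
    then show ?thesis using insert.prems(4) mult[OF ZC, of s c b] by (simp add: Z'_def)
  qed
  have sumZ: "(\<Sum>s\<in>S. cst (q s) \<odot>\<^bsub>M\<^esub> s) \<in> Z'" for q
  proof (rule sum_closed[where P = "\<lambda>x. x \<in> Z'"])
    show "0 \<in> Z'" using insert.prems(2) cc0 by (simp add: Z'_def)
    show "x + y \<in> Z'" if "x \<in> Z'" "y \<in> Z'" for x y
      using that insert.prems(1,3) add[of x y b] by (auto simp: Z'_def)
  qed (rule Sc)
  have neg: "- x \<in> carrier M \<and> cc (- x) z = - cc x z" if "x \<in> carrier M" for x z
    using add[of "- x" x z] cmodD(5)[OF M that] that cc0 by (simp add: eq_neg_iff_add_eq_0)
  have diff: "cc (x - y) z = cc x z - cc y z" if "x \<in> carrier M" "y \<in> carrier M" for x y z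
    using add[of x "- y" z] neg[of y] that by simp
  show ?case
  proof (cases "\<exists>w\<in>Z. cc w b \<noteq> 0")
    case False
    then have ZZ: "Z' = Z" by (auto simp: Z'_def)
    have "\<exists>q. \<forall>z\<in>insert b B. cc (u - (\<Sum>s\<in>S. cst (q s) \<odot>\<^bsub>M\<^esub> s)) z = 0" if u: "u \<in> Z" for u
    proof -
      obtain q where q: "\<forall>z\<in>B. cc (u - (\<Sum>s\<in>S. cst (q s) \<odot>\<^bsub>M\<^esub> s)) z = 0" using S(3)[of u] u ZZ by blast
      have "cc (u - (\<Sum>s\<in>S. cst (q s) \<odot>\<^bsub>M\<^esub> s)) b = 0"
        using diff[of u "\<Sum>s\<in>S. cst (q s) \<odot>\<^bsub>M\<^esub> s" b] u sumZ[of q] ZC ZZ False by auto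
      with q show ?thesis by blast
    qed
    then show ?thesis using S(1,2) ZZ by blast
  next
    case True
    then obtain w where w: "w \<in> Z" "cc w b \<noteq> 0" by blast
    have wS: "w \<notin> S" using w S(1) by (auto simp: Z'_def)
    have "\<exists>q. \<forall>z\<in>insert b B. cc (u - (\<Sum>s\<in>insert w S. cst (q s) \<odot>\<^bsub>M\<^esub> s)) z = 0" if u: "u \<in> Z" for u
    proof -
      let ?t = "cc u b / cc w b"
      have tw: "cst ?t \<odot>\<^bsub>M\<^esub> w \<in> Z" "cst (- ?t) \<odot>\<^bsub>M\<^esub> w \<in> Z" using insert.prems(4) w by blast+
      have mt: "cst (- ?t) \<odot>\<^bsub>M\<^esub> w = - (cst ?t \<odot>\<^bsub>M\<^esub> w)"
      proof -
        have "cst (- ?t + ?t) \<odot>\<^bsub>M\<^esub> w = cst (- ?t) \<odot>\<^bsub>M\<^esub> w + cst ?t \<odot>\<^bsub>M\<^esub> w"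
          unfolding cst_add by (rule cmodD(8)[OF M pols_cst pols_cst ZC[OF w(1)]])
        then show ?thesis using cmodD(12)[OF M ZC[OF w(1)]] by (simp add: eq_neg_iff_add_eq_0)
      qed
      have "u - cst ?t \<odot>\<^bsub>M\<^esub> w \<in> Z" using insert.prems(3)[OF u tw(2)] mt by simp
      moreover have "cc (u - cst ?t \<odot>\<^bsub>M\<^esub> w) b = 0"
        using diff[OF ZC[OF u] ZC[OF tw(1)], of b] mult[OF ZC[OF w(1)], of ?t b] w(2) by simp
      ultimately have "u - cst ?t \<odot>\<^bsub>M\<^esub> w \<in> Z'" by (simp add: Z'_def)
      then obtain q where q: "\<forall>z\<in>B. cc (u - cst ?t \<odot>\<^bsub>M\<^esub> w - (\<Sum>s\<in>S. cst (q s) \<odot>\<^bsub>M\<^esub> s)) z = 0"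
        using S(3) by blast
      have b0: "cc (u - cst ?t \<odot>\<^bsub>M\<^esub> w - (\<Sum>s\<in>S. cst (q s) \<odot>\<^bsub>M\<^esub> s)) b = 0"
        using diff[of "u - cst ?t \<odot>\<^bsub>M\<^esub> w" "\<Sum>s\<in>S. cst (q s) \<odot>\<^bsub>M\<^esub> s" b] sumZ[of q] \<open>u - cst ?t \<odot>\<^bsub>M\<^esub> w \<in> Z'\<close> ZC
        by (auto simp: Z'_def)
      let ?q = "q(w := ?t)"
      have "(\<Sum>s\<in>S. cst (?q s) \<odot>\<^bsub>M\<^esub> s) = (\<Sum>s\<in>S. cst (q s) \<odot>\<^bsub>M\<^esub> s)"
        using wS by (intro sum.cong refl) (metis fun_upd_other)
      then have "u - (\<Sum>s\<in>insert w S. cst (?q s) \<odot>\<^bsub>M\<^esub> s) = u - cst ?t \<odot>\<^bsub>M\<^esub> w - (\<Sum>s\<in>S. cst (q s) \<odot>\<^bsub>M\<^esub> s)"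
        using wS S(2) by (simp add: diff_diff_eq)
      with q b0 show ?thesis by (intro exI[of _ ?q]) (metis insert_iff)
    qed
    moreover have "insert w S \<subseteq> Z" using w S(1) by (auto simp: Z'_def)
    ultimately show ?thesis using S(2) by (intro exI[of _ "insert w S"]) auto
  qed
qed

section \<open>The submodule generated by the maximal ideal\<close>

lemma const_free_in_maximal_ideal:
  assumes "p \<in> pols V" "lookup p 0 = 0"
  shows "p \<in> Idl\<^bsub>pol_ring V\<^esub> (X ` V)"
proof -
  interpret R: cring "pol_ring V" by (rule cring_pol_ring)
  have XV: "X ` V \<subseteq> carrier (pol_ring V)" by (auto simp: pol_ring_def)
  interpret I: ideal "Idl\<^bsub>pol_ring V\<^esub> (X ` V)" "pol_ring V" by (rule R.genideal_ideal[OF XV])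
  have z: "0 \<in> Idl\<^bsub>pol_ring V\<^esub> (X ` V)" using I.zero_closed by (simp add: pol_ring_def)
  have a: "x \<in> Idl\<^bsub>pol_ring V\<^esub> (X ` V) \<Longrightarrow> y \<in> Idl\<^bsub>pol_ring V\<^esub> (X ` V) \<Longrightarrow> x + y \<in> Idl\<^bsub>pol_ring V\<^esub> (X ` V)" for x y
    using I.a_closed[of x y] by (simp add: pol_ring_def)
  have s: "single a c \<in> Idl\<^bsub>pol_ring V\<^esub> (X ` V)" if aV: "keys a \<subseteq> V" and a0: "a \<noteq> 0" for a c
  proof -
    obtain v where v: "v \<in> keys a" using a0 by (metis all_not_in_conv in_keys_iff lookup_zero poly_mapping_eqI)
    define e where "e = a - single v 1"
    have ae: "a = single v 1 + e"
      using v by (intro poly_mapping_eqI) (auto simp: e_def lookup_add lookup_minus lookup_single when_def in_keys_iff)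
    then have "keys e \<subseteq> V" using aV keys_mono_add[of "single v 1" e] by auto
    then have "single e c \<in> carrier (pol_ring V)" by (simp add: pol_ring_def pols_iff_single)
    moreover have "X v \<in> Idl\<^bsub>pol_ring V\<^esub> (X ` V)" using R.genideal_self[OF XV] v aV by blast
    ultimately have "single e c * X v \<in> Idl\<^bsub>pol_ring V\<^esub> (X ` V)"
      using I.I_l_closed[of "X v" "single e c"] by (simp add: pol_ring_def)
    then show ?thesis by (simp add: X_def mult_single ae add.commute)
  qed
  have "(\<Sum>a\<in>keys p. single a (lookup p a)) \<in> Idl\<^bsub>pol_ring V\<^esub> (X ` V)"
  proof (rule sum_closed[where P = "\<lambda>x. x \<in> Idl\<^bsub>pol_ring V\<^esub> (X ` V)"])
    fix a assume "a \<in> keys p"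
    then show "single a (lookup p a) \<in> Idl\<^bsub>pol_ring V\<^esub> (X ` V)"
      using assms by (intro s) (auto simp: pols_def in_keys_iff)
  qed (use z a in auto)
  then show ?thesis by (simp flip: mpol_expand)
qed

lemma additive_map:
  assumes "abelian_group M" "abelian_group N" "\<And>x. x \<in> carrier M \<Longrightarrow> f x \<in> carrier N"
    and "\<And>x y. x \<in> carrier M \<Longrightarrow> y \<in> carrier M \<Longrightarrow> f (x \<oplus>\<^bsub>M\<^esub> y) = f x \<oplus>\<^bsub>N\<^esub> f y"
  shows "f \<zero>\<^bsub>M\<^esub> = \<zero>\<^bsub>N\<^esub>" "x \<in> carrier M \<Longrightarrow> f (\<ominus>\<^bsub>M\<^esub> x) = \<ominus>\<^bsub>N\<^esub> f x"
proof -
  interpret group_hom "add_monoid M" "add_monoid N" f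
    using assms(3,4) abelian_group.a_group[OF assms(1)] abelian_group.a_group[OF assms(2)]
    by (intro group_hom.intro group_hom_axioms.intro) (auto simp: hom_def)
  show "f \<zero>\<^bsub>M\<^esub> = \<zero>\<^bsub>N\<^esub>" using hom_one by simp
  show "x \<in> carrier M \<Longrightarrow> f (\<ominus>\<^bsub>M\<^esub> x) = \<ominus>\<^bsub>N\<^esub> f x" using hom_inv[of x] by (simp add: a_inv_def)
qed

lemma pol_ring_module:
  assumes "module (pol_ring V) M"
  shows "abelian_group M" "p \<in> pols V \<Longrightarrow> x \<in> carrier M \<Longrightarrow> p \<odot>\<^bsub>M\<^esub> x \<in> carrier M"
    "p \<in> pols V \<Longrightarrow> x \<in> carrier M \<Longrightarrow> y \<in> carrier M \<Longrightarrow> p \<odot>\<^bsub>M\<^esub> (x \<oplus>\<^bsub>M\<^esub> y) = p \<odot>\<^bsub>M\<^esub> x \<oplus>\<^bsub>M\<^esub> p \<odot>\<^bsub>M\<^esub> y"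
    "p \<in> pols V \<Longrightarrow> q \<in> pols V \<Longrightarrow> x \<in> carrier M \<Longrightarrow> p \<odot>\<^bsub>M\<^esub> (q \<odot>\<^bsub>M\<^esub> x) = q \<odot>\<^bsub>M\<^esub> (p \<odot>\<^bsub>M\<^esub> x)"
proof -
  interpret module "pol_ring V" M by (rule assms)
  have P: "p \<in> carrier (pol_ring V) \<longleftrightarrow> p \<in> pols V" "p \<otimes>\<^bsub>pol_ring V\<^esub> q = p * q" for p q
    by (simp_all add: pol_ring_def)
  show "abelian_group M" by (rule M.abelian_group_axioms)
  show "p \<in> pols V \<Longrightarrow> x \<in> carrier M \<Longrightarrow> p \<odot>\<^bsub>M\<^esub> x \<in> carrier M"
    using smult_closed[of p x] by (simp add: P)
  show "p \<in> pols V \<Longrightarrow> x \<in> carrier M \<Longrightarrow> y \<in> carrier M \<Longrightarrow> p \<odot>\<^bsub>M\<^esub> (x \<oplus>\<^bsub>M\<^esub> y) = p \<odot>\<^bsub>M\<^esub> x \<oplus>\<^bsub>M\<^esub> p \<odot>\<^bsub>M\<^esub> y"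
    using smult_r_distr[of p x y] by (simp add: P)
  show "p \<in> pols V \<Longrightarrow> q \<in> pols V \<Longrightarrow> x \<in> carrier M \<Longrightarrow> p \<odot>\<^bsub>M\<^esub> (q \<odot>\<^bsub>M\<^esub> x) = q \<odot>\<^bsub>M\<^esub> (p \<odot>\<^bsub>M\<^esub> x)"
    using smult_assoc1[of p q x] smult_assoc1[of q p x] by (simp add: P mult.commute)
qed

lemma maximal_ideal_pols: "p \<in> Idl\<^bsub>pol_ring V\<^esub> (X ` V) \<Longrightarrow> p \<in> pols V"
proof -
  interpret R: cring "pol_ring V" by (rule cring_pol_ring)
  have "X ` V \<subseteq> carrier (pol_ring V)" by (auto simp: pol_ring_def)
  then have "Idl\<^bsub>pol_ring V\<^esub> (X ` V) \<subseteq> carrier (pol_ring V)"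
    by (rule additive_subgroup.a_subset[OF ideal.axioms(1)[OF R.genideal_ideal]])
  then show "p \<in> Idl\<^bsub>pol_ring V\<^esub> (X ` V) \<Longrightarrow> p \<in> pols V" by (auto simp: pol_ring_def)
qed

lemma max_submodule_subgroup:
  assumes "module (pol_ring V) M" shows "subgroup (max_submodule V M) (add_monoid M)"
  unfolding max_submodule_def
proof (rule group.generate_is_subgroup)
  note m = pol_ring_module[OF assms]
  show "group (add_monoid M)" by (rule abelian_group.a_group[OF m(1)])
  show "{p \<odot>\<^bsub>M\<^esub> x | p x. p \<in> Idl\<^bsub>pol_ring V\<^esub> (X ` V) \<and> x \<in> carrier M} \<subseteq> carrier (add_monoid M)"
    using m(2) maximal_ideal_pols by auto
qed

lemma max_submoduleI: "p \<in> pols V \<Longrightarrow> lookup p 0 = 0 \<Longrightarrow> x \<in> carrier M \<Longrightarrow> p \<odot>\<^bsub>M\<^esub> x \<in> max_submodule V M"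
  unfolding max_submodule_def using const_free_in_maximal_ideal[of p V] by (intro generate.incl) blast

lemma max_submodule_map:
  assumes M: "module (pol_ring V) M" and N: "module (pol_ring V) N"
    and c: "\<And>x. x \<in> carrier M \<Longrightarrow> f x \<in> carrier N"
    and add: "\<And>x y. x \<in> carrier M \<Longrightarrow> y \<in> carrier M \<Longrightarrow> f (x \<oplus>\<^bsub>M\<^esub> y) = f x \<oplus>\<^bsub>N\<^esub> f y"
    and s: "\<And>p x. p \<in> pols V \<Longrightarrow> x \<in> carrier M \<Longrightarrow> f (p \<odot>\<^bsub>M\<^esub> x) = p \<odot>\<^bsub>N\<^esub> f x"
    and x: "x \<in> max_submodule V M"
  shows "f x \<in> max_submodule V N"
proof -
  note mM = pol_ring_module[OF M] and mN = pol_ring_module[OF N]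
  have fa: "f \<zero>\<^bsub>M\<^esub> = \<zero>\<^bsub>N\<^esub>" "x \<in> carrier M \<Longrightarrow> f (\<ominus>\<^bsub>M\<^esub> x) = \<ominus>\<^bsub>N\<^esub> f x" for x
    using additive_map[OF mM(1) mN(1), of f] c add by blast+
  note sM = subgroup.mem_carrier[OF max_submodule_subgroup[OF M]]
  note sN = subgroup.one_closed[OF max_submodule_subgroup[OF N]] subgroup.m_closed[OF max_submodule_subgroup[OF N]]
    subgroup.m_inv_closed[OF max_submodule_subgroup[OF N]]
  have incl1: "f h \<in> max_submodule V N" and incl2: "h \<in> carrier M"
    if "h \<in> {p \<odot>\<^bsub>M\<^esub> x | p x. p \<in> Idl\<^bsub>pol_ring V\<^esub> (X ` V) \<and> x \<in> carrier M}" for h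
  proof -
    obtain p y where h: "h = p \<odot>\<^bsub>M\<^esub> y" "p \<in> Idl\<^bsub>pol_ring V\<^esub> (X ` V)" "y \<in> carrier M" using \<open>h \<in> _\<close> by blast
    note p = maximal_ideal_pols[OF h(2)]
    show "h \<in> carrier M" unfolding h(1) by (rule mM(2)[OF p h(3)])
    show "f h \<in> max_submodule V N"
      unfolding h(1) s[OF p h(3)] max_submodule_def using h(2) c[OF h(3)] by (intro generate.incl) blast
  qed
  show ?thesis
    using x[unfolded max_submodule_def]
  proof (induction rule: generate.induct)
    case one then show ?case using fa(1) sN(1) by simp
  next
    case (incl h) then show ?case by (rule incl1)
  next
    case (inv h)
    then show ?case using fa(2)[OF incl2[OF inv]] sN(3)[OF incl1[OF inv]]
      by (simp add: a_inv_def)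
  next
    case (eng h1 h2)
    then show ?case using add[of h1 h2] sM[of h1] sM[of h2] sN(2)[of "f h1" "f h2"] by (simp add: max_submodule_def)
  qed
qed

lemma max_submodule_cst:
  assumes M: "module (pol_ring V) M" and k: "k \<in> max_submodule V M"
  shows "cst c \<odot>\<^bsub>M\<^esub> k \<in> max_submodule V M"
  using pol_ring_module[OF M] by (intro max_submodule_map[OF M M _ _ _ k]) auto

text \<open>Unfolds the two quotients in the definition of cohomology. What remains is a statement
  about representatives: an element that is a cycle modulo \<open>max_submodule\<close> is, up to
  \<open>max_submodule\<close> and a boundary, a rational combination of the finitely many cycles
  \<open>G s\<close>. The vanishing constant term of \<open>w\<close> is what makes boundaries
  cycles modulo \<open>max_submodule\<close>.\<close>

lemma finite_dim_cohomologyI: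
  assumes M: "\<And>i. module (pol_ring V) (component M i)" and V: "ring_vars M = V"
    and d: "\<And>i x. x \<in> carrier (component M i) \<Longrightarrow> differential M i x \<in> carrier (component M (\<not> i))"
      "\<And>i x y. x \<in> carrier (component M i) \<Longrightarrow> y \<in> carrier (component M i) \<Longrightarrow>
         differential M i (x \<oplus>\<^bsub>component M i\<^esub> y) = differential M i x \<oplus>\<^bsub>component M (\<not> i)\<^esub> differential M i y"
      "\<And>i p x. p \<in> pols V \<Longrightarrow> x \<in> carrier (component M i) \<Longrightarrow>
         differential M i (p \<odot>\<^bsub>component M i\<^esub> x) = p \<odot>\<^bsub>component M (\<not> i)\<^esub> differential M i x"
      "\<And>i x. x \<in> carrier (component M i) \<Longrightarrow> differential M (\<not> i) (differential M i x) = w \<odot>\<^bsub>component M i\<^esub> x"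
    and w: "w \<in> pols V" "lookup w 0 = 0"
    and S: "finite S" "\<And>s. s \<in> S \<Longrightarrow> G s \<in> carrier (component M i)"
      "\<And>s. s \<in> S \<Longrightarrow> differential M i (G s) \<in> max_submodule V (component M (\<not> i))"
    and span: "\<And>x. x \<in> carrier (component M i) \<Longrightarrow> differential M i x \<in> max_submodule V (component M (\<not> i)) \<Longrightarrow>
      \<exists>q k y. k \<in> max_submodule V (component M i) \<and> y \<in> carrier (component M (\<not> i)) \<and>
        x = k \<oplus>\<^bsub>component M i\<^esub> (differential M (\<not> i) y \<oplus>\<^bsub>component M i\<^esub>
          finsum (component M i) (\<lambda>s. cst (q s) \<odot>\<^bsub>component M i\<^esub> G s) S)"
  shows "finite_dim_rat (cohomology M i)"
proof -
  define A where "A j = component M j" for j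
  define K where "K j = max_submodule V (A j)" for j
  define d where "d = differential M" 
  have RQ: "rat_quot (A j) (K j)" for j
    unfolding A_def K_def by (intro rat_quot.intro module_rat_mod[OF M] max_submodule_subgroup[OF M] max_submodule_cst[OF M])
  interpret P: rat_quot "A j" "K j" for j by (rule RQ)
  note D = d[folded A_def d_def]
  have dK: "d j x \<in> K (\<not> j)" if "x \<in> K j" for j x
    unfolding K_def using that[unfolded K_def] M[folded A_def] D by (intro max_submodule_map[where f = "d j"]) auto
  have R: "reduced M j = quot_module (A j) (K j)" for j by (simp add: reduced_def V A_def K_def)
  have rd: "reduced_differential M j (K j +>\<^bsub>A j\<^esub> x) = K (\<not> j) +>\<^bsub>A (\<not> j)\<^esub> d j x" if x: "x \<in> carrier (A j)" for j x
  proof -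
    have "(\<lambda>x. K (\<not> j) +>\<^bsub>A (\<not> j)\<^esub> d j x) ` (K j +>\<^bsub>A j\<^esub> x) = {K (\<not> j) +>\<^bsub>A (\<not> j)\<^esub> d j x}"
    proof (rule antisym)
      show "{K (\<not> j) +>\<^bsub>A (\<not> j)\<^esub> d j x} \<subseteq> (\<lambda>x. K (\<not> j) +>\<^bsub>A (\<not> j)\<^esub> d j x) ` (K j +>\<^bsub>A j\<^esub> x)"
        using P.self_\<pi>[OF x] by (intro Set.subsetI) (auto intro!: image_eqI)
      show "(\<lambda>x. K (\<not> j) +>\<^bsub>A (\<not> j)\<^esub> d j x) ` (K j +>\<^bsub>A j\<^esub> x) \<subseteq> {K (\<not> j) +>\<^bsub>A (\<not> j)\<^esub> d j x}"
      proof (rule image_subsetI)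
        fix y assume "y \<in> K j +>\<^bsub>A j\<^esub> x"
        then obtain k where k: "k \<in> K j" "y = k \<oplus>\<^bsub>A j\<^esub> x" unfolding P.\<pi>_eq by blast
        show "K (\<not> j) +>\<^bsub>A (\<not> j)\<^esub> d j y \<in> {K (\<not> j) +>\<^bsub>A (\<not> j)\<^esub> d j x}"
          using P.\<pi>_eqI[OF D(1)[OF x] dK[OF k(1)]] D(2)[OF P.K_closed(1)[OF k(1)] x] by (simp add: k(2))
      qed
    qed
    then show ?thesis by (simp add: reduced_differential_def V A_def K_def d_def)
  qed
  \<comment> \<open>The preimage in \<open>M\<close> of the cocycles of the reduced complex; all
    calculations use representatives in \<open>Z\<close>.\<close>
  define Z where "Z = {x \<in> carrier (A i). d i x \<in> K (\<not> i)}"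
  have Zc: "x \<in> Z \<Longrightarrow> x \<in> carrier (A i)" for x by (simp add: Z_def)
  note fa = additive_map[OF P.A.abelian_group_axioms P.A.abelian_group_axioms D(1,2)]
  have Z0: "\<zero>\<^bsub>A i\<^esub> \<in> Z" using fa(1)[of i] P.K_closed(2) by (simp add: Z_def)
  have Za: "x \<oplus>\<^bsub>A i\<^esub> y \<in> Z" if "x \<in> Z" "y \<in> Z" for x y
    using that D(2)[where i = i and x = x and y = y] P.K_closed(3)[where j = "\<not> i" and k = "d i x" and l = "d i y"] by (simp add: Z_def)
  have Zn: "\<ominus>\<^bsub>A i\<^esub> x \<in> Z" if "x \<in> Z" for x
    using that fa(2)[where x = x] P.K_closed(4)[where j = "\<not> i" and k = "d i x"] by (simp add: Z_def)
  have Zs: "cst c \<odot>\<^bsub>A i\<^esub> x \<in> Z" if "x \<in> Z" for c x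
    using that D(3)[OF pols_cst, where i = i and x = x] P.cK[where j = "\<not> i" and k = "d i x"] rat_modD(2)[OF P.A[of i], of x c] by (simp add: Z_def)
  have Zd: "d (\<not> i) y \<in> Z" if "y \<in> carrier (A (\<not> i))" for y
    using D(1,4)[OF that] max_submoduleI[OF w, of "y" "A (\<not> i)"] that by (simp add: Z_def K_def)
  let ?\<pi> = "\<lambda>x. K i +>\<^bsub>A i\<^esub> x"
  let ?Q = "quot_module (A i) (K i)"
  have ker: "a_kernel ?Q (quot_module (A (\<not> i)) (K (\<not> i))) (reduced_differential M i) = ?\<pi> ` Z"
  proof (rule Set.set_eqI)
    have "reduced_differential M i (?\<pi> x) = K (\<not> i) \<longleftrightarrow> x \<in> Z" if "x \<in> carrier (A i)" for x
      unfolding rd[OF that] P.\<pi>_K_iff[OF D(1)[OF that]] using that by (simp add: Z_def)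
    then have "C \<in> carrier ?Q \<and> reduced_differential M i C = K (\<not> i) \<longleftrightarrow> C \<in> ?\<pi> ` Z" for C
      unfolding P.Q_carrier using Zc by blast
    then show "C \<in> a_kernel ?Q (quot_module (A (\<not> i)) (K (\<not> i))) (reduced_differential M i) \<longleftrightarrow> C \<in> ?\<pi> ` Z" for C
      unfolding a_kernel_def kernel_def using P.Q_zero[of "\<not> i"] by simp
  qed
  define A' where "A' = ?Q\<lparr>carrier := ?\<pi> ` Z\<rparr>"
  have A's: "carrier A' = ?\<pi> ` Z" "(\<oplus>\<^bsub>A'\<^esub>) = (\<oplus>\<^bsub>?Q\<^esub>)" "(\<odot>\<^bsub>A'\<^esub>) = (\<odot>\<^bsub>?Q\<^esub>)" "\<zero>\<^bsub>A'\<^esub> = \<zero>\<^bsub>?Q\<^esub>"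
    by (simp_all add: A'_def)
  have \<pi>0: "?\<pi> \<zero>\<^bsub>A i\<^esub> = K i" using P.\<pi>_K_iff[where j = i, OF P.A.zero_closed] P.K_closed(2) by simp
  have A'op: "?\<pi> x \<oplus>\<^bsub>A'\<^esub> ?\<pi> y = ?\<pi> (x \<oplus>\<^bsub>A i\<^esub> y)" "cst c \<odot>\<^bsub>A'\<^esub> ?\<pi> x = ?\<pi> (cst c \<odot>\<^bsub>A i\<^esub> x)"
    if "x \<in> carrier (A i)" "y \<in> carrier (A i)" for x y c
    using P.Q_add[OF that] P.Q_smult[OF that(1)] by (simp_all add: A's)
  have A'0: "\<zero>\<^bsub>A'\<^esub> = ?\<pi> \<zero>\<^bsub>A i\<^esub>" by (simp add: A's P.Q_zero \<pi>0)
  have ag: "abelian_group A'"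
  proof (rule abelian_groupI)
    fix C D E assume "C \<in> carrier A'" "D \<in> carrier A'" "E \<in> carrier A'"
    then obtain x y z where *: "C = ?\<pi> x" "D = ?\<pi> y" "E = ?\<pi> z" "x \<in> Z" "y \<in> Z" "z \<in> Z" unfolding A's by blast
    note c = *(4-6)[THEN Zc]
    show "C \<oplus>\<^bsub>A'\<^esub> D \<in> carrier A'" using * c Za by (simp add: A'op) (simp add: A's)
    show "C \<oplus>\<^bsub>A'\<^esub> D \<oplus>\<^bsub>A'\<^esub> E = C \<oplus>\<^bsub>A'\<^esub> (D \<oplus>\<^bsub>A'\<^esub> E)" using * c by (simp add: A'op P.A.a_assoc)
    show "C \<oplus>\<^bsub>A'\<^esub> D = D \<oplus>\<^bsub>A'\<^esub> C" using * c by (simp add: A'op P.A.a_comm)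
    show "\<zero>\<^bsub>A'\<^esub> \<oplus>\<^bsub>A'\<^esub> C = C" using * c by (simp add: A'0 A'op)
    have "?\<pi> (\<ominus>\<^bsub>A i\<^esub> x) \<oplus>\<^bsub>A'\<^esub> C = \<zero>\<^bsub>A'\<^esub>" using * c by (simp add: A'0 A'op P.A.l_neg)
    moreover have "?\<pi> (\<ominus>\<^bsub>A i\<^esub> x) \<in> carrier A'" using Zn[OF *(4)] by (simp add: A's)
    ultimately show "\<exists>D\<in>carrier A'. D \<oplus>\<^bsub>A'\<^esub> C = \<zero>\<^bsub>A'\<^esub>" by (intro bexI)
  next
    show "\<zero>\<^bsub>A'\<^esub> \<in> carrier A'" unfolding A'0 using Z0 by (simp add: A's)
  qed
  have A': "rat_mod A'"
    unfolding rat_mod_def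
  proof (intro conjI ag allI ballI)
    fix C D c assume "C \<in> carrier A'" "D \<in> carrier A'"
    then obtain x y where *: "C = ?\<pi> x" "D = ?\<pi> y" "x \<in> Z" "y \<in> Z" unfolding A's by blast
    note c = *(3,4)[THEN Zc]
    show "cst c \<odot>\<^bsub>A'\<^esub> (C \<oplus>\<^bsub>A'\<^esub> D) = cst c \<odot>\<^bsub>A'\<^esub> C \<oplus>\<^bsub>A'\<^esub> cst c \<odot>\<^bsub>A'\<^esub> D"
      using * c rat_modD(2,3)[OF P.A] by (simp add: A'op)
  next
    fix C c d assume "C \<in> carrier A'"
    then obtain x where *: "C = ?\<pi> x" "x \<in> Z" unfolding A's by blast
    note c = Zc[OF *(2)]
    show "cst c \<odot>\<^bsub>A'\<^esub> C \<in> carrier A'" using * c Zs by (simp add: A'op) (simp add: A's)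
    show "cst (c + d) \<odot>\<^bsub>A'\<^esub> C = cst c \<odot>\<^bsub>A'\<^esub> C \<oplus>\<^bsub>A'\<^esub> cst d \<odot>\<^bsub>A'\<^esub> C"
      using * c rat_modD(2,4)[OF P.A] by (simp add: A'op)
  qed
  define K' where "K' = (\<lambda>y. ?\<pi> (d (\<not> i) y)) ` carrier (A (\<not> i))"
  have im: "reduced_differential M (\<not> i) ` carrier (reduced M (\<not> i)) = K'"
    unfolding K'_def R P.Q_carrier image_image using rd[of _ "\<not> i"] by (intro image_cong) auto
  have dc: "y \<in> carrier (A (\<not> i)) \<Longrightarrow> d (\<not> i) y \<in> carrier (A i)" for y using D(1)[where x = y and i = "\<not> i"] by simp
  have da: "x \<in> carrier (A (\<not> i)) \<Longrightarrow> y \<in> carrier (A (\<not> i)) \<Longrightarrow>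
      d (\<not> i) (x \<oplus>\<^bsub>A (\<not> i)\<^esub> y) = d (\<not> i) x \<oplus>\<^bsub>A i\<^esub> d (\<not> i) y" for x y using D(2)[where i = "\<not> i" and x = x and y = y] by simp
  have ds: "x \<in> carrier (A (\<not> i)) \<Longrightarrow> d (\<not> i) (cst c \<odot>\<^bsub>A (\<not> i)\<^esub> x) = cst c \<odot>\<^bsub>A i\<^esub> d (\<not> i) x" for x c
    using D(3)[OF pols_cst, where i = "\<not> i" and x = x] by simp
  note da' = additive_map[OF P.A.abelian_group_axioms P.A.abelian_group_axioms dc da]
  interpret A': abelian_group A' by (rule ag)
  have K's: "subgroup K' (add_monoid A')"
  proof (rule group.subgroupI[OF A'.a_group])
    show "K' \<subseteq> carrier (add_monoid A')" using Zd by (auto simp: K'_def A's)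
    show "K' \<noteq> {}" unfolding K'_def using P.A.zero_closed by blast
    fix C D assume "C \<in> K'" "D \<in> K'"
    then obtain x y where *: "C = ?\<pi> (d (\<not> i) x)" "D = ?\<pi> (d (\<not> i) y)" "x \<in> carrier (A (\<not> i))" "y \<in> carrier (A (\<not> i))"
      unfolding K'_def by blast
    have "C \<oplus>\<^bsub>A'\<^esub> D = ?\<pi> (d (\<not> i) (x \<oplus>\<^bsub>A (\<not> i)\<^esub> y))" using * dc by (simp add: A'op da)
    then show "C \<otimes>\<^bsub>add_monoid A'\<^esub> D \<in> K'" using * by (auto simp: K'_def)
    have "?\<pi> (d (\<not> i) (\<ominus>\<^bsub>A (\<not> i)\<^esub> x)) \<oplus>\<^bsub>A'\<^esub> C = \<zero>\<^bsub>A'\<^esub>"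
      using * dc by (simp add: A'op da' A'0 P.A.l_neg)
    moreover have "C \<in> carrier A'" "?\<pi> (d (\<not> i) (\<ominus>\<^bsub>A (\<not> i)\<^esub> x)) \<in> carrier A'" using * Zd by (simp_all add: A's)
    ultimately have "\<ominus>\<^bsub>A'\<^esub> C = ?\<pi> (d (\<not> i) (\<ominus>\<^bsub>A (\<not> i)\<^esub> x))" by (intro A'.minus_equality)
    then show "inv\<^bsub>add_monoid A'\<^esub> C \<in> K'" using * by (auto simp: K'_def a_inv_def)
  qed
  interpret H: rat_quot A' K'
  proof (rule rat_quot.intro[OF A' K's])
    fix c C assume "C \<in> K'"
    then obtain x where *: "C = ?\<pi> (d (\<not> i) x)" "x \<in> carrier (A (\<not> i))" unfolding K'_def by blast
    have "cst c \<odot>\<^bsub>A'\<^esub> C = ?\<pi> (d (\<not> i) (cst c \<odot>\<^bsub>A (\<not> i)\<^esub> x))" using * dc A'op(2)[OF dc dc] by (simp add: ds)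
    then show "cst c \<odot>\<^bsub>A'\<^esub> C \<in> K'" using * rat_modD(2)[OF P.A] by (auto simp: K'_def)
  qed
  have coh: "cohomology M i = quot_module A' K'"
    unfolding cohomology_def im unfolding R ker A'_def ..
  have GZ: "s \<in> S \<Longrightarrow> G s \<in> Z" for s using S by (simp add: Z_def A_def K_def d_def)
  let ?Cl = "\<lambda>x. K' +>\<^bsub>A'\<^esub> ?\<pi> x"
  have Clc: "x \<in> Z \<Longrightarrow> ?Cl x \<in> carrier (quot_module A' K')" for x by (simp add: H.Q_carrier A's)
  have Cla: "?Cl (x \<oplus>\<^bsub>A i\<^esub> y) = ?Cl x \<oplus>\<^bsub>quot_module A' K'\<^esub> ?Cl y" if "x \<in> Z" "y \<in> Z" for x y
    using that H.Q_add[of "?\<pi> x" "?\<pi> y"] A'op(1)[of x y] Zc by (simp add: A's)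
  have Cls: "?Cl (cst c \<odot>\<^bsub>A i\<^esub> x) = cst c \<odot>\<^bsub>quot_module A' K'\<^esub> ?Cl x" if "x \<in> Z" for x c
    using that H.Q_smult[of "?\<pi> x" c] A'op(2)[of x x c] Zc by (simp add: A's)
  have Cl0: "?Cl \<zero>\<^bsub>A i\<^esub> = \<zero>\<^bsub>quot_module A' K'\<^esub>"
    using H.\<pi>_K_iff[OF A'.zero_closed] H.K_closed(2) by (simp add: A'0 H.Q_zero)
  interpret H': abelian_group "quot_module A' K'" by (rule rat_modD(1)[OF H.Q_rat_mod])
  have sumZ: "finsum (A i) (\<lambda>s. cst (q s) \<odot>\<^bsub>A i\<^esub> G s) T \<in> Z \<and>
     ?Cl (finsum (A i) (\<lambda>s. cst (q s) \<odot>\<^bsub>A i\<^esub> G s) T) =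
       finsum (quot_module A' K') (\<lambda>s. cst (q s) \<odot>\<^bsub>quot_module A' K'\<^esub> ?Cl (G s)) T"
    if "finite T" "T \<subseteq> S" for q T
    using that
  proof (induction T rule: finite_induct)
    case empty then show ?case using Z0 Cl0 by simp
  next
    case (insert t T)
    have tS: "t \<in> S" and TS: "T \<subseteq> S" using insert.prems by auto
    have "finsum (A i) (\<lambda>s. cst (q s) \<odot>\<^bsub>A i\<^esub> G s) (insert t T) =
        cst (q t) \<odot>\<^bsub>A i\<^esub> G t \<oplus>\<^bsub>A i\<^esub> finsum (A i) (\<lambda>s. cst (q s) \<odot>\<^bsub>A i\<^esub> G s) T"
      by (rule P.A.finsum_insert[OF insert.hyps]) (use TS tS GZ Zs Zc in auto)
    moreover have "finsum (quot_module A' K') (\<lambda>s. cst (q s) \<odot>\<^bsub>quot_module A' K'\<^esub> ?Cl (G s)) (insert t T) =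
        cst (q t) \<odot>\<^bsub>quot_module A' K'\<^esub> ?Cl (G t) \<oplus>\<^bsub>quot_module A' K'\<^esub>
        finsum (quot_module A' K') (\<lambda>s. cst (q s) \<odot>\<^bsub>quot_module A' K'\<^esub> ?Cl (G s)) T"
      by (rule H'.finsum_insert[OF insert.hyps]) (use TS tS GZ Zs Clc rat_modD(2)[OF H.Q_rat_mod] in auto)
    ultimately show ?case using insert.IH[OF TS] Za[OF Zs[OF GZ[OF tS]]] Cla[OF Zs[OF GZ[OF tS]]] Cls[OF GZ[OF tS]]
      by simp
  qed
  show ?thesis
    unfolding coh
  proof (rule finite_dim_ratI[OF H.Q_rat_mod S(1), of "\<lambda>s. ?Cl (G s)"])
    show "?Cl (G s) \<in> carrier (quot_module A' K')" if "s \<in> S" for s by (rule Clc[OF GZ[OF that]])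
    fix C assume "C \<in> carrier (quot_module A' K')"
    then obtain x where x: "C = ?Cl x" "x \<in> Z" unfolding H.Q_carrier A's by blast
    obtain q k y where *: "k \<in> K i" "y \<in> carrier (A (\<not> i))"
      "x = k \<oplus>\<^bsub>A i\<^esub> (d (\<not> i) y \<oplus>\<^bsub>A i\<^esub> finsum (A i) (\<lambda>s. cst (q s) \<odot>\<^bsub>A i\<^esub> G s) S)"
      using span[folded A_def K_def d_def, of x] x(2)
      by (force simp: Z_def A_def K_def d_def)
    let ?y = "finsum (A i) (\<lambda>s. cst (q s) \<odot>\<^bsub>A i\<^esub> G s) S"
    have yZ: "?y \<in> Z" "?Cl ?y = finsum (quot_module A' K') (\<lambda>s. cst (q s) \<odot>\<^bsub>quot_module A' K'\<^esub> ?Cl (G s)) S"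
      using sumZ[OF S(1) order_refl] by blast+
    have "?\<pi> x = ?\<pi> (d (\<not> i) y) \<oplus>\<^bsub>A'\<^esub> ?\<pi> ?y"
      unfolding *(3) using P.\<pi>_eqI[OF P.A.a_closed[OF dc[OF *(2)] Zc[OF yZ(1)]] *(1)] A'op(1)[OF dc[OF *(2)] Zc[OF yZ(1)]] by simp
    moreover have "?\<pi> (d (\<not> i) y) \<in> K'" "?\<pi> ?y \<in> carrier A'" using *(2) yZ(1) by (simp_all add: K'_def A's)
    ultimately have "C = ?Cl ?y" using H.\<pi>_eqI x(1) by simp
    then show "\<exists>q. C = finsum (quot_module A' K') (\<lambda>s. cst (q s) \<odot>\<^bsub>quot_module A' K'\<^esub> ?Cl (G s)) S"
      using yZ(2) by (intro exI[of _ q]) simp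
  qed
qed

lemma subgroup_finsum:
  assumes "abelian_group M" "subgroup K (add_monoid M)" "finite S" "\<And>s. s \<in> S \<Longrightarrow> a s \<in> K"
  shows "finsum M a S \<in> K"
proof -
  interpret abelian_group M by (rule assms(1))
  note K = subgroup.one_closed[OF assms(2)] subgroup.m_closed[OF assms(2)] subgroup.mem_carrier[OF assms(2)]
  show ?thesis
    using assms(3,4)
  proof (induction S rule: finite_induct)
    case (insert s S)
    have "finsum M a (insert s S) = a s \<oplus>\<^bsub>M\<^esub> finsum M a S"
      by (rule finsum_insert[OF insert.hyps]) (use insert.prems K(3) in auto)
    then show ?case using insert.IH insert.prems K(2)[of "a s" "finsum M a S"] by simp
  qed (use K(1) in simp)
qed

lemma lin_maps_raw:
  assumes "f \<in> lin_maps V k M N"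
  shows "x \<in> carrier M \<Longrightarrow> f x \<in> carrier N"
    "x \<in> carrier M \<Longrightarrow> y \<in> carrier M \<Longrightarrow> f (x \<oplus>\<^bsub>M\<^esub> y) = f x \<oplus>\<^bsub>N\<^esub> f y"
    "p \<in> pols V \<Longrightarrow> x \<in> carrier M \<Longrightarrow> f (p \<odot>\<^bsub>M\<^esub> x) = p \<odot>\<^bsub>N\<^esub> f x"
  using assms unfolding lin_maps_def hom_def by auto

lemma cmod_module: "cmod V M \<Longrightarrow> module (pol_ring V) M"
  by (simp add: cmod_def gfree_module)

text \<open>The constant terms of the coordinates serve as coordinates modulo
  \<open>max_submodule\<close>: an element whose coordinates have no constant term lies in it. As
  the basis is finite, \<open>finite_span\<close> applies.\<close>

lemma finite_span_mod:
  fixes D :: "'d::ab_group_add gmodule"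
  assumes D: "cmod V D" "gfree_finite V D"
    and Z: "Z \<subseteq> carrier D" "0 \<in> Z" "\<And>x y. x \<in> Z \<Longrightarrow> y \<in> Z \<Longrightarrow> x + y \<in> Z" "\<And>c x. x \<in> Z \<Longrightarrow> cst c \<odot>\<^bsub>D\<^esub> x \<in> Z"
  shows "\<exists>S\<subseteq>Z. finite S \<and> (\<forall>u\<in>Z. \<exists>q. u - (\<Sum>s\<in>S. cst (q s) \<odot>\<^bsub>D\<^esub> s) \<in> max_submodule V D)"
proof -
  obtain B :: "idx set" and \<delta> \<phi> where B: "finite B" "miso V D (fsmod V B \<delta>) \<phi>"
    using D(2) by (auto simp: gfree_finite_def)
  interpret coord_module V D B \<delta> \<phi> by (rule coord_module.intro[OF B(2)])
  note c = cmodD[OF D(1)]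
  let ?cc = "\<lambda>u z. lookup (\<phi> u z) 0"
  have "\<exists>S\<subseteq>Z. finite S \<and> (\<forall>u\<in>Z. \<exists>q. \<forall>z\<in>B. ?cc (u - (\<Sum>s\<in>S. cst (q s) \<odot>\<^bsub>D\<^esub> s)) z = 0)"
  proof (rule finite_span[OF D(1) _ _ B(1) Z])
    show "?cc (x + y) z = ?cc x z + ?cc y z" if "x \<in> carrier D" "y \<in> carrier D" for x y z
      using coord_ops(2)[OF that] by (simp add: c(1) lookup_add)
    show "?cc (cst e \<odot>\<^bsub>D\<^esub> x) z = e * ?cc x z" if "x \<in> carrier D" for e x z
      using coord_ops(3)[OF pols_cst that] by (simp add: cst_def Poly_Mapping.map.rep_eq when_def flip: mult_map_scale_conv_mult)
  qed
  then obtain S where S: "S \<subseteq> Z" "finite S"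
    "\<And>u. u \<in> Z \<Longrightarrow> \<exists>q. \<forall>z\<in>B. ?cc (u - (\<Sum>s\<in>S. cst (q s) \<odot>\<^bsub>D\<^esub> s)) z = 0" by blast
  have mm: "u \<in> max_submodule V D" if u: "u \<in> carrier D" "\<And>z. z \<in> B \<Longrightarrow> ?cc u z = 0" for u
  proof -
    have "finsum D (\<lambda>z. \<phi> u z \<odot>\<^bsub>D\<^esub> bas z) {z. \<phi> u z \<noteq> 0} \<in> max_submodule V D"
    proof (rule subgroup_finsum[OF abelian_group max_submodule_subgroup[OF module] coord(3)[OF u(1)]])
      fix z assume "z \<in> {z. \<phi> u z \<noteq> 0}"
      then have "z \<in> B" using coord(2)[OF u(1)] by blast
      then show "\<phi> u z \<odot>\<^bsub>D\<^esub> bas z \<in> max_submodule V D"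
        by (intro max_submoduleI coord(1) u bas(1))
    qed
    then show ?thesis using expand[OF u(1)] by simp
  qed
  have Sc: "(\<Sum>s\<in>S. cst (q s) \<odot>\<^bsub>D\<^esub> s) \<in> carrier D" for q
    by (rule sum_closed[where P = "\<lambda>x. x \<in> carrier D"]) (use S(1) Z(1) c(3,4,7) in auto)
  have "\<exists>q. u - (\<Sum>s\<in>S. cst (q s) \<odot>\<^bsub>D\<^esub> s) \<in> max_submodule V D" if u: "u \<in> Z" for u
  proof -
    obtain q where "\<forall>z\<in>B. ?cc (u - (\<Sum>s\<in>S. cst (q s) \<odot>\<^bsub>D\<^esub> s)) z = 0" using S(3)[OF u] by blast
    moreover have "u \<in> carrier D" using u Z(1) by blast
    ultimately show ?thesis using mm[OF cmod_diff[OF D(1) _ Sc]] by blast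
  qed
  then show ?thesis using S(1,2) by blast
qed

text \<open>Finiteness is imported from a homotopy equivalent \<open>D\<close> of finite rank. The
  cycles of \<open>D\<close> modulo \<open>max_submodule\<close> are spanned by a finite
  \<open>S\<close>, and the images of \<open>S\<close> under \<open>g\<close> span the cohomology of
  \<open>M\<close>, because g f differs from the identity by a homotopy.\<close>

theorem finite_dim_cohomology:
  fixes D :: "'d::ab_group_add factorization" and M' :: "'e::ab_group_add factorization"
  assumes M: "fiso M M' \<phi>" "cfact n w V M'" and D: "cfact n w V D" "\<And>i. gfree_finite V (component D i)"
    and w: "lookup w 0 = 0" and heq: "heq n M D"
  shows "finite_dim_rat (cohomology M i)"
proof -
  note rv = fisoD(1)[OF M]
  obtain f g where f: "factorization_hom M D f" and g: "factorization_hom D M g"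
    and gf: "homotopic n M M (\<lambda>i. g i \<circ> f i) (\<lambda>i. id)" using heq unfolding heq_def by blast
  obtain h where h: "\<And>i. h i \<in> lin_maps V (- int n - 1) (component M i) (component M (\<not> i))"
    and hh: "\<And>i x. x \<in> carrier (component M i) \<Longrightarrow> g i (f i x) \<ominus>\<^bsub>component M i\<^esub> x =
       h (\<not> i) (differential M i x) \<oplus>\<^bsub>component M i\<^esub> differential M (\<not> i) (h i x)"
    using gf unfolding homotopic_def rv by auto
  have fl: "f i \<in> lin_maps V 0 (component M i) (component D i)"
    and fd: "x \<in> carrier (component M i) \<Longrightarrow> f (\<not> i) (differential M i x) = differential D i (f i x)" for i x
    using f unfolding factorization_hom_def rv by blast+
  have gl: "g i \<in> lin_maps V 0 (component D i) (component M i)"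
    and gd: "x \<in> carrier (component D i) \<Longrightarrow> g (\<not> i) (differential D i x) = differential M i (g i x)" for i x
    using g unfolding factorization_hom_def cfactD(1)[OF D(1)] by blast+
  have Mm: "module (pol_ring V) (component M i)" for i
    using gfree_module[OF gfree_miso[OF fisoD(2)[OF M]]] cfactD(3)[OF M(2)] by (simp add: cmod_def)
  have Dm: "module (pol_ring V) (component D i)" for i by (rule cmod_module[OF cfactD(3)[OF D(1)]])
  note dM = lin_maps_raw[OF fiso_differential_lin[OF M]] and dD = lin_maps_raw[OF cfactD(4)[OF D(1)]]
  note fl' = lin_maps_raw[OF fl] and gl' = lin_maps_raw[OF gl] and hl = lin_maps_raw[OF h]
  have ddM: "differential M (\<not> i) (differential M i x) = w \<odot>\<^bsub>component M i\<^esub> x"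
    if x: "x \<in> carrier (component M i)" for i x
  proof -
    note mi = fisoD(2)[OF M]
    have "\<phi> i (differential M (\<not> i) (differential M i x)) = w \<odot>\<^bsub>component M' i\<^esub> \<phi> i x"
      using fisoD(4)[OF M x] fisoD(4)[OF M fisoD(3)[OF M x]] cfactD(5)[OF M(2) misoD(4)[OF mi x]] by simp
    also have "\<dots> = \<phi> i (w \<odot>\<^bsub>component M i\<^esub> x)" using misoD(8)[OF mi cfactD(2)[OF M(2)] x] by simp
    finally show ?thesis
      using misoD(10)[OF mi] fisoD(3)[OF M fisoD(3)[OF M x]] misoD(7)[OF mi cfactD(2)[OF M(2)] x] by simp
  qed
  note cD = cmodD[OF cfactD(3)[OF D(1)]]
  define Z where "Z = {u \<in> carrier (component D i). differential D i u \<in> max_submodule V (component D (\<not> i))}"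
  note mD = max_submodule_subgroup[OF Dm]
  note mDs = subgroup.one_closed[OF mD] subgroup.m_closed[OF mD]
  note dDl = lin_mapsD[OF cfactD(4)[OF D(1)] cfactD(3)[OF D(1)] cfactD(3)[OF D(1)]]
  have "\<exists>S\<subseteq>Z. finite S \<and> (\<forall>u\<in>Z. \<exists>q. u - (\<Sum>s\<in>S. cst (q s) \<odot>\<^bsub>component D i\<^esub> s) \<in> max_submodule V (component D i))"
  proof (rule finite_span_mod[OF cfactD(3)[OF D(1)] D(2)])
    show "Z \<subseteq> carrier (component D i)" by (auto simp: Z_def)
    show "0 \<in> Z" using mDs(1)[of "\<not> i"] cD(2,3) dDl(5)[of i] by (simp add: Z_def)
    show "x + y \<in> Z" if "x \<in> Z" "y \<in> Z" for x y
      using that cD(4) mDs(2)[of "differential D i x" "\<not> i" "differential D i y"] dDl(2)[of x i y]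
      by (simp add: Z_def cD(1))
    show "cst c \<odot>\<^bsub>component D i\<^esub> x \<in> Z" if "x \<in> Z" for c x
      using that cD(7)[OF pols_cst] dDl(3)[OF pols_cst, of x i] max_submodule_cst[OF Dm] by (simp add: Z_def)
  qed
  then obtain S where S: "S \<subseteq> Z" "finite S"
    "\<And>u. u \<in> Z \<Longrightarrow> \<exists>q. u - (\<Sum>s\<in>S. cst (q s) \<odot>\<^bsub>component D i\<^esub> s) \<in> max_submodule V (component D i)" by blast
  have SZ: "s \<in> S \<Longrightarrow> s \<in> carrier (component D i)" "s \<in> S \<Longrightarrow> differential D i s \<in> max_submodule V (component D (\<not> i))" for s
    using S(1) by (auto simp: Z_def)
  have mf: "f j x \<in> max_submodule V (component D j)" if "x \<in> max_submodule V (component M j)" for j x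
    by (rule max_submodule_map[where f = "f j", OF Mm Dm fl' that])
  have mg: "g j x \<in> max_submodule V (component M j)" if "x \<in> max_submodule V (component D j)" for j x
    by (rule max_submodule_map[where f = "g j", OF Dm Mm gl' that])
  have mh: "h j x \<in> max_submodule V (component M (\<not> j))" if "x \<in> max_submodule V (component M j)" for j x
    by (rule max_submodule_map[where f = "h j", OF Mm Mm hl that])
  interpret M: abelian_group "component M j" for j by (rule pol_ring_module(1)[OF Mm])
  interpret D: abelian_group "component D j" for j by (rule pol_ring_module(1)[OF Dm])
  have gsum: "(\<Sum>s\<in>T. cst (q s) \<odot>\<^bsub>component D i\<^esub> s) \<in> carrier (component D i) \<and>
      g i (\<Sum>s\<in>T. cst (q s) \<odot>\<^bsub>component D i\<^esub> s) = finsum (component M i) (\<lambda>s. cst (q s) \<odot>\<^bsub>component M i\<^esub> g i s) T"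
    if "finite T" "T \<subseteq> S" for q T
    using that
  proof (induction T rule: finite_induct)
    case empty
    then show ?case using additive_map(1)[OF D.abelian_group_axioms M.abelian_group_axioms gl'(1,2)] cD(2,3) by simp
  next
    case (insert t T)
    have t: "t \<in> carrier (component D i)" "cst (q t) \<odot>\<^bsub>component D i\<^esub> t \<in> carrier (component D i)"
      using insert.prems SZ(1) cD(7)[OF pols_cst] by blast+
    have TS: "T \<subseteq> S" using insert.prems by blast
    have "finsum (component M i) (\<lambda>s. cst (q s) \<odot>\<^bsub>component M i\<^esub> g i s) (insert t T) =
       cst (q t) \<odot>\<^bsub>component M i\<^esub> g i t \<oplus>\<^bsub>component M i\<^esub> finsum (component M i) (\<lambda>s. cst (q s) \<odot>\<^bsub>component M i\<^esub> g i s) T"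
      by (rule M.finsum_insert[OF insert.hyps])
        (use TS t gl'(1) SZ(1) pol_ring_module(2)[OF Mm pols_cst] in blast)+
    then show ?case
      using insert.IH[OF TS] t gl'(2)[OF t(2)] gl'(3)[OF pols_cst t(1)] insert.hyps cD(4) by (simp add: cD(1))
  qed
  show ?thesis
  proof (rule finite_dim_cohomologyI[OF Mm rv dM ddM cfactD(2)[OF M(2)] w S(2), where G = "g i"])
    fix s assume s: "s \<in> S"
    show "g i s \<in> carrier (component M i)" using gl'(1) SZ(1)[OF s] by blast
    show "differential M i (g i s) \<in> max_submodule V (component M (\<not> i))"
      using mg[OF SZ(2)[OF s]] gd[OF SZ(1)[OF s]] by simp
  next
    fix x assume x: "x \<in> carrier (component M i)" "differential M i x \<in> max_submodule V (component M (\<not> i))"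
    have "f i x \<in> Z" using fl'(1)[OF x(1)] mf[OF x(2)] fd[OF x(1)] by (simp add: Z_def)
    then obtain q where q: "f i x - (\<Sum>s\<in>S. cst (q s) \<odot>\<^bsub>component D i\<^esub> s) \<in> max_submodule V (component D i)"
      using S(3) by blast
    let ?s = "\<Sum>s\<in>S. cst (q s) \<odot>\<^bsub>component D i\<^esub> s" and ?t = "finsum (component M i) (\<lambda>s. cst (q s) \<odot>\<^bsub>component M i\<^esub> g i s) S"
    note gs = gsum[OF S(2) order_refl, of q]
    have uc: "f i x - ?s \<in> carrier (component D i)" by (rule subgroup.mem_carrier[OF mD q, simplified])
    have gfx: "g i (f i x) = g i (f i x - ?s) \<oplus>\<^bsub>component M i\<^esub> ?t"
      using gl'(2)[OF uc, of ?s] gs by (simp add: cD(1))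
    have c: "g i (f i x - ?s) \<in> carrier (component M i)" "?t \<in> carrier (component M i)"
      using gl'(1)[OF uc] gl'(1)[of ?s i] gs by auto
    note hx = hl(1)[OF x(1)]
    have hd: "h (\<not> i) (differential M i x) \<in> max_submodule V (component M i)" using mh[OF x(2)] by simp
    have hdc: "h (\<not> i) (differential M i x) \<in> carrier (component M i)" using hl(1)[OF dM(1)[OF x(1)]] by simp
    have dhc: "differential M (\<not> i) (h i x) \<in> carrier (component M i)" using dM(1)[OF hx] by simp
    let ?k = "g i (f i x - ?s) \<ominus>\<^bsub>component M i\<^esub> h (\<not> i) (differential M i x)" and ?y = "\<ominus>\<^bsub>component M (\<not> i)\<^esub> h i x"
    have k: "?k \<in> max_submodule V (component M i)"
      using subgroup.m_closed[OF max_submodule_subgroup[OF Mm] mg[OF q] subgroup.m_inv_closed[OF max_submodule_subgroup[OF Mm] hd]]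
      by (simp add: a_minus_def a_inv_def)
    have dy: "differential M (\<not> i) ?y = \<ominus>\<^bsub>component M i\<^esub> differential M (\<not> i) (h i x)"
      using additive_map(2)[OF M.abelian_group_axioms M.abelian_group_axioms dM(1,2) hx] by simp
    have gfxc: "g i (f i x) \<in> carrier (component M i)" by (rule gl'(1)[OF fl'(1)[OF x(1)]])
    \<comment> \<open>The homotopy gives x = g f x - (h d x + d h x). Here h d x lies in
      \<open>max_submodule\<close> because d x does, d h x is a boundary, and g f x is a combination
      of the \<open>g i s\<close> modulo \<open>max_submodule\<close>.\<close>
    have "x = g i (f i x) \<ominus>\<^bsub>component M i\<^esub> (g i (f i x) \<ominus>\<^bsub>component M i\<^esub> x)"
      using x(1) gfxc by (simp add: a_minus_def M.minus_add M.r_neg1 M.r_neg2)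
    also have "\<dots> = (g i (f i x - ?s) \<oplus>\<^bsub>component M i\<^esub> ?t) \<ominus>\<^bsub>component M i\<^esub>
       (h (\<not> i) (differential M i x) \<oplus>\<^bsub>component M i\<^esub> differential M (\<not> i) (h i x))"
      unfolding hh[OF x(1)] unfolding gfx ..
    also have "\<dots> = ?k \<oplus>\<^bsub>component M i\<^esub> (differential M (\<not> i) ?y \<oplus>\<^bsub>component M i\<^esub> ?t)"
      unfolding dy using c hdc dhc by (simp add: a_minus_def M.minus_add M.a_ac)
    finally show "\<exists>q k y. k \<in> max_submodule V (component M i) \<and> y \<in> carrier (component M (\<not> i)) \<and>
        x = k \<oplus>\<^bsub>component M i\<^esub> (differential M (\<not> i) y \<oplus>\<^bsub>component M i\<^esub>
          finsum (component M i) (\<lambda>s. cst (q s) \<odot>\<^bsub>component M i\<^esub> g i s) S)"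
      using k M.a_inv_closed[OF hx] by (intro exI[of _ q] exI[of _ ?k] exI[of _ ?y]) simp
  qed
qed

declare idl.simps [simp del] One_nat_def [simp del]

lemmas ring_norms = algebra_simps power2_eq_square power3_eq_cube

subsection \<open>Monic elements and regular sequences\<close>

text \<open>Lets inclusions be checked on generators although the two ideals live in rings with
  different variables; z = 1 gives plain inclusion.\<close>

lemma idl_mult_into:
  assumes "V \<subseteq> U" "\<And>g. g \<in> set bs \<Longrightarrow> z * g \<in> idl U cs" "p \<in> idl V bs"
  shows "z * p \<in> idl U cs"
  using assms(3)
proof (induction rule: idl_induct)
  case (gen g r)
  then show ?case
    using idl_mult'[OF pols_mono[OF assms(1) gen(2)] assms(2)[OF gen(1)]] by (simp add: mult.assoc)
qed (auto simp: distrib_left intro: idl_add)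

lemma idl_hpart:
  assumes "\<And>b. b \<in> set bs \<Longrightarrow> \<exists>j. homogeneous j b" "p \<in> idl V bs"
  shows "hpart m p \<in> idl V bs"
  using assms(2)
proof (induction rule: idl_induct)
  case (gen b r)
  then obtain j where "homogeneous j b" using assms(1) by blast
  then show ?case using gen by (auto simp: hpart_mult intro: idl_mult' idl_gen hpart_pols)
qed (auto simp: hpart_add intro: idl_add)

text \<open>Generators free of \<open>v\<close> are fixed by the substitution, so for a member of
  the ideal both the remainder and the quotient of the division by \<open>X v - e\<close> stay in
  the ideal.\<close>

lemma idl_subst_split:
  assumes "v \<in> V" "e \<in> pols V" "set bs \<subseteq> pols (V - {v})" "p \<in> idl V bs"
  shows "subst (X(v := e)) p \<in> idl V bs \<and> (\<exists>t\<in>idl V bs. p = subst (X(v := e)) p + (X v - e) * t)"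
  using assms(4)
proof (induction rule: idl_induct)
  case (gen b r)
  obtain s where s: "s \<in> pols V" "r = subst (X(v := e)) r + (X v - e) * s"
    using subst_upd_dvd[OF gen(2) assms(1,2)] .
  have b: "subst (X(v := e)) b = b" using assms(3) gen(1) by (intro subst_upd_fix[of _ "V - {v}"]) auto
  have "subst (X(v := e)) (b * r) \<in> idl V bs"
    using idl_mult'[OF subst_upd_pols[OF gen(2) assms(2)] idl_gen[OF gen(1)]] by (simp add: subst_hom b)
  moreover have "b * r = subst (X(v := e)) (b * r) + (X v - e) * (b * s)"
    by (subst s(2)) (simp add: subst_hom b algebra_simps)
  moreover have "b * s \<in> idl V bs" by (rule idl_mult'[OF s(1) idl_gen[OF gen(1)]])
  ultimately show ?case by blast
next
  case (add q r)
  then obtain s t where "s \<in> idl V bs" "q = subst (X(v := e)) q + (X v - e) * s"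
    "t \<in> idl V bs" "r = subst (X(v := e)) r + (X v - e) * t" by blast
  note st = this
  have "q + r = subst (X(v := e)) q + (X v - e) * s + (subst (X(v := e)) r + (X v - e) * t)"
    by (rule arg_cong2[where f = "(+)", OF st(2,4)])
  then have "q + r = subst (X(v := e)) (q + r) + (X v - e) * (s + t)" by (simp add: subst_add algebra_simps)
  moreover have "subst (X(v := e)) (q + r) \<in> idl V bs" unfolding subst_add using add.IH by (blast intro: idl_add)
  ultimately show ?case using idl_add[OF st(1,3)] by blast
qed (auto intro!: bexI[of _ 0])

text \<open>The product vanishes under the substitution of \<open>e\<close> for \<open>X v\<close>,
  so it equals \<open>X v - e\<close> times a member \<open>t\<close> of the ideal, and the factor
  cancels in the polynomial ring.\<close>

lemma idl_monic_cancel: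
  assumes "v \<in> V" "e \<in> pols (V - {v})" "set bs \<subseteq> pols (V - {v})" "(X v - e) * p \<in> idl V bs"
  shows "p \<in> idl V bs"
proof -
  have eV: "e \<in> pols V" by (rule pols_mono[OF _ assms(2)]) auto
  have e: "subst (X(v := e)) e = e" using assms(2) by (intro subst_upd_fix[of _ "V - {v}"]) auto
  have z: "subst (X(v := e)) ((X v - e) * p) = 0" by (simp add: subst_hom e)
  obtain t where t: "t \<in> idl V bs" "(X v - e) * p = (X v - e) * t"
    using idl_subst_split[OF assms(1) eV assms(3,4)] unfolding z by auto
  have "subst (X(v := e + 1)) e = e" using assms(2) by (intro subst_upd_fix[of _ "V - {v}"]) auto
  then have "subst (X(v := e + 1)) (X v - e) = 1" by (simp add: subst_hom)
  then have "X v - e \<noteq> 0" by (metis subst_0 zero_neq_one)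
  then show ?thesis using t by simp
qed

lemma regular_monic:
  assumes "v \<in> V" "e \<in> pols (V - {v})" "set bs \<subseteq> pols (V - {v})" "regular V bs"
  shows "regular V ((X v - e) # bs)"
  using assms idl_monic_cancel[OF assms(1-3)] by auto

text \<open>The linear form is, up to sign, monic in \<open>X k\<close>. Eliminating
  \<open>X k\<close> with it turns the quadratic form into (X l - X i)(X l - X j), a product of two
  factors monic in \<open>X l\<close>. Both cancellations rely on the rest of the sequence avoiding
  the incoming variables.\<close>

lemma regular_wide:
  assumes V: "i \<in> V" "j \<in> V" "k \<in> V" "l \<in> V" and ne: "{i, j} \<inter> {k, l} = {}" "k \<noteq> l"
    and bs: "set bs \<subseteq> pols (V - {k, l})" "regular V bs"
  shows "regular V ((X i * X j - X k * X l) # (X i + X j - X k - X l) # bs)"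
proof -
  have V': "i \<in> V - {k}" "j \<in> V - {k}" "l \<in> V - {k}" using V ne by auto
  have bk: "set bs \<subseteq> pols (V - {k})" and bl: "set bs \<subseteq> pols (V - {l})"
    using bs(1) pols_mono[of "V - {k, l}" "V - {k}"] pols_mono[of "V - {k, l}" "V - {l}"] by auto
  define e where "e = X i + X j - X l"
  have e: "e \<in> pols (V - {k})" using V' by (auto simp: e_def intro!: pols_intros)
  have eV: "e \<in> pols V" by (rule pols_mono[OF _ e]) auto
  let ?l = "X i + X j - X k - X l"
  have l: "?l = - (X k - e)" by (simp add: e_def)
  have "p \<in> idl V bs" if "?l * p \<in> idl V bs" for p
  proof -
    have "(X k - e) * p = - (?l * p)" unfolding l by (simp add: algebra_simps)
    then have "(X k - e) * p \<in> idl V bs" using idl_uminus[OF that] by (simp only:)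
    then show ?thesis by (rule idl_monic_cancel[OF V(3) e bk])
  qed
  moreover have "p \<in> idl V (?l # bs)" if p: "p \<in> pols V" "(X i * X j - X k * X l) * p \<in> idl V (?l # bs)" for p
  proof -
    obtain r m where rm: "(X i * X j - X k * X l) * p = ?l * r + m" "r \<in> pols V" "m \<in> idl V bs" using p(2) by (auto simp: idl.simps)
    let ?\<sigma> = "subst (X(k := e))"
    have \<sigma>: "?\<sigma> (X i) = X i" "?\<sigma> (X j) = X j" "?\<sigma> (X l) = X l" "?\<sigma> (X k) = e" using ne by auto
    have "?\<sigma> ((X i * X j - X k * X l) * p) = ?\<sigma> (?l * r + m)" by (simp only: rm(1))
    then have "(X i * X j - e * X l) * ?\<sigma> p = (X i + X j - e - X l) * ?\<sigma> r + ?\<sigma> m"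
      unfolding subst_hom \<sigma> .
    then have "(X l - X i) * ((X l - X j) * ?\<sigma> p) = ?\<sigma> m" by (simp add: e_def algebra_simps)
    then have "(X l - X i) * ((X l - X j) * ?\<sigma> p) \<in> idl V bs"
      using idl_subst_split[OF V(3) eV bk rm(3)] by simp
    moreover have "X i \<in> pols (V - {l})" "X j \<in> pols (V - {l})" using V ne by auto
    ultimately have \<sigma>p: "?\<sigma> p \<in> idl V bs" using idl_monic_cancel[OF V(4) _ bl] by blast
    obtain s where "s \<in> pols V" "p = ?\<sigma> p + (X k - e) * s" using subst_upd_dvd[OF p(1) V(3) eV] .
    moreover have "?l * (- s) + ?\<sigma> p = ?\<sigma> p + (X k - e) * s" unfolding l by (simp add: algebra_simps)
    ultimately have "?l * (- s) + ?\<sigma> p = p" "- s \<in> pols V" by (simp_all only: pols_uminus)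
    then show ?thesis using idl_ConsI[of "- s" V "?\<sigma> p" bs ?l] \<sigma>p by (simp only:)
  qed
  ultimately show ?thesis using bs(2) by (auto)
qed

subsection \<open>The ideals of the four graphs\<close>

lemma X_neq: "i \<noteq> j \<Longrightarrow> X i \<noteq> X j"
proof
  assume "i \<noteq> j" "X i = X j"
  then have "subst (X(i := 0, j := 1)) (X i) = subst (X(i := 0, j := 1)) (X j)" by (simp only:)
  then show False using \<open>i \<noteq> j\<close> by simp
qed

text \<open>Read from the right, each wide edge adds two incoming variables that have not occurred
  before, which is the shape \<open>regular_wide\<close> asks for.\<close>

definition cube_seq :: "nat \<Rightarrow> nat \<Rightarrow> nat \<Rightarrow> nat \<Rightarrow> nat \<Rightarrow> nat \<Rightarrow> mpol list" where
  "cube_seq a b c d e f = [X 7 * X 9 - X d * X e, X 7 + X 9 - X d - X e, X 8 * X c - X 9 * X f, X 8 + X c - X 9 - X f,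
     X a * X b - X 7 * X 8, X a + X b - X 7 - X 8]"

definition web_seq :: "nat \<Rightarrow> nat \<Rightarrow> nat \<Rightarrow> nat \<Rightarrow> nat \<Rightarrow> nat \<Rightarrow> mpol list" where
  "web_seq a b c d e f = [X c - X f, X a * X b - X d * X e, X a + X b - X d - X e]"

definition sym_seq :: "nat \<Rightarrow> nat \<Rightarrow> nat \<Rightarrow> nat \<Rightarrow> nat \<Rightarrow> nat \<Rightarrow> mpol list" where
  "sym_seq a b c d e f = [X a + X b + X c - X d - X e - X f,
     X a * X b + X a * X c + X b * X c - X d * X e - X d * X f - X e * X f,
     X a * X b * X c - X d * X e * X f]"

text \<open>Multiplication of \<alpha> + \<beta> z and \<alpha>' + \<beta>' z modulo z^2 = M z - N,
  with explicit error terms so that it can be used modulo an ideal.\<close>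

lemma quadratic_product:
  fixes z :: mpol
  shows "q * r - (\<alpha> * \<alpha>' - \<beta> * \<beta>' * N) - (\<alpha> * \<beta>' + \<beta> * \<alpha>' + \<beta> * \<beta>' * M) * z =
    (q - \<alpha> - \<beta> * z) * r + (\<alpha> + \<beta> * z) * (r - \<alpha>' - \<beta>' * z) + \<beta> * \<beta>' * (z * z - M * z + N)"
  by (simp add: ring_norms)

text \<open>The coefficients stand for m-th powers. Each x is a root of the cubic of the x's; each y
  satisfies the same equation up to the differences of the elementary symmetric polynomials, which
  account for the last three terms.\<close>

lemma power_sum_recursion:
  fixes x1 :: mpol
  shows "A1 * x1 ^ 3 + A2 * x2 ^ 3 + A3 * x3 ^ 3 - B1 * y1 ^ 3 - B2 * y2 ^ 3 - B3 * y3 ^ 3 =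
    (x1 + x2 + x3) * (A1 * x1 ^ 2 + A2 * x2 ^ 2 + A3 * x3 ^ 2 - B1 * y1 ^ 2 - B2 * y2 ^ 2 - B3 * y3 ^ 2)
    - (x1 * x2 + x1 * x3 + x2 * x3) * (A1 * x1 + A2 * x2 + A3 * x3 - B1 * y1 - B2 * y2 - B3 * y3)
    + x1 * x2 * x3 * (A1 + A2 + A3 - B1 - B2 - B3)
    + (x1 + x2 + x3 - y1 - y2 - y3) * (B1 * y1 ^ 2 + B2 * y2 ^ 2 + B3 * y3 ^ 2)
    - (x1 * x2 + x1 * x3 + x2 * x3 - y1 * y2 - y1 * y3 - y2 * y3) * (B1 * y1 + B2 * y2 + B3 * y3)
    + (x1 * x2 * x3 - y1 * y2 * y3) * (B1 + B2 + B3)"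
  by (simp add: ring_norms)

text \<open>The external marks up to relabelling, so that one argument serves all four graphs: a, b,
  c are outgoing and d, e, f incoming. The internal marks stay 7, 8, 9.\<close>

locale marks =
  fixes a b c d e f :: nat
  assumes distinct: "distinct [a, b, c, d, e, f]" and marks: "set [a, b, c, d, e, f] = {1..6}"
begin

abbreviation "P \<equiv> pols {1..6}"
abbreviation "S \<equiv> pols {1..9}"
abbreviation "I1 \<equiv> idl {1..9} (cube_seq a b c d e f)"
abbreviation "I4 \<equiv> idl {1..6} (web_seq a b c d e f)"
abbreviation "E \<equiv> idl {1..6} (sym_seq a b c d e f)"
abbreviation "z \<equiv> X 8 - X f"

lemma bounds [simp]: "1 \<le> a" "a \<le> 6" "1 \<le> b" "b \<le> 6" "1 \<le> c" "c \<le> 6"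
  "1 \<le> d" "d \<le> 6" "1 \<le> e" "e \<le> 6" "1 \<le> f" "f \<le> 6"
proof -
  have "{a, b, c, d, e, f} \<subseteq> {1..6}" using marks by simp
  then show "1 \<le> a" "a \<le> 6" "1 \<le> b" "b \<le> 6" "1 \<le> c" "c \<le> 6"
    "1 \<le> d" "d \<le> 6" "1 \<le> e" "e \<le> 6" "1 \<le> f" "f \<le> 6" by auto
qed

lemma bounds9 [simp]: "a \<le> 9" "b \<le> 9" "c \<le> 9" "d \<le> 9" "e \<le> 9" "f \<le> 9"
  using bounds by linarith+

lemma XP [simp]: "X a \<in> P" "X b \<in> P" "X c \<in> P" "X d \<in> P" "X e \<in> P" "X f \<in> P"
  by simp_all

lemma PS: "p \<in> P \<Longrightarrow> p \<in> S" by (rule pols_mono) auto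

lemma XS [simp]: "X a \<in> S" "X b \<in> S" "X c \<in> S" "X d \<in> S" "X e \<in> S" "X f \<in> S" "X 7 \<in> S" "X 8 \<in> S" "X 9 \<in> S"
  by simp_all

definition "q1 = X a * X b - X 7 * X 8"
definition "l1 = X a + X b - X 7 - X 8"
definition "q2 = X 8 * X c - X 9 * X f"
definition "l2 = X 8 + X c - X 9 - X f"
definition "q3 = X 7 * X 9 - X d * X e"
definition "l3 = X 7 + X 9 - X d - X e"
definition "m0 = X c - X f"
definition "mq = X a * X b - X d * X e"
definition "ml = X a + X b - X d - X e"
definition "s1 = X a + X b + X c - X d - X e - X f"
definition "s2 = X a * X b + X a * X c + X b * X c - X d * X e - X d * X f - X e * X f"
definition "s3 = X a * X b * X c - X d * X e * X f"

lemmas pol_defs = q1_def l1_def q2_def l2_def q3_def l3_def m0_def mq_def ml_def s1_def s2_def s3_def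

lemma seqs: "cube_seq a b c d e f = [q3, l3, q2, l2, q1, l1]" "web_seq a b c d e f = [m0, mq, ml]"
  "sym_seq a b c d e f = [s1, s2, s3]"
  by (simp_all only: cube_seq_def web_seq_def sym_seq_def pol_defs)

text \<open>The relations that determine the internal variables: \<open>l1\<close> and
  \<open>l2\<close> eliminate \<open>X 7\<close> and \<open>X 9\<close>, and \<open>q1\<close>
  becomes a monic quadratic equation for \<open>X 8\<close>. Hence \<open>S\<close> modulo
  \<open>I0\<close> is free over \<open>P\<close> on 1 and \<open>z\<close>.\<close>

abbreviation "I0 \<equiv> idl {1..9} [l2, q1, l1]"

lemma gens: "q1 \<in> I1" "q2 \<in> I1" "q3 \<in> I1" "l1 \<in> I1" "l2 \<in> I1" "l3 \<in> I1"
  "m0 \<in> I4" "mq \<in> I4" "ml \<in> I4" "s1 \<in> E" "s2 \<in> E" "s3 \<in> E" "l2 \<in> I0" "q1 \<in> I0" "l1 \<in> I0"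
  unfolding seqs by (rule idl_gen; simp)+

lemmas idl_ops = idl_add idl_diff idl_mult idl_uminus idl_mult' gens

lemma quad: "(X 8 - X a) * (X 8 - X b) \<in> I0"
proof -
  have "(X 8 - X a) * (X 8 - X b) = q1 - X 8 * l1" unfolding pol_defs by (simp add: ring_norms)
  also have "\<dots> \<in> I0" by (intro idl_ops XS)
  finally show ?thesis .
qed

lemma quad_z: "(X 8 - X a) * (X 8 - X b) = z * z - ((X a - X f) + (X b - X f)) * z + (X f - X a) * (X f - X b)"
proof -
  have "(y - u) * (y - v) = y * y - (u + v) * y + (- u) * (- v)" for y u v :: mpol by (simp add: algebra_simps)
  from this[of z "X a - X f" "X b - X f"] show ?thesis by simp
qed

lemma I0_I1: "p \<in> I0 \<Longrightarrow> p \<in> I1"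
  using idl_subset[of "[l2, q1, l1]" "{1..9}" "cube_seq a b c d e f"] gens by auto

text \<open>Each wide edge preserves the elementary symmetric polynomials of its two strands, so the
  three edges together preserve those of all three strands.\<close>

lemma E_I1: "p \<in> E \<Longrightarrow> p \<in> I1"
proof -
  have "s1 = l1 + l2 + l3" "s2 = (q1 + X c * l1) + (X 7 * l2 + q2) + (q3 + X f * l3)"
    "s3 = X c * q1 + X 7 * q2 + X f * q3" unfolding pol_defs by (simp_all add: ring_norms)
  moreover have "l1 + l2 + l3 \<in> I1" "(q1 + X c * l1) + (X 7 * l2 + q2) + (q3 + X f * l3) \<in> I1"
    "X c * q1 + X 7 * q2 + X f * q3 \<in> I1" by (intro idl_ops XS)+
  ultimately have "1 * g \<in> I1" if "g \<in> set (sym_seq a b c d e f)" for g using that unfolding seqs by auto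
  then show "p \<in> E \<Longrightarrow> p \<in> I1" using idl_mult_into[of "{1..6}" "{1..9}" "sym_seq a b c d e f" 1] by simp
qed

text \<open>Eliminating \<open>X 9\<close> from the middle edge leaves the factored relation
  \<open>z * m0\<close>. Modulo \<open>I1\<close> the other two generators of \<open>I4\<close> are
  multiples of \<open>m0\<close>, so \<open>z\<close> annihilates them as well.\<close>

lemma zI4_I1: "p \<in> I4 \<Longrightarrow> z * p \<in> I1"
proof -
  have 0: "z * m0 = q2 - X f * l2" unfolding pol_defs by (simp add: ring_norms)
  have zm: "z * m0 \<in> I1" unfolding 0 by (intro idl_ops XS)
  have "z * ml = z * (l1 + l2 + l3) - z * m0" unfolding pol_defs by (simp add: ring_norms)
  moreover have "z * mq = z * (q1 + q3 + X 7 * l2) - X 7 * (z * m0)" unfolding pol_defs by (simp add: ring_norms)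
  moreover have "z * (l1 + l2 + l3) - z * m0 \<in> I1" "z * (q1 + q3 + X 7 * l2) - X 7 * (z * m0) \<in> I1"
    by (intro idl_diff[OF idl_mult zm] idl_diff[OF idl_mult idl_mult[OF _ zm]] idl_add idl_mult gens pols_diff XS)+
  ultimately have "z * g \<in> I1" if "g \<in> set (web_seq a b c d e f)" for g using that zm unfolding seqs by auto
  then show "p \<in> I4 \<Longrightarrow> z * p \<in> I1" using idl_mult_into[of "{1..6}" "{1..9}" "web_seq a b c d e f" z] by simp
qed

lemma E_I4: "p \<in> E \<Longrightarrow> p \<in> I4"
proof -
  have "s1 = ml + m0" "s2 = mq + X c * ml + (X d + X e) * m0" "s3 = X c * mq + X d * X e * m0"
    unfolding pol_defs by (simp_all add: ring_norms)
  moreover have "ml + m0 \<in> I4" "mq + X c * ml + (X d + X e) * m0 \<in> I4" "X c * mq + X d * X e * m0 \<in> I4"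
    by (intro idl_add idl_mult gens pols_add pols_mult XP)+
  ultimately have "1 * g \<in> I4" if "g \<in> set (sym_seq a b c d e f)" for g using that unfolding seqs by auto
  then show "p \<in> E \<Longrightarrow> p \<in> I4" using idl_mult_into[of "{1..6}" "{1..6}" "sym_seq a b c d e f" 1] by simp
qed

text \<open>\<open>N * m0\<close> is, up to sign, the cubic with roots X a, X b, X c evaluated at X
  f; the cubic with roots X d, X e, X f vanishes there, and the coefficients of the two differ by
  members of \<open>E\<close>. Since N is the constant term of the quadratic equation of
  \<open>z\<close>, this closes E + z I4 under multiplication by z.\<close>

lemma I4_E: "p \<in> I4 \<Longrightarrow> (X f - X a) * (X f - X b) * p \<in> E"
proof -
  define N where "N = (X f - X a) * (X f - X b)"
  have N: "N \<in> P" unfolding N_def by (intro pols_mult pols_diff XP)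
  have 0: "N * m0 = s1 * X f ^ 2 - s2 * X f + s3" unfolding pol_defs N_def by (simp add: ring_norms)
  have zm: "N * m0 \<in> E" unfolding 0 by (intro idl_add idl_diff idl_mult' gens pols_power XP)
  have "ml = s1 - m0" unfolding pol_defs by (simp add: ring_norms)
  then have 1: "N * ml = N * s1 - N * m0" by (simp add: right_diff_distrib)
  have l: "N * ml \<in> E" unfolding 1 by (intro idl_diff zm idl_mult[OF N] gens)
  have "mq = s2 - X c * ml - (X d + X e) * m0" unfolding pol_defs by (simp add: ring_norms)
  then have 2: "N * mq = N * s2 - X c * (N * ml) - (X d + X e) * (N * m0)"
    by (simp add: right_diff_distrib mult.left_commute)
  have "N * mq \<in> E"
    unfolding 2 by (intro idl_diff[OF idl_diff] idl_mult[OF _ l] idl_mult[OF _ zm] idl_mult[OF N] gens pols_add XP)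
  then have "N * g \<in> E" if "g \<in> set (web_seq a b c d e f)" for g using that zm l unfolding seqs by auto
  then show "p \<in> I4 \<Longrightarrow> (X f - X a) * (X f - X b) * p \<in> E"
    using idl_mult_into[of "{1..6}" "{1..6}" "web_seq a b c d e f" N] by (simp add: N_def)
qed

lemma X_cases:
  fixes i :: nat assumes "i \<in> {1..9}" obtains "i \<in> {1..6}" | "i = 7" | "i = 8" | "i = 9"
proof -
  have "i \<in> {1..6} \<or> i = 7 \<or> i = 8 \<or> i = 9" using assms by auto
  then show ?thesis using that by blast
qed

lemma decomposition:
  assumes "p \<in> S" shows "\<exists>\<alpha>\<in>P. \<exists>\<beta>\<in>P. p - \<alpha> - \<beta> * z \<in> I0"
  using assms
proof (induction rule: pols_ring_induct)
  case (cst r) then show ?case by (intro bexI[of _ "cst r"] bexI[of _ 0]) auto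
next
  case (X i)
  from X show ?case
  proof (cases rule: X_cases)
    case 1 then show ?thesis by (intro bexI[of _ "X i"] bexI[of _ 0]) auto
  next
    case 2
    have "X 7 - (X a + X b - X f) - (- 1) * z = - l1" unfolding pol_defs by (simp add: ring_norms)
    moreover have "- l1 \<in> I0" by (intro idl_uminus gens)
    ultimately have "X 7 - (X a + X b - X f) - (- 1) * z \<in> I0" by (simp only:)
    moreover have "X a + X b - X f \<in> P" "- 1 \<in> P" by (intro pols_add pols_diff pols_uminus pols_1 XP)+
    ultimately show ?thesis unfolding 2 by blast
  next
    case 3
    then show ?thesis by (intro bexI[of _ "X f"] bexI[of _ 1]) (auto)
  next
    case 4
    have "X 9 - X c - 1 * z = - l2" unfolding pol_defs by (simp add: ring_norms)
    moreover have "- l2 \<in> I0" by (intro idl_uminus gens)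
    ultimately have "X 9 - X c - 1 * z \<in> I0" by (simp only:)
    then show ?thesis unfolding 4 using XP(3) pols_1 by blast
  qed
next
  case (add q r)
  then obtain \<alpha> \<beta> \<alpha>' \<beta>' where *: "\<alpha> \<in> P" "\<beta> \<in> P" "\<alpha>' \<in> P" "\<beta>' \<in> P" "q - \<alpha> - \<beta> * z \<in> I0" "r - \<alpha>' - \<beta>' * z \<in> I0" by blast
  have "q + r - (\<alpha> + \<alpha>') - (\<beta> + \<beta>') * z = (q - \<alpha> - \<beta> * z) + (r - \<alpha>' - \<beta>' * z)" by (simp add: ring_norms)
  then have "q + r - (\<alpha> + \<alpha>') - (\<beta> + \<beta>') * z \<in> I0" using idl_add[OF *(5,6)] by (simp only:)
  then show ?case using *(1-4) by (blast intro: pols_add)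
next
  case (mult q r)
  then obtain \<alpha> \<beta> \<alpha>' \<beta>' where *: "\<alpha> \<in> P" "\<beta> \<in> P" "\<alpha>' \<in> P" "\<beta>' \<in> P" "q - \<alpha> - \<beta> * z \<in> I0" "r - \<alpha>' - \<beta>' * z \<in> I0" by blast
  define A where "A = \<alpha> * \<alpha>' - \<beta> * \<beta>' * ((X f - X a) * (X f - X b))"
  define B where "B = \<alpha> * \<beta>' + \<beta> * \<alpha>' + \<beta> * \<beta>' * ((X a - X f) + (X b - X f))"
  have AB: "A \<in> P" "B \<in> P" unfolding A_def B_def using *(1-4) by (auto intro!: pols_intros)
  have "q * r - A - B * z = (q - \<alpha> - \<beta> * z) * r + (\<alpha> + \<beta> * z) * (r - \<alpha>' - \<beta>' * z)
      + \<beta> * \<beta>' * ((X 8 - X a) * (X 8 - X b))"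
    unfolding A_def B_def quad_z by (rule quadratic_product)
  moreover have "(q - \<alpha> - \<beta> * z) * r + (\<alpha> + \<beta> * z) * (r - \<alpha>' - \<beta>' * z)
      + \<beta> * \<beta>' * ((X 8 - X a) * (X 8 - X b)) \<in> I0"
    by (intro idl_add[OF idl_add] idl_mult[OF _ quad] idl_mult'[OF _ *(5)] idl_mult[OF _ *(6)] mult.hyps
        pols_add pols_mult pols_diff XS PS[OF *(1)] PS[OF *(2)] PS[OF *(4)])
  ultimately show ?case using AB by (metis (no_types, lifting))
qed

text \<open>The quadratic equation has the two roots X a and X b for \<open>X 8\<close>. Evaluating
  at both and subtracting gives \<beta> (X a - X b) = 0.\<close>

lemma z_independent:
  assumes "\<alpha> \<in> P" "\<beta> \<in> P" "\<alpha> + \<beta> * z \<in> I0" shows "\<alpha> = 0" "\<beta> = 0"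
proof -
  have ev: "\<alpha> + \<beta> * (X i - X f) = 0" if ij: "(i, j) = (a, b) \<or> (i, j) = (b, a)" for i j
  proof -
    define \<sigma> where "\<sigma> = X(8 := X i, 7 := X j, 9 := X i + X c - X f)"
    have fx: "subst \<sigma> p = p" if "p \<in> P" for p
      using subst_cong_pols[OF that, of \<sigma> X] by (simp add: \<sigma>_def)
    have \<sigma>: "\<sigma> 8 = X i" "\<sigma> 7 = X j" "\<sigma> 9 = X i + X c - X f" by (simp_all add: \<sigma>_def)
    have "subst \<sigma> l1 = 0" "subst \<sigma> q1 = 0" "subst \<sigma> l2 = 0"
      using ij unfolding pol_defs subst_hom fx[OF XP(1)] fx[OF XP(2)] fx[OF XP(3)] fx[OF XP(6)]
      by (auto simp: \<sigma>)
    moreover have "subst \<sigma> p = 0" if "p \<in> I0" "\<forall>g\<in>set [l2, q1, l1]. subst \<sigma> g = 0" for p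
      using that by (induction rule: idl_induct) (auto simp: subst_hom)
    ultimately have "subst \<sigma> (\<alpha> + \<beta> * z) = 0" using assms(3) by simp
    then show ?thesis unfolding subst_hom fx[OF assms(1)] fx[OF assms(2)] fx[OF XP(6)] by (simp add: \<sigma>)
  qed
  have "\<beta> * (X a - X b) = 0" using arg_cong2[OF ev[of a b] ev[of b a], of "(-)"] by (simp add: ring_norms)
  moreover have "X a \<noteq> X b" using distinct X_neq[of a b] by simp
  ultimately show "\<beta> = 0" by simp
  then show "\<alpha> = 0" using ev[of a b] by simp
qed

text \<open>The set E + z I4 + I0. Showing that it is closed under multiplication and contains the
  generators of \<open>I1\<close> is the harder half of the description of the cube ideal.\<close>

definition "J = {p \<in> S. \<exists>\<alpha>\<in>E. \<exists>\<beta>\<in>I4. p - \<alpha> - \<beta> * z \<in> I0}"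

lemma EP: "p \<in> E \<Longrightarrow> p \<in> P" and IP: "p \<in> I4 \<Longrightarrow> p \<in> P" and I0S: "p \<in> I0 \<Longrightarrow> p \<in> S"
proof -
  have "set (sym_seq a b c d e f) \<subseteq> P" "set (web_seq a b c d e f) \<subseteq> P"
    unfolding sym_seq_def web_seq_def by (auto intro!: pols_intros)
  then show "p \<in> E \<Longrightarrow> p \<in> P" "p \<in> I4 \<Longrightarrow> p \<in> P" using idl_pols by blast+
  have "set [l2, q1, l1] \<subseteq> S" unfolding pol_defs by (auto intro!: pols_intros)
  then show "p \<in> I0 \<Longrightarrow> p \<in> S" using idl_pols by blast
qed

lemma J_add: "p \<in> J \<Longrightarrow> q \<in> J \<Longrightarrow> p + q \<in> J"
proof -
  assume "p \<in> J" "q \<in> J"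
  then obtain \<alpha> \<beta> \<alpha>' \<beta>' where *: "\<alpha> \<in> E" "\<beta> \<in> I4" "\<alpha>' \<in> E" "\<beta>' \<in> I4" "p - \<alpha> - \<beta> * z \<in> I0" "q - \<alpha>' - \<beta>' * z \<in> I0"
    "p \<in> S" "q \<in> S" unfolding J_def by blast
  have "p + q - (\<alpha> + \<alpha>') - (\<beta> + \<beta>') * z = (p - \<alpha> - \<beta> * z) + (q - \<alpha>' - \<beta>' * z)" by (simp add: ring_norms)
  then have "p + q - (\<alpha> + \<alpha>') - (\<beta> + \<beta>') * z \<in> I0" using idl_add[OF *(5,6)] by (simp only:)
  then show ?thesis unfolding J_def using *(1-4,7,8) by (blast intro: idl_add pols_add)
qed

lemma J_P: "r \<in> P \<Longrightarrow> p \<in> J \<Longrightarrow> r * p \<in> J"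
proof -
  assume r: "r \<in> P" and "p \<in> J"
  then obtain \<alpha> \<beta> where *: "\<alpha> \<in> E" "\<beta> \<in> I4" "p - \<alpha> - \<beta> * z \<in> I0" "p \<in> S" unfolding J_def by blast
  have "r * p - r * \<alpha> - (r * \<beta>) * z = r * (p - \<alpha> - \<beta> * z)" by (simp add: ring_norms)
  then have "r * p - r * \<alpha> - (r * \<beta>) * z \<in> I0" using idl_mult[OF PS[OF r] *(3)] by (simp only:)
  then show ?thesis unfolding J_def using *(1,2,4) r PS[OF r] by (blast intro: idl_mult pols_mult)
qed

lemma I0_J: "p \<in> I0 \<Longrightarrow> p \<in> J"
  unfolding J_def using I0S by (auto intro!: bexI[of _ 0])

text \<open>Write X 8 = z + X f and replace z^2 by means of its quadratic equation. The constant
  part then receives a multiple N \<beta>, which is in \<open>E\<close> by \<open>I4_E\<close>, and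
  the coefficient of z receives \<alpha>, which is in \<open>I4\<close> by
  \<open>E_I4\<close>.\<close>

lemma J_X8: "p \<in> J \<Longrightarrow> X 8 * p \<in> J"
proof -
  assume "p \<in> J"
  then obtain \<alpha> \<beta> where *: "\<alpha> \<in> E" "\<beta> \<in> I4" "p - \<alpha> - \<beta> * z \<in> I0" "p \<in> S" unfolding J_def by blast
  define A where "A = X f * \<alpha> - (X f - X a) * (X f - X b) * \<beta>"
  define B where "B = X f * \<beta> + \<alpha> + ((X a - X f) + (X b - X f)) * \<beta>"
  have A: "A \<in> E" unfolding A_def by (intro idl_diff idl_mult[OF _ *(1)] I4_E[OF *(2)] XP)
  have B: "B \<in> I4" unfolding B_def
    by (intro idl_add idl_mult[OF _ *(2)] E_I4[OF *(1)] pols_add pols_diff pols_mult pols_numeral XP)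
  have "X 8 * p - A - B * z = X 8 * (p - \<alpha> - \<beta> * z) + \<beta> * ((X 8 - X a) * (X 8 - X b))"
    using quadratic_product[of "z + X f" p "X f" \<alpha> 1 \<beta> "(X f - X a) * (X f - X b)" "(X a - X f) + (X b - X f)" z]
    unfolding A_def B_def quad_z by (simp add: algebra_simps)
  moreover have "X 8 * (p - \<alpha> - \<beta> * z) + \<beta> * ((X 8 - X a) * (X 8 - X b)) \<in> I0"
    by (intro idl_add idl_mult[OF _ *(3)] idl_mult[OF _ quad] XS PS[OF IP[OF *(2)]])
  ultimately have "X 8 * p - A - B * z \<in> I0" by (simp only:)
  moreover have "X 8 * p \<in> S" using *(4) by (intro pols_mult XS)
  ultimately show ?thesis unfolding J_def using A B by blast
qed

lemma J_mult: "r \<in> S \<Longrightarrow> p \<in> J \<Longrightarrow> r * p \<in> J"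
proof (induction arbitrary: p rule: pols_ring_induct)
  case (cst r) then show ?case by (intro J_P pols_cst)
next
  case (X i)
  have pS: "p \<in> S" using X(2) by (simp add: J_def)
  note 8 = J_X8[OF X(2)]
  have n8: "- 1 * (X 8 * p) \<in> J" by (rule J_P[OF _ 8]) (intro pols_uminus pols_1)
  from X(1) show ?case
  proof (cases rule: X_cases)
    case 1 then show ?thesis using X(2) by (intro J_P) auto
  next
    case 2
    have "X 7 * p = (X a + X b) * p + - 1 * (X 8 * p) + l1 * (- p)" unfolding pol_defs by (simp add: ring_norms)
    also have "\<dots> \<in> J"
      by (intro J_add n8 J_P[OF _ X(2)] I0_J[OF idl_mult'] pols_uminus pS gens pols_add XP)
    finally show ?thesis unfolding 2 .
  next
    case 3 then show ?thesis using 8 by simp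
  next
    case 4
    have "X 9 * p = X 8 * p + (X c - X f) * p + l2 * (- p)" unfolding pol_defs by (simp add: ring_norms)
    also have "\<dots> \<in> J"
      by (intro J_add 8 J_P[OF _ X(2)] I0_J[OF idl_mult'] pols_uminus pS gens pols_diff XP)
    finally show ?thesis unfolding 4 .
  qed
next
  case (add q r) then show ?case by (simp add: distrib_right J_add)
next
  case (mult q r) then show ?case by (simp add: mult.assoc)
qed

lemma I1_J: "p \<in> I1 \<Longrightarrow> p \<in> J"
proof (induction rule: idl_induct)
  case (gen g r)
  have JI: "g \<in> J" if "\<alpha> \<in> E" "\<beta> \<in> I4" "g - \<alpha> - \<beta> * z \<in> I0" "g \<in> S" for g \<alpha> \<beta> using that unfolding J_def by blast
  have zero: "0 \<in> I4" by simp
  \<comment> \<open>Modulo \<open>I0\<close> the three remaining generators are \<open>l3\<close> =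
    \<open>s1\<close>, \<open>q2\<close> = \<open>m0 * z\<close> and \<open>q3\<close> =
    \<open>s2 - X f * s1 - m0 * z\<close>.\<close>
  have l3: "l3 \<in> J"
  proof (rule JI[OF gens(10) zero])
    have "l3 - s1 - 0 * z = - l1 - l2" unfolding pol_defs by (simp add: ring_norms)
    also have "\<dots> \<in> I0" by (intro idl_diff idl_uminus gens)
    finally show "l3 - s1 - 0 * z \<in> I0" .
  qed (unfold pol_defs, intro pols_intros XS)
  have q2: "q2 \<in> J"
  proof (rule JI[OF _ gens(7)])
    have "q2 - 0 - m0 * z = X f * l2" unfolding pol_defs by (simp add: ring_norms)
    also have "\<dots> \<in> I0" by (intro idl_mult gens XS)
    finally show "q2 - 0 - m0 * z \<in> I0" .
  qed (simp, unfold pol_defs, intro pols_intros XS)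
  have q3: "q3 \<in> J"
  proof (rule JI)
    show "s2 - X f * s1 \<in> E" by (intro idl_diff idl_mult gens XP)
    show "- m0 \<in> I4" by (intro idl_uminus gens)
    have "q3 - (s2 - X f * s1) - (- m0) * z = - (X 9 * l1) - (X a + X b - X 8) * l2 - (X 8 - X a) * (X 8 - X b)"
      unfolding pol_defs by (simp add: ring_norms)
    also have "\<dots> \<in> I0" by (intro idl_diff[OF idl_diff] idl_uminus idl_mult gens quad pols_diff pols_add XS)
    finally show "q3 - (s2 - X f * s1) - (- m0) * z \<in> I0" .
  qed (unfold pol_defs, intro pols_intros XS)
  have "g \<in> J" using gen(1) l3 q2 q3 I0_J gens(13-15) unfolding seqs by auto
  then show ?case using J_mult[OF gen(2)] by (simp add: mult.commute)
qed (auto intro: J_add I0_J)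

lemma cube_ideal_iff:
  assumes "\<alpha> \<in> P" "\<beta> \<in> P" shows "\<alpha> + z * \<beta> \<in> I1 \<longleftrightarrow> \<alpha> \<in> E \<and> \<beta> \<in> I4"
proof
  assume "\<alpha> + z * \<beta> \<in> I1"
  then obtain \<alpha>' \<beta>' where *: "\<alpha>' \<in> E" "\<beta>' \<in> I4" "\<alpha> + z * \<beta> - \<alpha>' - \<beta>' * z \<in> I0" using I1_J unfolding J_def by blast
  have "\<alpha> + z * \<beta> - \<alpha>' - \<beta>' * z = (\<alpha> - \<alpha>') + (\<beta> - \<beta>') * z" by (simp add: ring_norms)
  then have I0: "(\<alpha> - \<alpha>') + (\<beta> - \<beta>') * z \<in> I0" using *(3) by (simp only:)
  have "\<alpha> - \<alpha>' \<in> P" "\<beta> - \<beta>' \<in> P" using assms EP[OF *(1)] IP[OF *(2)] by (auto intro: pols_diff)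
  note z_independent[OF this I0]
  then show "\<alpha> \<in> E \<and> \<beta> \<in> I4" using * by simp
next
  assume "\<alpha> \<in> E \<and> \<beta> \<in> I4"
  then show "\<alpha> + z * \<beta> \<in> I1" using idl_add[OF E_I1 zI4_I1] by blast
qed

text \<open>\<open>I1\<close> has homogeneous generators, so the decomposition may be replaced by
  its component of degree m; the coefficient of \<open>z\<close> loses degree 2.\<close>

lemma cube_decomposition:
  assumes "p \<in> S" "homogeneous m p"
  shows "\<exists>\<alpha>\<in>P. \<exists>\<beta>\<in>P. homogeneous m \<alpha> \<and> homogeneous (m - 2) \<beta> \<and> p - \<alpha> - z * \<beta> \<in> I1"
proof -
  obtain \<alpha> \<beta> where *: "\<alpha> \<in> P" "\<beta> \<in> P" "p - \<alpha> - \<beta> * z \<in> I0" using decomposition[OF assms(1)] by blast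
  have hz: "homogeneous 2 z" by (intro homogeneous_diff) auto
  have "hpart m (p - \<alpha> - z * \<beta>) \<in> I1"
  proof (rule idl_hpart)
    show "\<exists>j. homogeneous j g" if "g \<in> set (cube_seq a b c d e f)" for g
    proof -
      have "homogeneous 4 (X i * X j - X k * X l)" for i j k l
        by (intro homogeneous_diff homogeneous_mult_eq[of 2 _ 2]) auto
      moreover have "homogeneous 2 (X i + X j - X k - X l)" for i j k l
        by (intro homogeneous_diff homogeneous_add) auto
      ultimately have "homogeneous 4 g \<or> homogeneous 2 g" using that unfolding cube_seq_def by auto
      then show ?thesis by blast
    qed
    show "p - \<alpha> - z * \<beta> \<in> I1" using I0_I1[OF *(3)] by (simp add: mult.commute)
  qed
  moreover have "hpart m (p - \<alpha> - z * \<beta>) = p - hpart m \<alpha> - z * hpart (m - 2) \<beta>"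
    using hpart_homogeneous[OF assms(2), of m] by (simp add: hpart_diff hpart_mult[OF hz])
  ultimately show ?thesis using *(1,2) hpart_pols by (intro bexI[of _ "hpart m \<alpha>"] bexI[of _ "hpart (m - 2) \<beta>"]) auto
qed

section \<open>Regularity of the sequences and the finite-rank model\<close>

lemma not_internal: "a \<notin> {7, 8, 9}" "b \<notin> {7, 8, 9}" "c \<notin> {7, 8, 9}" "d \<notin> {7, 8, 9}" "e \<notin> {7, 8, 9}" "f \<notin> {7, 8, 9}"
  using bounds by (auto simp del: bounds)

lemma regular_cube: "regular {1..9} (cube_seq a b c d e f)"
proof -
  have m: "a \<in> {1..9}" "b \<in> {1..9}" "c \<in> {1..9}" "d \<in> {1..9}" "e \<in> {1..9}" "f \<in> {1..9}" using XS by simp_all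
  show ?thesis
    unfolding cube_seq_def using m distinct not_internal
    by (intro regular_wide) (auto intro!: pols_intros)
qed

lemma regular_web: "regular {1..6} (web_seq a b c d e f)"
proof -
  have m: "a \<in> {1..6}" "b \<in> {1..6}" "c \<in> {1..6}" "d \<in> {1..6}" "e \<in> {1..6}" "f \<in> {1..6}" using XP by simp_all
  show ?thesis
    unfolding web_seq_def using m distinct
    by (intro regular_monic regular_wide) (auto intro!: pols_intros)
qed

text \<open>A regular sequence that generates \<open>E\<close>; \<open>t2\<close> is \<open>h\<^sub>2 - h\<^sub>1 e\<^sub>1 + e\<^sub>2\<close> and \<open>t3\<close> is
  \<open>\<Prod>(X a - y)\<close>, where \<open>h\<^sub>i\<close> is complete symmetric in \<open>X a, X b\<close> and \<open>e\<^sub>i, y\<close> refer to the incoming variables.\<close>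

definition "t2 = X b ^ 2 + X a * X b + X a ^ 2 - (X a + X b) * (X d + X e + X f) + (X d * X e + X d * X f + X e * X f)"
definition "t3 = (X a - X d) * ((X a - X e) * (X a - X f))"

text \<open>\<open>t3\<close> is the incoming cubic at X a, where the outgoing cubic vanishes; it is
  thus a combination of \<open>s1\<close>, \<open>s2\<close>, \<open>s3\<close> with coefficient 1
  at \<open>s3\<close>. Likewise \<open>t2\<close> is a multiple of \<open>s1\<close> minus
  \<open>s2\<close>, so the change of generators is triangular and invertible.\<close>

lemma ups_ideal: "idl {1..6} [s1, t3, t2] = E"
proof
  have "t2 = (X a + X b) * s1 - s2" "t3 = X a ^ 2 * s1 - X a * s2 + s3"
    unfolding pol_defs t2_def t3_def by (simp_all add: ring_norms)
  moreover have "(X a + X b) * s1 - s2 \<in> E" "X a ^ 2 * s1 - X a * s2 + s3 \<in> E"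
    by (intro idl_add idl_diff idl_mult gens pols_add pols_power XP)+
  ultimately show "idl {1..6} [s1, t3, t2] \<subseteq> E" using gens by (intro idl_subset) (auto)
  have g: "s1 \<in> idl {1..6} [s1, t3, t2]" "t2 \<in> idl {1..6} [s1, t3, t2]" "t3 \<in> idl {1..6} [s1, t3, t2]"
    by (rule idl_gen; simp)+
  have "s2 = (X a + X b) * s1 - t2" "s3 = t3 - X a ^ 2 * s1 + X a * ((X a + X b) * s1 - t2)"
    unfolding pol_defs t2_def t3_def by (simp_all add: ring_norms)
  moreover have "(X a + X b) * s1 - t2 \<in> idl {1..6} [s1, t3, t2]"
    "t3 - X a ^ 2 * s1 + X a * ((X a + X b) * s1 - t2) \<in> idl {1..6} [s1, t3, t2]"
    by (intro idl_add idl_diff idl_mult g pols_add pols_power XP)+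
  ultimately show "E \<subseteq> idl {1..6} [s1, t3, t2]" unfolding seqs using g by (intro idl_subset) (auto)
qed

text \<open>\<open>t2\<close> and \<open>X a - X y\<close> have no common factor, since
  \<open>t2\<close> keeps the term \<open>X b ^ 2\<close> when \<open>X y\<close> is set to
  \<open>X a\<close>. Hence the cofactor \<open>s\<close> vanishes under this substitution and is
  divisible by \<open>X y - X a\<close>.\<close>

lemma t2_cancel:
  assumes "y \<in> {d, e, f}" "p \<in> P" "(X a - X y) * p \<in> idl {1..6} [t2]" shows "p \<in> idl {1..6} [t2]"
proof -
  have y: "X y \<in> P" "y \<in> {1..6}" "a \<in> {1..6}" using assms(1) XP by auto
  obtain s where s: "s \<in> P" "(X a - X y) * p = t2 * s" using assms(3) by (auto simp: idl.simps)
  let ?\<sigma> = "subst (X(y := X a))"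
  have "?\<sigma> ((X a - X y) * p) = ?\<sigma> (t2 * s)" by (simp only: s(2))
  moreover have "y \<noteq> a" using assms(1) distinct by auto
  ultimately have 0: "?\<sigma> t2 * ?\<sigma> s = 0" by (simp add: subst_hom)
  have "subst (\<lambda>i. if i = b then 1 else 0) (?\<sigma> t2) = 1"
    using assms(1) distinct unfolding t2_def subst_hom by (auto simp: subst_hom)
  then have "?\<sigma> t2 \<noteq> 0" by auto
  then have \<sigma>s: "?\<sigma> s = 0" using 0 by simp
  obtain r where r: "r \<in> P" "s = ?\<sigma> s + (X y - X a) * r" using subst_upd_dvd[OF s(1) y(2) XP(1)] .
  have sr: "s = (X y - X a) * r" using r(2) unfolding \<sigma>s by simp
  have "(X a - X y) * p = (X a - X y) * (t2 * (- r))" unfolding s(2) sr by (simp add: algebra_simps)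
  moreover have "X a - X y \<noteq> 0" using X_neq[of a y] \<open>y \<noteq> a\<close> by simp
  ultimately have "p = t2 * (- r)" using mult_left_cancel by blast
  then show ?thesis using idl_ConsI[of "- r" "{1..6}" 0 "[]" t2] r(1) by (simp add: pols_uminus)
qed

lemma t2_t3: "t2 \<in> pols ({1..6} - {c})" "t3 \<in> pols ({1..6} - {c})"
  using distinct marks unfolding t2_def t3_def by (auto intro!: pols_intros)

text \<open>\<open>t3\<close> is a product of three linear forms, each of which cancels modulo
  \<open>t2\<close>; \<open>s1\<close> is monic in \<open>X c\<close>, which occurs in neither
  \<open>t2\<close> nor \<open>t3\<close>.\<close>

lemma regular_ups: "regular {1..6} [s1, t3, t2]"
proof -
  have "subst (\<lambda>i. if i = b then 1 else 0) t2 = 1" using distinct unfolding t2_def by (auto simp: subst_hom)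
  then have "t2 \<noteq> 0" by auto
  then have 1: "regular {1..6} [t2]" by (simp add: idl.simps)
  have "p \<in> idl {1..6} [t2]" if "p \<in> P" "t3 * p \<in> idl {1..6} [t2]" for p
    using that t2_cancel[of d "(X a - X e) * ((X a - X f) * p)"] t2_cancel[of e "(X a - X f) * p"] t2_cancel[of f p]
    unfolding t3_def by (simp add: mult.assoc pols_mult pols_diff)
  then have 2: "regular {1..6} [t3, t2]" using 1 by simp
  have "X d + X e + X f - X a - X b \<in> pols ({1..6} - {c})" using distinct marks by (auto intro!: pols_intros)
  then have "regular {1..6} [X c - (X d + X e + X f - X a - X b), t3, t2]"
    using XP(3) t2_t3 by (intro regular_monic 2) auto
  moreover have "X c - (X d + X e + X f - X a - X b) = s1" unfolding s1_def by (simp add: ring_norms)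
  ultimately show ?thesis by (simp only:)
qed

text \<open>The recursion has order three, so three consecutive exponents are treated together. For
  the exponent n + 1 it puts the potential into \<open>E\<close>, as is necessary for a Koszul
  factorization of it on generators of \<open>E\<close>.\<close>

lemma power_sum_E: "X a ^ m + X b ^ m + X c ^ m - X d ^ m - X e ^ m - X f ^ m \<in> E"
proof -
  let ?D = "\<lambda>m. X a ^ m + X b ^ m + X c ^ m - X d ^ m - X e ^ m - X f ^ m"
  let ?p = "\<lambda>m. X d ^ m + X e ^ m + X f ^ m"
  have pP: "?p k \<in> P" for k by (intro pols_add pols_power XP)
  have "?D m \<in> E \<and> ?D (m + 1) \<in> E \<and> ?D (m + 2) \<in> E"
  proof (induction m)
    case 0
    have "?D 2 = (X a + X b + X c + X d + X e + X f) * s1 - 2 * s2" unfolding pol_defs by (simp add: ring_norms)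
    moreover have "(X a + X b + X c + X d + X e + X f) * s1 - 2 * s2 \<in> E"
      by (intro idl_diff idl_mult gens pols_add pols_numeral XP)
    ultimately have 2: "?D 2 \<in> E" by (simp only:)
    have 1: "?D 1 = s1" by (simp add: s1_def)
    show ?case using 2 gens(10) unfolding 1[symmetric] by (simp add: numeral_2_eq_2)
  next
    case (Suc m)
    have "?D (m + 3) = (X a + X b + X c) * ?D (m + 2) - (X a * X b + X a * X c + X b * X c) * ?D (m + 1) + X a * X b * X c * ?D m
      + s1 * ?p (m + 2) - s2 * ?p (m + 1) + s3 * ?p m"
      unfolding power_add power_one_right s1_def s2_def s3_def by (rule power_sum_recursion)
    also have "\<dots> \<in> E"
      by (intro idl_add idl_diff idl_mult'[OF pP] gens idl_mult[OF _ Suc.IH[THEN conjunct1]]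
        idl_mult[OF _ Suc.IH[THEN conjunct2, THEN conjunct1]] idl_mult[OF _ Suc.IH[THEN conjunct2, THEN conjunct2]]
        pols_add pols_mult XP)
    finally have "?D (m + 3) \<in> E" .
    moreover have "m + 1 + 1 = m + 2" "m + 1 + 2 = m + 3" by simp_all
    ultimately show ?case using Suc.IH unfolding Suc_eq_plus1 by (simp only:)
  qed
  then show ?thesis by blast
qed

abbreviation "w n \<equiv> X a ^ (n + 1) + X b ^ (n + 1) + X c ^ (n + 1) - X d ^ (n + 1) - X e ^ (n + 1) - X f ^ (n + 1)"

lemma homogeneous_w: "homogeneous (2 * (int n + 1)) (w n)"
proof -
  have "homogeneous (2 * (int n + 1)) (X i ^ (n + 1))" for i
    using homogeneous_power[of 2 "X i" "n + 1"] by (simp add: mult.commute)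
  then show ?thesis by (intro homogeneous_add homogeneous_diff)
qed

text \<open>The entries a have no closed formula: they are homogeneous components of the
  coefficients that express \<open>w n\<close> as a member of \<open>E\<close>. The generators have
  degrees 2, 6 and 4, hence 2n, 2n - 4 and 2n - 2; for n = 1 the middle coefficient has negative
  degree and is 0.\<close>

lemma ups_pairs:
  "\<exists>r1 r3 r2. graded_pairs n {1..6} [(2 * int n, r1, s1), (2 * int n - 4, r3, t3), (2 * int n - 2, r2, t2)] \<and>
     potential [(2 * int n, r1, s1), (2 * int n - 4, r3, t3), (2 * int n - 2, r2, t2)] = w n"
proof -
  have XX: "homogeneous 4 (X i * X j)" for i j by (rule homogeneous_mult_eq[of 2 _ 2]) auto
  have h1: "homogeneous 2 s1" unfolding s1_def by (intro homogeneous_add homogeneous_diff) auto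
  have h2: "homogeneous 4 t2" unfolding t2_def
  proof (intro homogeneous_add homogeneous_diff XX)
    show "homogeneous 4 ((X a + X b) * (X d + X e + X f))"
      by (rule homogeneous_mult_eq[of 2 _ 2]) (auto intro!: homogeneous_add)
  qed (simp_all add: power2_eq_square XX)
  have h3: "homogeneous 6 t3" unfolding t3_def
    by (rule homogeneous_mult_eq[of 2 _ 4], auto intro!: homogeneous_diff,
        rule homogeneous_mult_eq[of 2 _ 2], auto intro!: homogeneous_diff)
  obtain r1 r3 r2 where r: "r1 \<in> P" "r3 \<in> P" "r2 \<in> P" "w n = s1 * r1 + (t3 * r3 + (t2 * r2 + 0))"
    using power_sum_E[of "n + 1"] unfolding ups_ideal[symmetric] idl.simps by auto
  have "w n = hpart (2 * (int n + 1)) (w n)" using homogeneous_w homogeneous_iff_hpart by simp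
  also have "\<dots> = s1 * hpart (2 * int n) r1 + (t3 * hpart (2 * int n - 4) r3 + t2 * hpart (2 * int n - 2) r2)"
    unfolding r(4) by (simp add: hpart_add hpart_mult[OF h1] hpart_mult[OF h2] hpart_mult[OF h3])
  finally have w: "w n = s1 * hpart (2 * int n) r1 + (t3 * hpart (2 * int n - 4) r3 + t2 * hpart (2 * int n - 2) r2)" .
  have sP: "s1 \<in> P" "t2 \<in> P" "t3 \<in> P" unfolding s1_def t2_def t3_def by (intro pols_intros XP)+
  show ?thesis
    by (intro exI[of _ "hpart (2 * int n) r1"] exI[of _ "hpart (2 * int n - 4) r3"] exI[of _ "hpart (2 * int n - 2) r2"] conjI)
      (use r(1-3) sP h1 h2 h3 in \<open>simp_all add: w hpart_pols mult.commute\<close>)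
qed

end

subsection \<open>Presentations of the augmentation\<close>

text \<open>The offsets are the shifts. Three wide edges give -3; the coefficient of
  \<open>z\<close>, which has degree 2, is then shifted by -1, just like the factorization of one
  wide edge and an arc.\<close>

definition triple_deg :: "nat set \<Rightarrow> int \<Rightarrow> mpol \<Rightarrow> mpol \<Rightarrow> mpol \<Rightarrow> bool" where
  "triple_deg V k \<alpha> \<beta> \<gamma> \<longleftrightarrow> \<alpha> \<in> pols V \<and> homogeneous (k + 3) \<alpha> \<and> \<beta> \<in> pols V \<and> homogeneous (k + 1) \<beta> \<and>
     \<gamma> \<in> pols V \<and> homogeneous (k + 1) \<gamma>"

text \<open>The relation \<open>T\<close> identifies the quotient of \<open>M\<^sup>0\<close> by \<open>F 0\<close> with \<open>\<rat>[V]/A \<oplus> \<rat>[V]/B \<oplus> \<rat>[V]/C\<close>,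
  where the summands are shifted by \<open>-3\<close>, \<open>-1\<close>, \<open>-1\<close>.\<close>

definition presents :: "nat set \<Rightarrow> 'm::ab_group_add factorization \<Rightarrow> (nat \<Rightarrow> bool \<Rightarrow> 'm set) \<Rightarrow>
    mpol set \<Rightarrow> mpol set \<Rightarrow> mpol set \<Rightarrow> ('m \<Rightarrow> mpol \<Rightarrow> mpol \<Rightarrow> mpol \<Rightarrow> bool) \<Rightarrow> bool" where
  "presents V M F A B C T \<longleftrightarrow>
     (\<forall>k. \<forall>x\<in>deg_part (component M False) k. \<exists>\<alpha> \<beta> \<gamma>. triple_deg V k \<alpha> \<beta> \<gamma> \<and> T x \<alpha> \<beta> \<gamma>) \<and>
     (\<forall>k \<alpha> \<beta> \<gamma>. triple_deg V k \<alpha> \<beta> \<gamma> \<longrightarrow> (\<exists>x\<in>deg_part (component M False) k. T x \<alpha> \<beta> \<gamma>)) \<and>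
     (\<forall>x\<in>carrier (component M False). \<forall>y\<in>carrier (component M False). \<forall>\<alpha> \<beta> \<gamma> \<alpha>' \<beta>' \<gamma>'.
        T x \<alpha> \<beta> \<gamma> \<longrightarrow> T y \<alpha>' \<beta>' \<gamma>' \<longrightarrow> T (x + y) (\<alpha> + \<alpha>') (\<beta> + \<beta>') (\<gamma> + \<gamma>')) \<and>
     (\<forall>p\<in>pols V. \<forall>x\<in>carrier (component M False). \<forall>\<alpha> \<beta> \<gamma>.
        T x \<alpha> \<beta> \<gamma> \<longrightarrow> T (p \<odot>\<^bsub>component M False\<^esub> x) (p * \<alpha>) (p * \<beta>) (p * \<gamma>)) \<and>
     (\<forall>x\<in>carrier (component M False). \<forall>\<alpha>\<in>pols V. \<forall>\<beta>\<in>pols V. \<forall>\<gamma>\<in>pols V.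
        T x \<alpha> \<beta> \<gamma> \<longrightarrow> (x \<in> F 0 False \<longleftrightarrow> \<alpha> \<in> A \<and> \<beta> \<in> B \<and> \<gamma> \<in> C)) \<and>
     (\<forall>x\<in>F 0 False. T x 0 0 0)"

lemma presentsD:
  assumes "presents V M F A B C T"
  shows "x \<in> deg_part (component M False) k \<Longrightarrow> \<exists>\<alpha> \<beta> \<gamma>. triple_deg V k \<alpha> \<beta> \<gamma> \<and> T x \<alpha> \<beta> \<gamma>"
    "triple_deg V k \<alpha> \<beta> \<gamma> \<Longrightarrow> \<exists>x\<in>deg_part (component M False) k. T x \<alpha> \<beta> \<gamma>"
    "x \<in> carrier (component M False) \<Longrightarrow> y \<in> carrier (component M False) \<Longrightarrow> T x \<alpha> \<beta> \<gamma> \<Longrightarrow> T y \<alpha>' \<beta>' \<gamma>' \<Longrightarrow>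
       T (x + y) (\<alpha> + \<alpha>') (\<beta> + \<beta>') (\<gamma> + \<gamma>')"
    "p \<in> pols V \<Longrightarrow> x \<in> carrier (component M False) \<Longrightarrow> T x \<alpha> \<beta> \<gamma> \<Longrightarrow>
       T (p \<odot>\<^bsub>component M False\<^esub> x) (p * \<alpha>) (p * \<beta>) (p * \<gamma>)"
    "x \<in> carrier (component M False) \<Longrightarrow> \<alpha> \<in> pols V \<Longrightarrow> \<beta> \<in> pols V \<Longrightarrow> \<gamma> \<in> pols V \<Longrightarrow> T x \<alpha> \<beta> \<gamma> \<Longrightarrow>
       x \<in> F 0 False \<longleftrightarrow> \<alpha> \<in> A \<and> \<beta> \<in> B \<and> \<gamma> \<in> C"
    "x \<in> F 0 False \<Longrightarrow> T x 0 0 0"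
proof -
  note h1 = assms[unfolded presents_def]
  note h2 = h1[THEN conjunct2] note h3 = h2[THEN conjunct2] note h4 = h3[THEN conjunct2] note h5 = h4[THEN conjunct2]
  show "x \<in> deg_part (component M False) k \<Longrightarrow> \<exists>\<alpha> \<beta> \<gamma>. triple_deg V k \<alpha> \<beta> \<gamma> \<and> T x \<alpha> \<beta> \<gamma>"
    using h1[THEN conjunct1] by blast
  show "triple_deg V k \<alpha> \<beta> \<gamma> \<Longrightarrow> \<exists>x\<in>deg_part (component M False) k. T x \<alpha> \<beta> \<gamma>"
    using h2[THEN conjunct1] by blast
  show "x \<in> carrier (component M False) \<Longrightarrow> y \<in> carrier (component M False) \<Longrightarrow> T x \<alpha> \<beta> \<gamma> \<Longrightarrow> T y \<alpha>' \<beta>' \<gamma>' \<Longrightarrow>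
       T (x + y) (\<alpha> + \<alpha>') (\<beta> + \<beta>') (\<gamma> + \<gamma>')"
    using h3[THEN conjunct1] by blast
  show "p \<in> pols V \<Longrightarrow> x \<in> carrier (component M False) \<Longrightarrow> T x \<alpha> \<beta> \<gamma> \<Longrightarrow>
       T (p \<odot>\<^bsub>component M False\<^esub> x) (p * \<alpha>) (p * \<beta>) (p * \<gamma>)"
    using h4[THEN conjunct1] by blast
  show "x \<in> carrier (component M False) \<Longrightarrow> \<alpha> \<in> pols V \<Longrightarrow> \<beta> \<in> pols V \<Longrightarrow> \<gamma> \<in> pols V \<Longrightarrow> T x \<alpha> \<beta> \<gamma> \<Longrightarrow>
       x \<in> F 0 False \<longleftrightarrow> \<alpha> \<in> A \<and> \<beta> \<in> B \<and> \<gamma> \<in> C"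
    using h5[THEN conjunct1] by blast
  show "x \<in> F 0 False \<Longrightarrow> T x 0 0 0" using h5[THEN conjunct2] by blast
qed

text \<open>The two sides of the isomorphism present the ideals of the two webs in opposite order;
  this aligns them.\<close>

lemma presents_swap:
  assumes "presents V M F A B C T" shows "presents V M F A C B (\<lambda>x \<alpha> \<beta> \<gamma>. T x \<alpha> \<gamma> \<beta>)"
proof -
  note D = presentsD[OF assms]
  have sw: "triple_deg V k \<alpha> \<beta> \<gamma> \<Longrightarrow> triple_deg V k \<alpha> \<gamma> \<beta>" for k \<alpha> \<beta> \<gamma> unfolding triple_deg_def by blast
  show ?thesis
    unfolding presents_def
  proof (intro conjI allI ballI impI)
    fix k x assume "x \<in> deg_part (component M False) k"
    then obtain \<alpha> \<beta> \<gamma> where "triple_deg V k \<alpha> \<beta> \<gamma>" "T x \<alpha> \<beta> \<gamma>" using D(1) by blast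
    then show "\<exists>\<alpha> \<beta> \<gamma>. triple_deg V k \<alpha> \<beta> \<gamma> \<and> T x \<alpha> \<gamma> \<beta>" using sw by blast
  next
    fix k \<alpha> \<beta> \<gamma> assume "triple_deg V k \<alpha> \<beta> \<gamma>"
    then show "\<exists>x\<in>deg_part (component M False) k. T x \<alpha> \<gamma> \<beta>" by (rule D(2)[OF sw])
  next
    fix x \<alpha> \<beta> \<gamma> assume "x \<in> carrier (component M False)" "\<alpha> \<in> pols V" "\<beta> \<in> pols V" "\<gamma> \<in> pols V" "T x \<alpha> \<gamma> \<beta>"
    then show "x \<in> F 0 False \<longleftrightarrow> \<alpha> \<in> A \<and> \<beta> \<in> C \<and> \<gamma> \<in> B" using D(5)[of x \<alpha> \<gamma> \<beta>] by blast
  qed (rule D; assumption)+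
qed

text \<open>Elements are related when they share a triple of representatives. This is the graph of
  the isomorphism of quotients that \<open>heq_resolved\<close> asks for.\<close>

theorem heq_presented:
  assumes M: "resolved n w V M F" "presents V M F A B C T" and N: "resolved n w V N G" "presents V N G A B C T'"
  shows "heq n M N"
proof (rule heq_resolved[OF M(1) N(1), where R = "\<lambda>x y. \<exists>\<alpha>\<in>pols V. \<exists>\<beta>\<in>pols V. \<exists>\<gamma>\<in>pols V. T x \<alpha> \<beta> \<gamma> \<and> T' y \<alpha> \<beta> \<gamma>"])
  note D = presentsD[OF M(2)] and D' = presentsD[OF N(2)]
  note sM = submodD(1)[OF resolvedD(2)[OF M(1)]] and sN = submodD(1)[OF resolvedD(2)[OF N(1)]]
  show "\<exists>y\<in>deg_part (component N False) k. \<exists>\<alpha>\<in>pols V. \<exists>\<beta>\<in>pols V. \<exists>\<gamma>\<in>pols V. T x \<alpha> \<beta> \<gamma> \<and> T' y \<alpha> \<beta> \<gamma>"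
    if hx: "x \<in> deg_part (component M False) k" for x k
  proof -
    obtain \<alpha> \<beta> \<gamma> where *: "triple_deg V k \<alpha> \<beta> \<gamma>" "T x \<alpha> \<beta> \<gamma>" using D(1)[OF hx] by blast
    then show ?thesis using D'(2)[OF *(1)] unfolding triple_deg_def by blast
  qed
  show "\<exists>x\<in>deg_part (component M False) k. \<exists>\<alpha>\<in>pols V. \<exists>\<beta>\<in>pols V. \<exists>\<gamma>\<in>pols V. T x \<alpha> \<beta> \<gamma> \<and> T' y \<alpha> \<beta> \<gamma>"
    if hx: "y \<in> deg_part (component N False) k" for y k
  proof -
    obtain \<alpha> \<beta> \<gamma> where *: "triple_deg V k \<alpha> \<beta> \<gamma>" "T' y \<alpha> \<beta> \<gamma>" using D'(1)[OF hx] by blast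
    then show ?thesis using D(2)[OF *(1)] unfolding triple_deg_def by blast
  qed
  show "\<exists>\<alpha>\<in>pols V. \<exists>\<beta>\<in>pols V. \<exists>\<gamma>\<in>pols V. T (x + x') \<alpha> \<beta> \<gamma> \<and> T' (y + y') \<alpha> \<beta> \<gamma>"
    if c: "x \<in> carrier (component M False)" "x' \<in> carrier (component M False)"
      "y \<in> carrier (component N False)" "y' \<in> carrier (component N False)"
      and 1: "\<exists>\<alpha>\<in>pols V. \<exists>\<beta>\<in>pols V. \<exists>\<gamma>\<in>pols V. T x \<alpha> \<beta> \<gamma> \<and> T' y \<alpha> \<beta> \<gamma>"
      and 2: "\<exists>\<alpha>\<in>pols V. \<exists>\<beta>\<in>pols V. \<exists>\<gamma>\<in>pols V. T x' \<alpha> \<beta> \<gamma> \<and> T' y' \<alpha> \<beta> \<gamma>" for x x' y y'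
  proof -
    obtain \<alpha> \<beta> \<gamma> where a: "\<alpha> \<in> pols V" "\<beta> \<in> pols V" "\<gamma> \<in> pols V" "T x \<alpha> \<beta> \<gamma>" "T' y \<alpha> \<beta> \<gamma>" using 1 by blast
    obtain \<alpha>' \<beta>' \<gamma>' where b: "\<alpha>' \<in> pols V" "\<beta>' \<in> pols V" "\<gamma>' \<in> pols V" "T x' \<alpha>' \<beta>' \<gamma>'" "T' y' \<alpha>' \<beta>' \<gamma>'" using 2 by blast
    show ?thesis
      using D(3)[OF c(1,2) a(4) b(4)] D'(3)[OF c(3,4) a(5) b(5)] pols_add[OF a(1) b(1)] pols_add[OF a(2) b(2)]
        pols_add[OF a(3) b(3)] by blast
  qed
  show "\<exists>\<alpha>\<in>pols V. \<exists>\<beta>\<in>pols V. \<exists>\<gamma>\<in>pols V. T (p \<odot>\<^bsub>component M False\<^esub> x) \<alpha> \<beta> \<gamma> \<and> T' (p \<odot>\<^bsub>component N False\<^esub> y) \<alpha> \<beta> \<gamma>"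
    if c: "p \<in> pols V" "x \<in> carrier (component M False)" "y \<in> carrier (component N False)"
      and 1: "\<exists>\<alpha>\<in>pols V. \<exists>\<beta>\<in>pols V. \<exists>\<gamma>\<in>pols V. T x \<alpha> \<beta> \<gamma> \<and> T' y \<alpha> \<beta> \<gamma>" for p x y
  proof -
    obtain \<alpha> \<beta> \<gamma> where a: "\<alpha> \<in> pols V" "\<beta> \<in> pols V" "\<gamma> \<in> pols V" "T x \<alpha> \<beta> \<gamma>" "T' y \<alpha> \<beta> \<gamma>" using 1 by blast
    show ?thesis
      using D(4)[OF c(1,2) a(4)] D'(4)[OF c(1,3) a(5)] pols_mult[OF c(1) a(1)] pols_mult[OF c(1) a(2)]
        pols_mult[OF c(1) a(3)] by blast
  qed
  show "\<exists>\<alpha>\<in>pols V. \<exists>\<beta>\<in>pols V. \<exists>\<gamma>\<in>pols V. T x \<alpha> \<beta> \<gamma> \<and> T' y \<alpha> \<beta> \<gamma>" if "x \<in> F 0 False" "y \<in> G 0 False" for x y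
    using D(6)[OF that(1)] D'(6)[OF that(2)] pols_0 by blast
  show "y \<in> G 0 False" if "x \<in> F 0 False" "y \<in> carrier (component N False)"
    "\<exists>\<alpha>\<in>pols V. \<exists>\<beta>\<in>pols V. \<exists>\<gamma>\<in>pols V. T x \<alpha> \<beta> \<gamma> \<and> T' y \<alpha> \<beta> \<gamma>" for x y
    using that D(5)[OF sM[OF that(1)]] D'(5)[OF that(2)] by blast
  show "x \<in> F 0 False" if "x \<in> carrier (component M False)" "y \<in> G 0 False"
    "\<exists>\<alpha>\<in>pols V. \<exists>\<beta>\<in>pols V. \<exists>\<gamma>\<in>pols V. T x \<alpha> \<beta> \<gamma> \<and> T' y \<alpha> \<beta> \<gamma>" for x y
    using that D'(5)[OF sN[OF that(2)]] D(5)[OF that(1)] by blast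
qed

abbreviation aug :: "kpairs \<Rightarrow> (bool list \<Rightarrow> mpol) \<Rightarrow> mpol" where "aug ps v \<equiv> v (replicate (length ps) False)"
abbreviation koszR :: "nat \<Rightarrow> nat set \<Rightarrow> int \<Rightarrow> kpairs \<Rightarrow> (bool list \<Rightarrow> mpol) factorization" where
  "koszR n V m ps \<equiv> restrict_scalars {1..6} (kosz n V m ps)"

lemma restrict_scalars_simps [simp]: "ring_vars (restrict_scalars W M) = W"
  "component (restrict_scalars W M) = component M" "differential (restrict_scalars W M) = differential M"
  by (simp_all add: restrict_scalars_def)

lemma dl_replicate: "dl n ps (replicate (length ps) False) = 0"
  by (induction ps) auto

lemma replicate_BL: "replicate l False \<in> BL l False"
proof -
  have "cnt (replicate l False) = 0" by (induction l) auto
  then show ?thesis by (simp add: BL_def)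
qed

lemma aug:
  "x \<in> carrier (component (kosz n V m ps) False) \<Longrightarrow> aug ps x \<in> pols V"
  "x \<in> deg_part (component (kosz n V m ps) False) k \<Longrightarrow> aug ps x \<in> pols V \<and> homogeneous (k - m) (aug ps x)"
  "p \<in> pols V \<Longrightarrow> homogeneous (k - m) p \<Longrightarrow>
     sgl (replicate (length ps) False) p \<in> deg_part (component (kosz n V m ps) False) k"
  "aug ps (x + y) = aug ps x + aug ps y"
  "aug ps (p \<odot>\<^bsub>component (kosz n V m ps) False\<^esub> x) = p * aug ps x"
  "x \<in> kfilt n V m ps 0 False \<longleftrightarrow> x \<in> carrier (component (kosz n V m ps) False) \<and> aug ps x \<in> idl V (map (\<lambda>(k, a, b). b) ps)"
proof -
  show "x \<in> carrier (component (kosz n V m ps) False) \<Longrightarrow> aug ps x \<in> pols V" by (simp add: fmod_def)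
  show "aug ps x \<in> pols V \<and> homogeneous (k - m) (aug ps x)" if "x \<in> deg_part (component (kosz n V m ps) False) k"
  proof -
    have "aug ps x \<in> pols V \<and> homogeneous (k - (m + dl n ps (replicate (length ps) False))) (aug ps x)"
      using that by (simp add: fmod_def)
    then show ?thesis by (simp add: dl_replicate)
  qed
  show "sgl (replicate (length ps) False) p \<in> deg_part (component (kosz n V m ps) False) k"
    if "p \<in> pols V" "homogeneous (k - m) p"
    using that replicate_BL by (auto simp: fmod_def sgl_def dl_replicate)
  show "aug ps (x + y) = aug ps x + aug ps y" by simp
  show "aug ps (p \<odot>\<^bsub>component (kosz n V m ps) False\<^esub> x) = p * aug ps x" by (simp add: fmod_def)
  show "x \<in> kfilt n V m ps 0 False \<longleftrightarrow> x \<in> carrier (component (kosz n V m ps) False) \<and> aug ps x \<in> idl V (map (\<lambda>(k, a, b). b) ps)"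
    by (simp add: kfilt_def)
qed

lemma idl_congruent: "p - q \<in> idl V bs \<Longrightarrow> p \<in> idl V bs \<longleftrightarrow> q \<in> idl V bs"
  using idl_add[of "p - q" V bs q] idl_diff[of p V bs "p - q"] by auto

text \<open>Meant for \<Upsilon> and two webs, where each summand contributes the quotient by its
  own ideal and its augmentation gives the representative.\<close>

lemma presents_sum3:
  assumes "map (\<lambda>(k, a, b). b) ps = bs" "map (\<lambda>(k, a, b). b) qs = cs" "map (\<lambda>(k, a, b). b) rs = ds"
  shows "presents {1..6} (koszR n {1..6} (- 3) ps \<oplus>\<^sub>f (koszR n {1..6} (- 1) qs \<oplus>\<^sub>f koszR n {1..6} (- 1) rs))
    (\<lambda>k i. kfilt n {1..6} (- 3) ps k i \<times> (kfilt n {1..6} (- 1) qs k i \<times> kfilt n {1..6} (- 1) rs k i))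
    (idl {1..6} bs) (idl {1..6} cs) (idl {1..6} ds)
    (\<lambda>(u, t, s) \<alpha> \<beta> \<gamma>. aug ps u - \<alpha> \<in> idl {1..6} bs \<and> aug qs t - \<beta> \<in> idl {1..6} cs \<and> aug rs s - \<gamma> \<in> idl {1..6} ds)"
    (is "presents _ ?M ?F ?A ?B ?C ?T")
  unfolding presents_def
proof (intro conjI allI ballI impI)
  let ?c = "component ?M False"
  define ku kt ks where "ku = component (kosz n {1..6} (- 3) ps) False" and "kt = component (kosz n {1..6} (- 1) qs) False"
    and "ks = component (kosz n {1..6} (- 1) rs) False"
  note aug1 = aug(1-3,5,6)[where n = n and V = "{1..6}" and m = "- 3" and ps = ps, folded ku_def]
  note aug2 = aug(1-3,5,6)[where n = n and V = "{1..6}" and m = "- 1" and ps = qs, folded kt_def]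
  note aug3 = aug(1-3,5,6)[where n = n and V = "{1..6}" and m = "- 1" and ps = rs, folded ks_def]
  have dp: "(u, t, s) \<in> deg_part ?c k \<longleftrightarrow> u \<in> deg_part ku k \<and> t \<in> deg_part kt k \<and> s \<in> deg_part ks k" for u t s k
    unfolding ku_def kt_def ks_def by (simp add: direct_sum_def sum_module_def)
  have ca: "(u, t, s) \<in> carrier ?c \<longleftrightarrow> u \<in> carrier ku \<and> t \<in> carrier kt \<and> s \<in> carrier ks" for u t s
    unfolding ku_def kt_def ks_def by (simp add: direct_sum_def sum_module_def)
  have sm: "p \<odot>\<^bsub>?c\<^esub> (u, t, s) = (p \<odot>\<^bsub>ku\<^esub> u, p \<odot>\<^bsub>kt\<^esub> t, p \<odot>\<^bsub>ks\<^esub> s)" for p u t s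
    unfolding ku_def kt_def ks_def by (simp add: direct_sum_def sum_module_def)
  {
    fix k x assume "x \<in> deg_part ?c k"
    then obtain u t s where x: "x = (u, t, s)" "u \<in> deg_part ku k" "t \<in> deg_part kt k" "s \<in> deg_part ks k"
      using dp by (metis prod_cases3)
    show "\<exists>\<alpha> \<beta> \<gamma>. triple_deg {1..6} k \<alpha> \<beta> \<gamma> \<and> ?T x \<alpha> \<beta> \<gamma>"
      unfolding x(1) triple_deg_def using aug1(2)[OF x(2)] aug2(2)[OF x(3)] aug3(2)[OF x(4)]
      by - (rule exI[of _ "aug ps u"], rule exI[of _ "aug qs t"], rule exI[of _ "aug rs s"], simp)
  next
    fix k \<alpha> \<beta> \<gamma> assume "triple_deg {1..6} k \<alpha> \<beta> \<gamma>"
    note t = this[unfolded triple_deg_def]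
    have "sgl (replicate (length ps) False) \<alpha> \<in> deg_part ku k" using t by (intro aug1(3)) auto
    moreover have "sgl (replicate (length qs) False) \<beta> \<in> deg_part kt k" using t by (intro aug2(3)) auto
    moreover have "sgl (replicate (length rs) False) \<gamma> \<in> deg_part ks k" using t by (intro aug3(3)) auto
    ultimately show "\<exists>x\<in>deg_part ?c k. ?T x \<alpha> \<beta> \<gamma>"
      by (intro bexI[of _ "(sgl (replicate (length ps) False) \<alpha>, sgl (replicate (length qs) False) \<beta>, sgl (replicate (length rs) False) \<gamma>)"])
        (simp_all only: dp case_prod_conv sgl_simps diff_self idl_0 simp_thms)
  next
    fix x y \<alpha> \<beta> \<gamma> \<alpha>' \<beta>' \<gamma>' assume T: "?T x \<alpha> \<beta> \<gamma>" "?T y \<alpha>' \<beta>' \<gamma>'"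
    have add_diff: "p + q - (r + r') = (p - r) + (q - r')" for p q r r' :: mpol by simp
    obtain u t s u' t' s' where x: "x = (u, t, s)" "y = (u', t', s')" by (metis prod_cases3)
    show "?T (x + y) (\<alpha> + \<alpha>') (\<beta> + \<beta>') (\<gamma> + \<gamma>')"
      using T unfolding x plus_prod_def fst_conv snd_conv case_prod_conv aug(4) add_diff
      by (blast intro: idl_add)
  next
    fix p x \<alpha> \<beta> \<gamma> assume p: "p \<in> pols {1..6}" and T: "?T x \<alpha> \<beta> \<gamma>"
    obtain u t s where x: "x = (u, t, s)" by (metis prod_cases3)
    show "?T (p \<odot>\<^bsub>?c\<^esub> x) (p * \<alpha>) (p * \<beta>) (p * \<gamma>)"
      using T idl_mult[OF p] unfolding x sm case_prod_conv aug1(4) aug2(4) aug3(4) right_diff_distrib[symmetric] by blast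
  next
    fix x \<alpha> \<beta> \<gamma> assume c: "x \<in> carrier ?c" and T: "?T x \<alpha> \<beta> \<gamma>"
    obtain u t s where x: "x = (u, t, s)" by (metis prod_cases3)
    note T = T[unfolded x case_prod_conv]
    show "x \<in> ?F 0 False \<longleftrightarrow> \<alpha> \<in> ?A \<and> \<beta> \<in> ?B \<and> \<gamma> \<in> ?C"
      using c[unfolded x ca] idl_congruent[OF T[THEN conjunct1]] idl_congruent[OF T[THEN conjunct2, THEN conjunct1]]
        idl_congruent[OF T[THEN conjunct2, THEN conjunct2]]
      unfolding x mem_Sigma_iff aug1(5) aug2(5) aug3(5) assms by blast
  next
    fix x assume F: "x \<in> ?F 0 False"
    obtain u t s where x: "x = (u, t, s)" by (metis prod_cases3)
    show "?T x 0 0 0"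
      using F unfolding x mem_Sigma_iff aug1(5) aug2(5) aug3(5) assms case_prod_conv diff_zero by blast
  }
qed

section \<open>Arcs, wide edges and graphs in coordinates\<close>

definition wide_pairs :: "nat \<Rightarrow> nat \<Rightarrow> nat \<Rightarrow> nat \<Rightarrow> nat \<Rightarrow> kpairs" where
  "wide_pairs n i j k l = [(2 * int n - 2, u2 n (X i) (X j) (X k) (X l), X i * X j - X k * X l),
     (2 * int n, u1 n (X i) (X j) (X k) (X l), X i + X j - X k - X l)]"

definition arc_pairs :: "nat \<Rightarrow> nat \<Rightarrow> nat \<Rightarrow> kpairs" where
  "arc_pairs n i j = [(2 * int n, pi_pol n i j, X i - X j)]"

lemma wide_pairs:
  assumes "{i, j} \<inter> {k, l} = {}" "k \<noteq> l"
  shows "graded_pairs n {i, j, k, l} (wide_pairs n i j k l)"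
    "potential (wide_pairs n i j k l) = X i ^ (n + 1) + X j ^ (n + 1) - X k ^ (n + 1) - X l ^ (n + 1)"
    "\<exists>\<phi>. fiso (wide_edge n i j k l) (kosz n {i, j, k, l} (- 1) (wide_pairs n i j k l)) \<phi>"
proof -
  note u = u1_u2[OF assms, of n]
  let ?V = "{i, j, k, l}"
  have b: "X i * X j - X k * X l \<in> pols ?V" "X i + X j - X k - X l \<in> pols ?V" by (auto intro!: pols_intros)
  have "homogeneous 4 (X i * X j - X k * X l)" by (intro homogeneous_diff homogeneous_mult_eq[of 2 _ 2]) auto
  moreover have "homogeneous 2 (X i + X j - X k - X l)" by (intro homogeneous_diff homogeneous_add) auto
  ultimately show "graded_pairs n ?V (wide_pairs n i j k l)"
    using u b unfolding wide_pairs_def by simp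
  show "potential (wide_pairs n i j k l) = X i ^ (n + 1) + X j ^ (n + 1) - X k ^ (n + 1) - X l ^ (n + 1)"
    using u(5) unfolding wide_pairs_def by (simp add: add.commute)
  show "\<exists>\<phi>. fiso (wide_edge n i j k l) (kosz n ?V (- 1) (wide_pairs n i j k l)) \<phi>"
    using fiso_shift[OF fiso_tensor[OF fiso_koszul[OF u(1) b(2), of n "2 * int n"] fiso_koszul[OF u(3) b(1), of n "2 * int n - 2"]], of "- 1"]
    unfolding wide_edge_def wide_pairs_def Let_def by (auto simp: insert_commute)
qed

lemma arc_pairs:
  assumes "i \<noteq> j"
  shows "graded_pairs n {i, j} (arc_pairs n i j)" "potential (arc_pairs n i j) = X i ^ (n + 1) - X j ^ (n + 1)"
    "\<exists>\<phi>. fiso (arc n i j) (kosz n {i, j} 0 (arc_pairs n i j)) \<phi>"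
proof -
  note p = pi_pol[OF assms, of n]
  have b: "X i - X j \<in> pols {i, j}" by (auto intro!: pols_intros)
  have "homogeneous 2 (X i - X j)" by (intro homogeneous_diff) auto
  then show "graded_pairs n {i, j} (arc_pairs n i j)" using p b unfolding arc_pairs_def by simp
  show "potential (arc_pairs n i j) = X i ^ (n + 1) - X j ^ (n + 1)" using p(3) unfolding arc_pairs_def by simp
  show "\<exists>\<phi>. fiso (arc n i j) (kosz n {i, j} 0 (arc_pairs n i j)) \<phi>"
    using fiso_koszul[OF p(1) b, of n "2 * int n"] unfolding arc_def arc_pairs_def by blast
qed

context marks
begin

abbreviation "cube n \<equiv> wide_edge n a b 7 8 \<otimes>\<^sub>f wide_edge n 8 c 9 f \<otimes>\<^sub>f wide_edge n 7 9 d e"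
abbreviation "web n \<equiv> wide_edge n a b d e \<otimes>\<^sub>f arc n c f"
abbreviation "cube_pairs n \<equiv> wide_pairs n 7 9 d e @ (wide_pairs n 8 c 9 f @ wide_pairs n a b 7 8)"
abbreviation "web_pairs n \<equiv> arc_pairs n c f @ wide_pairs n a b d e"

lemma disjoint: "{a, b} \<inter> {7, 8} = {}" "{8, c} \<inter> {9, f} = {}" "{7, 9} \<inter> {d, e} = {}" "{a, b} \<inter> {d, e} = {}"
  "9 \<noteq> f" "d \<noteq> e" "c \<noteq> f" "(7::nat) \<noteq> 8"
  using not_internal distinct by auto

lemma internal_vars: "{a, b, 7, 8} \<union> {8, c, 9, f} \<union> {7, 9, d, e} = {1..9}" "{a, b, d, e} \<union> {c, f} = {1..6}"
proof -
  have m: "{a, b, c, d, e, f} = {1..6}" using marks by simp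
  have "{1..9} = {1..6} \<union> {7, 8, 9 :: nat}" by auto
  then show "{a, b, 7, 8} \<union> {8, c, 9, f} \<union> {7, 9, d, e} = {1..9}" unfolding m[symmetric] by auto
  show "{a, b, d, e} \<union> {c, f} = {1..6}" unfolding m[symmetric] by auto
qed

lemma pairs_seq: "map (\<lambda>(k, a, b). b) (cube_pairs n) = cube_seq a b c d e f"
  "map (\<lambda>(k, a, b). b) (web_pairs n) = web_seq a b c d e f"
  by (simp_all add: wide_pairs_def arc_pairs_def cube_seq_def web_seq_def)

lemma fiso_cube: "\<exists>\<phi>. fiso (restrict_scalars {1..6} (cube n)) (koszR n {1..9} (- 3) (cube_pairs n)) \<phi>"
proof -
  obtain \<phi>1 \<phi>2 \<phi>3 where p: "fiso (wide_edge n a b 7 8) (kosz n {a, b, 7, 8} (- 1) (wide_pairs n a b 7 8)) \<phi>1"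
    "fiso (wide_edge n 8 c 9 f) (kosz n {8, c, 9, f} (- 1) (wide_pairs n 8 c 9 f)) \<phi>2"
    "fiso (wide_edge n 7 9 d e) (kosz n {7, 9, d, e} (- 1) (wide_pairs n 7 9 d e)) \<phi>3"
    using wide_pairs(3) disjoint by metis
  have "- 1 + - 1 + - 1 = (- 3 :: int)" by simp
  note exI[where P = "fiso (cube n) (kosz n {1..9} (- 3) (cube_pairs n))", OF fiso_tensor[OF fiso_tensor[OF p(1,2)] p(3), unfolded internal_vars(1) this]]
  then obtain \<phi> where \<phi>: "fiso (cube n) (kosz n {1..9} (- 3) (cube_pairs n)) \<phi>" by blast
  then have "ring_vars (cube n) = {1..9}" by (simp add: fiso_def)
  then show ?thesis using fiso_restrict[OF \<phi>, of "{1..6}"] by auto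
qed

lemma fiso_web: "\<exists>\<phi>. fiso (restrict_scalars {1..6} (web n)) (koszR n {1..6} (- 1) (web_pairs n)) \<phi>"
proof -
  obtain \<phi>1 \<phi>2 where p: "fiso (wide_edge n a b d e) (kosz n {a, b, d, e} (- 1) (wide_pairs n a b d e)) \<phi>1"
    "fiso (arc n c f) (kosz n {c, f} 0 (arc_pairs n c f)) \<phi>2"
    using wide_pairs(3) arc_pairs(3) disjoint by metis
  note exI[where P = "fiso (web n) (kosz n {1..6} (- 1) (web_pairs n))", OF fiso_tensor[OF p(1,2), unfolded internal_vars(2) add_0_right]]
  then obtain \<phi> where \<phi>: "fiso (web n) (kosz n {1..6} (- 1) (web_pairs n)) \<phi>" by blast
  then have "ring_vars (web n) = {1..6}" by (simp add: fiso_def)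
  then show ?thesis using fiso_restrict[OF \<phi>, of "{1..6}"] by auto
qed

lemma w_pols: "w n \<in> P" by (intro pols_diff pols_add pols_power XP)

lemma resolved_cube: "resolved n (w n) {1..6} (koszR n {1..9} (- 3) (cube_pairs n)) (kfilt n {1..9} (- 3) (cube_pairs n))"
proof (rule resolved_kosz)
  have s: "{a, b, 7, 8} \<subseteq> {1..9}" "{8, c, 9, f} \<subseteq> {1..9}" "{7, 9, d, e} \<subseteq> {1..9}" using internal_vars(1) by auto
  show "graded_pairs n {1..9} (cube_pairs n)"
    unfolding graded_pairs_simps
    by (intro conjI graded_pairs_mono[OF wide_pairs(1)[OF disjoint(1,8)] s(1)]
      graded_pairs_mono[OF wide_pairs(1)[OF disjoint(2,5)] s(2)] graded_pairs_mono[OF wide_pairs(1)[OF disjoint(3,6)] s(3)])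
  show "potential (cube_pairs n) = w n"
    unfolding potential_append wide_pairs(2)[OF disjoint(1,8)] wide_pairs(2)[OF disjoint(2,5)] wide_pairs(2)[OF disjoint(3,6)] by simp
  show "regular {1..9} (map (\<lambda>(k, a, b). b) (cube_pairs n))" unfolding pairs_seq by (rule regular_cube)
qed (use w_pols in auto)

lemma resolved_web: "resolved n (w n) {1..6} (koszR n {1..6} (- 1) (web_pairs n)) (kfilt n {1..6} (- 1) (web_pairs n))"
proof (rule resolved_kosz)
  have s: "{a, b, d, e} \<subseteq> {1..6}" "{c, f} \<subseteq> {1..6}" using internal_vars(2) by auto
  show "graded_pairs n {1..6} (web_pairs n)"
    unfolding graded_pairs_simps
    by (intro conjI graded_pairs_mono[OF wide_pairs(1)[OF disjoint(4,6)] s(1)]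
      graded_pairs_mono[OF arc_pairs(1)[OF disjoint(7)] s(2)])
  show "potential (web_pairs n) = w n"
    unfolding potential_append wide_pairs(2)[OF disjoint(4,6)] arc_pairs(2)[OF disjoint(7)] by simp
  show "regular {1..6} (map (\<lambda>(k, a, b). b) (web_pairs n))" unfolding pairs_seq by (rule regular_web)
qed (use w_pols in auto)

text \<open>\<alpha> and \<beta> are the coordinates of a class on 1 and \<open>z\<close>:
  \<open>cube_decomposition\<close> provides them in the right degrees and
  \<open>cube_ideal_iff\<close> says when the class is zero. The second summand supplies the third
  entry.\<close>

lemma presents_cube:
  assumes rs: "map (\<lambda>(k, a, b). b) rs = ds"
  shows "presents {1..6} (koszR n {1..9} (- 3) (cube_pairs n) \<oplus>\<^sub>f koszR n {1..6} (- 1) rs)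
    (\<lambda>k i. kfilt n {1..9} (- 3) (cube_pairs n) k i \<times> kfilt n {1..6} (- 1) rs k i) E I4 (idl {1..6} ds)
    (\<lambda>(v, s) \<alpha> \<beta> \<gamma>. aug (cube_pairs n) v - (\<alpha> + z * \<beta>) \<in> I1 \<and> aug rs s - \<gamma> \<in> idl {1..6} ds)"
    (is "presents _ ?M ?F ?A ?B ?C ?T")
  unfolding presents_def
proof (intro conjI allI ballI impI)
  let ?c = "component ?M False"
  let ?p = "cube_pairs n"
  define kc where "kc = component (kosz n {1..9} (- 3) ?p) False"
  define kr where "kr = component (kosz n {1..6} (- 1) rs) False"
  note aug1 = aug(1-3,5,6)[where n = n and V = "{1..9}" and m = "- 3" and ps = ?p, folded kc_def]
  note aug2 = aug(1-3,5,6)[where n = n and V = "{1..6}" and m = "- 1" and ps = rs, folded kr_def]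
  have dp: "(v, s) \<in> deg_part ?c k \<longleftrightarrow> v \<in> deg_part kc k \<and> s \<in> deg_part kr k" for v s k
    unfolding kc_def kr_def by (simp add: direct_sum_def sum_module_def)
  have ca: "(v, s) \<in> carrier ?c \<longleftrightarrow> v \<in> carrier kc \<and> s \<in> carrier kr" for v s
    unfolding kc_def kr_def by (simp add: direct_sum_def sum_module_def)
  have sm: "p \<odot>\<^bsub>?c\<^esub> (v, s) = (p \<odot>\<^bsub>kc\<^esub> v, p \<odot>\<^bsub>kr\<^esub> s)" for p v s
    unfolding kc_def kr_def by (simp add: direct_sum_def sum_module_def)
  {
    fix k x assume "x \<in> deg_part ?c k"
    then obtain v s where x: "x = (v, s)" "v \<in> deg_part kc k" "s \<in> deg_part kr k" using dp by (metis surj_pair)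
    have h: "aug ?p v \<in> S" "homogeneous (k + 3) (aug ?p v)" "aug rs s \<in> P" "homogeneous (k + 1) (aug rs s)"
      using aug1(2)[OF x(2)] aug2(2)[OF x(3)] by simp_all
    obtain \<alpha> \<beta> where "\<alpha> \<in> P" "\<beta> \<in> P" "homogeneous (k + 3) \<alpha>" "homogeneous (k + 3 - 2) \<beta>" "aug ?p v - \<alpha> - z * \<beta> \<in> I1"
      using cube_decomposition[OF h(1,2)] by blast
    moreover have "k + 3 - 2 = k + 1" by simp
    ultimately show "\<exists>\<alpha> \<beta> \<gamma>. triple_deg {1..6} k \<alpha> \<beta> \<gamma> \<and> ?T x \<alpha> \<beta> \<gamma>"
      unfolding x(1) triple_deg_def using h(3,4)
      by - (rule exI[of _ \<alpha>], rule exI[of _ \<beta>], rule exI[of _ "aug rs s"], simp only: diff_diff_eq case_prod_conv diff_self idl_0 simp_thms)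
  next
    fix k \<alpha> \<beta> \<gamma> assume "triple_deg {1..6} k \<alpha> \<beta> \<gamma>"
    note t = this[unfolded triple_deg_def]
    have "homogeneous (k + 3) (z * \<beta>)"
      using t by (intro homogeneous_mult_eq[of 2 _ "k + 1"] homogeneous_diff) auto
    then have "homogeneous (k - - 3) (\<alpha> + z * \<beta>)" using t by (auto intro: homogeneous_add)
    moreover have "\<alpha> + z * \<beta> \<in> S" using t PS by (intro pols_add pols_mult pols_diff XS) auto
    ultimately have "sgl (replicate (length ?p) False) (\<alpha> + z * \<beta>) \<in> deg_part kc k" by (intro aug1(3))
    moreover have "sgl (replicate (length rs) False) \<gamma> \<in> deg_part kr k" using t by (intro aug2(3)) auto
    ultimately show "\<exists>x\<in>deg_part ?c k. ?T x \<alpha> \<beta> \<gamma>"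
      by (intro bexI[of _ "(sgl (replicate (length ?p) False) (\<alpha> + z * \<beta>), sgl (replicate (length rs) False) \<gamma>)"])
        (simp_all only: dp case_prod_conv sgl_simps diff_self idl_0 simp_thms)
  next
    fix x y \<alpha> \<beta> \<gamma> \<alpha>' \<beta>' \<gamma>' assume T: "?T x \<alpha> \<beta> \<gamma>" "?T y \<alpha>' \<beta>' \<gamma>'"
    obtain v s v' s' where x: "x = (v, s)" "y = (v', s')" by (metis surj_pair)
    have "aug ?p (v + v') - (\<alpha> + \<alpha>' + z * (\<beta> + \<beta>')) = (aug ?p v - (\<alpha> + z * \<beta>)) + (aug ?p v' - (\<alpha>' + z * \<beta>'))"
      unfolding aug(4) distrib_left by (simp only: algebra_simps)
    moreover have "aug rs (s + s') - (\<gamma> + \<gamma>') = (aug rs s - \<gamma>) + (aug rs s' - \<gamma>')" unfolding aug(4) by (simp only: algebra_simps)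
    ultimately show "?T (x + y) (\<alpha> + \<alpha>') (\<beta> + \<beta>') (\<gamma> + \<gamma>')"
      using T unfolding x plus_prod_def fst_conv snd_conv case_prod_conv by (auto simp only: intro: idl_add)
  next
    fix p x \<alpha> \<beta> \<gamma> assume p: "p \<in> P" and T: "?T x \<alpha> \<beta> \<gamma>"
    obtain v s where x: "x = (v, s)" by (metis surj_pair)
    have "p * aug ?p v - (p * \<alpha> + z * (p * \<beta>)) = p * (aug ?p v - (\<alpha> + z * \<beta>))"
      "p * aug rs s - p * \<gamma> = p * (aug rs s - \<gamma>)" by (simp_all only: algebra_simps)
    then show "?T (p \<odot>\<^bsub>?c\<^esub> x) (p * \<alpha>) (p * \<beta>) (p * \<gamma>)"
      using T idl_mult[OF PS[OF p]] idl_mult[OF p] unfolding x sm case_prod_conv aug1(4) aug2(4) by (simp only:)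
  next
    fix x \<alpha> \<beta> \<gamma> assume c: "x \<in> carrier ?c" and P: "\<alpha> \<in> P" "\<beta> \<in> P" and T: "?T x \<alpha> \<beta> \<gamma>"
    obtain v s where x: "x = (v, s)" by (metis surj_pair)
    note T = T[unfolded x case_prod_conv]
    show "x \<in> ?F 0 False \<longleftrightarrow> \<alpha> \<in> ?A \<and> \<beta> \<in> ?B \<and> \<gamma> \<in> ?C"
      using c[unfolded x ca] idl_congruent[OF T[THEN conjunct1]] idl_congruent[OF T[THEN conjunct2]] cube_ideal_iff[OF P]
      unfolding x mem_Sigma_iff aug1(5) aug2(5) rs pairs_seq by blast
  next
    fix x assume F: "x \<in> ?F 0 False"
    obtain v s where x: "x = (v, s)" by (metis surj_pair)
    show "?T x 0 0 0"
      using F unfolding x mem_Sigma_iff aug1(5) aug2(5) rs pairs_seq case_prod_conv mult_zero_right add_0_right diff_zero by blast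
  }
qed

end

section \<open>Comparison of the two sides\<close>

lemma fiso_refl: "cfact n w V D \<Longrightarrow> fiso D D (\<lambda>i x. x)"
proof -
  assume D: "cfact n w V D"
  note c = cfactD[OF D]
  note l = lin_mapsD[OF c(4) c(3) c(3)]
  have "miso V (component D i) (component D i) (\<lambda>x. x)" for i
    unfolding miso_def
    using cmodD(3,4,7,15)[OF c(3)] by (auto simp: cmodD(1,2)[OF c(3)] bij_betw_def)
  then show ?thesis unfolding fiso_def c(1) using l(1) by blast
qed

lemma homogeneous_lookup_0: "homogeneous k p \<Longrightarrow> k \<noteq> 0 \<Longrightarrow> lookup p 0 = 0"
  by (rule ccontr) (auto simp: homogeneous_def mono_deg_def simp flip: in_keys_iff dest!: bspec[where x = 0])

theorem proposition32:
  fixes n :: nat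
  assumes "n \<ge> 1"
  defines "w \<equiv> X 1 ^ (n + 1) + X 2 ^ (n + 1) + X 3 ^ (n + 1)
             - X 4 ^ (n + 1) - X 5 ^ (n + 1) - X 6 ^ (n + 1)"
    and "C\<Gamma>\<^sub>1 \<equiv> wide_edge n 1 2 7 8 \<otimes>\<^sub>f wide_edge n 8 3 9 6 \<otimes>\<^sub>f wide_edge n 7 9 4 5"
    and "C\<Gamma>\<^sub>2 \<equiv> wide_edge n 2 3 5 6 \<otimes>\<^sub>f arc n 1 4"
    and "C\<Gamma>\<^sub>3 \<equiv> wide_edge n 3 2 7 8 \<otimes>\<^sub>f wide_edge n 8 1 9 4 \<otimes>\<^sub>f wide_edge n 7 9 6 5"
    and "C\<Gamma>\<^sub>4 \<equiv> wide_edge n 1 2 4 5 \<otimes>\<^sub>f arc n 3 6"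
    and "R' \<equiv> {1..6}"
  shows "hmf_isomorphic R' n w
           (restrict_scalars R' C\<Gamma>\<^sub>1 \<oplus>\<^sub>f restrict_scalars R' C\<Gamma>\<^sub>2)
           (restrict_scalars R' C\<Gamma>\<^sub>3 \<oplus>\<^sub>f restrict_scalars R' C\<Gamma>\<^sub>4)"
proof -
  \<comment> \<open>The labelling \<open>m1\<close> covers \<Gamma>1 and \<Gamma>4,
    \<open>m2\<close> covers \<Gamma>2 and \<open>m3\<close> covers \<Gamma>3.\<close>
  have m1: "marks 1 2 3 4 5 6" and m2: "marks 2 3 1 5 6 4" and m3: "marks 3 2 1 6 5 4"
    by (unfold_locales, auto)+
  define p1 where "p1 = wide_pairs n 7 9 4 5 @ (wide_pairs n 8 3 9 6 @ wide_pairs n 1 2 7 8)"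
  define p2 where "p2 = arc_pairs n 1 4 @ wide_pairs n 2 3 5 6"
  define p3 where "p3 = wide_pairs n 7 9 6 5 @ (wide_pairs n 8 1 9 4 @ wide_pairs n 3 2 7 8)"
  define p4 where "p4 = arc_pairs n 3 6 @ wide_pairs n 1 2 4 5"
  have w2: "X 2 ^ (n + 1) + X 3 ^ (n + 1) + X 1 ^ (n + 1) - X 5 ^ (n + 1) - X 6 ^ (n + 1) - X 4 ^ (n + 1) = w"
    and w3: "X 3 ^ (n + 1) + X 2 ^ (n + 1) + X 1 ^ (n + 1) - X 6 ^ (n + 1) - X 5 ^ (n + 1) - X 4 ^ (n + 1) = w"
    unfolding w_def by (simp_all add: algebra_simps)
  have hw: "homogeneous (2 * (int n + 1)) w" unfolding w_def by (rule marks.homogeneous_w[OF m1])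
  have wP: "w \<in> pols {1..6}" unfolding w_def by (rule marks.w_pols[OF m1])
  note res1 = marks.resolved_cube[OF m1, of n, folded w_def p1_def]
  note res2 = marks.resolved_web[OF m2, of n, unfolded w2, folded p2_def]
  note res3 = marks.resolved_cube[OF m3, of n, unfolded w3, folded p3_def]
  note res4 = marks.resolved_web[OF m1, of n, folded w_def p4_def]
  obtain r1 r3 r2 where r: "graded_pairs n {1..6} [(2 * int n, r1, marks.s1 1 2 3 4 5 6),
      (2 * int n - 4, r3, marks.t3 1 4 5 6), (2 * int n - 2, r2, marks.t2 1 2 4 5 6)] \<and>
    potential [(2 * int n, r1, marks.s1 1 2 3 4 5 6),
      (2 * int n - 4, r3, marks.t3 1 4 5 6), (2 * int n - 2, r2, marks.t2 1 2 4 5 6)] = w"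
    using marks.ups_pairs[OF m1, of n, folded w_def] by blast
  define us where "us = [(2 * int n, r1, marks.s1 1 2 3 4 5 6),
      (2 * int n - 4, r3, marks.t3 1 4 5 6), (2 * int n - 2, r2, marks.t2 1 2 4 5 6)]"
  have us: "graded_pairs n {1..6} us" "potential us = w"
    "map (\<lambda>(k, a, b). b) us = [marks.s1 1 2 3 4 5 6, marks.t3 1 4 5 6, marks.t2 1 2 4 5 6]"
    using r unfolding us_def by (blast, blast, simp)
  have resU: "resolved n w {1..6} (koszR n {1..6} (- 3) us) (kfilt n {1..6} (- 3) us)"
    by (rule resolved_kosz[OF us(1,2) wP order_refl]) (unfold us(3), rule marks.regular_ups[OF m1])
  have b2: "map (\<lambda>(k, a, b). b) p2 = web_seq 2 3 1 5 6 4" and b4: "map (\<lambda>(k, a, b). b) p4 = web_seq 1 2 3 4 5 6"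
    unfolding p2_def p4_def by (rule marks.pairs_seq(2)[OF m2] marks.pairs_seq(2)[OF m1])+
  \<comment> \<open>Exchanging 1 with 3 and 4 with 6 fixes the generators of the symmetric ideal and
    carries those of the ideal of \<Gamma>4 to those of \<Gamma>2.\<close>
  have sym: "sym_seq 3 2 1 6 5 4 = sym_seq 1 2 3 4 5 6" "web_seq 3 2 1 6 5 4 = web_seq 2 3 1 5 6 4"
    by (simp_all add: sym_seq_def web_seq_def algebra_simps)
  note pres12 = marks.presents_cube[OF m1 b2, of n, folded p1_def]
  note pres34 = presents_swap[OF marks.presents_cube[OF m3 b4, of n, folded p3_def, unfolded sym]]
  note presD = presents_sum3[OF us(3) b4 b2, of n, unfolded marks.ups_ideal[OF m1]]
  note res12 = resolved_sum[OF res1 res2] and res34 = resolved_sum[OF res3 res4]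
    and resD = resolved_sum[OF resU resolved_sum[OF res4 res2]]
  \<comment> \<open>The two sides are compared directly here. The equivalences \<open>h12\<close>
    and \<open>h34\<close> with the sum of finite rank serve the finiteness of cohomology.\<close>
  note h = heq_presented[OF res12 pres12 res34 pres34]
  note h12 = heq_presented[OF res12 pres12 resD presD] and h34 = heq_presented[OF res34 pres34 resD presD]
  note cf12 = resolvedD(1)[OF res12] and cf34 = resolvedD(1)[OF res34] and cfD = resolvedD(1)[OF resD]
  obtain \<phi>1 \<phi>2 \<phi>3 \<phi>4 where f: "fiso (restrict_scalars R' C\<Gamma>\<^sub>1) (koszR n {1..9} (- 3) p1) \<phi>1"
    "fiso (restrict_scalars R' C\<Gamma>\<^sub>2) (koszR n {1..6} (- 1) p2) \<phi>2"
    "fiso (restrict_scalars R' C\<Gamma>\<^sub>3) (koszR n {1..9} (- 3) p3) \<phi>3"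
    "fiso (restrict_scalars R' C\<Gamma>\<^sub>4) (koszR n {1..6} (- 1) p4) \<phi>4"
    using marks.fiso_cube[OF m1, of n] marks.fiso_web[OF m2, of n] marks.fiso_cube[OF m3, of n] marks.fiso_web[OF m1, of n]
    unfolding R'_def C\<Gamma>\<^sub>1_def C\<Gamma>\<^sub>2_def C\<Gamma>\<^sub>3_def C\<Gamma>\<^sub>4_def p1_def p2_def p3_def p4_def by blast
  have rv: "ring_vars (restrict_scalars R' M) = ring_vars (restrict_scalars R' N)" for M :: "'x factorization" and N :: "'y factorization"
    by simp
  note f12 = fiso_sum[OF f(1,2) rv] and f34 = fiso_sum[OF f(3,4) rv]
  have fin: "gfree_finite {1..6} (component (koszR n {1..6} (- 3) us \<oplus>\<^sub>f (koszR n {1..6} (- 1) p4 \<oplus>\<^sub>f koszR n {1..6} (- 1) p2)) i)" for i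
    unfolding direct_sum_simps restrict_scalars_simps kosz_simps
    by (intro gfree_finite_sum gfree_finite_fmod finite_BL)
  have w0: "lookup w 0 = 0" by (rule homogeneous_lookup_0[OF hw]) simp
  note coh12 = finite_dim_cohomology[OF f12 cf12 cfD fin w0 heq_transport[OF f12 cf12 fiso_refl[OF cfD] cfD h12]]
  note coh34 = finite_dim_cohomology[OF f34 cf34 cfD fin w0 heq_transport[OF f34 cf34 fiso_refl[OF cfD] cfD h34]]
  have "hmf_object R' n w (restrict_scalars R' C\<Gamma>\<^sub>1 \<oplus>\<^sub>f restrict_scalars R' C\<Gamma>\<^sub>2)"
    unfolding hmf_object_def using fisoD(1)[OF f12 cf12] fiso_graded_factorization[OF f12 cf12 _ hw] coh12 by (simp add: R'_def)
  moreover have "hmf_object R' n w (restrict_scalars R' C\<Gamma>\<^sub>3 \<oplus>\<^sub>f restrict_scalars R' C\<Gamma>\<^sub>4)"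
    unfolding hmf_object_def using fisoD(1)[OF f34 cf34] fiso_graded_factorization[OF f34 cf34 _ hw] coh34 by (simp add: R'_def)
  ultimately show ?thesis
    using heq_transport[OF f12 cf12 f34 cf34 h] unfolding hmf_isomorphic_def heq_def by blast
qed

end
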